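(* Consider the particle Gibbs (PGibbs) sampler with $N\ge2$ particles, i.e. the kernel $\Phi_N(\theta_0,x;S):=\int_S\pi_x(d\theta)P_{\theta,N}(x,dy)$ on $\Theta\times\mathsf X$, where $P_{\theta,N}$ is the i-cSMC kernel with $N$ particles for the kernels $\{M_{\theta,t}\}$ and potentials $\{G_{\theta,t}\}$, with normalizing constant $\gamma_{\theta,T}$ (see context). Let $\Phi_{N,x}(x,B):=\Phi_N(\theta_0,x;\Theta\times B)$, let $\Gamma,\Gamma_x$ be the Gibbs sampler kernels of the context, and let $$\varrho:=\varrho_N:=\inf_{f\in L^2(\mathsf X,\pi)}\frac{\int_\Theta\pi(d\theta)\,\mathrm{var}_{\pi_\theta}(f)\,\mathrm{Gap}(P_{\theta,N})}{\int_\Theta\pi(d\theta)\,\mathrm{var}_{\pi_\theta}(f)}.$$ Write $\Phi=\Phi_N$, $\Phi_x=\Phi_{N,x}$, and $\bar f(x):=\pi_x(f)$ for $f:\Theta\to\mathbb R$. Then the general results (I) and (II) listed below hold, with $\varrho$ bounded as follows. (a) If $\displaystyle R:=\pi\text{-}\mathrm{ess\,sup}_\theta\frac{\prod_{t=1}^T\bar G_{\theta,t}}{\gamma_{\theta,T}}<\infty$, where $\bar G_{\theta,t}:=\sup_{z\in\mathsf Z}G_{\theta,t}(z)$, then $$\varrho\ge\frac{(1-1/N)^T}{1+\big[1-(1-\tfrac2N)^T\big]\,[R-1]}.$$ (b) If we have the uniform mixing condition, for some $0\le\alpha<\infty$, $$\pi\text{-}\mathrm{ess\,sup}_{\theta,z}\;\frac{Q_{\theta,p,p+k}(1)(z)}{\eta_{\theta,p}Q_{\theta,p,p+k}(1)}\le\alpha$$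 for all $p,k\ge1$ with $p+k\le T+1$, then $$\varrho\ge\Big(\frac{1-1/N}{1+2(\alpha-1)/N}\Big)^T.$$ (I) For any $f\in L^2(\mathsf X,\pi)$: 1. $2\mathcal E_{\Gamma_x}(f)\ge\mathcal E_{\Phi_x}(f)\ge\varrho\,\mathcal E_{\Gamma_x}(f)$; 2. $2\,\mathrm{Gap}(\Gamma_x)\ge\mathrm{Gap}(\Phi_x)\ge\varrho\,\mathrm{Gap}(\Gamma_x)$; 3. $0\le\tfrac12\big[\mathrm{var}(f,\Gamma_x)-\mathrm{var}_\pi(f)\big]\le\mathrm{var}(f,\Phi_x)\le(\varrho^{-1}-1)\mathrm{var}_\pi(f)+\varrho^{-1}\mathrm{var}(f,\Gamma_x)$, the last inequality for $\varrho>0$; 4. if there exists $\epsilon>0$ such that $P_{\theta,N}(x,B)\ge\epsilon\,\pi_\theta(B)$ for all $\theta\in\Theta$ and $(x,B)\in\mathsf X\times\mathcal B(\mathsf X)$, then $\dfrac{\mathrm{var}(f,\Gamma_x)-(1-\epsilon)\mathrm{var}_\pi(f)}{2-\epsilon}\le\mathrm{var}(f,\Phi_x)$; 5. since each $P_{\theta,N}$ is a positive operator, $\mathrm{var}(f,\Gamma_x)\le\mathrm{var}(f,\Phi_x)$. (II) 1. Assume that for some class of functions $\mathcal G\subset\{g:\mathsf X\to\mathbb R:\pi(|g|)<\infty\}$ there exist a function $|\cdot|_{\mathcal G}:\mathcal G\to[0,\infty]$ and $\rho\in[0,1)$ such that for any probability distribution $\nu$ on $(\mathsf X,\mathcal B(\mathsf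 X))$ there exists $W_\nu\in[0,\infty]$ such that $|\nu\Phi_x^k(g)-\pi(g)|\le|g|_{\mathcal G}W_\nu\rho^k$ for all $g\in\mathcal G$ and any $k\ge1$. Then for any $f:\Theta\to\mathbb R$ such that $\bar f\in\mathcal G$ and any $k\ge2$, $|\nu\Phi^k(f)-\pi(f)|\le|\bar f|_{\mathcal G}W_\nu\rho^{k-1}$. 2. For any $f\in L^2(\Theta,\pi)$ and $k\ge1$, $\bar f\in L^2(\mathsf X,\pi)$, $\langle f,\Phi^kf\rangle_\pi=\langle\bar f,\Phi_x^{k-1}\bar f\rangle_\pi$ and $\mathrm{var}(f,\Phi)=\mathrm{var}_\pi(f)+\mathrm{var}_\pi(\bar f)+\mathrm{var}(\bar f,\Phi_x)$. 3. If $\varrho>0$, then for $f\in L^2(\Theta,\pi)$, $\mathrm{var}(f,\Phi)\le\mathrm{var}_\pi(f)+\varrho^{-1}\mathrm{var}_\pi(\bar f)+\varrho^{-1}\mathrm{var}(\bar f,\Gamma_x)\le(1-\varrho^{-1})\mathrm{var}_\pi(f)+\varrho^{-1}\mathrm{var}(f,\Gamma)$. 4. Since each $P_{\theta,N}$ is a positive operator, $\mathrm{var}(f,\Phi)\ge\mathrm{var}(f,\Gamma)$ for $f\in L^2(\Theta,\pi)$. In particular, in both cases (a) and (b), $\varrho=\varrho_N\to1$ as $N\to\infty$, implying that the spectral gaps and the asymptotic variances associated with the PGibbs sampler converge to those of the related Gibbs sampler.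
   Context: Setting. $\mathsf X:=\mathsf Z^T$, $[N]:=\{1,\dots,N\}$. For each $\theta\in\Theta$, $M_{\theta,1}$ is a probability on $\mathsf Z$, $M_{\theta,t}$ ($2\le t\le T$) are Markov kernels on $\mathsf Z$, $G_{\theta,t}:\mathsf Z\to[0,\infty)$ ($t\in[T]$), all jointly measurable in $\theta$. Let $(Z_1,\dots,Z_T)$ be, under $\mathbb P_\theta$, the Markov chain with $Z_1\sim M_{\theta,1}$ and transition $M_{\theta,t}(Z_{t-1},\cdot)$ at time $t$; $\gamma_{\theta,T}:=\mathbb E_\theta[\prod_{t=1}^TG_{\theta,t}(Z_t)]$, with $0<\gamma_{\theta,T}<\infty$. $\pi$ is a probability on $\Theta\times\mathsf X$ with conditional distribution of $x$ given $\theta$ equal to $\pi_\theta(B)=\gamma_{\theta,T}^{-1}\mathbb E_\theta[\mathbb I\{Z_{1:T}\in B\}\prod_tG_{\theta,t}(Z_t)]$; $\pi_x(d\theta)$ is the conditional of $\theta$ given $x$; $\pi(d\theta),\pi(dx)$ are the marginals. For $1\le p\le q$: $Q_{\theta,p,q}(f)(z):=\mathbb E_\theta[f(Z_q)\prod_{k=p}^{q-1}G_{\theta,k}(Z_k)\mid Z_p=z]$ (only $f=1$ is used when $q=T+1$), $Q_{\theta,0,p}(f):=M_{\theta,1}(Q_{\theta,1,p}(f))$, $\eta_{\theta,p}(f):=Q_{\theta,0,p}(f)/Q_{\theta,0,p}(1)$. $\pi\text{-}\mathrm{ess\,sup}_\theta$ is the essential supremum with respect to the marginal $\pi(d\theta)$;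 in (b), $\pi\text{-}\mathrm{ess\,sup}_{\theta,z}$ is the joint essential supremum with respect to the law of $(\theta,x_p)$ under $\pi$, $z$ being the value of the $p$-th coordinate $x_p$ of $x$. i-cSMC kernel $P_{\theta,N}$ (write $M_t,G_t$ for $M_{\theta,t},G_{\theta,t}$). Given $x=(x_1,\dots,x_T)\in\mathsf X$, generate: $Z_1^1=x_1$ and $Z_1^2,\dots,Z_1^N$ i.i.d. $M_1$; for $2\le t\le T$, given the past, $Z_t^1=x_t$, $A_{t-1}^1=1$, and independently for $i=2,\dots,N$, $A_{t-1}^i=k$ with probability $G_{t-1}(Z_{t-1}^k)/\sum_{j=1}^NG_{t-1}(Z_{t-1}^j)$ and then $Z_t^i\sim M_t(Z_{t-1}^{A_{t-1}^i},\cdot)$; finally $A_T=k$ with probability $G_T(Z_T^k)/\sum_jG_T(Z_T^j)$ (if a denominator is zero the index $1$ is selected). With $i_T:=A_T$, $i_t:=A_t^{i_{t+1}}$, $P_{\theta,N}(x,\cdot)$ is the law of $(Z_1^{i_1},\dots,Z_T^{i_T})$. It is $\pi_\theta$-reversible and positive. Gibbs sampler. $\Gamma(\theta_0,x;S):=\int_S\pi_x(d\vartheta)\pi_\vartheta(dy)$ on $\Theta\times\mathsf X$, $\Gamma_x(x,B):=\Gamma(\theta_0,x;\Theta\times B)$; the subscript $x$ in $\Gamma_x,\Phi_{N,x},\Phi_x$ is a name, not a variable. None of these kernels depends on $\theta_0$, so for $\nu$ a probability on $\mathsf X$ the expression $\nu\Phi^k$ makes sense. Notation. $f\in L^2(\Theta,\pi)$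 (resp. $L^2(\mathsf X,\pi)$) means $f$ depends only on $\theta$ (resp. $x$) and is square integrable under the relevant marginal. For a $\mu$-reversible kernel $\Pi$: $\mathcal E_\Pi(f):=\langle f,(I-\Pi)f\rangle_\mu$, $\mathrm{Gap}(\Pi):=\inf\{\mathcal E_\Pi(f)/\|f\|_\mu^2:f\in L^2(\mu),\mu(f)=0,f\neq0\}$. $\mathrm{var}_\mu(f):=\mu(f^2)-\mu(f)^2$; $\mathrm{var}(f,\Pi):=\lim_M\mathrm{var}(M^{-1/2}\sum_{i=1}^M[f(\xi_i)-\mu(f)])$ for the stationary chain with kernel $\Pi$ and invariant law $\mu$. The infimum defining $\varrho$ is over $f$ with nonzero denominator. *)

theory Defs
  imports "HOL-Probability.Probability"
begin

text \<open>
  Spaces are carried by measures, of which only the \<open>space\<close> and \<open>sets\<close> components matter. A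
  trajectory is an element of \<open>PiM {p..q} (\<lambda>_. Z)\<close>. \<open>chain_from Z M p z k\<close> is the law of
  \<open>(Z\<^sub>p, \<dots>, Z\<^bsub>p+k\<^esub>)\<close> given \<open>Z\<^sub>p = z\<close>, where \<open>M t\<close> is the transition from time \<open>t - 1\<close> to time \<open>t\<close>.
\<close>

primrec chain_from ::
  "'z measure \<Rightarrow> (nat \<Rightarrow> 'z \<Rightarrow> 'z measure) \<Rightarrow> nat \<Rightarrow> 'z \<Rightarrow> nat \<Rightarrow> (nat \<Rightarrow> 'z) measure"
where
  "chain_from Z M p z 0 = return (PiM {p..p} (\<lambda>_. Z)) (\<lambda>i\<in>{p}. z)"
| "chain_from Z M p z (Suc k) =
     chain_from Z M p z k \<bind>
       (\<lambda>y. distr (M (p + Suc k) (y (p + k))) (PiM {p..p + Suc k} (\<lambda>_. Z)) (\<lambda>w. y(p + Suc k := w)))"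

text \<open>The law of \<open>(Z\<^sub>1, \<dots>, Z\<^sub>T)\<close> for \<open>T \<ge> 1\<close>, with \<open>Z\<^sub>1\<close> distributed as \<open>M1\<close>.\<close>

definition path_law ::
  "'z measure \<Rightarrow> nat \<Rightarrow> 'z measure \<Rightarrow> (nat \<Rightarrow> 'z \<Rightarrow> 'z measure) \<Rightarrow> (nat \<Rightarrow> 'z) measure"
where
  "path_law Z T M1 M = M1 \<bind> (\<lambda>z. chain_from Z M 1 z (T - 1))"

primrec kernel_power :: "'a measure \<Rightarrow> ('a \<Rightarrow> 'a measure) \<Rightarrow> nat \<Rightarrow> 'a \<Rightarrow> 'a measure" where
  "kernel_power S K 0 x = return S x"
| "kernel_power S K (Suc k) x = kernel_power S K k x \<bind> K"

definition L2 :: "'a measure \<Rightarrow> ('a \<Rightarrow> real) set" where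
  "L2 \<mu> = {f \<in> borel_measurable \<mu>. integrable \<mu> (\<lambda>x. (f x)\<^sup>2)}"

definition inner_L2 :: "'a measure \<Rightarrow> ('a \<Rightarrow> real) \<Rightarrow> ('a \<Rightarrow> real) \<Rightarrow> real" where
  "inner_L2 \<mu> f g = (\<integral>x. f x * g x \<partial>\<mu>)"

definition kernel_op :: "('a \<Rightarrow> 'b measure) \<Rightarrow> ('b \<Rightarrow> real) \<Rightarrow> 'a \<Rightarrow> real" where
  "kernel_op K f x = (\<integral>y. f y \<partial>K x)"

definition var :: "'a measure \<Rightarrow> ('a \<Rightarrow> real) \<Rightarrow> real" where
  "var \<mu> f = (\<integral>x. (f x)\<^sup>2 \<partial>\<mu>) - (\<integral>x. f x \<partial>\<mu>)\<^sup>2"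

definition dirichlet :: "'a measure \<Rightarrow> ('a \<Rightarrow> 'a measure) \<Rightarrow> ('a \<Rightarrow> real) \<Rightarrow> real" where
  "dirichlet \<mu> K f = inner_L2 \<mu> f (\<lambda>x. f x - kernel_op K f x)"

text \<open>
  The infimum is taken in \<open>ereal\<close>, so it is \<open>\<infinity>\<close> when every element of \<open>L\<^sup>2\<close> is almost everywhere
  constant.
\<close>

definition Gap :: "'a measure \<Rightarrow> ('a \<Rightarrow> 'a measure) \<Rightarrow> ereal" where
  "Gap \<mu> K =
     (INF f \<in> {f \<in> L2 \<mu>. (\<integral>x. f x \<partial>\<mu>) = 0 \<and> \<not> (AE x in \<mu>. f x = 0)}.
        ereal (dirichlet \<mu> K f / inner_L2 \<mu> f f))"

text \<open>
  \<open>path_law \<mu> m \<mu> (\<lambda>_. K)\<close> is the law of \<open>m\<close> successive states of the stationary chain. The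
  limit may be \<open>\<infinity>\<close>.
\<close>

definition asvar :: "'a measure \<Rightarrow> ('a \<Rightarrow> 'a measure) \<Rightarrow> ('a \<Rightarrow> real) \<Rightarrow> ereal" where
  "asvar \<mu> K f =
     lim (\<lambda>m. ereal (var (path_law \<mu> m \<mu> (\<lambda>_. K))
                       (\<lambda>\<xi>. (\<Sum>i=1..m. f (\<xi> i) - (\<integral>x. f x \<partial>\<mu>)) / sqrt (real m))))"

text \<open>
  The library constant \<open>esssup\<close> is \<open>\<top>\<close> on non-measurable functions. The variant below is also
  meaningful for functions like \<open>\<theta> \<mapsto> sup\<^sub>z G\<^sub>\<theta>(z)\<close>, which need not be measurable.
\<close>

definition ess_sup :: "'a measure \<Rightarrow> ('a \<Rightarrow> ennreal) \<Rightarrow> ennreal" where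
  "ess_sup \<mu> f = Inf {c. AE x in \<mu>. f x \<le> c}"

lemma ess_sup_eq_esssup: "f \<in> borel_measurable \<mu> \<Longrightarrow> ess_sup \<mu> f = esssup \<mu> f"
  by (simp add: ess_sup_def esssup_eq_AE)

definition gamma_T ::
  "'z measure \<Rightarrow> nat \<Rightarrow> 'z measure \<Rightarrow> (nat \<Rightarrow> 'z \<Rightarrow> 'z measure) \<Rightarrow> (nat \<Rightarrow> 'z \<Rightarrow> real) \<Rightarrow> ennreal"
where
  "gamma_T Z T M1 M G = (\<integral>\<^sup>+ z. (\<Prod>t=1..T. ennreal (G t (z t))) \<partial>path_law Z T M1 M)"

definition fk_target ::
  "'z measure \<Rightarrow> nat \<Rightarrow> 'z measure \<Rightarrow> (nat \<Rightarrow> 'z \<Rightarrow> 'z measure) \<Rightarrow> (nat \<Rightarrow> 'z \<Rightarrow> real)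
     \<Rightarrow> (nat \<Rightarrow> 'z) measure"
where
  "fk_target Z T M1 M G =
     density (path_law Z T M1 M) (\<lambda>z. (\<Prod>t=1..T. ennreal (G t (z t))) / gamma_T Z T M1 M G)"

text \<open>
  \<open>Q\<^sub>p\<^sub>,\<^sub>q(f)(z)\<close> for \<open>1 \<le> p \<le> q \<le> T + 1\<close>. The chain is only run up to time \<open>min q T\<close>; for
  \<open>q = T + 1\<close> the function \<open>f\<close> has to be constant. The conditional expectation given
  \<open>Z\<^sub>p = z\<close> is the version supplied by the transition kernels.
\<close>

definition fk_Q ::
  "'z measure \<Rightarrow> nat \<Rightarrow> (nat \<Rightarrow> 'z \<Rightarrow> 'z measure) \<Rightarrow> (nat \<Rightarrow> 'z \<Rightarrow> real)
     \<Rightarrow> nat \<Rightarrow> nat \<Rightarrow> ('z \<Rightarrow> ennreal) \<Rightarrow> 'z \<Rightarrow> ennreal"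
where
  "fk_Q Z T M G p q f z =
     (\<integral>\<^sup>+ y. f (y q) * (\<Prod>k=p..<q. ennreal (G k (y k))) \<partial>chain_from Z M p z (min q T - p))"

definition fk_Q0 ::
  "'z measure \<Rightarrow> nat \<Rightarrow> 'z measure \<Rightarrow> (nat \<Rightarrow> 'z \<Rightarrow> 'z measure) \<Rightarrow> (nat \<Rightarrow> 'z \<Rightarrow> real)
     \<Rightarrow> nat \<Rightarrow> ('z \<Rightarrow> ennreal) \<Rightarrow> ennreal"
where
  "fk_Q0 Z T M1 M G p f = (\<integral>\<^sup>+ z. fk_Q Z T M G 1 p f z \<partial>M1)"

text \<open>
  No finiteness of \<open>Q\<^sub>0\<^sub>,\<^sub>p(1)\<close> is assumed for \<open>p \<le> T\<close>; \<open>ennreal\<close> division has \<open>a / \<infinity> = 0\<close>, also for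
  \<open>a = \<infinity>\<close>, and \<open>a / 0 = \<infinity>\<close> for \<open>a > 0\<close>.
\<close>

definition fk_eta ::
  "'z measure \<Rightarrow> nat \<Rightarrow> 'z measure \<Rightarrow> (nat \<Rightarrow> 'z \<Rightarrow> 'z measure) \<Rightarrow> (nat \<Rightarrow> 'z \<Rightarrow> real)
     \<Rightarrow> nat \<Rightarrow> ('z \<Rightarrow> ennreal) \<Rightarrow> ennreal"
where
  "fk_eta Z T M1 M G p f = fk_Q0 Z T M1 M G p f / fk_Q0 Z T M1 M G p (\<lambda>_. 1)"

definition select_index :: "nat \<Rightarrow> (nat \<Rightarrow> real) \<Rightarrow> nat measure" where
  "select_index N w =
     point_measure {1..N}
       (\<lambda>k. if (\<Sum>j=1..N. w j) = 0 then (if k = 1 then 1 else 0) else ennreal (w k / (\<Sum>j=1..N. w j)))"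

text \<open>
  Particle \<open>i\<close> at time \<open>t\<close> is stored together with the index of its parent, as
  \<open>(A\<^bsub>t-1\<^esub>\<^sup>i, Z\<^sub>t\<^sup>i)\<close>; at time \<open>1\<close> the parent index is a dummy. \<open>prev\<close> is the generation at
  time \<open>t - 1\<close>, and \<open>x\<close> the reference trajectory.
\<close>

definition particle_space :: "nat \<Rightarrow> 'z measure \<Rightarrow> (nat \<times> 'z) measure" where
  "particle_space N Z = count_space {1..N} \<Otimes>\<^sub>M Z"

definition generation_space :: "nat \<Rightarrow> 'z measure \<Rightarrow> (nat \<Rightarrow> nat \<times> 'z) measure" where
  "generation_space N Z = PiM {1..N} (\<lambda>_. particle_space N Z)"

definition particle_law ::
  "'z measure \<Rightarrow> nat \<Rightarrow> 'z measure \<Rightarrow> (nat \<Rightarrow> 'z \<Rightarrow> 'z measure) \<Rightarrow> (nat \<Rightarrow> 'z \<Rightarrow> real)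
     \<Rightarrow> (nat \<Rightarrow> 'z) \<Rightarrow> nat \<Rightarrow> (nat \<Rightarrow> nat \<times> 'z) \<Rightarrow> nat \<Rightarrow> (nat \<times> 'z) measure"
where
  "particle_law Z N M1 M G x t prev i =
     (if i = 1 then return (particle_space N Z) (1, x t)
      else if t = 1 then distr M1 (particle_space N Z) (\<lambda>z. (1, z))
      else select_index N (\<lambda>k. G (t - 1) (snd (prev k))) \<bind>
             (\<lambda>k. distr (M t (snd (prev k))) (particle_space N Z) (\<lambda>z. (k, z))))"

primrec csmc_history ::
  "'z measure \<Rightarrow> nat \<Rightarrow> 'z measure \<Rightarrow> (nat \<Rightarrow> 'z \<Rightarrow> 'z measure) \<Rightarrow> (nat \<Rightarrow> 'z \<Rightarrow> real)
     \<Rightarrow> (nat \<Rightarrow> 'z) \<Rightarrow> nat \<Rightarrow> (nat \<Rightarrow> nat \<Rightarrow> nat \<times> 'z) measure"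
where
  "csmc_history Z N M1 M G x 0 =
     return (PiM {1..0} (\<lambda>_. generation_space N Z)) (\<lambda>_. undefined)"
| "csmc_history Z N M1 M G x (Suc t) =
     csmc_history Z N M1 M G x t \<bind>
       (\<lambda>h. distr (PiM {1..N} (particle_law Z N M1 M G x (Suc t) (h t)))
              (PiM {1..Suc t} (\<lambda>_. generation_space N Z)) (\<lambda>g. h(Suc t := g)))"

text \<open>\<open>ancestor h T k j\<close> is \<open>i\<^bsub>T-j\<^esub>\<close> when \<open>i\<^sub>T = k\<close>.\<close>

primrec ancestor :: "(nat \<Rightarrow> nat \<Rightarrow> nat \<times> 'z) \<Rightarrow> nat \<Rightarrow> nat \<Rightarrow> nat \<Rightarrow> nat" where
  "ancestor h T k 0 = k"
| "ancestor h T k (Suc j) = fst (h (T - j) (ancestor h T k j))"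

definition icsmc ::
  "'z measure \<Rightarrow> nat \<Rightarrow> nat \<Rightarrow> 'z measure \<Rightarrow> (nat \<Rightarrow> 'z \<Rightarrow> 'z measure) \<Rightarrow> (nat \<Rightarrow> 'z \<Rightarrow> real)
     \<Rightarrow> (nat \<Rightarrow> 'z) \<Rightarrow> (nat \<Rightarrow> 'z) measure"
where
  "icsmc Z T N M1 M G x =
     csmc_history Z N M1 M G x T \<bind>
       (\<lambda>h. select_index N (\<lambda>k. G T (snd (h T k))) \<bind>
         (\<lambda>k. return (PiM {1..T} (\<lambda>_. Z)) (\<lambda>t\<in>{1..T}. snd (h t (ancestor h T k (T - t))))))"

text \<open>
  From \<open>(\<theta>\<^sub>0, x)\<close>, draw \<open>\<theta>\<close> from \<open>\<kappa> x\<close> and then the new trajectory from \<open>K \<theta> x\<close>. The result does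
  not depend on \<open>\<theta>\<^sub>0\<close>, and \<open>scan_kernel_x\<close> is its marginal on trajectories.
\<close>

definition scan_step ::
  "'th measure \<Rightarrow> 'x measure \<Rightarrow> ('x \<Rightarrow> 'th measure) \<Rightarrow> ('th \<Rightarrow> 'x \<Rightarrow> 'x measure)
     \<Rightarrow> 'x \<Rightarrow> ('th \<times> 'x) measure"
where
  "scan_step \<Theta> X \<kappa> K x = \<kappa> x \<bind> (\<lambda>\<theta>. K \<theta> x \<bind> (\<lambda>y. return (\<Theta> \<Otimes>\<^sub>M X) (\<theta>, y)))"

definition scan_kernel ::
  "'th measure \<Rightarrow> 'x measure \<Rightarrow> ('x \<Rightarrow> 'th measure) \<Rightarrow> ('th \<Rightarrow> 'x \<Rightarrow> 'x measure)
     \<Rightarrow> 'th \<times> 'x \<Rightarrow> ('th \<times> 'x) measure"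
where
  "scan_kernel \<Theta> X \<kappa> K = (\<lambda>(\<theta>\<^sub>0, x). scan_step \<Theta> X \<kappa> K x)"

definition scan_kernel_x ::
  "'th measure \<Rightarrow> 'x measure \<Rightarrow> ('x \<Rightarrow> 'th measure) \<Rightarrow> ('th \<Rightarrow> 'x \<Rightarrow> 'x measure)
     \<Rightarrow> 'x \<Rightarrow> 'x measure"
where
  "scan_kernel_x \<Theta> X \<kappa> K x = distr (scan_step \<Theta> X \<kappa> K x) X snd"

text \<open>
  \<open>\<pi>T\<close> and \<open>\<pi>X\<close> are the marginals, \<open>tgt \<theta>\<close> is the conditional law of \<open>x\<close> given \<open>\<theta>\<close>, and \<open>P \<theta>\<close> is
  \<open>tgt \<theta>\<close>-reversible. Spectral gaps of reversible kernels are non-negative, so \<open>e2ennreal\<close> loses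
  nothing; a gap \<open>\<infinity>\<close> occurs only where the variance is \<open>0\<close>. If \<open>\<theta> \<mapsto> Gap (tgt \<theta>) (P \<theta>)\<close> is not
  measurable, \<open>nn_integral\<close> is the lower integral. For positive \<open>P \<theta>\<close> the gap is at most \<open>1\<close> where
  the variance is not \<open>0\<close>, so the infimum lies in \<open>[0, 1]\<close> and \<open>enn2real\<close> loses nothing. When every
  \<open>L\<^sup>2\<close> function of \<open>x\<close> is almost surely a function of \<open>\<theta>\<close>, there is no \<open>f\<close> to take the infimum
  over, and the value is set to \<open>1\<close>, the largest possible one.
\<close>

definition gap_ratio ::
  "'th measure \<Rightarrow> 'x measure \<Rightarrow> ('th \<Rightarrow> 'x measure) \<Rightarrow> ('th \<Rightarrow> 'x \<Rightarrow> 'x measure) \<Rightarrow> real"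
where
  "gap_ratio \<pi>T \<pi>X tgt P =
     (let F = {f \<in> L2 \<pi>X. (\<integral>\<^sup>+ \<theta>. ennreal (var (tgt \<theta>) f) \<partial>\<pi>T) \<noteq> 0}
      in if F = {} then 1
         else enn2real (INF f\<in>F.
                (\<integral>\<^sup>+ \<theta>. ennreal (var (tgt \<theta>) f) * e2ennreal (Gap (tgt \<theta>) (P \<theta>)) \<partial>\<pi>T)
                  / (\<integral>\<^sup>+ \<theta>. ennreal (var (tgt \<theta>) f) \<partial>\<pi>T)))"

end

theory Submission
  imports Defs
begin

text \<open>
 Both samplers have Dirichlet forms on functions of \<open>x\<close> which are mixtures over \<open>\<theta>\<close>, namely of
 \<open>\<E>\<^bsub>P\<^sub>\<theta>\<^esub>(f)\<close> for particle Gibbs and of \<open>var\<^bsub>\<pi>\<^sub>\<theta>\<^esub>(f)\<close> for Gibbs, so that the definition of \<open>\<rho>\<close> and the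
 positivity of \<open>P\<^sub>\<theta>\<close> give \<open>\<rho> \<E>\<^bsub>\<Gamma>\<^esub> \<le> \<E>\<^bsub>\<Phi>\<^esub> \<le> \<E>\<^bsub>\<Gamma>\<^esub>\<close>. For a positive reversible kernel \<open>\<Pi>\<close> the asymptotic variance
 \<open>2 \<Sum>\<^sub>k \<langle>f, \<Pi>\<^sup>k f\<rangle> - \<parallel>f\<parallel>\<^sup>2\<close> of a centred \<open>f\<close> has a variational formula which shows that it is antitone in the
 Dirichlet form. Since \<open>\<Phi>\<close> forgets its first component, the correlations of a function \<open>f\<close> of \<open>\<theta>\<close> are those
 of \<open>x \<mapsto> \<pi>\<^sub>x(f)\<close>, with a shift by one step.

 The conditional particle filter is reversible and positive since the old and the new path are conditionally
 independent and identically distributed given an exchangeable particle system which contains both. For the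
 bounds on \<open>\<rho>\<close>, only new paths \<open>y\<close> that never select the reference path \<open>x\<close> are taken into account. Jensen's
 inequality for \<open>u \<mapsto> 1 / u\<close> gives \<open>P\<^sub>\<theta>(x, dy) \<ge> (N - 1)\<^sup>T \<gamma>\<^sub>\<theta> \<pi>\<^sub>\<theta>(dy) / h(x, y)\<close>, where \<open>h(x, y)\<close> is the expected
 product of the total weights of a particle system with the two fixed paths \<open>x\<close> and \<open>y\<close>. It expands into
 products of Feynman--Kac semigroups, which are controlled by the bounds on the potentials in (a) and by the
 mixing condition in (b).
\<close>

text \<open>Reversibility and positivity are stated for nonnegative functions in
  \<open>ennreal\<close>, so the particle system needs no integrability; signed statements follow by
  splitting into positive and negative parts. No spectral theorem enters: the correlations of a
  positive kernel are nonnegative, and sums of iterates serve as approximate maximisers in the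
  variational formula. The constants come from counting. With two frozen paths among N particles,
  the product of the T total weights has N^T terms. The (N - 2)^T terms that follow free particles
  throughout integrate to \<gamma>. In (a) each other term is at most the product of the suprema; in
  (b) a frozen path costs a factor \<alpha>, which makes N - 2 + 2 \<alpha> per time step. Jensen's
  inequality is applied one time step at a time in a backward recursion, which avoids constructing
  the law of the system with two frozen paths. The selection of index 1 at total weight 0 breaks the
  symmetry of the particles; such states are discarded explicitly.\<close>

abbreviation (input) "bm \<equiv> borel_measurable"
abbreviation (input) prob_kernels (infixr "\<leadsto>" 60) where "M \<leadsto> N \<equiv> M \<rightarrow>\<^sub>M prob_algebra N"

lemmas comp_fst = measurable_compose[OF measurable_fst]
lemmas comp_snd = measurable_compose[OF measurable_snd]
lemmas comp_ennreal = measurable_compose[OF _ measurable_ennreal]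

section \<open>Probability kernels and disintegration of integrals\<close>

lemma sets_prob_algebra_cong: "sets M = sets N ==> prob_algebra M = prob_algebra N"
 unfolding prob_algebra_def by (simp cong: subprob_algebra_cong)

lemma prob_kernelD:
 assumes "K \<in> M \<leadsto> N" "x \<in> space M"
 shows "prob_space (K x)" "sets (K x) = sets N" "space (K x) = space N"
 using measurable_space[OF assms] sets_eq_imp_space_eq[of "K x" N] by (auto simp: space_prob_algebra)

lemma nn_integral_kernel_bind:
 assumes "sets \<mu> = sets M" "K \<in> M \<leadsto> N" "f \<in> bm N"
 shows "nn_integral (\<mu> \<bind> K) f = (\<integral>\<^sup>+x. \<integral>\<^sup>+y. f y \<partial>K x \<partial>\<mu>)"
 by (rule nn_integral_bind[OF assms(3)])
   (use assms in \<open>auto cong: measurable_cong_sets intro: measurable_prob_algebraD\<close>)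

lemma nn_integral_kernel_measurable:
 assumes "K \<in> M \<leadsto> N" "f \<in> bm N"
 shows "(\<lambda>x. \<integral>\<^sup>+y. f y \<partial>K x) \<in> bm M"
 by (rule measurable_compose[OF measurable_prob_algebraD[OF assms(1)] nn_integral_measurable_subprob_algebra[OF assms(2)]])

lemma nn_integral_kernel_measurable2:
 assumes "K \<in> M \<leadsto> N" "(\<lambda>(x, y). f x y) \<in> bm (M \<Otimes>\<^sub>M N)"
 shows "(\<lambda>x. \<integral>\<^sup>+y. f x y \<partial>K x) \<in> bm M"
 by (rule nn_integral_measurable_subprob_algebra2[OF assms(2) measurable_prob_algebraD[OF assms(1)]])

lemma integral_kernel_measurable:
 fixes f :: "'b => real"
 assumes "K \<in> M \<leadsto> N" "f \<in> bm N"
 shows "(\<lambda>x. \<integral>y. f y \<partial>K x) \<in> bm M"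
 by (rule measurable_compose[OF measurable_prob_algebraD[OF assms(1)] integral_measurable_subprob_algebra[OF assms(2)]])

lemma sets_kernel_bind:
 assumes "sets \<mu> = sets M" "K \<in> M \<leadsto> N" "space \<mu> \<noteq> {}"
 shows "sets (\<mu> \<bind> K) = sets N"
 by (rule sets_bind) (use assms prob_kernelD(2)[OF assms(2)] sets_eq_imp_space_eq[OF assms(1)] in auto)

text \<open>P is not assumed measurable: the exceptional set is first enlarged to a measurable null
  set of the mixture, to which \<open>AE_bind\<close> applies.\<close>

lemma AE_kernel_bind:
 assumes "sets \<mu> = sets M" "K \<in> M \<leadsto> N" "space \<mu> \<noteq> {}"
  and "AE y in \<mu> \<bind> K. P y"
 shows "AE x in \<mu>. AE y in K x. P y"
proof -
 from assms(4) obtain A where A: "A \<in> null_sets (\<mu> \<bind> K)" "{y \<in> space (\<mu> \<bind> K). \<not> P y} \<subseteq> A"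
  unfolding eventually_ae_filter by auto
 have sN: "sets (\<mu> \<bind> K) = sets N" using assms by (intro sets_kernel_bind)
 have sp: "space (\<mu> \<bind> K) = space N" using sN by (rule sets_eq_imp_space_eq)
 have AN: "A \<in> sets N" using A sN by auto
 have "AE y in \<mu> \<bind> K. y \<notin> A" using A(1) by (rule AE_not_in)
 then have "AE x in \<mu>. AE y in K x. y \<notin> A"
  by (subst (asm) AE_bind[where B=N])
    (use assms AN in \<open>auto cong: measurable_cong_sets intro: measurable_prob_algebraD\<close>)
 moreover have "AE x in \<mu>. x \<in> space \<mu>" by simp
 ultimately show ?thesis
 proof eventually_elim
  case (elim x)
  then have "x \<in> space M" using sets_eq_imp_space_eq[OF assms(1)] by simp
  then have "space (K x) = space N" by (rule prob_kernelD[OF assms(2)])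
  then have "AE y in K x. y \<in> space N" by (intro AE_I2) simp
  with elim(1) show ?case by eventually_elim (use A(2) sp in auto)
 qed
qed

text \<open>Since f is integrable for the mixture only, it may fail to be integrable for
  \<open>K x\<close> on a null set of x, where the inner integral takes its default value.
  Everything is reduced to nonnegative integrals.\<close>

lemma integral_kernel_bind:
 fixes f :: "'b => real"
 assumes \<mu>: "sets \<mu> = sets M" and K: "K \<in> M \<leadsto> N" and ne: "space \<mu> \<noteq> {}"
  and f: "integrable (\<mu> \<bind> K) f"
 shows "AE x in \<mu>. integrable (K x) f"
  and "integrable \<mu> (\<lambda>x. \<integral>y. f y \<partial>K x)"
  and "integral\<^sup>L (\<mu> \<bind> K) f = (\<integral>x. \<integral>y. f y \<partial>K x \<partial>\<mu>)"
proof -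
 have sN: "sets (\<mu> \<bind> K) = sets N" using \<mu> K ne by (rule sets_kernel_bind)
 have fm[measurable]: "f \<in> bm N" using f sN by (auto cong: measurable_cong_sets)
 have Kx: "sets (K x) = sets N" if "x \<in> space \<mu>" for x
  using that prob_kernelD(2)[OF K] sets_eq_imp_space_eq[OF \<mu>] by simp
 have fmK: "f \<in> bm (K x)" if "x \<in> space \<mu>" for x
  using fm Kx[OF that] by (auto cong: measurable_cong_sets)
 have nn: "(\<integral>\<^sup>+y. ennreal (h (f y)) \<partial>(\<mu> \<bind> K)) = (\<integral>\<^sup>+x. \<integral>\<^sup>+y. ennreal (h (f y)) \<partial>K x \<partial>\<mu>)"
  if [measurable]: "h \<in> bm borel" for h :: "real => real"
  by (rule nn_integral_kernel_bind[OF \<mu> K]) measurable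
 have m: "(\<lambda>x. \<integral>\<^sup>+y. ennreal (h (f y)) \<partial>K x) \<in> bm \<mu>"
  if [measurable]: "h \<in> bm borel" for h :: "real => real"
  using nn_integral_kernel_measurable[OF K, of "\<lambda>y. ennreal (h (f y))"] \<mu>
  by (auto cong: measurable_cong_sets)
 have fin: "(\<integral>\<^sup>+x. \<integral>\<^sup>+y. ennreal \<bar>f y\<bar> \<partial>K x \<partial>\<mu>) < \<infinity>"
  using f nn[of abs] by (simp add: integrable_iff_bounded)
 have "AE x in \<mu>. (\<integral>\<^sup>+y. ennreal \<bar>f y\<bar> \<partial>K x) \<noteq> \<infinity>"
  by (rule nn_integral_PInf_AE) (use m[of abs] fin in auto)
 moreover have "AE x in \<mu>. x \<in> space \<mu>" by simp
 ultimately show ae: "AE x in \<mu>. integrable (K x) f"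
  by eventually_elim (use fmK in \<open>auto simp: integrable_iff_bounded top.not_eq_extremum\<close>)
 have gm: "(\<lambda>x. \<integral>y. f y \<partial>K x) \<in> bm \<mu>"
  using integral_kernel_measurable[OF K fm] \<mu> by (auto cong: measurable_cong_sets)
 have pp: "(\<lambda>x. max 0 x) \<in> bm (borel :: real measure)" by measurable
 \<comment> \<open>Used for h the identity and for h the negation: \<open>ennreal\<close> cuts off
   negative values, so these are the positive and the negative part of f.\<close>
 have P: "integrable \<mu> (\<lambda>x. enn2real (\<integral>\<^sup>+y. ennreal (h (f y)) \<partial>K x))"
  "(\<integral>x. enn2real (\<integral>\<^sup>+y. ennreal (h (f y)) \<partial>K x) \<partial>\<mu>) = enn2real (\<integral>\<^sup>+y. ennreal (h (f y)) \<partial>(\<mu> \<bind> K))"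
  if h[measurable]: "h \<in> bm borel" and hb: "\<And>x. h x \<le> \<bar>x\<bar>" for h :: "real => real"
 proof -
  have le: "(\<integral>\<^sup>+y. ennreal (h (f y)) \<partial>K x) \<le> (\<integral>\<^sup>+y. ennreal \<bar>f y\<bar> \<partial>K x)" for x
   by (intro nn_integral_mono ennreal_leI hb)
  have fin': "AE x in \<mu>. (\<integral>\<^sup>+y. ennreal (h (f y)) \<partial>K x) < \<infinity>"
   using ae by eventually_elim
    (use le in \<open>auto simp: integrable_iff_bounded intro: le_less_trans\<close>)
  have e: "(\<integral>\<^sup>+x. ennreal (enn2real (\<integral>\<^sup>+y. ennreal (h (f y)) \<partial>K x)) \<partial>\<mu>) = (\<integral>\<^sup>+y. ennreal (h (f y)) \<partial>(\<mu> \<bind> K))"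
   unfolding nn[OF h] using fin' by (intro nn_integral_cong_AE) (auto elim!: eventually_mono)
  have mm: "(\<lambda>x. enn2real (\<integral>\<^sup>+y. ennreal (h (f y)) \<partial>K x)) \<in> bm \<mu>"
   using m[OF h] by measurable
  have lt: "(\<integral>\<^sup>+y. ennreal (h (f y)) \<partial>(\<mu> \<bind> K)) < \<infinity>"
   unfolding nn[OF h] using fin by (rule le_less_trans[rotated]) (intro nn_integral_mono le)
  show 1: "integrable \<mu> (\<lambda>x. enn2real (\<integral>\<^sup>+y. ennreal (h (f y)) \<partial>K x))"
   using mm e lt by (auto simp: integrable_iff_bounded)
  show "(\<integral>x. enn2real (\<integral>\<^sup>+y. ennreal (h (f y)) \<partial>K x) \<partial>\<mu>) = enn2real (\<integral>\<^sup>+y. ennreal (h (f y)) \<partial>(\<mu> \<bind> K))"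
   by (subst integral_eq_nn_integral) (use mm e in auto)
 qed
 have id: "(\<lambda>x::real. x) \<in> bm borel" "(\<lambda>x::real. - x) \<in> bm borel" by auto
 note P1 = P[of "\<lambda>x. x", OF id(1)] and P2 = P[of uminus, OF id(2)]
 have eq: "AE x in \<mu>. integral\<^sup>L (K x) f =
   enn2real (\<integral>\<^sup>+y. ennreal (f y) \<partial>K x) - enn2real (\<integral>\<^sup>+y. ennreal (- f y) \<partial>K x)"
  using ae by eventually_elim (simp add: real_lebesgue_integral_def)
 have I: "integrable \<mu> (\<lambda>x. enn2real (\<integral>\<^sup>+y. ennreal (f y) \<partial>K x) - enn2real (\<integral>\<^sup>+y. ennreal (- f y) \<partial>K x))"
  using P1(1) P2(1) by auto
 have gm': "(\<lambda>x. enn2real (\<integral>\<^sup>+y. ennreal (f y) \<partial>K x) - enn2real (\<integral>\<^sup>+y. ennreal (- f y) \<partial>K x)) \<in> bm \<mu>"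
  using I by auto
 show "integrable \<mu> (\<lambda>x. \<integral>y. f y \<partial>K x)"
  using integrable_cong_AE[OF gm gm' eq] I by simp
 have "(\<integral>x. \<integral>y. f y \<partial>K x \<partial>\<mu>) = (\<integral>x. enn2real (\<integral>\<^sup>+y. ennreal (f y) \<partial>K x) - enn2real (\<integral>\<^sup>+y. ennreal (- f y) \<partial>K x) \<partial>\<mu>)"
  by (rule integral_cong_AE[OF gm gm' eq])
 also have "... = integral\<^sup>L (\<mu> \<bind> K) f"
  using P1 P2 f by (simp add: real_lebesgue_integral_def)
 finally show "integral\<^sup>L (\<mu> \<bind> K) f = (\<integral>x. \<integral>y. f y \<partial>K x \<partial>\<mu>)" by simp
qed

lemma measurable_param_section:
 assumes "(\<lambda>(\<theta>, z). N \<theta> z) \<in> A \<Otimes>\<^sub>M Z \<rightarrow>\<^sub>M L" "\<theta> \<in> space A" shows "N \<theta> \<in> Z \<rightarrow>\<^sub>M L"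
 using measurable_compose[OF measurable_Pair1'[OF assms(2)] assms(1)] by simp

context
 fixes \<mu> A :: "'a measure" and B :: "'b measure" and K N and h :: "'a => 'b => 'c"
 assumes \<mu>: "sets \<mu> = sets A" and K: "K \<in> A \<leadsto> B" and h: "(\<lambda>(x, y). h x y) \<in> A \<Otimes>\<^sub>M B \<rightarrow>\<^sub>M N"
begin

lemma kernel_distr_measurable: "(\<lambda>x. distr (K x) N (h x)) \<in> A \<leadsto> N"
 by (rule measurable_distr_prob_space2[OF K h])

lemma section_measurable: "x \<in> space \<mu> ==> h x \<in> K x \<rightarrow>\<^sub>M N"
 using measurable_param_section[OF h] prob_kernelD(2)[OF K] sets_eq_imp_space_eq[OF \<mu>] by (simp cong: measurable_cong_sets)

lemma nn_integral_bind_distr: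
 assumes F: "F \<in> bm N"
 shows "nn_integral (\<mu> \<bind> (\<lambda>x. distr (K x) N (h x))) F = (\<integral>\<^sup>+x. \<integral>\<^sup>+y. F (h x y) \<partial>K x \<partial>\<mu>)"
 unfolding nn_integral_kernel_bind[OF \<mu> kernel_distr_measurable F]
 by (intro nn_integral_cong nn_integral_distr section_measurable) (simp_all add: F)

lemma AE_bind_distr:
 assumes "space \<mu> \<noteq> {}" "AE q in \<mu> \<bind> (\<lambda>x. distr (K x) N (h x)). P q"
 shows "AE x in \<mu>. AE y in K x. P (h x y)"
proof -
 have "AE x in \<mu>. x \<in> space \<mu>" by simp
 with AE_kernel_bind[OF \<mu> kernel_distr_measurable assms] show ?thesis
  by eventually_elim (rule AE_distrD[OF section_measurable])
qed

lemma integral_bind_distr: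
 fixes F :: "'c => real"
 assumes "space \<mu> \<noteq> {}" "integrable (\<mu> \<bind> (\<lambda>x. distr (K x) N (h x))) F" "F \<in> bm N"
 shows "integral\<^sup>L (\<mu> \<bind> (\<lambda>x. distr (K x) N (h x))) F = (\<integral>x. \<integral>y. F (h x y) \<partial>K x \<partial>\<mu>)"
 unfolding integral_kernel_bind(3)[OF \<mu> kernel_distr_measurable assms(1,2)]
 by (intro Bochner_Integration.integral_cong refl integral_distr section_measurable assms(3))

end

text \<open>Nonnegativity of the variance. If the square is not integrable, the right-hand side is
  \<infinity>, so the bound can serve to prove square integrability.\<close>

lemma square_integral_le:
 fixes f :: "'a => real"
 assumes "prob_space M" and [measurable]: "f \<in> bm M"
 shows "ennreal ((integral\<^sup>L M f)\<^sup>2) \<le> (\<integral>\<^sup>+x. ennreal ((f x)\<^sup>2) \<partial>M)"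
proof (cases "integrable M (\<lambda>x. (f x)\<^sup>2)")
 case True
 interpret prob_space M by fact
 have "integrable M f" by (rule square_integrable_imp_integrable[OF _ True]) simp
 have "0 \<le> variance f" by (rule variance_positive)
 then have "(integral\<^sup>L M f)\<^sup>2 \<le> (\<integral>x. (f x)\<^sup>2 \<partial>M)"
  using variance_eq[OF \<open>integrable M f\<close> True] by simp
 moreover have "(\<integral>\<^sup>+x. ennreal ((f x)\<^sup>2) \<partial>M) = ennreal (\<integral>x. (f x)\<^sup>2 \<partial>M)"
  by (rule nn_integral_eq_integral[OF True]) simp
 ultimately show ?thesis by (simp add: ennreal_leI)
next
 case False
 then have "(\<integral>\<^sup>+x. ennreal ((f x)\<^sup>2) \<partial>M) = \<infinity>" using top.not_eq_extremum by (fastforce simp: integrable_iff_bounded)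
 then show ?thesis by simp
qed

subsection \<open>Square integrable functions\<close>

lemma L2_measurable: "f \<in> L2 \<mu> ==> f \<in> bm \<mu>"
 and L2_square_integrable: "f \<in> L2 \<mu> ==> integrable \<mu> (\<lambda>x. (f x)\<^sup>2)"
 by (auto simp: L2_def)

lemma L2_iff_nn: "f \<in> L2 \<mu> \<longleftrightarrow> f \<in> bm \<mu> \<and> (\<integral>\<^sup>+x. ennreal ((f x)\<^sup>2) \<partial>\<mu>) < \<infinity>"
 by (auto simp: L2_def integrable_iff_bounded)

lemma L2_integrable_mult:
 assumes "f \<in> L2 \<mu>" "g \<in> L2 \<mu>"
 shows "integrable \<mu> (\<lambda>x. f x * g x)"
proof (rule Bochner_Integration.integrable_bound)
 show "integrable \<mu> (\<lambda>x. (f x)\<^sup>2 + (g x)\<^sup>2)" using assms by (auto simp: L2_def)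
 show "AE x in \<mu>. norm (f x * g x) \<le> norm ((f x)\<^sup>2 + (g x)\<^sup>2)"
 proof (rule AE_I2)
  fix x
  have "2 * (\<bar>f x\<bar> * \<bar>g x\<bar>) \<le> (f x)\<^sup>2 + (g x)\<^sup>2"
   using sum_squares_bound[of "\<bar>f x\<bar>" "\<bar>g x\<bar>"] by simp
  moreover have "0 \<le> \<bar>f x\<bar> * \<bar>g x\<bar>" by simp
  ultimately have "\<bar>f x\<bar> * \<bar>g x\<bar> \<le> (f x)\<^sup>2 + (g x)\<^sup>2" by linarith
  then show "norm (f x * g x) \<le> norm ((f x)\<^sup>2 + (g x)\<^sup>2)" by (simp add: abs_mult)
 qed
qed (use assms in \<open>auto simp: L2_def\<close>)

lemma L2_add: "f \<in> L2 \<mu> ==> g \<in> L2 \<mu> ==> (\<lambda>x. f x + g x) \<in> L2 \<mu>"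
 using L2_integrable_mult[of f \<mu> g] by (auto simp: L2_def power2_sum mult.assoc)

lemma L2_cmult: "f \<in> L2 \<mu> ==> (\<lambda>x. c * f x) \<in> L2 \<mu>"
 by (auto simp: L2_def power_mult_distrib)

lemma L2_diff: "f \<in> L2 \<mu> ==> g \<in> L2 \<mu> ==> (\<lambda>x. f x - g x) \<in> L2 \<mu>"
 using L2_add[of f \<mu> "\<lambda>x. (-1) * g x"] L2_cmult[of g \<mu> "-1"] by simp

lemma L2_sum: "(\<And>i. i \<in> I ==> f i \<in> L2 \<mu>) ==> (\<lambda>x. \<Sum>i\<in>I. f i x) \<in> L2 \<mu>"
 by (induction I rule: infinite_finite_induct) (auto simp: L2_add, auto simp: L2_def)

lemma (in finite_measure) L2_const: "(\<lambda>x. c) \<in> L2 M"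
 by (auto simp: L2_def)

lemma (in finite_measure) L2_integrable: "f \<in> L2 M ==> integrable M f"
 using L2_integrable_mult[OF _ L2_const[of 1], of f] by simp

lemma inner_L2_commute: "inner_L2 \<mu> f g = inner_L2 \<mu> g f"
 by (simp add: inner_L2_def mult.commute)

lemma inner_L2_add: "f \<in> L2 \<mu> ==> g \<in> L2 \<mu> ==> h \<in> L2 \<mu> ==> inner_L2 \<mu> f (\<lambda>x. g x + h x) = inner_L2 \<mu> f g + inner_L2 \<mu> f h"
 using L2_integrable_mult[of f \<mu> g] L2_integrable_mult[of f \<mu> h]
 by (simp add: inner_L2_def distrib_left)

lemma inner_L2_diff: "f \<in> L2 \<mu> ==> g \<in> L2 \<mu> ==> h \<in> L2 \<mu> ==> inner_L2 \<mu> f (\<lambda>x. g x - h x) = inner_L2 \<mu> f g - inner_L2 \<mu> f h"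
 using L2_integrable_mult[of f \<mu> g] L2_integrable_mult[of f \<mu> h]
 by (simp add: inner_L2_def right_diff_distrib)

lemma inner_L2_cmult: "inner_L2 \<mu> f (\<lambda>x. c * g x) = c * inner_L2 \<mu> f g"
proof -
 have "(\<lambda>x. f x * (c * g x)) = (\<lambda>x. c * (f x * g x))" by (auto simp: ac_simps)
 then show ?thesis by (simp add: inner_L2_def)
qed

lemma inner_L2_sum: "f \<in> L2 \<mu> ==> (\<And>i. i \<in> I ==> g i \<in> L2 \<mu>) ==>
  inner_L2 \<mu> f (\<lambda>x. \<Sum>i\<in>I. g i x) = (\<Sum>i\<in>I. inner_L2 \<mu> f (g i))"
 by (simp add: inner_L2_def sum_distrib_left L2_integrable_mult)

lemma inner_L2_cong_AE:
 assumes "f \<in> bm \<mu>" "g \<in> bm \<mu>" "h \<in> bm \<mu>" "AE x in \<mu>. g x = h x"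
 shows "inner_L2 \<mu> f g = inner_L2 \<mu> f h"
 unfolding inner_L2_def by (rule integral_cong_AE) (use assms in auto)

subsection \<open>Invariant kernels\<close>

text \<open>Invariance is kept apart from reversibility because the systematic scan on pairs
  (\<theta>, x) is in general not reversible; only its action on x is.\<close>

locale invariant_kernel = prob_space \<mu> for \<mu> :: "'a measure" +
 fixes K :: "'a => 'a measure"
 assumes K: "K \<in> \<mu> \<leadsto> \<mu>"
  and inv: "\<mu> \<bind> K = \<mu>"
begin

lemma nn_integral_inv:
 assumes "f \<in> bm \<mu>"
 shows "(\<integral>\<^sup>+x. \<integral>\<^sup>+y. f y \<partial>K x \<partial>\<mu>) = nn_integral \<mu> f"
 using nn_integral_kernel_bind[OF refl K assms] inv by simp

lemma AE_inv: "AE y in \<mu>. P y ==> AE x in \<mu>. AE y in K x. P y"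
 using AE_kernel_bind[OF refl K not_empty, of P] unfolding inv .

lemma integral_inv:
 fixes f :: "'a => real"
 assumes "integrable \<mu> f"
 shows "AE x in \<mu>. integrable (K x) f" "integrable \<mu> (kernel_op K f)" "integral\<^sup>L \<mu> (kernel_op K f) = integral\<^sup>L \<mu> f"
 using integral_kernel_bind[OF refl K not_empty, of f] assms inv
 by (simp_all add: kernel_op_def[abs_def])

lemma kernel_op_measurable: "f \<in> bm \<mu> ==> kernel_op K f \<in> bm \<mu>"
 using integral_kernel_measurable[OF K, of f] by (simp add: kernel_op_def[abs_def])

lemma kernel_op_square_le:
 assumes "f \<in> bm \<mu>"
 shows "(\<integral>\<^sup>+x. ennreal ((kernel_op K f x)\<^sup>2) \<partial>\<mu>) \<le> (\<integral>\<^sup>+x. ennreal ((f x)\<^sup>2) \<partial>\<mu>)"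
proof -
 have "(\<integral>\<^sup>+x. ennreal ((kernel_op K f x)\<^sup>2) \<partial>\<mu>) \<le> (\<integral>\<^sup>+x. \<integral>\<^sup>+y. ennreal ((f y)\<^sup>2) \<partial>K x \<partial>\<mu>)"
 proof (rule nn_integral_mono)
  fix x assume "x \<in> space \<mu>"
  note p = prob_kernelD[OF K this]
  show "ennreal ((kernel_op K f x)\<^sup>2) \<le> (\<integral>\<^sup>+y. ennreal ((f y)\<^sup>2) \<partial>K x)"
   unfolding kernel_op_def
   by (rule square_integral_le[OF p(1)]) (use assms p(2) in \<open>auto cong: measurable_cong_sets\<close>)
 qed
 also have "... = (\<integral>\<^sup>+x. ennreal ((f x)\<^sup>2) \<partial>\<mu>)" using assms by (intro nn_integral_inv) auto
 finally show ?thesis .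
qed

lemma kernel_op_L2: "f \<in> L2 \<mu> ==> kernel_op K f \<in> L2 \<mu>"
 using kernel_op_square_le[of f] kernel_op_measurable[of f] by (auto simp: L2_iff_nn intro: le_less_trans)

lemma kernel_op_cong_AE:
 assumes "f \<in> bm \<mu>" "g \<in> bm \<mu>" "AE x in \<mu>. f x = g x"
 shows "AE x in \<mu>. kernel_op K f x = kernel_op K g x"
proof -
 have "AE x in \<mu>. x \<in> space \<mu>" by simp
 with AE_inv[OF assms(3)] show ?thesis
 proof eventually_elim
  case (elim x)
  note p = prob_kernelD[OF K elim(2)]
  show ?case unfolding kernel_op_def
   by (rule integral_cong_AE) (use elim(1) assms p(2) in \<open>auto cong: measurable_cong_sets\<close>)
 qed
qed

text \<open>Linearity can fail at those x for which f or g is not integrable under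
  \<open>K x\<close>; by invariance they form a null set.\<close>

lemma kernel_op_lincomb_AE:
 assumes "f \<in> L2 \<mu>" "g \<in> L2 \<mu>"
 shows "AE x in \<mu>. kernel_op K (\<lambda>x. f x + c * g x) x = kernel_op K f x + c * kernel_op K g x"
 using integral_inv(1)[OF L2_integrable[OF assms(1)]] integral_inv(1)[OF L2_integrable[OF assms(2)]]
 by eventually_elim (simp add: kernel_op_def)

lemma inner_kernel_op_lincomb:
 assumes "h \<in> L2 \<mu>" "f \<in> L2 \<mu>" "g \<in> L2 \<mu>"
 shows "inner_L2 \<mu> h (kernel_op K (\<lambda>x. f x + c * g x)) = inner_L2 \<mu> h (kernel_op K f) + c * inner_L2 \<mu> h (kernel_op K g)"
proof -
 have "inner_L2 \<mu> h (kernel_op K (\<lambda>x. f x + c * g x)) = inner_L2 \<mu> h (\<lambda>x. kernel_op K f x + c * kernel_op K g x)"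
  by (rule inner_L2_cong_AE)
    (use assms kernel_op_lincomb_AE[of f g c] in \<open>auto intro!: kernel_op_measurable borel_measurable_add borel_measurable_times dest: L2_measurable\<close>)
 also have "... = inner_L2 \<mu> h (kernel_op K f) + c * inner_L2 \<mu> h (kernel_op K g)"
  by (subst inner_L2_add) (use assms in \<open>auto intro: kernel_op_L2 L2_cmult simp: inner_L2_cmult\<close>)
 finally show ?thesis .
qed

lemma inner_kernel_op_sum:
 assumes "h \<in> L2 \<mu>" "\<And>i. i \<in> I ==> f i \<in> L2 \<mu>" "finite I"
 shows "inner_L2 \<mu> h (kernel_op K (\<lambda>x. \<Sum>i\<in>I. f i x)) = (\<Sum>i\<in>I. inner_L2 \<mu> h (kernel_op K (f i)))"
 using assms(3,2)
proof (induction I)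
 case empty
 then show ?case by (simp add: kernel_op_def[abs_def] inner_L2_def)
next
 case (insert i I)
 have "inner_L2 \<mu> h (kernel_op K (\<lambda>x. \<Sum>i\<in>insert i I. f i x)) =
   inner_L2 \<mu> h (kernel_op K (\<lambda>x. f i x + 1 * (\<Sum>i\<in>I. f i x)))"
  using insert by simp
 also have "... = inner_L2 \<mu> h (kernel_op K (f i)) + 1 * inner_L2 \<mu> h (kernel_op K (\<lambda>x. \<Sum>i\<in>I. f i x))"
  by (rule inner_kernel_op_lincomb) (use insert assms in \<open>auto intro: L2_sum\<close>)
 finally show ?case using insert by simp
qed

lemma kernel_power_measurable: "kernel_power \<mu> K k \<in> \<mu> \<leadsto> \<mu>"
proof (induction k)
 case 0
 then show ?case using measurable_return_prob_space[of \<mu>] by (simp cong: measurable_cong)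
next
 case (Suc k)
 have "(\<lambda>x. kernel_power \<mu> K k x \<bind> K) \<in> \<mu> \<leadsto> \<mu>"
  by (rule measurable_bind_prob_space[OF Suc K])
 then show ?case by (simp cong: measurable_cong)
qed

lemma kernel_power_inv: "\<mu> \<bind> kernel_power \<mu> K k = \<mu>"
proof (induction k)
 case 0
 have "\<mu> \<bind> kernel_power \<mu> K 0 = \<mu> \<bind> return \<mu>" by (rule bind_cong) auto
 then show ?case by (simp add: bind_return'')
next
 case (Suc k)
 have "\<mu> \<bind> kernel_power \<mu> K (Suc k) = \<mu> \<bind> (\<lambda>x. kernel_power \<mu> K k x \<bind> K)" by (rule bind_cong) auto
 also have "... = (\<mu> \<bind> kernel_power \<mu> K k) \<bind> K"
  by (rule bind_assoc[symmetric]) (use kernel_power_measurable K in \<open>auto intro: measurable_prob_algebraD\<close>)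
 finally show ?case unfolding Suc inv .
qed

lemma invariant_kernel_power: "invariant_kernel \<mu> (kernel_power \<mu> K k)"
 by unfold_locales (auto simp: kernel_power_measurable kernel_power_inv)

lemma kernel_op_power_0:
 "f \<in> bm \<mu> ==> x \<in> space \<mu> ==> kernel_op (kernel_power \<mu> K 0) f x = f x"
 by (simp add: kernel_op_def integral_return)

lemma nn_integral_kernel_power_Suc:
 assumes "x \<in> space \<mu>" "f \<in> bm \<mu>"
 shows "nn_integral (kernel_power \<mu> K (Suc k) x) f = (\<integral>\<^sup>+y. \<integral>\<^sup>+z. f z \<partial>K y \<partial>kernel_power \<mu> K k x)"
 using nn_integral_kernel_bind[OF prob_kernelD(2)[OF kernel_power_measurable assms(1)] K assms(2)] by simp

lemma kernel_op_power_Suc: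
 assumes "f \<in> L2 \<mu>"
 shows "AE x in \<mu>. kernel_op (kernel_power \<mu> K (Suc k)) f x = kernel_op (kernel_power \<mu> K k) (kernel_op K f) x"
proof -
 interpret S: invariant_kernel \<mu> "kernel_power \<mu> K (Suc k)" by (rule invariant_kernel_power)
 have "AE x in \<mu>. x \<in> space \<mu>" by simp
 with S.integral_inv(1)[OF L2_integrable[OF assms]] show ?thesis
 proof eventually_elim
  case (elim x)
  note p = prob_kernelD[OF kernel_power_measurable elim(2), of k]
  show ?case
   using integral_kernel_bind(3)[OF p(2) K _, of f] elim(1) prob_space.not_empty[OF p(1)]
   by (simp add: kernel_op_def[abs_def])
 qed
qed

lemma funpow_L2: "f \<in> L2 \<mu> ==> (kernel_op K ^^ k) f \<in> L2 \<mu>"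
 by (induction k) (auto intro: kernel_op_L2)

text \<open>Replaces the measures \<open>kernel_power\<close> by powers of an operator on functions,
  for which symmetry can be iterated.\<close>

lemma kernel_op_power_eq:
 assumes "f \<in> L2 \<mu>"
 shows "AE x in \<mu>. kernel_op (kernel_power \<mu> K k) f x = (kernel_op K ^^ k) f x"
 using assms
proof (induction k arbitrary: f)
 case 0
 then show ?case by (intro AE_I2) (simp only: kernel_op_power_0[OF L2_measurable] funpow.simps id_apply)
next
 case (Suc k)
 from Suc.IH[OF kernel_op_L2[OF Suc.prems]] kernel_op_power_Suc[OF Suc.prems, of k]
 show ?case by eventually_elim (simp add: funpow_swap1 del: kernel_power.simps)
qed

lemma inner_kernel_power:
 assumes "f \<in> L2 \<mu>" "g \<in> L2 \<mu>"
 shows "inner_L2 \<mu> g (kernel_op (kernel_power \<mu> K k) f) = inner_L2 \<mu> g ((kernel_op K ^^ k) f)"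
 by (rule inner_L2_cong_AE)
   (use assms kernel_op_power_eq[of f k] invariant_kernel.kernel_op_measurable[OF invariant_kernel_power] funpow_L2[of f k] in
   \<open>auto dest: L2_measurable\<close>)

end

subsection \<open>Laws of Markov chains\<close>

lemma measurable_fun_upd_PiM:
 assumes "t \<notin> I"
 shows "(\<lambda>(y, w). y(t := w)) \<in> PiM I M \<Otimes>\<^sub>M M t \<rightarrow>\<^sub>M PiM (insert t I) M"
 by (rule measurable_add_dim)

lemma chain_from_measurable:
 assumes M: "\<And>t. t \<in> {p+1..p+k} ==> (\<lambda>(\<theta>, z). M \<theta> t z) \<in> \<Theta> \<Otimes>\<^sub>M Z \<leadsto> Z"
 shows "(\<lambda>(\<theta>, z). chain_from Z (M \<theta>) p z k) \<in> \<Theta> \<Otimes>\<^sub>M Z \<leadsto> (PiM {p..p+k} (\<lambda>_. Z))"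
 using M
proof (induction k)
 case 0
 have "(\<lambda>z. \<lambda>i\<in>{p}. z) \<in> Z \<rightarrow>\<^sub>M PiM {p} (\<lambda>_. Z)" by (rule measurable_restrict) auto
 from measurable_compose[OF this measurable_return_prob_space]
 have "(\<lambda>x. return (PiM {p} (\<lambda>_. Z)) (\<lambda>i\<in>{p}. snd x)) \<in> \<Theta> \<Otimes>\<^sub>M Z \<leadsto> (PiM {p} (\<lambda>_. Z))"
  by (rule comp_snd)
 then show ?case by (simp add: case_prod_beta')
next
 case (Suc k)
 have ins: "{p..p + Suc k} = insert (p + Suc k) {p..p+k}" by auto
 have IH: "(\<lambda>x. chain_from Z (M (fst x)) p (snd x) k) \<in> \<Theta> \<Otimes>\<^sub>M Z \<leadsto> (PiM {p..p+k} (\<lambda>_. Z))"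
  using Suc.IH Suc.prems by (simp add: case_prod_beta')
 have m: "(\<lambda>x. M (fst x) (p + Suc k) (snd x)) \<in> \<Theta> \<Otimes>\<^sub>M Z \<leadsto> Z"
  using Suc.prems[of "p + Suc k"] by (simp add: case_prod_beta')
 have c[measurable]: "(\<lambda>y. y (p+k)) \<in> PiM {p..p+k} (\<lambda>_. Z) \<rightarrow>\<^sub>M Z" by (rule measurable_component_singleton) auto
 have u: "(\<lambda>(y, w). y(p + Suc k := w)) \<in> PiM {p..p+k} (\<lambda>_. Z) \<Otimes>\<^sub>M Z \<rightarrow>\<^sub>M PiM {p..p+Suc k} (\<lambda>_. Z)"
  unfolding ins by (rule measurable_fun_upd_PiM) auto
 let ?N = "\<lambda>(x, y). distr (M (fst x) (p + Suc k) (y (p + k))) (PiM {p..p + Suc k} (\<lambda>_. Z)) (\<lambda>w. y(p + Suc k := w))"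
 have "(\<lambda>q. M (fst (fst q)) (p + Suc k) (snd q (p+k))) \<in> (\<Theta> \<Otimes>\<^sub>M Z) \<Otimes>\<^sub>M PiM {p..p+k} (\<lambda>_. Z) \<leadsto> Z"
  using measurable_compose[OF _ m, of "\<lambda>q. (fst (fst q), snd q (p+k))" "(\<Theta> \<Otimes>\<^sub>M Z) \<Otimes>\<^sub>M PiM {p..p+k} (\<lambda>_. Z)"] by simp
 moreover have "(\<lambda>(q, w). (snd q)(p + Suc k := w)) \<in> ((\<Theta> \<Otimes>\<^sub>M Z) \<Otimes>\<^sub>M PiM {p..p+k} (\<lambda>_. Z)) \<Otimes>\<^sub>M Z \<rightarrow>\<^sub>M PiM {p..p+Suc k} (\<lambda>_. Z)"
  using measurable_compose[of "\<lambda>q. (snd (fst q), snd q)" "((\<Theta> \<Otimes>\<^sub>M Z) \<Otimes>\<^sub>M PiM {p..p+k} (\<lambda>_. Z)) \<Otimes>\<^sub>M Z" "PiM {p..p+k} (\<lambda>_. Z) \<Otimes>\<^sub>M Z", OF _ u]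
  by (simp add: case_prod_beta')
 ultimately have N: "?N \<in> (\<Theta> \<Otimes>\<^sub>M Z) \<Otimes>\<^sub>M PiM {p..p+k} (\<lambda>_. Z) \<leadsto> (PiM {p..p+Suc k} (\<lambda>_. Z))"
  unfolding case_prod_beta' by (rule measurable_distr_prob_space2[unfolded case_prod_beta'])
 show ?case
  using measurable_bind_prob_space2[OF IH N] by (simp add: case_prod_beta')
qed

lemma measurable_param_const:
 assumes "N \<in> Z \<rightarrow>\<^sub>M L" shows "(\<lambda>(\<theta>, z). N z) \<in> A \<Otimes>\<^sub>M Z \<rightarrow>\<^sub>M L"
 using comp_snd[OF assms, of A] by (simp add: case_prod_beta')

text \<open>The kernel without parameter is the case of a one-point parameter space. The same device
  recurs several times below.\<close>

lemma chain_from_measurable1: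
 assumes M: "\<And>t. t \<in> {p+1..p+k} ==> M t \<in> Z \<leadsto> Z"
 shows "(\<lambda>z. chain_from Z M p z k) \<in> Z \<leadsto> (PiM {p..p+k} (\<lambda>_. Z))"
 by (rule measurable_param_section[of "\<lambda>\<theta> z. chain_from Z M p z k" "count_space {()}" _ _ "()"])
   (use chain_from_measurable[of p k "\<lambda>_. M" "count_space {()}" Z] M measurable_param_const in auto)

lemma path_law_measurable:
 assumes "1 \<le> T" and M1: "M1 \<in> \<Theta> \<leadsto> Z"
  and M: "\<And>t. t \<in> {2..T} ==> (\<lambda>(\<theta>, z). M \<theta> t z) \<in> \<Theta> \<Otimes>\<^sub>M Z \<leadsto> Z"
 shows "(\<lambda>\<theta>. path_law Z T (M1 \<theta>) (M \<theta>)) \<in> \<Theta> \<leadsto> (PiM {1..T} (\<lambda>_. Z))"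
 unfolding path_law_def
proof (rule measurable_bind_prob_space2[OF M1])
 show "(\<lambda>(\<theta>, z). chain_from Z (M \<theta>) 1 z (T - 1)) \<in> \<Theta> \<Otimes>\<^sub>M Z \<leadsto> (PiM {1..T} (\<lambda>_. Z))"
  using chain_from_measurable[of 1 "T-1" M \<Theta> Z] M \<open>1 \<le> T\<close> by simp
qed

lemma path_law_prob:
 assumes "1 \<le> T" and M1: "M1 \<in> space (prob_algebra Z)"
  and M: "\<And>t. t \<in> {2..T} ==> M t \<in> Z \<leadsto> Z"
 shows "path_law Z T M1 M \<in> space (prob_algebra (PiM {1..T} (\<lambda>_. Z)))"
 using measurable_space[OF path_law_measurable[of T "\<lambda>_. M1" "count_space {()}" Z "\<lambda>_. M"], of "()"] assms
 by (auto intro: measurable_param_const)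

lemma nn_integral_chain_from_Suc:
 assumes z: "z \<in> space Z" and M: "\<And>t. t \<in> {p+1..p + Suc k} ==> M t \<in> Z \<leadsto> Z"
  and f: "f \<in> bm (PiM {p..p + Suc k} (\<lambda>_. Z))"
 shows "nn_integral (chain_from Z M p z (Suc k)) f =
  (\<integral>\<^sup>+y. \<integral>\<^sup>+w. f (y(p + Suc k := w)) \<partial>M (p + Suc k) (y (p + k)) \<partial>chain_from Z M p z k)"
 unfolding chain_from.simps
proof (rule nn_integral_bind_distr[OF _ _ _ f])
 have "chain_from Z M p z k \<in> space (prob_algebra (PiM {p..p + k} (\<lambda>_. Z)))"
  by (rule measurable_space[OF chain_from_measurable1 z]) (use M in auto)
 then show "sets (chain_from Z M p z k) = sets (PiM {p..p + k} (\<lambda>_. Z))" by (simp add: space_prob_algebra)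
 show "(\<lambda>y. M (p + Suc k) (y (p + k))) \<in> PiM {p..p + k} (\<lambda>_. Z) \<leadsto> Z"
  by (rule measurable_compose[where f="\<lambda>y. y (p + k)", OF measurable_component_singleton M]) auto
 have "{p..p + Suc k} = insert (p + Suc k) {p..p + k}" by auto
 then show "(\<lambda>(y, w). y(p + Suc k := w)) \<in> PiM {p..p + k} (\<lambda>_. Z) \<Otimes>\<^sub>M Z \<rightarrow>\<^sub>M PiM {p..p + Suc k} (\<lambda>_. Z)"
  using measurable_fun_upd_PiM[of "p + Suc k" "{p..p + k}" "\<lambda>_. Z"] by simp
qed

text \<open>\<open>path_law\<close> binds the first state and then the remaining chain. Here the
  last state is split off instead, the form that inductions over the length need.\<close>

lemma nn_integral_path_law_Suc:
 assumes t: "1 \<le> t" and M1: "M1 \<in> space (prob_algebra Z)"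
  and M: "\<And>s. s \<in> {2..Suc t} ==> M s \<in> Z \<leadsto> Z"
  and f: "f \<in> bm (PiM {1..Suc t} (\<lambda>_. Z))"
 shows "nn_integral (path_law Z (Suc t) M1 M) f = (\<integral>\<^sup>+y. \<integral>\<^sup>+w. f (y(Suc t := w)) \<partial>M (Suc t) (y t) \<partial>path_law Z t M1 M)"
proof -
 let ?g = "\<lambda>y. \<integral>\<^sup>+w. f (y(Suc t := w)) \<partial>M (Suc t) (y t)"
 obtain k where k: "t = Suc k" using t by (cases t) auto
 have s: "sets M1 = sets Z" using M1 by (simp add: space_prob_algebra)
 have c: "(\<lambda>z. chain_from Z M 1 z j) \<in> Z \<leadsto> (PiM {1..Suc j} (\<lambda>_. Z))" if "j \<le> t" for j
  using chain_from_measurable1[of 1 j M Z] M that by simp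
 have g: "?g \<in> bm (PiM {1..t} (\<lambda>_. Z))"
 proof (rule nn_integral_kernel_measurable2)
  show "(\<lambda>y. M (Suc t) (y t)) \<in> PiM {1..t} (\<lambda>_. Z) \<leadsto> Z"
   using t by (intro measurable_compose[where f="\<lambda>y. y t", OF measurable_component_singleton M]) auto
  have "{1..Suc t} = insert (Suc t) {1..t}" by auto
  then show "(\<lambda>(y, w). f (y(Suc t := w))) \<in> bm (PiM {1..t} (\<lambda>_. Z) \<Otimes>\<^sub>M Z)"
   using measurable_compose[OF measurable_fun_upd_PiM[of "Suc t" "{1..t}" "\<lambda>_. Z"], of f borel] f by (simp add: case_prod_beta')
 qed
 have "nn_integral (path_law Z (Suc t) M1 M) f = (\<integral>\<^sup>+z. \<integral>\<^sup>+y. f y \<partial>chain_from Z M 1 z t \<partial>M1)"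
  unfolding path_law_def using nn_integral_kernel_bind[OF s c[OF order_refl] f] by simp
 also have "... = (\<integral>\<^sup>+z. \<integral>\<^sup>+y. ?g y \<partial>chain_from Z M 1 z k \<partial>M1)"
  using nn_integral_chain_from_Suc[of _ Z 1 k M f] M f sets_eq_imp_space_eq[OF s] by (intro nn_integral_cong) (simp add: k)
 also have "... = nn_integral (path_law Z t M1 M) ?g"
  unfolding path_law_def using nn_integral_kernel_bind[OF s c[of k]] g by (simp add: k)
 finally show ?thesis .
qed

lemma nn_integral_path_law_1:
 assumes M1: "M1 \<in> space (prob_algebra Z)"
  and f: "f \<in> bm (PiM {1} (\<lambda>_. Z))"
 shows "nn_integral (path_law Z 1 M1 M) f = (\<integral>\<^sup>+z. f (\<lambda>i\<in>{1}. z) \<partial>M1)"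
proof -
 have s: "sets M1 = sets Z" using M1 by (simp add: space_prob_algebra)
 have r: "(\<lambda>z. \<lambda>i\<in>{1}. z) \<in> Z \<rightarrow>\<^sub>M PiM {1::nat} (\<lambda>_. Z)" by (rule measurable_restrict) auto
 then have "(\<lambda>z. return (PiM {1::nat} (\<lambda>_. Z)) (\<lambda>i\<in>{1}. z)) \<in> Z \<leadsto> (PiM {1} (\<lambda>_. Z))"
  by (rule measurable_compose[OF _ measurable_return_prob_space])
 from nn_integral_kernel_bind[OF s this f]
 have "nn_integral (path_law Z 1 M1 M) f = (\<integral>\<^sup>+z. \<integral>\<^sup>+y. f y \<partial>return (PiM {1::nat} (\<lambda>_. Z)) (\<lambda>i\<in>{1}. z) \<partial>M1)"
  by (simp add: path_law_def)
 also have "... = (\<integral>\<^sup>+z. f (\<lambda>i\<in>{1}. z) \<partial>M1)"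
 proof (rule nn_integral_cong)
  fix z assume "z \<in> space M1"
  then have "z \<in> space Z" using s by (auto dest: sets_eq_imp_space_eq)
  then show "nn_integral (return (PiM {1::nat} (\<lambda>_. Z)) (\<lambda>i\<in>{1}. z)) f = f (\<lambda>i\<in>{1}. z)"
   by (intro nn_integral_return f measurable_space[OF r])
 qed
 finally show ?thesis .
qed

context invariant_kernel
begin

text \<open>By induction on the length, splitting off the last state. If it is neither of the two
  states, it integrates to 1; if it is the later one only, a step of K is absorbed into \<phi>; if
  both indices are last, invariance gives it the law \<mu>.\<close>

lemma nn_integral_stationary_pair:
 assumes "1 \<le> i" "i \<le> j" "j \<le> m" and \<phi>: "(\<lambda>(x, y). \<phi> x y) \<in> bm (\<mu> \<Otimes>\<^sub>M \<mu>)"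
 shows "(\<integral>\<^sup>+\<xi>. \<phi> (\<xi> i) (\<xi> j) \<partial>path_law \<mu> m \<mu> (\<lambda>_. K)) = (\<integral>\<^sup>+x. \<integral>\<^sup>+y. \<phi> x y \<partial>kernel_power \<mu> K (j - i) x \<partial>\<mu>)"
 using assms
proof (induction m arbitrary: i j \<phi>)
 case 0
 then show ?case by simp
next
 case (Suc m)
 have \<mu>: "\<mu> \<in> space (prob_algebra \<mu>)" by (auto simp: space_prob_algebra) unfold_locales
 note \<phi> = Suc.prems(4)
 have ph: "(\<lambda>\<xi>. \<phi> (\<xi> i) (\<xi> j)) \<in> bm (PiM {1..Suc m} (\<lambda>_. \<mu>))"
 proof -
  have "(\<lambda>\<xi>. (\<xi> i, \<xi> j)) \<in> PiM {1..Suc m} (\<lambda>_. \<mu>) \<rightarrow>\<^sub>M \<mu> \<Otimes>\<^sub>M \<mu>"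
   using Suc.prems by (intro measurable_Pair measurable_component_singleton) auto
  from measurable_compose[OF this \<phi>] show ?thesis by simp
 qed
 have \<phi>2: "\<phi> x \<in> bm \<mu>" if "x \<in> space \<mu>" for x
  using measurable_param_section[OF \<phi> that] .
 have diag: "(\<lambda>x. \<phi> x x) \<in> bm \<mu>"
  using measurable_compose[of "\<lambda>x. (x, x)", OF _ \<phi>] by simp
 show ?case
 proof (cases "m = 0")
  case True
  with Suc.prems have ij: "i = 1" "j = 1" by auto
  have "(\<integral>\<^sup>+\<xi>. \<phi> (\<xi> i) (\<xi> j) \<partial>path_law \<mu> (Suc m) \<mu> (\<lambda>_. K)) = (\<integral>\<^sup>+x. \<phi> x x \<partial>\<mu>)"
   using nn_integral_path_law_1[OF \<mu>, of "\<lambda>\<xi>. \<phi> (\<xi> i) (\<xi> j)" "\<lambda>_. K"] ph True ij by simp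
  also have "... = (\<integral>\<^sup>+x. \<integral>\<^sup>+y. \<phi> x y \<partial>kernel_power \<mu> K (j - i) x \<partial>\<mu>)"
   using ij \<phi>2 by (intro nn_integral_cong) (simp add: nn_integral_return)
  finally show ?thesis .
 next
  case False
  have step: "(\<integral>\<^sup>+\<xi>. \<phi> (\<xi> i) (\<xi> j) \<partial>path_law \<mu> (Suc m) \<mu> (\<lambda>_. K)) =
   (\<integral>\<^sup>+\<xi>. \<integral>\<^sup>+w. \<phi> ((\<xi>(Suc m := w)) i) ((\<xi>(Suc m := w)) j) \<partial>K (\<xi> m) \<partial>path_law \<mu> m \<mu> (\<lambda>_. K))"
   using False K ph by (intro nn_integral_path_law_Suc[OF _ \<mu>]) auto
  have pl: "path_law \<mu> m \<mu> (\<lambda>_. K) \<in> space (prob_algebra (PiM {1..m} (\<lambda>_. \<mu>)))"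
   using False \<mu> K by (intro path_law_prob) auto
  have spc: "\<xi> k \<in> space \<mu>" if "\<xi> \<in> space (path_law \<mu> m \<mu> (\<lambda>_. K))" "k \<in> {1..m}" for \<xi> k
  proof -
   have "space (path_law \<mu> m \<mu> (\<lambda>_. K)) = space (PiM {1..m} (\<lambda>_. \<mu>))"
    using pl by (intro sets_eq_imp_space_eq) (auto simp: space_prob_algebra)
   then show ?thesis using that by (auto simp: space_PiM)
  qed
  consider "j \<le> m" | "j = Suc m" "i \<le> m" | "j = Suc m" "i = Suc m" using Suc.prems by linarith
  then show ?thesis
  proof cases
   case 1
   have "(\<integral>\<^sup>+\<xi>. \<integral>\<^sup>+w. \<phi> ((\<xi>(Suc m := w)) i) ((\<xi>(Suc m := w)) j) \<partial>K (\<xi> m) \<partial>path_law \<mu> m \<mu> (\<lambda>_. K))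
     = (\<integral>\<^sup>+\<xi>. \<phi> (\<xi> i) (\<xi> j) \<partial>path_law \<mu> m \<mu> (\<lambda>_. K))"
   proof (rule nn_integral_cong)
    fix \<xi> assume "\<xi> \<in> space (path_law \<mu> m \<mu> (\<lambda>_. K))"
    from spc[OF this, of m] False interpret k: prob_space "K (\<xi> m)"
     by (intro prob_kernelD[OF K]) auto
    show "(\<integral>\<^sup>+w. \<phi> ((\<xi>(Suc m := w)) i) ((\<xi>(Suc m := w)) j) \<partial>K (\<xi> m)) = \<phi> (\<xi> i) (\<xi> j)"
     using 1 Suc.prems by (simp add: k.emeasure_space_1)
   qed
   with step Suc.IH[OF Suc.prems(1,2) 1 \<phi>] show ?thesis by simp
  next
   case 2
   have m: "(\<lambda>(x, y). \<integral>\<^sup>+w. \<phi> x w \<partial>K y) \<in> bm (\<mu> \<Otimes>\<^sub>M \<mu>)"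
   proof -
    have "(\<lambda>q. \<integral>\<^sup>+w. \<phi> (fst q) w \<partial>K (snd q)) \<in> bm (\<mu> \<Otimes>\<^sub>M \<mu>)"
    proof (rule nn_integral_kernel_measurable2[OF comp_snd[OF K]])
     show "(\<lambda>(x, y). \<phi> (fst x) y) \<in> bm ((\<mu> \<Otimes>\<^sub>M \<mu>) \<Otimes>\<^sub>M \<mu>)"
      using measurable_compose[of "\<lambda>q. (fst (fst q), snd q)" "(\<mu> \<Otimes>\<^sub>M \<mu>) \<Otimes>\<^sub>M \<mu>", OF _ \<phi>] by (simp add: case_prod_beta')
    qed
    then show ?thesis by (simp add: case_prod_beta')
   qed
   have "(\<integral>\<^sup>+\<xi>. \<phi> (\<xi> i) (\<xi> j) \<partial>path_law \<mu> (Suc m) \<mu> (\<lambda>_. K)) = (\<integral>\<^sup>+\<xi>. \<integral>\<^sup>+w. \<phi> (\<xi> i) w \<partial>K (\<xi> m) \<partial>path_law \<mu> m \<mu> (\<lambda>_. K))"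
    unfolding step using 2 by simp
   also have "... = (\<integral>\<^sup>+x. \<integral>\<^sup>+y. \<integral>\<^sup>+w. \<phi> x w \<partial>K y \<partial>kernel_power \<mu> K (m - i) x \<partial>\<mu>)"
    using Suc.IH[OF Suc.prems(1) 2(2) order_refl m] .
   also have "... = (\<integral>\<^sup>+x. \<integral>\<^sup>+y. \<phi> x y \<partial>kernel_power \<mu> K (Suc (m - i)) x \<partial>\<mu>)"
    by (intro nn_integral_cong nn_integral_kernel_power_Suc[symmetric] \<phi>2)
   finally show ?thesis using 2 by (simp add: Suc_diff_le)
  next
   case 3
   have m: "(\<lambda>(x, y). \<integral>\<^sup>+w. \<phi> w w \<partial>K y) \<in> bm (\<mu> \<Otimes>\<^sub>M \<mu>)"
    by (rule measurable_param_const nn_integral_kernel_measurable K diag)+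
   have "(\<integral>\<^sup>+\<xi>. \<phi> (\<xi> i) (\<xi> j) \<partial>path_law \<mu> (Suc m) \<mu> (\<lambda>_. K)) = (\<integral>\<^sup>+\<xi>. \<integral>\<^sup>+w. \<phi> w w \<partial>K (\<xi> m) \<partial>path_law \<mu> m \<mu> (\<lambda>_. K))"
    unfolding step using 3 by simp
   also have "... = (\<integral>\<^sup>+x. \<integral>\<^sup>+y. \<integral>\<^sup>+w. \<phi> w w \<partial>K y \<partial>kernel_power \<mu> K (m - m) x \<partial>\<mu>)"
    using Suc.IH[of m m, OF _ order_refl order_refl m] False by simp
   also have "... = (\<integral>\<^sup>+x. \<integral>\<^sup>+w. \<phi> w w \<partial>K x \<partial>\<mu>)"
    using nn_integral_kernel_measurable[OF K diag] by (intro nn_integral_cong) (simp add: nn_integral_return)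
   also have "... = (\<integral>\<^sup>+x. \<phi> x x \<partial>\<mu>)" by (rule nn_integral_inv[OF diag])
   also have "... = (\<integral>\<^sup>+x. \<integral>\<^sup>+y. \<phi> x y \<partial>kernel_power \<mu> K (j - i) x \<partial>\<mu>)"
    using 3 \<phi>2 by (intro nn_integral_cong) (simp add: nn_integral_return)
   finally show ?thesis .
  qed
 qed
qed

end

subsection \<open>Asymptotic variances\<close>

text \<open>The limit may be \<infinity>. For the lower bound the first n0 terms are dropped and the
  others are at least \<open>T n0\<close>, which costs the factor (m - n0) / m.\<close>

lemma cesaro_incseq_ereal:
 fixes T :: "nat => real"
 assumes "incseq T" "\<And>n. 0 \<le> T n"
 shows "(\<lambda>m. ereal ((\<Sum>n=1..m. T n) / m)) \<longlonglongrightarrow> (SUP n. ereal (T n))"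
proof (rule order_tendstoI)
 fix a assume a: "a < (SUP n. ereal (T n))"
 then obtain n0 where n0: "a < ereal (T n0)" by (auto simp: less_SUP_iff)
 have "(\<lambda>m. 1 - real n0 / real m) \<longlonglongrightarrow> 1 - 0"
  by (intro tendsto_diff tendsto_const lim_const_over_n)
 moreover have "\<forall>\<^sub>F m in sequentially. 1 - real n0 / real m = (real m - real n0) / real m"
  using eventually_gt_at_top[of 0] by eventually_elim (simp add: diff_divide_distrib)
 ultimately have "(\<lambda>m. (real m - real n0) / real m) \<longlonglongrightarrow> 1" by (simp add: tendsto_cong)
 then have "(\<lambda>m. (real m - real n0) / real m * T n0) \<longlonglongrightarrow> 1 * T n0"
  by (intro tendsto_mult tendsto_const)
 then have "(\<lambda>m. ereal ((real m - real n0) / real m * T n0)) \<longlonglongrightarrow> ereal (T n0)" by simp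
 then have "\<forall>\<^sub>F m in sequentially. a < ereal ((real m - real n0) / real m * T n0)"
  using n0 by (rule order_tendstoD)
 moreover have "\<forall>\<^sub>F m in sequentially. n0 < m" by (rule eventually_gt_at_top)
 ultimately show "\<forall>\<^sub>F m in sequentially. a < ereal ((\<Sum>n=1..m. T n) / m)"
 proof eventually_elim
  case (elim m)
  have "(real m - real n0) * T n0 = (\<Sum>n=Suc n0..m. T n0)" using elim by (simp add: of_nat_diff)
  also have "... \<le> (\<Sum>n=Suc n0..m. T n)" by (intro sum_mono) (use assms(1) in \<open>auto simp: incseq_def\<close>)
  also have "... \<le> (\<Sum>n=1..m. T n)" by (intro sum_mono2) (use assms(2) in auto)
  finally have "(real m - real n0) * T n0 / m \<le> (\<Sum>n=1..m. T n) / m"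
   by (rule divide_right_mono) simp
  then have "(real m - real n0) / real m * T n0 \<le> (\<Sum>n=1..m. T n) / m" by simp
  with elim(1) show ?case by (meson ereal_less_eq(3) less_le_trans)
 qed
next
 fix a assume a: "(SUP n. ereal (T n)) < a"
 have "\<forall>\<^sub>F m in sequentially. 0 < m" by (rule eventually_gt_at_top)
 then show "\<forall>\<^sub>F m in sequentially. ereal ((\<Sum>n=1..m. T n) / m) < a"
 proof eventually_elim
  case (elim m)
  have "(\<Sum>n=1..m. T n) \<le> (\<Sum>n=1..m. T m)" by (intro sum_mono) (use assms(1) in \<open>auto simp: incseq_def\<close>)
  then have "(\<Sum>n=1..m. T n) / m \<le> T m" using elim by (simp add: field_simps)
  then have "ereal ((\<Sum>n=1..m. T n) / m) \<le> (SUP n. ereal (T n))" by (intro SUP_upper2[of m]) auto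
  with a show ?case by simp
 qed
qed

text \<open>Entries of a symmetric Toeplitz matrix, by induction on its size: the new row and the
  new column each contribute a partial sum of lags, with the corner \<open>c 0\<close> counted
  once.\<close>

lemma sum_symmetric_lags:
 fixes c :: "nat => real"
 shows "(\<Sum>i=1..m. \<Sum>j=1..m. c (if i \<le> j then j - i else i - j)) = 2 * (\<Sum>n=1..m. \<Sum>k<n. c k) - m * c 0"
proof (induction m)
 case 0
 then show ?case by simp
next
 case (Suc m)
 have r: "(\<Sum>i=1..m. c (Suc m - i)) = (\<Sum>k<m. c (Suc k))"
  by (rule sum.reindex_bij_witness[of _ "\<lambda>k. m - k" "\<lambda>i. m - i"]) (auto simp: Suc_diff_le)
 have T: "(\<Sum>k<Suc m. c k) = c 0 + (\<Sum>k<m. c (Suc k))" by (rule sum.lessThan_Suc_shift)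
 have l: "(\<Sum>i=1..m. c (if i \<le> Suc m then Suc m - i else i - Suc m)) = (\<Sum>i=1..m. c (Suc m - i))"
  by (intro sum.cong) auto
 have l': "(\<Sum>j=1..m. c (if Suc m \<le> j then j - Suc m else Suc m - j)) = (\<Sum>i=1..m. c (Suc m - i))"
  by (intro sum.cong) auto
 have "(\<Sum>i=1..Suc m. \<Sum>j=1..Suc m. c (if i \<le> j then j - i else i - j)) =
   (\<Sum>i=1..m. \<Sum>j=1..m. c (if i \<le> j then j - i else i - j)) + 2 * (\<Sum>i=1..m. c (Suc m - i)) + c 0"
  using l l' by (simp add: sum.distrib)
 also have "... = 2 * (\<Sum>n=1..Suc m. \<Sum>k<n. c k) - Suc m * c 0"
  unfolding Suc.IH r using T by (simp add: algebra_simps del: sum.lessThan_Suc)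
 finally show ?case .
qed

lemma borel_pair_mult:
 fixes f :: "'a => real" and g :: "'b => real"
 assumes [measurable]: "f \<in> bm M" "g \<in> bm N"
 shows "(\<lambda>q. f (fst q) * g (snd q)) \<in> bm (M \<Otimes>\<^sub>M N)"
 by measurable

context invariant_kernel
begin

text \<open>Both marginals of this law of two successive states are \<mu>, and inner products with
  \<open>kernel_op K g\<close> become ordinary integrals of products.\<close>

definition pair_law :: "('a \<times> 'a) measure" where
 "pair_law = \<mu> \<bind> (\<lambda>x. distr (K x) (\<mu> \<Otimes>\<^sub>M \<mu>) (Pair x))"

lemma nn_integral_pair_law:
 "F \<in> bm (\<mu> \<Otimes>\<^sub>M \<mu>) ==> nn_integral pair_law F = (\<integral>\<^sup>+x. \<integral>\<^sup>+y. F (x, y) \<partial>K x \<partial>\<mu>)"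
 unfolding pair_law_def by (rule nn_integral_bind_distr[OF refl K]) simp_all

lemma sets_pair_law: "sets pair_law = sets (\<mu> \<Otimes>\<^sub>M \<mu>)"
 unfolding pair_law_def by (rule sets_kernel_bind[OF refl kernel_distr_measurable[OF refl K] not_empty]) simp

lemma L2_pair_law:
 assumes "f \<in> L2 \<mu>"
 shows "(\<lambda>q. f (fst q)) \<in> L2 pair_law" "(\<lambda>q. f (snd q)) \<in> L2 pair_law"
  "(\<integral>q. (f (fst q))\<^sup>2 \<partial>pair_law) = inner_L2 \<mu> f f" "(\<integral>q. (f (snd q))\<^sup>2 \<partial>pair_law) = inner_L2 \<mu> f f"
proof -
 have [measurable]: "f \<in> bm \<mu>" and fin: "(\<integral>\<^sup>+x. ennreal ((f x)\<^sup>2) \<partial>\<mu>) < \<infinity>"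
  using assms by (auto simp: L2_iff_nn)
 have m[measurable]: "(\<lambda>q. f (fst q)) \<in> bm pair_law" "(\<lambda>q. f (snd q)) \<in> bm pair_law"
  unfolding measurable_cong_sets[OF sets_pair_law refl] by measurable
 have 1: "(\<integral>\<^sup>+q. ennreal ((f (fst q))\<^sup>2) \<partial>pair_law) = (\<integral>\<^sup>+x. ennreal ((f x)\<^sup>2) \<partial>\<mu>)"
  using prob_space.emeasure_space_1[OF prob_kernelD(1)[OF K]] by (subst nn_integral_pair_law) (auto cong: nn_integral_cong)
 have 2: "(\<integral>\<^sup>+q. ennreal ((f (snd q))\<^sup>2) \<partial>pair_law) = (\<integral>\<^sup>+x. ennreal ((f x)\<^sup>2) \<partial>\<mu>)"
  by (subst nn_integral_pair_law) (auto simp: nn_integral_inv)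
 show "(\<lambda>q. f (fst q)) \<in> L2 pair_law" "(\<lambda>q. f (snd q)) \<in> L2 pair_law"
  using 1 2 fin m by (auto simp: L2_iff_nn)
 have "inner_L2 \<mu> f f = enn2real (\<integral>\<^sup>+x. ennreal ((f x)\<^sup>2) \<partial>\<mu>)"
  unfolding inner_L2_def by (subst integral_eq_nn_integral) (auto simp: power2_eq_square)
 then show "(\<integral>q. (f (fst q))\<^sup>2 \<partial>pair_law) = inner_L2 \<mu> f f" "(\<integral>q. (f (snd q))\<^sup>2 \<partial>pair_law) = inner_L2 \<mu> f f"
  using 1 2 by (auto simp: integral_eq_nn_integral)
qed

lemma integral_pair_law:
 assumes f: "f \<in> L2 \<mu>" and g: "g \<in> L2 \<mu>"
 shows "integrable pair_law (\<lambda>q. f (fst q) * g (snd q))"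
  and "(\<integral>q. f (fst q) * g (snd q) \<partial>pair_law) = inner_L2 \<mu> f (kernel_op K g)"
proof -
 show i: "integrable pair_law (\<lambda>q. f (fst q) * g (snd q))" by (intro L2_integrable_mult L2_pair_law f g)
 have "(\<lambda>q. f (fst q) * g (snd q)) \<in> bm (\<mu> \<Otimes>\<^sub>M \<mu>)" using f g by (intro borel_pair_mult L2_measurable)
 from integral_bind_distr[OF refl K _ not_empty i[unfolded pair_law_def] this]
 show "(\<integral>q. f (fst q) * g (snd q) \<partial>pair_law) = inner_L2 \<mu> f (kernel_op K g)"
  by (simp add: pair_law_def inner_L2_def kernel_op_def)
qed

text \<open>For centred f this is the autocovariance at lag k of the stationary chain.\<close>

definition corr :: "('a => real) => nat => real" where
 "corr f k = inner_L2 \<mu> f (kernel_op (kernel_power \<mu> K k) f)"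

lemma path_law_stationary: "1 \<le> m ==> path_law \<mu> m \<mu> (\<lambda>_. K) \<in> space (prob_algebra (PiM {1..m} (\<lambda>_. \<mu>)))"
 by (intro path_law_prob) (auto simp: space_prob_algebra K intro: prob_space_axioms)

lemma stationary_pair_integral:
 assumes ij: "1 \<le> i" "i \<le> j" "j \<le> m" and f: "f \<in> L2 \<mu>"
 shows "integrable (path_law \<mu> m \<mu> (\<lambda>_. K)) (\<lambda>\<xi>. f (\<xi> i) * f (\<xi> j))"
  and "(\<integral>\<xi>. f (\<xi> i) * f (\<xi> j) \<partial>path_law \<mu> m \<mu> (\<lambda>_. K)) = corr f (j - i)"
proof -
 let ?P = "path_law \<mu> m \<mu> (\<lambda>_. K)"
 interpret k: invariant_kernel \<mu> "kernel_power \<mu> K (j - i)" by (rule invariant_kernel_power)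
 have [measurable]: "f \<in> bm \<mu>" using f by (auto dest: L2_measurable)
 have sP: "sets ?P = sets (PiM {1..m} (\<lambda>_. \<mu>))" using path_law_stationary[of m] ij by (auto simp: space_prob_algebra)
 have pm: "(\<lambda>\<xi>. (\<xi> i, \<xi> j)) \<in> ?P \<rightarrow>\<^sub>M \<mu> \<Otimes>\<^sub>M \<mu>"
  unfolding measurable_cong_sets[OF sP refl]
  using ij by (intro measurable_Pair measurable_component_singleton) auto
 \<comment> \<open>Agreement on indicators identifies the joint law of the two states; signed
   integrals are then inherited from \<open>pair_law\<close> of the kernel with j - i steps.\<close>
 have eq: "distr ?P (\<mu> \<Otimes>\<^sub>M \<mu>) (\<lambda>\<xi>. (\<xi> i, \<xi> j)) = k.pair_law"
 proof (rule measure_eqI)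
  show "sets (distr ?P (\<mu> \<Otimes>\<^sub>M \<mu>) (\<lambda>\<xi>. (\<xi> i, \<xi> j))) = sets k.pair_law" by (simp add: k.sets_pair_law)
  fix A assume "A \<in> sets (distr ?P (\<mu> \<Otimes>\<^sub>M \<mu>) (\<lambda>\<xi>. (\<xi> i, \<xi> j)))"
  then have A[measurable]: "A \<in> sets (\<mu> \<Otimes>\<^sub>M \<mu>)" by simp
  have "emeasure (distr ?P (\<mu> \<Otimes>\<^sub>M \<mu>) (\<lambda>\<xi>. (\<xi> i, \<xi> j))) A = (\<integral>\<^sup>+\<xi>. indicator A (\<xi> i, \<xi> j) \<partial>?P)"
   using pm by (subst nn_integral_indicator[symmetric], simp, subst nn_integral_distr) auto
  also have "... = (\<integral>\<^sup>+x. \<integral>\<^sup>+y. indicator A (x, y) \<partial>kernel_power \<mu> K (j - i) x \<partial>\<mu>)"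
   by (rule nn_integral_stationary_pair[OF ij, of "\<lambda>x y. indicator A (x, y)"]) simp
  also have "... = emeasure k.pair_law A" using k.nn_integral_pair_law[of "indicator A"] by (simp add: k.sets_pair_law)
  finally show "emeasure (distr ?P (\<mu> \<Otimes>\<^sub>M \<mu>) (\<lambda>\<xi>. (\<xi> i, \<xi> j))) A = emeasure k.pair_law A" .
 qed
 have fm: "(\<lambda>q. f (fst q) * f (snd q)) \<in> bm (\<mu> \<Otimes>\<^sub>M \<mu>)" by (rule borel_pair_mult) auto
 show "integrable ?P (\<lambda>\<xi>. f (\<xi> i) * f (\<xi> j))"
  using integrable_distr_eq[OF pm fm] k.integral_pair_law(1)[OF f f] eq by simp
 show "(\<integral>\<xi>. f (\<xi> i) * f (\<xi> j) \<partial>?P) = corr f (j - i)"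
  using integral_distr[OF pm fm] k.integral_pair_law(2)[OF f f] eq by (simp add: corr_def)
qed

lemma stationary_marginal_integral:
 assumes i: "1 \<le> i" "i \<le> m" and f: "f \<in> L2 \<mu>"
 shows "integrable (path_law \<mu> m \<mu> (\<lambda>_. K)) (\<lambda>\<xi>. f (\<xi> i))"
  and "(\<integral>\<xi>. f (\<xi> i) \<partial>path_law \<mu> m \<mu> (\<lambda>_. K)) = integral\<^sup>L \<mu> f"
proof -
 let ?P = "path_law \<mu> m \<mu> (\<lambda>_. K)"
 have [measurable]: "f \<in> bm \<mu>" using f by (auto dest: L2_measurable)
 have sP: "sets ?P = sets (PiM {1..m} (\<lambda>_. \<mu>))" using path_law_stationary[of m] i by (auto simp: space_prob_algebra)
 have pm: "(\<lambda>\<xi>. \<xi> i) \<in> ?P \<rightarrow>\<^sub>M \<mu>"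
  unfolding measurable_cong_sets[OF sP refl] using i by (intro measurable_component_singleton) auto
 have eq: "distr ?P \<mu> (\<lambda>\<xi>. \<xi> i) = \<mu>"
 proof (rule measure_eqI)
  fix A assume "A \<in> sets (distr ?P \<mu> (\<lambda>\<xi>. \<xi> i))"
  then have A[measurable]: "A \<in> sets \<mu>" by simp
  have "emeasure (distr ?P \<mu> (\<lambda>\<xi>. \<xi> i)) A = nn_integral (distr ?P \<mu> (\<lambda>\<xi>. \<xi> i)) (indicator A)" by simp
  also have "... = (\<integral>\<^sup>+\<xi>. indicator A (\<xi> i) \<partial>?P)" using pm by (subst nn_integral_distr) auto
  also have "... = (\<integral>\<^sup>+x. \<integral>\<^sup>+y. indicator A x \<partial>kernel_power \<mu> K (i - i) x \<partial>\<mu>)"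
   by (rule nn_integral_stationary_pair[OF i(1) order_refl i(2), of "\<lambda>x y. indicator A x"]) simp
  also have "... = nn_integral \<mu> (indicator A)" by (intro nn_integral_cong) (simp add: nn_integral_return)
  finally show "emeasure (distr ?P \<mu> (\<lambda>\<xi>. \<xi> i)) A = emeasure \<mu> A" by simp
 qed simp
 show "integrable ?P (\<lambda>\<xi>. f (\<xi> i))"
  using integrable_distr_eq[OF pm, of f] L2_integrable[OF f] eq by simp
 show "(\<integral>\<xi>. f (\<xi> i) \<partial>?P) = integral\<^sup>L \<mu> f"
  using integral_distr[OF pm, of f] eq by simp
qed

text \<open>The Cesaro mean of the partial sums of correlations is isolated, so that
  \<open>cesaro_incseq_ereal\<close> yields the limit.\<close>

lemma var_partial_sum:
 assumes f: "f \<in> L2 \<mu>" and m: "1 \<le> m"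
 defines "f0 \<equiv> \<lambda>x. f x - (integral\<^sup>L \<mu> f)"
 shows "var (path_law \<mu> m \<mu> (\<lambda>_. K)) (\<lambda>\<xi>. (\<Sum>i=1..m. f (\<xi> i) - (integral\<^sup>L \<mu> f)) / sqrt (real m)) =
   2 * ((\<Sum>n=1..m. \<Sum>k<n. corr f0 k) / m) - corr f0 0"
proof -
 let ?P = "path_law \<mu> m \<mu> (\<lambda>_. K)"
 have f0: "f0 \<in> L2 \<mu>" unfolding f0_def by (intro L2_diff f L2_const)
 have z: "integral\<^sup>L \<mu> f0 = 0" unfolding f0_def using L2_integrable[OF f] by (simp add: prob_space)
 have pair: "integrable ?P (\<lambda>\<xi>. f0 (\<xi> i) * f0 (\<xi> j)) \<and>
   (\<integral>\<xi>. f0 (\<xi> i) * f0 (\<xi> j) \<partial>?P) = corr f0 (if i \<le> j then j - i else i - j)"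
  if "i \<in> {1..m}" "j \<in> {1..m}" for i j
  using stationary_pair_integral[of i j m f0] stationary_pair_integral[of j i m f0] f0 that
  by (cases "i \<le> j") (auto simp: mult.commute)
 have "(\<integral>\<xi>. ((\<Sum>i=1..m. f0 (\<xi> i)) / sqrt (real m))\<^sup>2 \<partial>?P) = (\<integral>\<xi>. (\<Sum>i=1..m. \<Sum>j=1..m. f0 (\<xi> i) * f0 (\<xi> j)) / m \<partial>?P)"
  by (simp add: power_divide power2_eq_square sum_product)
 also have "... = (\<Sum>i=1..m. \<Sum>j=1..m. corr f0 (if i \<le> j then j - i else i - j)) / m"
 proof -
  have i1: "integrable ?P (\<lambda>\<xi>. f0 (\<xi> i) * f0 (\<xi> j))" if "i \<in> {1..m}" "j \<in> {1..m}" for i j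
   using pair[OF that] by (rule conjunct1)
  have "(\<integral>\<xi>. (\<Sum>i=1..m. \<Sum>j=1..m. f0 (\<xi> i) * f0 (\<xi> j)) \<partial>?P) = (\<Sum>i=1..m. \<integral>\<xi>. (\<Sum>j=1..m. f0 (\<xi> i) * f0 (\<xi> j)) \<partial>?P)"
   by (intro Bochner_Integration.integral_sum Bochner_Integration.integrable_sum i1)
  also have "... = (\<Sum>i=1..m. \<Sum>j=1..m. \<integral>\<xi>. f0 (\<xi> i) * f0 (\<xi> j) \<partial>?P)"
   by (intro sum.cong refl Bochner_Integration.integral_sum i1)
  also have "... = (\<Sum>i=1..m. \<Sum>j=1..m. corr f0 (if i \<le> j then j - i else i - j))"
   by (intro sum.cong refl) (rule conjunct2[OF pair])
  finally show ?thesis by (simp del: One_nat_def)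
 qed
 also have "... = 2 * ((\<Sum>n=1..m. \<Sum>k<n. corr f0 k) / m) - corr f0 0"
  unfolding sum_symmetric_lags using m by (simp add: field_simps)
 finally have 2: "(\<integral>\<xi>. ((\<Sum>i=1..m. f0 (\<xi> i)) / sqrt (real m))\<^sup>2 \<partial>?P) = 2 * ((\<Sum>n=1..m. \<Sum>k<n. corr f0 k) / m) - corr f0 0" .
 have "(\<integral>\<xi>. (\<Sum>i=1..m. f0 (\<xi> i)) / sqrt (real m) \<partial>?P) = (\<Sum>i=1..m. \<integral>\<xi>. f0 (\<xi> i) \<partial>?P) / sqrt (real m)"
  using stationary_marginal_integral(1)[OF _ _ f0] by (simp add: Bochner_Integration.integral_sum)
 also have "... = 0" using stationary_marginal_integral(2)[OF _ _ f0] z by simp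
 finally have 1: "(\<integral>\<xi>. (\<Sum>i=1..m. f0 (\<xi> i)) / sqrt (real m) \<partial>?P) = 0" .
 show ?thesis using 1 2 by (simp add: var_def f0_def)
qed

text \<open>Nonnegative correlations make their partial sums increasing, hence the limit exists in
  the extended reals.\<close>

lemma asvar_eq:
 assumes f: "f \<in> L2 \<mu>"
 defines "f0 \<equiv> \<lambda>x. f x - (integral\<^sup>L \<mu> f)"
 assumes nonneg: "\<And>k. 0 \<le> corr f0 k"
 shows "asvar \<mu> K f = 2 * (SUP n. ereal (\<Sum>k<n. corr f0 k)) - ereal (corr f0 0)"
proof -
 let ?L = "SUP n. ereal (\<Sum>k<n. corr f0 k)"
 have "(\<lambda>m. ereal ((\<Sum>n=1..m. \<Sum>k<n. corr f0 k) / m)) \<longlonglongrightarrow> ?L"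
  by (rule cesaro_incseq_ereal) (auto simp: incseq_def nonneg intro: sum_mono2 sum_nonneg)
 then have "(\<lambda>m. 2 * ereal ((\<Sum>n=1..m. \<Sum>k<n. corr f0 k) / m) + - ereal (corr f0 0)) \<longlonglongrightarrow> 2 * ?L + - ereal (corr f0 0)"
  by (intro tendsto_add_ereal_general1 tendsto_cmult_ereal tendsto_const) auto
 moreover have "\<forall>\<^sub>F m in sequentially. 2 * ereal ((\<Sum>n=1..m. \<Sum>k<n. corr f0 k) / m) + - ereal (corr f0 0) =
  ereal (var (path_law \<mu> m \<mu> (\<lambda>_. K)) (\<lambda>\<xi>. (\<Sum>i=1..m. f (\<xi> i) - (integral\<^sup>L \<mu> f)) / sqrt (real m)))"
  using eventually_ge_at_top[of 1]
 proof eventually_elim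
  case (elim m)
  show ?case unfolding var_partial_sum[OF f elim] f0_def[symmetric] by simp
 qed
 ultimately have "(\<lambda>m. ereal (var (path_law \<mu> m \<mu> (\<lambda>_. K)) (\<lambda>\<xi>. (\<Sum>i=1..m. f (\<xi> i) - (integral\<^sup>L \<mu> f)) / sqrt (real m))))
   \<longlonglongrightarrow> 2 * ?L + - ereal (corr f0 0)"
  by (rule Lim_transform_eventually)
 then show ?thesis unfolding asvar_def by (simp add: limI minus_ereal_def)
qed

lemma var_eq_corr:
 assumes f: "f \<in> L2 \<mu>"
 shows "var \<mu> f = corr (\<lambda>x. f x - (integral\<^sup>L \<mu> f)) 0"
proof -
 let ?f0 = "\<lambda>x. f x - (integral\<^sup>L \<mu> f)"
 have f0: "?f0 \<in> L2 \<mu>" by (intro L2_diff f L2_const)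
 have "corr ?f0 0 = (\<integral>x. (?f0 x)\<^sup>2 \<partial>\<mu>)"
  unfolding corr_def inner_L2_def using kernel_op_power_0[OF L2_measurable[OF f0]]
  by (intro Bochner_Integration.integral_cong) (auto simp: power2_eq_square simp del: kernel_power.simps)
 also have "... = var \<mu> f" unfolding var_def using variance_eq[OF L2_integrable[OF f] L2_square_integrable[OF f]] by simp
 finally show ?thesis by simp
qed

end

subsection \<open>Reversible positive kernels\<close>

text \<open>The pointwise source of the assumption \<open>pos\<close> below, which is obtained by
  integrating this inequality.\<close>

lemma ennreal_two_mult_le:
 fixes a b :: ennreal
 shows "2 * (a * b) \<le> a * a + b * b"
proof (cases "a = \<infinity> \<or> b = \<infinity>")
 case True
 then have "a * a = top \<or> b * b = top" by (auto simp: ennreal_mult_eq_top_iff)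
 then show ?thesis by (auto simp: top_unique)
next
 case False
 then obtain x y where xy: "a = ennreal x" "b = ennreal y" "0 \<le> x" "0 \<le> y"
  by (cases a; cases b) auto
 have "2 * (x * y) \<le> x * x + y * y" using sum_squares_bound[of x y] by (simp add: power2_eq_square)
 then have "ennreal (2 * (x * y)) \<le> ennreal (x * x + y * y)" by (rule ennreal_leI)
 then show ?thesis using xy by (simp add: ennreal_mult)
qed

text \<open>\<open>pos\<close> is the positivity of the operator at f = a - b, for nonnegative a and
  b, with the cross terms moved to the other side so that it makes sense in
  \<open>ennreal\<close>.\<close>

locale rev_pos_kernel = prob_space \<mu> for \<mu> :: "'a measure" +
 fixes K :: "'a => 'a measure"
 assumes kernel: "K \<in> \<mu> \<leadsto> \<mu>"
  and rev: "\<And>a b. a \<in> bm \<mu> ==> b \<in> bm \<mu> ==>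
   (\<integral>\<^sup>+x. a x * nn_integral (K x) b \<partial>\<mu>) = (\<integral>\<^sup>+x. b x * nn_integral (K x) a \<partial>\<mu>)"
  and pos: "\<And>a b. a \<in> bm \<mu> ==> b \<in> bm \<mu> ==>
   2 * (\<integral>\<^sup>+x. a x * nn_integral (K x) b \<partial>\<mu>)
    \<le> (\<integral>\<^sup>+x. a x * nn_integral (K x) a \<partial>\<mu>) + (\<integral>\<^sup>+x. b x * nn_integral (K x) b \<partial>\<mu>)"
begin

sublocale invariant_kernel \<mu> K
proof
 show "K \<in> \<mu> \<leadsto> \<mu>" by (rule kernel)
 show "\<mu> \<bind> K = \<mu>"
 proof (rule measure_eqI)
  show s: "sets (\<mu> \<bind> K) = sets \<mu>" by (rule sets_kernel_bind[OF refl kernel not_empty])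
  fix A assume "A \<in> sets (\<mu> \<bind> K)"
  then have A[measurable]: "A \<in> sets \<mu>" using s by simp
  have "emeasure (\<mu> \<bind> K) A = (\<integral>\<^sup>+x. 1 * nn_integral (K x) (indicator A) \<partial>\<mu>)"
   using nn_integral_kernel_bind[OF refl kernel, of "indicator A"] A s by simp
  also have "... = (\<integral>\<^sup>+x. indicator A x * (\<integral>\<^sup>+y. 1 \<partial>K x) \<partial>\<mu>)" by (rule rev) auto
  also have "... = nn_integral \<mu> (indicator A)"
   using prob_space.emeasure_space_1[OF prob_kernelD(1)[OF kernel]] by (intro nn_integral_cong) simp
  finally show "emeasure (\<mu> \<bind> K) A = emeasure \<mu> A" by simp
 qed
qed

lemma inner_nonneg_functions:
 assumes f: "f \<in> L2 \<mu>" "\<And>x. 0 \<le> f x" and g: "g \<in> L2 \<mu>" "\<And>x. 0 \<le> g x"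
 shows "ennreal (inner_L2 \<mu> f (kernel_op K g)) = (\<integral>\<^sup>+x. ennreal (f x) * (\<integral>\<^sup>+y. ennreal (g y) \<partial>K x) \<partial>\<mu>)"
  and "0 \<le> inner_L2 \<mu> f (kernel_op K g)"
proof -
 have nn: "0 \<le> f x * kernel_op K g x" for x
  unfolding kernel_op_def using f g by (intro mult_nonneg_nonneg integral_nonneg_AE) auto
 then show "0 \<le> inner_L2 \<mu> f (kernel_op K g)" unfolding inner_L2_def by (intro integral_nonneg_AE) auto
 have "ennreal (inner_L2 \<mu> f (kernel_op K g)) = (\<integral>\<^sup>+x. ennreal (f x * kernel_op K g x) \<partial>\<mu>)"
  unfolding inner_L2_def using L2_integrable_mult[OF f(1) kernel_op_L2[OF g(1)]] nn
  by (intro nn_integral_eq_integral[symmetric]) auto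
 also have "... = (\<integral>\<^sup>+x. ennreal (f x) * (\<integral>\<^sup>+y. ennreal (g y) \<partial>K x) \<partial>\<mu>)"
 proof (rule nn_integral_cong_AE)
  show "AE x in \<mu>. ennreal (f x * kernel_op K g x) = ennreal (f x) * (\<integral>\<^sup>+y. ennreal (g y) \<partial>K x)"
   using integral_inv(1)[OF L2_integrable[OF g(1)]]
  proof eventually_elim
   case (elim x)
   then show ?case using f(2) g(2)
    by (simp add: kernel_op_def ennreal_mult nn_integral_eq_integral integral_nonneg_AE)
  qed
 qed
 finally show "ennreal (inner_L2 \<mu> f (kernel_op K g)) = (\<integral>\<^sup>+x. ennreal (f x) * (\<integral>\<^sup>+y. ennreal (g y) \<partial>K x) \<partial>\<mu>)" .
qed

lemma L2_max: "f \<in> L2 \<mu> ==> (\<lambda>x. max 0 (f x)) \<in> L2 \<mu>"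
proof -
 assume f: "f \<in> L2 \<mu>"
 have "(\<integral>\<^sup>+x. ennreal ((max 0 (f x))\<^sup>2) \<partial>\<mu>) \<le> (\<integral>\<^sup>+x. ennreal ((f x)\<^sup>2) \<partial>\<mu>)"
  by (intro nn_integral_mono ennreal_leI) (auto simp: max_def)
 with f show ?thesis by (auto simp: L2_iff_nn)
qed

lemma inner_split:
 assumes f: "f \<in> L2 \<mu>" and g: "g \<in> L2 \<mu>"
 defines "fp \<equiv> \<lambda>x. max 0 (f x)" and "fn \<equiv> \<lambda>x. max 0 (- f x)" and "gp \<equiv> \<lambda>x. max 0 (g x)" and "gn \<equiv> \<lambda>x. max 0 (- g x)"
 shows "inner_L2 \<mu> f (kernel_op K g) =
   inner_L2 \<mu> fp (kernel_op K gp) - inner_L2 \<mu> fp (kernel_op K gn) - (inner_L2 \<mu> fn (kernel_op K gp) - inner_L2 \<mu> fn (kernel_op K gn))"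
proof -
 have L: "fp \<in> L2 \<mu>" "fn \<in> L2 \<mu>" "gp \<in> L2 \<mu>" "gn \<in> L2 \<mu>"
  using L2_max[OF f] L2_max[OF g] L2_max[OF L2_cmult[OF f, of "-1"]] L2_max[OF L2_cmult[OF g, of "-1"]]
  by (auto simp: fp_def fn_def gp_def gn_def)
 have f': "f = (\<lambda>x. fp x - fn x)" and g': "g = (\<lambda>x. gp x - gn x)"
  by (auto simp: fp_def fn_def gp_def gn_def)
 have "inner_L2 \<mu> f (kernel_op K g) = inner_L2 \<mu> fp (kernel_op K g) - inner_L2 \<mu> fn (kernel_op K g)"
  using inner_L2_diff[OF kernel_op_L2[OF g] L(1,2)] by (simp add: inner_L2_commute[of _ _ "kernel_op K g"] flip: f')
 also have "inner_L2 \<mu> h (kernel_op K g) = inner_L2 \<mu> h (kernel_op K gp) - inner_L2 \<mu> h (kernel_op K gn)" if "h \<in> L2 \<mu>" for h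
  using inner_kernel_op_lincomb[OF that L(3,4), of "-1"] by (simp flip: g')
 ultimately show ?thesis using L by simp
qed

lemma inner_sym:
 assumes "f \<in> L2 \<mu>" "g \<in> L2 \<mu>"
 shows "inner_L2 \<mu> f (kernel_op K g) = inner_L2 \<mu> g (kernel_op K f)"
proof -
 have sym: "inner_L2 \<mu> a (kernel_op K b) = inner_L2 \<mu> b (kernel_op K a)"
  if "a \<in> L2 \<mu>" "\<And>x. 0 \<le> a x" "b \<in> L2 \<mu>" "\<And>x. 0 \<le> b x" for a b
 proof -
  have [measurable]: "a \<in> bm \<mu>" "b \<in> bm \<mu>" using that by (auto dest: L2_measurable)
  have "ennreal (inner_L2 \<mu> a (kernel_op K b)) = ennreal (inner_L2 \<mu> b (kernel_op K a))"
   using inner_nonneg_functions(1)[OF that] inner_nonneg_functions(1)[OF that(3,4,1,2)]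
    rev[of "\<lambda>x. ennreal (a x)" "\<lambda>x. ennreal (b x)"] by simp
  then show ?thesis using inner_nonneg_functions(2)[OF that] inner_nonneg_functions(2)[OF that(3,4,1,2)] by simp
 qed
 have m: "(\<lambda>x. max 0 (f x)) \<in> L2 \<mu>" "(\<lambda>x. max 0 (- f x)) \<in> L2 \<mu>" if "f \<in> L2 \<mu>" for f
  using L2_max[OF that] L2_max[OF L2_cmult[OF that, of "-1"]] by simp_all
 show ?thesis
  unfolding inner_split[OF assms] inner_split[OF assms(2,1)]
  using sym[OF m(1)[OF assms(1)] _ m(1)[OF assms(2)]] sym[OF m(1)[OF assms(1)] _ m(2)[OF assms(2)]]
   sym[OF m(2)[OF assms(1)] _ m(1)[OF assms(2)]] sym[OF m(2)[OF assms(1)] _ m(2)[OF assms(2)]] by simp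
qed

lemma inner_pos:
 assumes "f \<in> L2 \<mu>"
 shows "0 \<le> inner_L2 \<mu> f (kernel_op K f)"
proof -
 define p n where "p = (\<lambda>x. max 0 (f x))" and "n = (\<lambda>x. max 0 (- f x))"
 have m: "p \<in> L2 \<mu>" "n \<in> L2 \<mu>"
  using L2_max[OF assms] L2_max[OF L2_cmult[OF assms, of "-1"]] by (simp_all add: p_def n_def)
 have nonneg: "0 \<le> p x" "0 \<le> n x" for x by (simp_all add: p_def n_def)
 have [measurable]: "p \<in> bm \<mu>" "n \<in> bm \<mu>" using m by (auto dest: L2_measurable)
 note nn = inner_nonneg_functions[OF m(1) nonneg(1) m(1) nonneg(1)] inner_nonneg_functions[OF m(1) nonneg(1) m(2) nonneg(2)] inner_nonneg_functions[OF m(2) nonneg(2) m(2) nonneg(2)]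
 have "ennreal (2 * inner_L2 \<mu> p (kernel_op K n)) = 2 * ennreal (inner_L2 \<mu> p (kernel_op K n))"
  by (simp add: ennreal_mult')
 also have "... \<le> ennreal (inner_L2 \<mu> p (kernel_op K p)) + ennreal (inner_L2 \<mu> n (kernel_op K n))"
  using pos[of "\<lambda>x. ennreal (p x)" "\<lambda>x. ennreal (n x)"] nn by simp
 also have "... = ennreal (inner_L2 \<mu> p (kernel_op K p) + inner_L2 \<mu> n (kernel_op K n))"
  using nn by simp
 finally have "2 * inner_L2 \<mu> p (kernel_op K n) \<le> inner_L2 \<mu> p (kernel_op K p) + inner_L2 \<mu> n (kernel_op K n)"
  using nn by (subst (asm) ennreal_le_iff) auto
 then show ?thesis unfolding inner_split[OF assms assms] p_def[symmetric] n_def[symmetric] using inner_sym[OF m] by simp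
qed

lemma dirichlet_eq: "f \<in> L2 \<mu> ==> dirichlet \<mu> K f = inner_L2 \<mu> f f - inner_L2 \<mu> f (kernel_op K f)"
 by (simp add: dirichlet_def inner_L2_diff kernel_op_L2)

lemma dirichlet_diff:
 assumes g: "g \<in> L2 \<mu>" and u: "u \<in> L2 \<mu>"
 shows "dirichlet \<mu> K (\<lambda>x. g x - u x) =
  dirichlet \<mu> K g - 2 * (inner_L2 \<mu> g u - inner_L2 \<mu> g (kernel_op K u)) + dirichlet \<mu> K u"
proof -
 define B where "B = (\<lambda>h k. inner_L2 \<mu> h k - inner_L2 \<mu> h (kernel_op K k))"
 have gu: "(\<lambda>x. g x - u x) \<in> L2 \<mu>" by (intro L2_diff g u)
 have diff: "B h (\<lambda>x. g x - u x) = B h g - B h u" if "h \<in> L2 \<mu>" for h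
  using inner_L2_diff[OF that g u] inner_kernel_op_lincomb[OF that g u, of "-1"] by (simp add: B_def)
 have sym: "B h k = B k h" if "h \<in> L2 \<mu>" "k \<in> L2 \<mu>" for h k
  using inner_sym[OF that] inner_L2_commute[of \<mu> h k] by (simp add: B_def)
 have "B (\<lambda>x. g x - u x) (\<lambda>x. g x - u x) = B g (\<lambda>x. g x - u x) - B u (\<lambda>x. g x - u x)"
  using diff[OF gu] sym[OF gu g] sym[OF gu u] by simp
 also have "... = B g g - 2 * B g u + B u u" using diff[OF g] diff[OF u] sym[OF u g] by simp
 finally show ?thesis using g u gu by (simp add: B_def dirichlet_eq)
qed

lemma dirichlet_le_norm: "f \<in> L2 \<mu> ==> dirichlet \<mu> K f \<le> inner_L2 \<mu> f f"
 using inner_pos[of f] by (simp add: dirichlet_eq)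

text \<open>After expanding the square, both pure squares integrate to the squared norm of f by
  invariance. In this form the Dirichlet form is visibly nonnegative, unchanged by shifts of f,
  monotone in the kernel and additive over mixtures of kernels.\<close>

lemma dirichlet_nn_integral:
 assumes f: "f \<in> L2 \<mu>"
 shows "ennreal (2 * dirichlet \<mu> K f) = (\<integral>\<^sup>+x. \<integral>\<^sup>+y. ennreal ((f x - f y)\<^sup>2) \<partial>K x \<partial>\<mu>)"
  and "0 \<le> dirichlet \<mu> K f"
proof -
 let ?g = "\<lambda>x. (f x)\<^sup>2"
 have m[measurable]: "f \<in> bm \<mu>" using f by (rule L2_measurable)
 have d: "(f x - f y)\<^sup>2 = (f x)\<^sup>2 + (f y)\<^sup>2 - 2 * (f x * f y)" for x y by (simp add: power2_diff)
 note kpl = L2_pair_law(1,2)[OF f, THEN L2_square_integrable] L2_pair_law(3,4)[OF f]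
 note pl = integral_pair_law[OF f f]
 have I: "integrable pair_law (\<lambda>q. (f (fst q) - f (snd q))\<^sup>2)"
  unfolding d using kpl pl by auto
 have E: "(\<integral>q. (f (fst q) - f (snd q))\<^sup>2 \<partial>pair_law) = 2 * dirichlet \<mu> K f"
  unfolding d dirichlet_eq[OF f] using kpl pl by simp
 have sm: "(\<lambda>q. ennreal ((f (fst q) - f (snd q))\<^sup>2)) \<in> bm (\<mu> \<Otimes>\<^sub>M \<mu>)"
  by (intro comp_ennreal borel_measurable_power borel_measurable_diff
    comp_fst[OF m] comp_snd[OF m])
 have "ennreal (2 * dirichlet \<mu> K f) = (\<integral>\<^sup>+q. ennreal ((f (fst q) - f (snd q))\<^sup>2) \<partial>pair_law)"
  using nn_integral_eq_integral[OF I] E by simp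
 also have "... = (\<integral>\<^sup>+x. \<integral>\<^sup>+y. ennreal ((f x - f y)\<^sup>2) \<partial>K x \<partial>\<mu>)"
  using nn_integral_pair_law[OF sm] by simp
 finally show "ennreal (2 * dirichlet \<mu> K f) = (\<integral>\<^sup>+x. \<integral>\<^sup>+y. ennreal ((f x - f y)\<^sup>2) \<partial>K x \<partial>\<mu>)" .
 have "0 \<le> (\<integral>q. (f (fst q) - f (snd q))\<^sup>2 \<partial>pair_law)" by simp
 with E show "0 \<le> dirichlet \<mu> K f" by simp
qed

lemma dirichlet_shift:
 assumes f: "f \<in> L2 \<mu>"
 shows "dirichlet \<mu> K (\<lambda>x. f x - c) = dirichlet \<mu> K f"
proof -
 have g: "(\<lambda>x. f x - c) \<in> L2 \<mu>" by (intro L2_diff f L2_const)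
 have "ennreal (2 * dirichlet \<mu> K (\<lambda>x. f x - c)) = ennreal (2 * dirichlet \<mu> K f)"
  unfolding dirichlet_nn_integral(1)[OF f] dirichlet_nn_integral(1)[OF g] by simp
 then show ?thesis using dirichlet_nn_integral(2)[OF f] dirichlet_nn_integral(2)[OF g] by simp
qed

lemma inner_centered:
 assumes f: "f \<in> L2 \<mu>"
 shows "inner_L2 \<mu> (\<lambda>x. f x - (integral\<^sup>L \<mu> f)) (\<lambda>x. f x - (integral\<^sup>L \<mu> f)) = var \<mu> f"
 using variance_eq[OF L2_integrable[OF f] L2_square_integrable[OF f]]
 by (simp add: inner_L2_def var_def power2_eq_square)

text \<open>Positivity bounds the form by the squared norm; since shifts do not change the form, the
  norm can be that of the centred function.\<close>

lemma dirichlet_le_var: "f \<in> L2 \<mu> ==> dirichlet \<mu> K f \<le> var \<mu> f"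
 using dirichlet_le_norm[of "\<lambda>x. f x - (integral\<^sup>L \<mu> f)"] dirichlet_shift[of f "\<integral>x. f x \<partial>\<mu>"] inner_centered[of f]
 by (simp add: L2_diff L2_const)

section \<open>Correlations and the variational formula\<close>

lemma inner_funpow_sym:
 assumes "f \<in> L2 \<mu>" "g \<in> L2 \<mu>"
 shows "inner_L2 \<mu> ((kernel_op K ^^ j) g) ((kernel_op K ^^ k) f) = inner_L2 \<mu> g ((kernel_op K ^^ (j + k)) f)"
 using assms
proof (induction j arbitrary: k)
 case (Suc j)
 have "inner_L2 \<mu> ((kernel_op K ^^ Suc j) g) ((kernel_op K ^^ k) f) =
   inner_L2 \<mu> ((kernel_op K ^^ k) f) (kernel_op K ((kernel_op K ^^ j) g))"
  by (simp add: inner_L2_commute)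
 also have "... = inner_L2 \<mu> ((kernel_op K ^^ j) g) ((kernel_op K ^^ Suc k) f)"
  using Suc.prems by (simp add: inner_sym funpow_L2)
 also have "... = inner_L2 \<mu> g ((kernel_op K ^^ (j + Suc k)) f)" by (rule Suc.IH[OF Suc.prems])
 finally show ?case by simp
qed simp

lemma corr_eq_funpow: "f \<in> L2 \<mu> ==> corr f k = inner_L2 \<mu> f ((kernel_op K ^^ k) f)"
 unfolding corr_def by (rule inner_kernel_power)

text \<open>An even lag 2 j gives the squared norm of K^j f. At an odd lag one factor K remains, and
  positivity is applied at K^j f.\<close>

lemma corr_nonneg:
 assumes "f \<in> L2 \<mu>"
 shows "0 \<le> corr f k"
proof (cases "even k")
 case True
 then obtain j where k: "k = j + j" by (metis evenE mult_2)
 have "corr f k = inner_L2 \<mu> ((kernel_op K ^^ j) f) ((kernel_op K ^^ j) f)"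
  unfolding corr_eq_funpow[OF assms] k by (rule inner_funpow_sym[OF assms assms, symmetric])
 then show ?thesis by (simp add: inner_L2_def integral_nonneg_AE)
next
 case False
 then obtain j where k: "k = j + Suc j" by (metis oddE add_Suc_right mult_2 Suc_eq_plus1)
 have "corr f k = inner_L2 \<mu> ((kernel_op K ^^ j) f) (kernel_op K ((kernel_op K ^^ j) f))"
  unfolding corr_eq_funpow[OF assms] k using inner_funpow_sym[OF assms assms, of j "Suc j"] by simp
 then show ?thesis using inner_pos[OF funpow_L2[OF assms]] by simp
qed

lemma corr_antimono_even: "f \<in> L2 \<mu> ==> corr f (2 * n) = inner_L2 \<mu> ((kernel_op K ^^ n) f) ((kernel_op K ^^ n) f)"
 using inner_funpow_sym[of f f n n] by (simp add: corr_eq_funpow mult_2)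

text \<open>
 For \<open>u = \<Sum>k<n. K\<^sup>k f\<close> the functional \<open>g \<mapsto> 2\<langle>f, g\<rangle> - \<E>(g)\<close>, whose supremum is
 \<open>\<langle>f, (I - K)\<^sup>-\<^sup>1 f\<rangle>\<close>, takes the value \<open>\<Sum>k<2n. \<langle>f, K\<^sup>k f\<rangle>\<close>, since \<open>(I - K) u = f - K\<^sup>n f\<close>.
\<close>

lemma resolvent_inner:
 assumes f: "f \<in> L2 \<mu>" and g: "g \<in> L2 \<mu>"
 defines "u \<equiv> \<lambda>n x. \<Sum>k<n. (kernel_op K ^^ k) f x"
 shows "inner_L2 \<mu> g (u n) - inner_L2 \<mu> g (kernel_op K (u n)) = inner_L2 \<mu> g f - inner_L2 \<mu> g ((kernel_op K ^^ n) f)"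
proof -
 have "inner_L2 \<mu> g (kernel_op K (u n)) = (\<Sum>k<n. inner_L2 \<mu> g (kernel_op K ((kernel_op K ^^ k) f)))"
  unfolding u_def by (rule inner_kernel_op_sum) (use f g in \<open>auto intro: funpow_L2\<close>)
 moreover have "inner_L2 \<mu> g (u n) = (\<Sum>k<n. inner_L2 \<mu> g ((kernel_op K ^^ k) f))"
  unfolding u_def by (rule inner_L2_sum) (use f g in \<open>auto intro: funpow_L2\<close>)
 ultimately have "inner_L2 \<mu> g (u n) - inner_L2 \<mu> g (kernel_op K (u n)) =
   (\<Sum>k<n. inner_L2 \<mu> g ((kernel_op K ^^ k) f) - inner_L2 \<mu> g ((kernel_op K ^^ Suc k) f))"
  by (simp add: sum_subtractf)
 also have "... = inner_L2 \<mu> g f - inner_L2 \<mu> g ((kernel_op K ^^ n) f)"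
  by (subst sum_lessThan_telescope') simp
 finally show ?thesis .
qed

lemma variational_value:
 assumes f: "f \<in> L2 \<mu>"
 defines "u \<equiv> \<lambda>n x. \<Sum>k<n. (kernel_op K ^^ k) f x"
 shows "u n \<in> L2 \<mu>" "inner_L2 \<mu> f (u n) = (\<Sum>k<n. corr f k)"
  and "dirichlet \<mu> K (u n) = 2 * (\<Sum>k<n. corr f k) - (\<Sum>k<2*n. corr f k)"
  and "2 * inner_L2 \<mu> f (u n) - dirichlet \<mu> K (u n) = (\<Sum>k<2*n. corr f k)"
proof -
 have un_eq: "(\<lambda>x. \<Sum>k<n. (kernel_op K ^^ k) f x) = u n" by (simp add: u_def)
 show uL: "u n \<in> L2 \<mu>" unfolding u_def by (intro L2_sum funpow_L2 f)
 show fu: "inner_L2 \<mu> f (u n) = (\<Sum>k<n. corr f k)"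
  unfolding u_def by (subst inner_L2_sum) (use f in \<open>auto intro: funpow_L2 simp: corr_eq_funpow\<close>)
 \<comment> \<open>The boundary term of the telescoping sum: by symmetry it collects the lags n,
   ..., 2 n - 1.\<close>
 have "inner_L2 \<mu> (u n) ((kernel_op K ^^ n) f) = (\<Sum>k<n. inner_L2 \<mu> ((kernel_op K ^^ n) f) ((kernel_op K ^^ k) f))"
  unfolding u_def by (subst inner_L2_commute, subst inner_L2_sum) (use f in \<open>auto intro: funpow_L2\<close>)
 also have "... = (\<Sum>k<n. corr f (n + k))"
  using inner_funpow_sym[OF f f] by (simp add: corr_eq_funpow[OF f])
 also have "... = (\<Sum>k<2*n. corr f k) - (\<Sum>k<n. corr f k)"
  using sum.lessThan_Suc_shift sum.nat_group
  by (simp add: mult_2 lessThan_atLeast0 sum.atLeastLessThan_concat[of 0 n "n+n", symmetric]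
    sum.shift_bounds_nat_ivl[of _ 0 n n, simplified, symmetric] add.commute)
 finally have un: "inner_L2 \<mu> (u n) ((kernel_op K ^^ n) f) = (\<Sum>k<2*n. corr f k) - (\<Sum>k<n. corr f k)" .
 show d: "dirichlet \<mu> K (u n) = 2 * (\<Sum>k<n. corr f k) - (\<Sum>k<2*n. corr f k)"
  using resolvent_inner[OF f uL, of n, unfolded un_eq] un fu
  by (simp add: dirichlet_eq[OF uL] inner_L2_commute[of \<mu> "u n" f])
 show "2 * inner_L2 \<mu> f (u n) - dirichlet \<mu> K (u n) = (\<Sum>k<2*n. corr f k)"
  unfolding d fu by simp
qed

text \<open>The functional at g is compared with its value at u n through nonnegativity of the
  Dirichlet form at g - u n. As (I - K) (u n) = f - K^n f, the error is 2 <g, K^n f>, at most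
  \<delta> |g|^2 + |K^n f|^2 / \<delta>. The last norm is the correlation at lag 2 n; it tends to 0,
  because bounded partial sums make the correlations summable. Finally \<delta> tends to 0.\<close>

lemma variational_upper:
 assumes f: "f \<in> L2 \<mu>" and g: "g \<in> L2 \<mu>" and s: "\<And>n. (\<Sum>k<n. corr f k) \<le> s"
 shows "2 * inner_L2 \<mu> f g - dirichlet \<mu> K g \<le> s"
proof -
 define u where "u = (\<lambda>n x. \<Sum>k<n. (kernel_op K ^^ k) f x)"
 have V: "u n \<in> L2 \<mu>" "dirichlet \<mu> K (u n) = 2 * (\<Sum>k<n. corr f k) - (\<Sum>k<2*n. corr f k)" for n
  using variational_value(1,3)[OF f, of n] by (simp_all add: u_def)
 have R: "inner_L2 \<mu> g (u n) - inner_L2 \<mu> g (kernel_op K (u n)) = inner_L2 \<mu> g f - inner_L2 \<mu> g ((kernel_op K ^^ n) f)" for n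
  using resolvent_inner[OF f g, of n] by (simp add: u_def)
 have le: "2 * inner_L2 \<mu> f g - dirichlet \<mu> K g \<le> s + \<delta> * inner_L2 \<mu> g g + corr f (2 * n) / \<delta>" if "0 < \<delta>" for \<delta> n
 proof -
  let ?h = "(kernel_op K ^^ n) f"
  have h: "?h \<in> L2 \<mu>" by (rule funpow_L2[OF f])
  have gu: "(\<lambda>x. g x - u n x) \<in> L2 \<mu>" by (intro L2_diff g V(1))
  have "dirichlet \<mu> K (\<lambda>x. g x - u n x) =
   dirichlet \<mu> K g - 2 * (inner_L2 \<mu> g (u n) - inner_L2 \<mu> g (kernel_op K (u n))) + dirichlet \<mu> K (u n)"
   by (rule dirichlet_diff[OF g V(1)])
  then have "0 \<le> dirichlet \<mu> K g - 2 * (inner_L2 \<mu> g f - inner_L2 \<mu> g ?h) + (2 * (\<Sum>k<n. corr f k) - (\<Sum>k<2*n. corr f k))"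
   using dirichlet_nn_integral(2)[OF gu] R[of n] V(2) by simp
  moreover have "(\<Sum>k<n. corr f k) \<le> (\<Sum>k<2*n. corr f k)" by (intro sum_mono2) (auto simp: corr_nonneg[OF f])
  moreover have "2 * inner_L2 \<mu> g ?h \<le> \<delta> * inner_L2 \<mu> g g + corr f (2 * n) / \<delta>"
  proof -
   have "0 \<le> inner_L2 \<mu> (\<lambda>x. \<delta> * g x - ?h x) (\<lambda>x. \<delta> * g x - ?h x)"
    unfolding inner_L2_def by (intro integral_nonneg_AE) simp
   also have "... = inner_L2 \<mu> (\<lambda>x. \<delta> * g x - ?h x) (\<lambda>x. \<delta> * g x) - inner_L2 \<mu> (\<lambda>x. \<delta> * g x - ?h x) ?h"
    by (rule inner_L2_diff) (intro L2_diff L2_cmult g h)+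
   also have "inner_L2 \<mu> (\<lambda>x. \<delta> * g x - ?h x) (\<lambda>x. \<delta> * g x) = \<delta> * inner_L2 \<mu> g (\<lambda>x. \<delta> * g x - ?h x)"
    by (simp only: inner_L2_cmult inner_L2_commute[of \<mu> "\<lambda>x. \<delta> * g x - ?h x"])
   also have "inner_L2 \<mu> g (\<lambda>x. \<delta> * g x - ?h x) = \<delta> * inner_L2 \<mu> g g - inner_L2 \<mu> g ?h"
    by (subst inner_L2_diff) (simp_all add: L2_cmult g h inner_L2_cmult)
   also have "inner_L2 \<mu> (\<lambda>x. \<delta> * g x - ?h x) ?h = inner_L2 \<mu> ?h (\<lambda>x. \<delta> * g x - ?h x)"
    by (rule inner_L2_commute)
   also have "... = \<delta> * inner_L2 \<mu> g ?h - inner_L2 \<mu> ?h ?h"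
    by (subst inner_L2_diff) (simp_all add: L2_cmult g h inner_L2_cmult inner_L2_commute[of \<mu> ?h g])
   finally have "2 * \<delta> * inner_L2 \<mu> g ?h \<le> \<delta> * \<delta> * inner_L2 \<mu> g g + corr f (2 * n)"
    unfolding corr_antimono_even[OF f] by (simp add: algebra_simps)
   then show ?thesis using that by (simp add: field_simps)
  qed
  ultimately show ?thesis using s[of n] inner_L2_commute[of \<mu> f g] by simp
 qed
 have "summable (corr f)"
  by (rule bounded_imp_summable[of _ s]) (use corr_nonneg[OF f] s[of "Suc _"] in \<open>auto simp: lessThan_Suc_atMost\<close>)
 then have "corr f \<longlonglongrightarrow> 0" by (rule summable_LIMSEQ_zero)
 then have c0: "(\<lambda>n. corr f (2 * n)) \<longlonglongrightarrow> 0"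
  by (rule LIMSEQ_subseq_LIMSEQ[unfolded comp_def]) (auto simp: strict_mono_def)
 have le2: "2 * inner_L2 \<mu> f g - dirichlet \<mu> K g \<le> s + \<delta> * inner_L2 \<mu> g g" if "0 < \<delta>" for \<delta>
 proof (rule tendsto_lowerbound[OF _ _ sequentially_bot])
  show "(\<lambda>n. s + \<delta> * inner_L2 \<mu> g g + corr f (2 * n) / \<delta>) \<longlonglongrightarrow> s + \<delta> * inner_L2 \<mu> g g"
   using tendsto_add[OF tendsto_const[of "s + \<delta> * inner_L2 \<mu> g g"] tendsto_divide[OF c0 tendsto_const[of \<delta>]]] that by simp
 qed (use le[OF that] in auto)
 have "((\<lambda>\<delta>. s + \<delta> * inner_L2 \<mu> g g) \<longlongrightarrow> s + 0 * inner_L2 \<mu> g g) (at_right 0)"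
  by (intro tendsto_intros)
 then have "((\<lambda>\<delta>. s + \<delta> * inner_L2 \<mu> g g) \<longlongrightarrow> s) (at_right 0)" by simp
 then show ?thesis
  by (rule tendsto_lowerbound) (use le2 in \<open>auto simp: eventually_at_right[of 0 1] intro!: exI[of _ 1]\<close>)
qed

definition corr_sum :: "('a => real) => ereal" where
 "corr_sum f = (SUP n. ereal (\<Sum>k<n. corr f k))"

lemma corr_sum_ge: "f \<in> L2 \<mu> ==> ereal (corr f 0) \<le> corr_sum f"
 unfolding corr_sum_def by (rule SUP_upper2[of 1]) auto

end

text \<open>The variational formula for L is used at c u, with u the approximate maximiser for K.
  Writing E_K and E_L for the two forms, its value 2 c <f, u> - c^2 E_L(u) is at least c (2 <f, u> -
  E_K(u)), which is c times a partial sum for K.\<close>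

lemma corr_sum_mono:
 assumes "rev_pos_kernel \<mu> K" "rev_pos_kernel \<mu> L" and f: "f \<in> L2 \<mu>" and c: "0 < c"
  and le: "\<And>g. g \<in> L2 \<mu> ==> c * dirichlet \<mu> L g \<le> dirichlet \<mu> K g"
 shows "rev_pos_kernel.corr_sum \<mu> K f \<le> ereal (1 / c) * rev_pos_kernel.corr_sum \<mu> L f"
proof -
 interpret K: rev_pos_kernel \<mu> K by fact
 interpret L: rev_pos_kernel \<mu> L by fact
 show ?thesis
 proof (cases "L.corr_sum f = \<infinity>")
  case True
  then show ?thesis using c by simp
 next
  case False
  moreover have "0 \<le> L.corr_sum f"
   using L.corr_sum_ge[OF f] L.corr_nonneg[OF f, of 0] by (meson ereal_less_eq(5) order_trans)
  ultimately obtain s where s: "L.corr_sum f = ereal s" by (cases "L.corr_sum f") auto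
  have bd: "(\<Sum>k<n. L.corr f k) \<le> s" for n
   using SUP_upper[of n UNIV "\<lambda>n. ereal (\<Sum>k<n. L.corr f k)"] s by (simp add: L.corr_sum_def)
  have "(\<Sum>k<n. K.corr f k) \<le> s / c" for n
  proof -
   define u where "u = (\<lambda>x. \<Sum>k<n. (kernel_op K ^^ k) f x)"
   note V = K.variational_value[OF f, of n, folded u_def]
   have cu: "(\<lambda>x. c * u x) \<in> L2 \<mu>" by (intro L2_cmult V(1))
   have "dirichlet \<mu> L (\<lambda>x. c * u x) = c * c * dirichlet \<mu> L u"
   proof -
    have "kernel_op L (\<lambda>x. c * u x) = (\<lambda>x. c * kernel_op L u x)" by (simp add: kernel_op_def[abs_def])
    then have "dirichlet \<mu> L (\<lambda>x. c * u x) = (\<integral>x. (c * c) * (u x * (u x - kernel_op L u x)) \<partial>\<mu>)"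
     by (simp add: dirichlet_def inner_L2_def algebra_simps)
    then show ?thesis by (simp add: dirichlet_def inner_L2_def)
   qed
   then have "c * (2 * inner_L2 \<mu> f u) - c * (c * dirichlet \<mu> L u) \<le> s"
    using L.variational_upper[OF f cu bd] by (simp add: inner_L2_cmult algebra_simps)
   moreover have "c * (c * dirichlet \<mu> L u) \<le> c * dirichlet \<mu> K u"
    using le[OF V(1)] c by (intro mult_left_mono) auto
   ultimately have "c * (2 * inner_L2 \<mu> f u - dirichlet \<mu> K u) \<le> s" by (simp add: algebra_simps)
   then have "(\<Sum>k<2*n. K.corr f k) \<le> s / c" unfolding V(4) using c by (simp add: field_simps)
   moreover have "(\<Sum>k<n. K.corr f k) \<le> (\<Sum>k<2*n. K.corr f k)"
    by (intro sum_mono2) (auto simp: K.corr_nonneg[OF f])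
   ultimately show ?thesis by simp
  qed
  then have "K.corr_sum f \<le> ereal (s / c)" unfolding K.corr_sum_def by (intro SUP_least) simp
  then show ?thesis using s by simp
 qed
qed

context rev_pos_kernel
begin

lemma asvar_eq_corr_sum:
 assumes f: "f \<in> L2 \<mu>"
 shows "asvar \<mu> K f = 2 * corr_sum (\<lambda>x. f x - (integral\<^sup>L \<mu> f)) - ereal (var \<mu> f)"
 unfolding corr_sum_def var_eq_corr[OF f] by (rule asvar_eq[OF f]) (intro corr_nonneg L2_diff f L2_const)

end

text \<open>The constant kernel draws afresh and forgets its state. With it the exact Gibbs sampler
  fits the same locale, and its Dirichlet form is the variance.\<close>

lemma (in prob_space) rev_pos_kernel_const: "rev_pos_kernel M (\<lambda>_. M)"
proof
 show "(\<lambda>_. M) \<in> M \<leadsto> M" by (intro measurable_const) (simp add: space_prob_algebra prob_space_axioms)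
 fix a b :: "'a => ennreal" assume [measurable]: "a \<in> bm M" "b \<in> bm M"
 show "(\<integral>\<^sup>+x. a x * nn_integral M b \<partial>M) = (\<integral>\<^sup>+x. b x * nn_integral M a \<partial>M)"
  by (simp add: nn_integral_multc mult.commute)
 show "2 * (\<integral>\<^sup>+x. a x * nn_integral M b \<partial>M) \<le> (\<integral>\<^sup>+x. a x * nn_integral M a \<partial>M) + (\<integral>\<^sup>+x. b x * nn_integral M b \<partial>M)"
  using ennreal_two_mult_le by (simp add: nn_integral_multc)
qed

lemma (in prob_space) dirichlet_const:
 assumes f: "f \<in> L2 M"
 shows "dirichlet M (\<lambda>_. M) f = var M f"
proof -
 interpret C: rev_pos_kernel M "\<lambda>_. M" by (rule rev_pos_kernel_const)
 have "inner_L2 M f (kernel_op (\<lambda>_. M) f) = (integral\<^sup>L M f)\<^sup>2"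
  by (simp add: inner_L2_def kernel_op_def power2_eq_square)
 then show ?thesis unfolding C.dirichlet_eq[OF f] by (simp add: var_def inner_L2_def power2_eq_square)
qed

text \<open>Twice the variance is the double integral of (f x - f y)^2 under the constant kernel
  \<mu>; the minorization compares its inner integral with that under \<open>K x\<close>.\<close>

lemma (in rev_pos_kernel) minorization_dirichlet:
 assumes f: "f \<in> L2 \<mu>" and e: "0 \<le> \<epsilon>"
  and minor: "AE x in \<mu>. \<forall>h\<in>bm \<mu>. ennreal \<epsilon> * nn_integral \<mu> h \<le> nn_integral (K x) h"
 shows "\<epsilon> * var \<mu> f \<le> dirichlet \<mu> K f"
proof -
 interpret C: rev_pos_kernel \<mu> "\<lambda>_. \<mu>" by (rule rev_pos_kernel_const)
 have m[measurable]: "f \<in> bm \<mu>" using f by (rule L2_measurable)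
 have "ennreal (2 * (\<epsilon> * var \<mu> f)) = ennreal \<epsilon> * (\<integral>\<^sup>+x. \<integral>\<^sup>+y. ennreal ((f x - f y)\<^sup>2) \<partial>\<mu> \<partial>\<mu>)"
  using C.dirichlet_nn_integral[OF f] e dirichlet_const[OF f] by (metis ennreal_mult' mult.left_commute)
 also have "... = (\<integral>\<^sup>+x. ennreal \<epsilon> * \<integral>\<^sup>+y. ennreal ((f x - f y)\<^sup>2) \<partial>\<mu> \<partial>\<mu>)"
 proof (rule nn_integral_cmult[symmetric])
  have "(\<lambda>(x, y). ennreal ((f x - f y)\<^sup>2)) \<in> bm (\<mu> \<Otimes>\<^sub>M \<mu>)"
   unfolding case_prod_beta'
   by (intro comp_ennreal borel_measurable_power borel_measurable_diff
     comp_fst[OF m] comp_snd[OF m])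
  then show "(\<lambda>x. \<integral>\<^sup>+y. ennreal ((f x - f y)\<^sup>2) \<partial>\<mu>) \<in> bm \<mu>"
   by (rule borel_measurable_nn_integral)
 qed
 also have "... \<le> (\<integral>\<^sup>+x. \<integral>\<^sup>+y. ennreal ((f x - f y)\<^sup>2) \<partial>K x \<partial>\<mu>)"
 proof (rule nn_integral_mono_AE)
  show "AE x in \<mu>. ennreal \<epsilon> * (\<integral>\<^sup>+y. ennreal ((f x - f y)\<^sup>2) \<partial>\<mu>) \<le> (\<integral>\<^sup>+y. ennreal ((f x - f y)\<^sup>2) \<partial>K x)"
   using minor by eventually_elim (auto elim!: bspec)
 qed
 also have "... = ennreal (2 * dirichlet \<mu> K f)" by (rule dirichlet_nn_integral(1)[OF f, symmetric])
 finally show ?thesis using dirichlet_nn_integral(2)[OF f] by (subst (asm) ennreal_le_iff) auto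
qed

subsection \<open>Two-component Gibbs samplers\<close>

lemma kernel_power_cong_sets: "sets M = sets N ==> kernel_power M K k = kernel_power N K k"
 by (induction k) (auto simp: fun_eq_iff cong: return_cong)

lemma measure_eq_rectangles:
 assumes M: "prob_space M" "sets M = sets (A \<Otimes>\<^sub>M B)" and N: "sets N = sets (A \<Otimes>\<^sub>M B)"
  and eq: "\<And>a b. a \<in> sets A ==> b \<in> sets B ==> emeasure M (a \<times> b) = emeasure N (a \<times> b)"
 shows "M = N"
proof (rule measure_eqI_generator_eq[OF Int_stable_pair_measure_generator[of A B]])
 interpret prob_space M by (rule M)
 show "{a \<times> b |a b. a \<in> sets A \<and> b \<in> sets B} \<subseteq> Pow (space A \<times> space B)"
  by (auto dest: sets.sets_into_space)
 show "sets M = sigma_sets (space A \<times> space B) {a \<times> b |a b. a \<in> sets A \<and> b \<in> sets B}"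
  "sets N = sigma_sets (space A \<times> space B) {a \<times> b |a b. a \<in> sets A \<and> b \<in> sets B}"
  using M(2) N by (simp_all add: sets_pair_measure)
 show "range (\<lambda>_::nat. space A \<times> space B) \<subseteq> {a \<times> b |a b. a \<in> sets A \<and> b \<in> sets B}" by auto
 show "(\<Union>i::nat. space A \<times> space B) = space A \<times> space B" by auto
 show "emeasure M (space A \<times> space B) \<noteq> \<infinity>" by simp
qed (use eq in auto)

locale gibbs =
 fixes \<Theta> :: "'th measure" and X :: "'x measure" and \<pi> :: "('th \<times> 'x) measure" and \<pi>T :: "'th measure" and \<pi>X :: "'x measure"
  and tgt :: "'th => 'x measure" and \<kappa> :: "'x => 'th measure"
 assumes \<pi>: "\<pi> \<in> space (prob_algebra (\<Theta> \<Otimes>\<^sub>M X))"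
  and \<pi>T: "\<pi>T = distr \<pi> \<Theta> fst" and \<pi>X: "\<pi>X = distr \<pi> X snd"
  and tgt: "tgt \<in> \<Theta> \<leadsto> X"
  and \<pi>_tgt: "\<And>A B. A \<in> sets \<Theta> ==> B \<in> sets X ==>
     emeasure \<pi> (A \<times> B) = (\<integral>\<^sup>+ \<theta>. emeasure (tgt \<theta>) B * indicator A \<theta> \<partial>\<pi>T)"
  and \<kappa>: "\<kappa> \<in> X \<leadsto> \<Theta>"
  and \<pi>_\<kappa>: "\<And>A B. A \<in> sets \<Theta> ==> B \<in> sets X ==>
     emeasure \<pi> (A \<times> B) = (\<integral>\<^sup>+ x. emeasure (\<kappa> x) A * indicator B x \<partial>\<pi>X)"
begin

abbreviation "\<Theta>X \<equiv> \<Theta> \<Otimes>\<^sub>M X"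

lemma sets_\<pi>: "sets \<pi> = sets \<Theta>X" and prob_\<pi>: "prob_space \<pi>"
 using \<pi> by (auto simp: space_prob_algebra)

lemma sets_\<pi>T: "sets \<pi>T = sets \<Theta>" and sets_\<pi>X: "sets \<pi>X = sets X"
 by (simp_all add: \<pi>T \<pi>X)

lemma space_\<pi>T: "space \<pi>T = space \<Theta>" and space_\<pi>X: "space \<pi>X = space X"
 and space_\<pi>: "space \<pi> = space \<Theta> \<times> space X"
 using sets_eq_imp_space_eq[OF sets_\<pi>] by (simp_all add: \<pi>T \<pi>X space_pair_measure)

lemma fst_measurable_\<pi>: "fst \<in> \<pi> \<rightarrow>\<^sub>M \<Theta>" and snd_measurable_\<pi>: "snd \<in> \<pi> \<rightarrow>\<^sub>M X"
 unfolding measurable_cong_sets[OF sets_\<pi> refl] by auto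

lemma prob_\<pi>T: "prob_space \<pi>T" and prob_\<pi>X: "prob_space \<pi>X"
 unfolding \<pi>T \<pi>X using fst_measurable_\<pi> snd_measurable_\<pi> prob_\<pi>
 by (auto intro: prob_space.prob_space_distr)

lemma not_empty: "space \<pi> \<noteq> {}" "space \<pi>T \<noteq> {}" "space \<pi>X \<noteq> {}"
 using prob_\<pi> prob_\<pi>T prob_\<pi>X by (auto dest: prob_space.not_empty)

lemma prob_algebra_\<pi>X: "prob_algebra \<pi>X = prob_algebra X" and prob_algebra_\<pi>: "prob_algebra \<pi> = prob_algebra \<Theta>X"
 by (rule sets_prob_algebra_cong[OF sets_\<pi>X], rule sets_prob_algebra_cong[OF sets_\<pi>])

lemma \<pi>_eq_bind_tgt: "\<pi> = \<pi>T \<bind> (\<lambda>\<theta>. distr (tgt \<theta>) \<Theta>X (Pair \<theta>))" (is "_ = ?M")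
proof (rule measure_eq_rectangles[OF prob_\<pi> sets_\<pi>])
 show s: "sets ?M = sets \<Theta>X"
  by (rule sets_kernel_bind[OF sets_\<pi>T kernel_distr_measurable[OF sets_\<pi>T tgt] not_empty(2)]) simp
 fix a b assume ab: "a \<in> sets \<Theta>" "b \<in> sets X"
 have "emeasure ?M (a \<times> b) = (\<integral>\<^sup>+\<theta>. \<integral>\<^sup>+x. indicator (a \<times> b) (\<theta>, x) \<partial>tgt \<theta> \<partial>\<pi>T)"
  using nn_integral_bind_distr[OF sets_\<pi>T tgt, of Pair "\<Theta> \<Otimes>\<^sub>M X" "indicator (a \<times> b)"] ab s by simp
 also have "... = emeasure \<pi> (a \<times> b)"
  unfolding \<pi>_tgt[OF ab] using prob_kernelD(2)[OF tgt] ab(2)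
  by (intro nn_integral_cong) (simp add: space_\<pi>T indicator_times nn_integral_cmult_indicator mult.commute[of "emeasure _ _"])
 finally show "emeasure \<pi> (a \<times> b) = emeasure ?M (a \<times> b)" by simp
qed

lemma \<pi>_eq_bind_\<kappa>: "\<pi> = \<pi>X \<bind> (\<lambda>x. distr (\<kappa> x) \<Theta>X (\<lambda>\<theta>. (\<theta>, x)))" (is "_ = ?M")
proof (rule measure_eq_rectangles[OF prob_\<pi> sets_\<pi>])
 show s: "sets ?M = sets \<Theta>X"
  by (rule sets_kernel_bind[OF sets_\<pi>X kernel_distr_measurable[OF sets_\<pi>X \<kappa>] not_empty(3)]) simp
 fix a b assume ab: "a \<in> sets \<Theta>" "b \<in> sets X"
 have "emeasure ?M (a \<times> b) = (\<integral>\<^sup>+x. \<integral>\<^sup>+\<theta>. indicator (a \<times> b) (\<theta>, x) \<partial>\<kappa> x \<partial>\<pi>X)"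
  using nn_integral_bind_distr[OF sets_\<pi>X \<kappa>, of "\<lambda>x \<theta>. (\<theta>, x)" "\<Theta> \<Otimes>\<^sub>M X" "indicator (a \<times> b)"] ab s by simp
 also have "... = emeasure \<pi> (a \<times> b)"
  unfolding \<pi>_\<kappa>[OF ab] using prob_kernelD(2)[OF \<kappa>] ab(1)
  by (intro nn_integral_cong) (simp add: space_\<pi>X indicator_times mult.commute[of "indicator a _"] nn_integral_cmult_indicator mult.commute[of "emeasure _ _"])
 finally show "emeasure \<pi> (a \<times> b) = emeasure ?M (a \<times> b)" by simp
qed

lemma nn_integral_\<pi>_tgt:
 "F \<in> bm \<Theta>X ==> nn_integral \<pi> F = (\<integral>\<^sup>+\<theta>. \<integral>\<^sup>+x. F (\<theta>, x) \<partial>tgt \<theta> \<partial>\<pi>T)"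
 by (subst \<pi>_eq_bind_tgt, rule nn_integral_bind_distr[OF sets_\<pi>T tgt]) simp_all

lemma nn_integral_\<pi>_\<kappa>:
 "F \<in> bm \<Theta>X ==> nn_integral \<pi> F = (\<integral>\<^sup>+x. \<integral>\<^sup>+\<theta>. F (\<theta>, x) \<partial>\<kappa> x \<partial>\<pi>X)"
 by (subst \<pi>_eq_bind_\<kappa>, rule nn_integral_bind_distr[OF sets_\<pi>X \<kappa>]) simp_all

lemma AE_\<pi>_tgt: "AE q in \<pi>. P q ==> AE \<theta> in \<pi>T. AE x in tgt \<theta>. P (\<theta>, x)"
proof -
 assume "AE q in \<pi>. P q"
 then have "AE q in \<pi>T \<bind> (\<lambda>\<theta>. distr (tgt \<theta>) \<Theta>X (Pair \<theta>)). P q" by (simp only: \<pi>_eq_bind_tgt[symmetric])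
 from AE_bind_distr[OF sets_\<pi>T tgt _ not_empty(2) this] show ?thesis by simp
qed

lemma nn_integral_\<pi>X_tgt:
 assumes "f \<in> bm X"
 shows "nn_integral \<pi>X f = (\<integral>\<^sup>+\<theta>. \<integral>\<^sup>+x. f x \<partial>tgt \<theta> \<partial>\<pi>T)"
 unfolding \<pi>X using assms snd_measurable_\<pi>
 by (subst nn_integral_distr) (auto simp: nn_integral_\<pi>_tgt)

lemma nn_integral_\<pi>T_\<kappa>:
 assumes "f \<in> bm \<Theta>"
 shows "nn_integral \<pi>T f = (\<integral>\<^sup>+x. \<integral>\<^sup>+\<theta>. f \<theta> \<partial>\<kappa> x \<partial>\<pi>X)"
 unfolding \<pi>T using assms fst_measurable_\<pi>
 by (subst nn_integral_distr) (auto simp: nn_integral_\<pi>_\<kappa>)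

lemma AE_space_\<pi>T: "AE \<theta> in \<pi>T. \<theta> \<in> space \<Theta>"
 by (rule AE_I2) (simp add: space_\<pi>T)

text \<open>\<open>\<pi>X\<close> is a mixture of the laws \<open>tgt \<theta>\<close>, so a finite
  second moment of the mixture is finite for almost every \<theta>.\<close>

lemma L2_tgt:
 assumes f: "f \<in> L2 \<pi>X"
 shows "AE \<theta> in \<pi>T. f \<in> L2 (tgt \<theta>)"
proof -
 have m: "f \<in> bm X" using L2_measurable[OF f] sets_\<pi>X by (simp cong: measurable_cong_sets)
 have m2: "(\<lambda>x. ennreal ((f x)\<^sup>2)) \<in> bm X" using m by measurable
 have "(\<integral>\<^sup>+\<theta>. \<integral>\<^sup>+x. ennreal ((f x)\<^sup>2) \<partial>tgt \<theta> \<partial>\<pi>T) < \<infinity>"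
  using f nn_integral_\<pi>X_tgt[OF m2] by (simp add: L2_iff_nn)
 then have "AE \<theta> in \<pi>T. (\<integral>\<^sup>+x. ennreal ((f x)\<^sup>2) \<partial>tgt \<theta>) \<noteq> \<infinity>"
  using nn_integral_kernel_measurable[OF tgt m2] sets_\<pi>T
  by (intro nn_integral_PInf_AE) (auto cong: measurable_cong_sets)
 moreover note AE_space_\<pi>T
 ultimately show ?thesis
 proof eventually_elim
  case (elim \<theta>)
  then show ?case using m prob_kernelD(2)[OF tgt elim(2)]
   by (auto simp: L2_iff_nn less_top cong: measurable_cong_sets)
 qed
qed

definition bar :: "('th => real) => 'x => real" where
 "bar f x = integral\<^sup>L (\<kappa> x) f"

lemma bar_measurable: "f \<in> bm \<Theta> ==> bar f \<in> bm X"
 unfolding bar_def[abs_def] by (rule integral_kernel_measurable[OF \<kappa>])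

lemma L2_\<pi>T_measurable: "f \<in> L2 \<pi>T ==> f \<in> bm \<Theta>"
 using L2_measurable[of f \<pi>T] sets_\<pi>T by (simp cong: measurable_cong_sets)

lemma L2_\<pi>X_measurable: "f \<in> L2 \<pi>X ==> f \<in> bm X"
 using L2_measurable[of f \<pi>X] sets_\<pi>X by (simp cong: measurable_cong_sets)

lemma bar_L2:
 assumes f: "f \<in> L2 \<pi>T"
 shows "bar f \<in> L2 \<pi>X"
proof -
 have m: "f \<in> bm \<Theta>" by (rule L2_\<pi>T_measurable[OF f])
 have "(\<integral>\<^sup>+x. ennreal ((bar f x)\<^sup>2) \<partial>\<pi>X) \<le> (\<integral>\<^sup>+x. \<integral>\<^sup>+\<theta>. ennreal ((f \<theta>)\<^sup>2) \<partial>\<kappa> x \<partial>\<pi>X)"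
 proof (rule nn_integral_mono)
  fix x assume "x \<in> space \<pi>X"
  then have x: "x \<in> space X" by (simp add: space_\<pi>X)
  note k = prob_kernelD[OF \<kappa> x]
  show "ennreal ((bar f x)\<^sup>2) \<le> (\<integral>\<^sup>+\<theta>. ennreal ((f \<theta>)\<^sup>2) \<partial>\<kappa> x)"
   unfolding bar_def by (rule square_integral_le[OF k(1)]) (use m k(2) in \<open>simp cong: measurable_cong_sets\<close>)
 qed
 also have "... = (\<integral>\<^sup>+\<theta>. ennreal ((f \<theta>)\<^sup>2) \<partial>\<pi>T)"
  using m by (intro nn_integral_\<pi>T_\<kappa>[symmetric]) measurable
 also have "... < \<infinity>" using f by (simp add: L2_iff_nn)
 finally show ?thesis using bar_measurable[OF m] sets_\<pi>X by (simp add: L2_iff_nn cong: measurable_cong_sets)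
qed

lemma integral_bar:
 assumes "integrable \<pi>T f"
 shows "integral\<^sup>L \<pi>X (bar f) = integral\<^sup>L \<pi>T f" "AE x in \<pi>X. integrable (\<kappa> x) f"
proof -
 have e: "\<pi>X \<bind> \<kappa> = \<pi>T"
 proof (rule measure_eqI)
  show s: "sets (\<pi>X \<bind> \<kappa>) = sets \<pi>T" using sets_kernel_bind[OF sets_\<pi>X \<kappa> not_empty(3)] sets_\<pi>T by simp
  fix A assume "A \<in> sets (\<pi>X \<bind> \<kappa>)"
  then have A: "A \<in> sets \<Theta>" using s sets_\<pi>T by simp
  have "emeasure (\<pi>X \<bind> \<kappa>) A = (\<integral>\<^sup>+x. \<integral>\<^sup>+\<theta>. indicator A \<theta> \<partial>\<kappa> x \<partial>\<pi>X)"
   using nn_integral_kernel_bind[OF sets_\<pi>X \<kappa>, of "indicator A"] A s sets_\<pi>T by simp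
  also have "... = emeasure \<pi>T A" using nn_integral_\<pi>T_\<kappa>[of "indicator A"] A sets_\<pi>T by simp
  finally show "emeasure (\<pi>X \<bind> \<kappa>) A = emeasure \<pi>T A" .
 qed
 show "integral\<^sup>L \<pi>X (bar f) = integral\<^sup>L \<pi>T f" "AE x in \<pi>X. integrable (\<kappa> x) f"
  using integral_kernel_bind[OF sets_\<pi>X \<kappa> not_empty(3), of f] assms unfolding e by (simp_all add: bar_def[abs_def])
qed

lemma L2_\<pi>_fst:
 assumes f: "f \<in> L2 \<pi>T"
 shows "(\<lambda>(\<theta>, x). f \<theta>) \<in> L2 \<pi>"
proof -
 have m: "f \<in> bm \<Theta>" by (rule L2_\<pi>T_measurable[OF f])
 have i: "integrable (distr \<pi> \<Theta> fst) (\<lambda>x. (f x)\<^sup>2)" using f by (simp add: \<pi>T L2_def)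
 have "integrable \<pi> (\<lambda>q. (f (fst q))\<^sup>2)"
  by (rule integrable_distr[OF fst_measurable_\<pi> i])
 moreover have "(\<lambda>q. f (fst q)) \<in> bm \<pi>" by (rule measurable_compose[OF fst_measurable_\<pi> m])
 ultimately show ?thesis by (simp add: L2_def case_prod_beta')
qed

lemma L2_\<pi>_snd:
 assumes h: "h \<in> L2 \<pi>X"
 shows "(\<lambda>(\<theta>, x). h x) \<in> L2 \<pi>"
proof -
 have m: "h \<in> bm X" by (rule L2_\<pi>X_measurable[OF h])
 have i: "integrable (distr \<pi> X snd) (\<lambda>x. (h x)\<^sup>2)" using h by (simp add: \<pi>X L2_def)
 have "integrable \<pi> (\<lambda>q. (h (snd q))\<^sup>2)"
  by (rule integrable_distr[OF snd_measurable_\<pi> i])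
 moreover have "(\<lambda>q. h (snd q)) \<in> bm \<pi>" by (rule measurable_compose[OF snd_measurable_\<pi> m])
 ultimately show ?thesis by (simp add: L2_def case_prod_beta')
qed

lemma integral_\<pi>_fst: "f \<in> bm \<Theta> ==> (\<integral>q. f (fst q) \<partial>\<pi>) = integral\<^sup>L \<pi>T f" for f :: "'th => real"
 unfolding \<pi>T by (rule integral_distr[OF fst_measurable_\<pi>, symmetric])

text \<open>\<open>bar\<close> is the conditional expectation given x, the adjoint of the embedding
  of functions of x.\<close>

lemma inner_bar:
 assumes f: "f \<in> L2 \<pi>T" and h: "h \<in> L2 \<pi>X"
 shows "inner_L2 \<pi> (\<lambda>(\<theta>, x). f \<theta>) (\<lambda>(\<theta>, x). h x) = inner_L2 \<pi>X (bar f) h"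
proof -
 let ?F = "\<lambda>q. f (fst q) * h (snd q)"
 have Fm: "?F \<in> bm \<Theta>X" by (rule borel_pair_mult[OF L2_\<pi>T_measurable[OF f] L2_\<pi>X_measurable[OF h]])
 have int: "integrable \<pi> ?F" using L2_integrable_mult[OF L2_\<pi>_fst[OF f] L2_\<pi>_snd[OF h]] by (simp add: case_prod_beta')
 have "inner_L2 \<pi> (\<lambda>(\<theta>, x). f \<theta>) (\<lambda>(\<theta>, x). h x) = integral\<^sup>L \<pi> ?F" by (simp add: inner_L2_def case_prod_beta')
 also have "... = (\<integral>x. bar f x * h x \<partial>\<pi>X)"
  using integral_bind_distr[OF sets_\<pi>X \<kappa> _ not_empty(3), of "\<lambda>x \<theta>. (\<theta>, x)" "\<Theta> \<Otimes>\<^sub>M X" ?F] int Fm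
  by (simp add: \<pi>_eq_bind_\<kappa>[symmetric] bar_def)
 finally show ?thesis by (simp add: inner_L2_def)
qed

end

abbreviation (input) "lift f \<equiv> \<lambda>(\<theta>, x). f \<theta>"

text \<open>Both samplers are instances: \<open>K \<theta>\<close> is the conditional particle
  filter for particle Gibbs, and the constant kernel \<open>tgt \<theta>\<close> for the exact
  sampler (\<open>gibbs_kernel_const\<close>).\<close>

locale gibbs_kernel = gibbs +
 fixes K :: "'a => 'b => 'b measure"
 assumes K_measurable: "(\<lambda>(\<theta>, x). K \<theta> x) \<in> \<Theta>X \<leadsto> X"
  and K_rev_pos: "\<And>\<theta>. \<theta> \<in> space \<Theta> ==> rev_pos_kernel (tgt \<theta>) (K \<theta>)"
begin

abbreviation step where "step \<equiv> scan_step \<Theta> X \<kappa> K"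
abbreviation S where "S \<equiv> scan_kernel \<Theta> X \<kappa> K"
abbreviation Kx where "Kx \<equiv> scan_kernel_x \<Theta> X \<kappa> K"

lemma K_measurable_swap: "(\<lambda>(x, \<theta>). K \<theta> x) \<in> X \<Otimes>\<^sub>M \<Theta> \<leadsto> X"
 using measurable_compose[OF measurable_pair_swap' K_measurable] by (simp add: case_prod_beta')

lemma inner_step_measurable:
 "(\<lambda>(x, \<theta>). K \<theta> x \<bind> (\<lambda>y. return \<Theta>X (\<theta>, y))) \<in> X \<Otimes>\<^sub>M \<Theta> \<leadsto> \<Theta>X"
proof -
 have "(\<lambda>q. (snd (fst q), snd q)) \<in> (X \<Otimes>\<^sub>M \<Theta>) \<Otimes>\<^sub>M X \<rightarrow>\<^sub>M \<Theta> \<Otimes>\<^sub>M X" by measurable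
 from measurable_compose[OF this measurable_return_prob_space]
 have "(\<lambda>(q, y). return \<Theta>X (snd q, y)) \<in> (X \<Otimes>\<^sub>M \<Theta>) \<Otimes>\<^sub>M X \<leadsto> \<Theta>X"
  by (simp add: case_prod_beta')
 from measurable_bind_prob_space2[OF K_measurable_swap this] show ?thesis by (simp add: case_prod_beta')
qed

lemma step_measurable: "step \<in> X \<leadsto> \<Theta>X"
 unfolding scan_step_def[abs_def] by (rule measurable_bind_prob_space2[OF \<kappa> inner_step_measurable])

lemma S_measurable: "S \<in> \<Theta>X \<leadsto> \<Theta>X"
 unfolding scan_kernel_def case_prod_beta' by (rule comp_snd[OF step_measurable])

lemma Kx_measurable: "Kx \<in> X \<leadsto> X"
 unfolding scan_kernel_x_def[abs_def] by (rule measurable_compose[OF step_measurable measurable_distr_prob_space]) simp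

lemma nn_integral_step:
 assumes x: "x \<in> space X" and F: "F \<in> bm \<Theta>X"
 shows "nn_integral (step x) F = (\<integral>\<^sup>+\<theta>. \<integral>\<^sup>+y. F (\<theta>, y) \<partial>K \<theta> x \<partial>\<kappa> x)"
proof -
 have k: "sets (\<kappa> x) = sets \<Theta>" by (rule prob_kernelD[OF \<kappa> x])
 have m: "(\<lambda>\<theta>. K \<theta> x \<bind> (\<lambda>y. return \<Theta>X (\<theta>, y))) \<in> \<Theta> \<leadsto> \<Theta>X"
  using measurable_compose[OF measurable_Pair1'[OF x, of \<Theta>] inner_step_measurable] by simp
 have "nn_integral (step x) F = (\<integral>\<^sup>+\<theta>. \<integral>\<^sup>+q. F q \<partial>(K \<theta> x \<bind> (\<lambda>y. return \<Theta>X (\<theta>, y))) \<partial>\<kappa> x)"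
  unfolding scan_step_def by (rule nn_integral_kernel_bind[OF k m F])
 also have "... = (\<integral>\<^sup>+\<theta>. \<integral>\<^sup>+y. F (\<theta>, y) \<partial>K \<theta> x \<partial>\<kappa> x)"
 proof (rule nn_integral_cong)
  fix \<theta> assume "\<theta> \<in> space (\<kappa> x)"
  then have t: "\<theta> \<in> space \<Theta>" using k by (auto dest: sets_eq_imp_space_eq)
  have sK: "sets (K \<theta> x) = sets X"
   using prob_kernelD(2)[OF K_measurable, of "(\<theta>, x)"] t x by (simp add: space_pair_measure)
  have "nn_integral (K \<theta> x \<bind> (\<lambda>y. return \<Theta>X (\<theta>, y))) F = (\<integral>\<^sup>+y. \<integral>\<^sup>+q. F q \<partial>return \<Theta>X (\<theta>, y) \<partial>K \<theta> x)"
   by (rule nn_integral_kernel_bind[OF sK _ F])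
     (rule measurable_compose[OF measurable_Pair1'[OF t] measurable_return_prob_space])
  also have "... = (\<integral>\<^sup>+y. F (\<theta>, y) \<partial>K \<theta> x)"
   using sets_eq_imp_space_eq[OF sK] t F
   by (intro nn_integral_cong) (simp add: nn_integral_return space_pair_measure)
  finally show "nn_integral (K \<theta> x \<bind> (\<lambda>y. return \<Theta>X (\<theta>, y))) F = (\<integral>\<^sup>+y. F (\<theta>, y) \<partial>K \<theta> x)" .
 qed
 finally show ?thesis .
qed

lemma nn_integral_Kx:
 assumes x: "x \<in> space X" and g: "g \<in> bm X"
 shows "nn_integral (Kx x) g = (\<integral>\<^sup>+\<theta>. \<integral>\<^sup>+y. g y \<partial>K \<theta> x \<partial>\<kappa> x)"
proof -
 have "snd \<in> step x \<rightarrow>\<^sub>M X" unfolding measurable_cong_sets[OF prob_kernelD(2)[OF step_measurable x] refl] by simp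
 then have "nn_integral (Kx x) g = (\<integral>\<^sup>+q. g (snd q) \<partial>step x)"
  unfolding scan_kernel_x_def by (rule nn_integral_distr) (use g in simp)
 also have "... = (\<integral>\<^sup>+\<theta>. \<integral>\<^sup>+y. g y \<partial>K \<theta> x \<partial>\<kappa> x)"
  using nn_integral_step[OF x comp_snd[OF g]] by simp
 finally show ?thesis .
qed

lemma distr_step_fst:
 assumes x: "x \<in> space X" shows "distr (step x) \<Theta> fst = \<kappa> x"
proof (rule measure_eqI)
 note k = prob_kernelD[OF \<kappa> x]
 show "sets (distr (step x) \<Theta> fst) = sets (\<kappa> x)" using k by simp
 fix A assume "A \<in> sets (distr (step x) \<Theta> fst)"
 then have A[measurable]: "A \<in> sets \<Theta>" by simp
 have f: "fst \<in> step x \<rightarrow>\<^sub>M \<Theta>" unfolding measurable_cong_sets[OF prob_kernelD(2)[OF step_measurable x] refl] by simp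
 have "emeasure (distr (step x) \<Theta> fst) A = nn_integral (distr (step x) \<Theta> fst) (indicator A)" by simp
 also have "... = (\<integral>\<^sup>+q. indicator A (fst q) \<partial>step x)" by (rule nn_integral_distr[OF f]) measurable
 also have "... = (\<integral>\<^sup>+\<theta>. \<integral>\<^sup>+y. indicator A \<theta> \<partial>K \<theta> x \<partial>\<kappa> x)"
  using nn_integral_step[OF x, of "\<lambda>q. indicator A (fst q)"] by simp
 also have "... = nn_integral (\<kappa> x) (indicator A)"
 proof (rule nn_integral_cong)
  fix \<theta> assume "\<theta> \<in> space (\<kappa> x)"
  then have "prob_space (K \<theta> x)"
   using prob_kernelD(1)[OF K_measurable, of "(\<theta>, x)"] x k(3) by (simp add: space_pair_measure)
  then show "(\<integral>\<^sup>+y. indicator A \<theta> \<partial>K \<theta> x) = indicator A \<theta>" by (simp add: prob_space.emeasure_space_1)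
 qed
 finally show "emeasure (distr (step x) \<Theta> fst) A = emeasure (\<kappa> x) A" using k A by simp
qed

text \<open>\<open>Kx\<close> draws \<theta> given x, so that (\<theta>, x) has law \<pi>.
  Disintegrating \<pi> the other way round makes the transition a mixture over \<theta> of
  \<open>K \<theta>\<close> started from \<open>tgt \<theta>\<close>.\<close>

lemma nn_integral_Kx_weighted:
 assumes F: "(\<lambda>(x, y). F x y) \<in> bm (X \<Otimes>\<^sub>M X)"
 shows "(\<integral>\<^sup>+x. \<integral>\<^sup>+y. F x y \<partial>Kx x \<partial>\<pi>X) = (\<integral>\<^sup>+\<theta>. \<integral>\<^sup>+x. \<integral>\<^sup>+y. F x y \<partial>K \<theta> x \<partial>tgt \<theta> \<partial>\<pi>T)"
proof -
 have m: "(\<lambda>q. \<integral>\<^sup>+y. F (snd q) y \<partial>K (fst q) (snd q)) \<in> bm \<Theta>X"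
 proof (rule nn_integral_kernel_measurable2)
  show "(\<lambda>q. K (fst q) (snd q)) \<in> \<Theta>X \<leadsto> X" using K_measurable by (simp add: case_prod_beta')
  show "(\<lambda>(q, y). F (snd q) y) \<in> bm (\<Theta>X \<Otimes>\<^sub>M X)"
   using measurable_compose[OF _ F, of "\<lambda>q. (snd (fst q), snd q)" "\<Theta>X \<Otimes>\<^sub>M X"] by (simp add: case_prod_beta')
 qed
 have "(\<integral>\<^sup>+x. \<integral>\<^sup>+y. F x y \<partial>Kx x \<partial>\<pi>X) = (\<integral>\<^sup>+x. \<integral>\<^sup>+\<theta>. \<integral>\<^sup>+y. F x y \<partial>K \<theta> x \<partial>\<kappa> x \<partial>\<pi>X)"
  by (intro nn_integral_cong nn_integral_Kx measurable_param_section[OF F]) (simp_all add: space_\<pi>X)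
 also have "... = (\<integral>\<^sup>+q. \<integral>\<^sup>+y. F (snd q) y \<partial>K (fst q) (snd q) \<partial>\<pi>)"
  using nn_integral_\<pi>_\<kappa>[OF m] by simp
 also have "... = (\<integral>\<^sup>+\<theta>. \<integral>\<^sup>+x. \<integral>\<^sup>+y. F x y \<partial>K \<theta> x \<partial>tgt \<theta> \<partial>\<pi>T)"
  using nn_integral_\<pi>_tgt[OF m] by simp
 finally show ?thesis .
qed

lemma nn_integral_Kx_product:
 assumes a: "a \<in> bm X" and b: "b \<in> bm X"
 shows "(\<integral>\<^sup>+x. a x * nn_integral (Kx x) b \<partial>\<pi>X) = (\<integral>\<^sup>+\<theta>. \<integral>\<^sup>+x. a x * nn_integral (K \<theta> x) b \<partial>tgt \<theta> \<partial>\<pi>T)"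
proof -
 have m: "(\<lambda>(x, y). a x * b y) \<in> bm (X \<Otimes>\<^sub>M X)"
  unfolding case_prod_beta' using a b by measurable
 have "(\<integral>\<^sup>+x. a x * nn_integral (Kx x) b \<partial>\<pi>X) = (\<integral>\<^sup>+x. \<integral>\<^sup>+y. a x * b y \<partial>Kx x \<partial>\<pi>X)"
  using b prob_kernelD(2)[OF Kx_measurable]
  by (intro nn_integral_cong nn_integral_cmult[symmetric]) (simp add: space_\<pi>X cong: measurable_cong_sets)
 also have "... = (\<integral>\<^sup>+\<theta>. \<integral>\<^sup>+x. \<integral>\<^sup>+y. a x * b y \<partial>K \<theta> x \<partial>tgt \<theta> \<partial>\<pi>T)"
  by (rule nn_integral_Kx_weighted[OF m])
 also have "... = (\<integral>\<^sup>+\<theta>. \<integral>\<^sup>+x. a x * nn_integral (K \<theta> x) b \<partial>tgt \<theta> \<partial>\<pi>T)"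
 proof (intro nn_integral_cong nn_integral_cmult)
  fix \<theta> x assume "\<theta> \<in> space \<pi>T" "x \<in> space (tgt \<theta>)"
  then have "(\<theta>, x) \<in> space \<Theta>X" using prob_kernelD(3)[OF tgt] by (simp add: space_\<pi>T space_pair_measure)
  from prob_kernelD(2)[OF K_measurable this] show "b \<in> bm (K \<theta> x)" using b by (simp cong: measurable_cong_sets)
 qed
 finally show ?thesis .
qed

lemma measurable_tgt: "\<theta> \<in> space \<Theta> ==> a \<in> bm X ==> a \<in> bm (tgt \<theta>)"
 using prob_kernelD(2)[OF tgt] by (simp cong: measurable_cong_sets)

lemma measurable_\<pi>X_iff: "a \<in> bm \<pi>X \<longleftrightarrow> a \<in> bm X"
 using sets_\<pi>X by (simp cong: measurable_cong_sets)

lemma product_measurable: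
 assumes a: "a \<in> bm X" and b: "b \<in> bm X"
 shows "(\<lambda>\<theta>. \<integral>\<^sup>+x. a x * nn_integral (K \<theta> x) b \<partial>tgt \<theta>) \<in> bm \<pi>T"
proof -
 have "(\<lambda>\<theta>. \<integral>\<^sup>+x. a x * nn_integral (K \<theta> x) b \<partial>tgt \<theta>) \<in> bm \<Theta>"
 proof (rule nn_integral_kernel_measurable2[OF tgt])
  have "(\<lambda>q. \<integral>\<^sup>+y. b y \<partial>K (fst q) (snd q)) \<in> bm \<Theta>X"
   using nn_integral_kernel_measurable[OF K_measurable b] by (simp add: case_prod_beta')
  then show "(\<lambda>(\<theta>, x). a x * nn_integral (K \<theta> x) b) \<in> bm \<Theta>X"
   unfolding case_prod_beta' by (intro borel_measurable_times_ennreal comp_snd[OF a])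
 qed
 then show ?thesis using sets_\<pi>T by (simp cong: measurable_cong_sets)
qed

lemma rev_pos_Kx: "rev_pos_kernel \<pi>X Kx"
proof (unfold rev_pos_kernel_def rev_pos_kernel_axioms_def, intro conjI allI impI prob_\<pi>X)
 show "Kx \<in> \<pi>X \<leadsto> \<pi>X"
  using Kx_measurable unfolding measurable_cong_sets[OF sets_\<pi>X refl] prob_algebra_\<pi>X .
 fix a b :: "'b => ennreal" assume "a \<in> bm \<pi>X" "b \<in> bm \<pi>X"
 then have a: "a \<in> bm X" and b: "b \<in> bm X" by (auto simp: measurable_\<pi>X_iff)
 note m = measurable_tgt[OF _ a] measurable_tgt[OF _ b]
 show "(\<integral>\<^sup>+x. a x * nn_integral (Kx x) b \<partial>\<pi>X) = (\<integral>\<^sup>+x. b x * nn_integral (Kx x) a \<partial>\<pi>X)"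
  unfolding nn_integral_Kx_product[OF a b] nn_integral_Kx_product[OF b a]
  by (intro nn_integral_cong rev_pos_kernel.rev[OF K_rev_pos] m) (simp_all add: space_\<pi>T)
 have "2 * (\<integral>\<^sup>+\<theta>. \<integral>\<^sup>+x. a x * nn_integral (K \<theta> x) b \<partial>tgt \<theta> \<partial>\<pi>T) = (\<integral>\<^sup>+\<theta>. 2 * (\<integral>\<^sup>+x. a x * nn_integral (K \<theta> x) b \<partial>tgt \<theta>) \<partial>\<pi>T)"
  by (rule nn_integral_cmult[symmetric, OF product_measurable[OF a b]])
 also have "... \<le> (\<integral>\<^sup>+\<theta>. (\<integral>\<^sup>+x. a x * nn_integral (K \<theta> x) a \<partial>tgt \<theta>) + (\<integral>\<^sup>+x. b x * nn_integral (K \<theta> x) b \<partial>tgt \<theta>) \<partial>\<pi>T)"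
  by (intro nn_integral_mono rev_pos_kernel.pos[OF K_rev_pos] m) (simp_all add: space_\<pi>T)
 also have "... = (\<integral>\<^sup>+\<theta>. (\<integral>\<^sup>+x. a x * nn_integral (K \<theta> x) a \<partial>tgt \<theta>) \<partial>\<pi>T) + (\<integral>\<^sup>+\<theta>. (\<integral>\<^sup>+x. b x * nn_integral (K \<theta> x) b \<partial>tgt \<theta>) \<partial>\<pi>T)"
  by (rule nn_integral_add[OF product_measurable[OF a a] product_measurable[OF b b]])
 finally show "2 * (\<integral>\<^sup>+x. a x * nn_integral (Kx x) b \<partial>\<pi>X)
   \<le> (\<integral>\<^sup>+x. a x * nn_integral (Kx x) a \<partial>\<pi>X) + (\<integral>\<^sup>+x. b x * nn_integral (Kx x) b \<partial>\<pi>X)"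
  unfolding nn_integral_Kx_product[OF a b] nn_integral_Kx_product[OF a a] nn_integral_Kx_product[OF b b] .
qed

sublocale x: rev_pos_kernel \<pi>X Kx by (rule rev_pos_Kx)

lemma dirichlet_mixture:
 assumes f: "f \<in> L2 \<pi>X"
 shows "ennreal (2 * dirichlet \<pi>X Kx f) = (\<integral>\<^sup>+\<theta>. ennreal (2 * dirichlet (tgt \<theta>) (K \<theta>) f) \<partial>\<pi>T)"
proof -
 have fm: "f \<in> bm X" by (rule L2_\<pi>X_measurable[OF f])
 have m: "(\<lambda>(x, y). ennreal ((f x - f y)\<^sup>2)) \<in> bm (X \<Otimes>\<^sub>M X)"
  unfolding case_prod_beta'
  by (intro comp_ennreal borel_measurable_power borel_measurable_diff
    comp_fst[OF fm] comp_snd[OF fm])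
 have "ennreal (2 * dirichlet \<pi>X Kx f) = (\<integral>\<^sup>+x. \<integral>\<^sup>+y. ennreal ((f x - f y)\<^sup>2) \<partial>Kx x \<partial>\<pi>X)"
  by (rule x.dirichlet_nn_integral(1)[OF f])
 also have "... = (\<integral>\<^sup>+\<theta>. \<integral>\<^sup>+x. \<integral>\<^sup>+y. ennreal ((f x - f y)\<^sup>2) \<partial>K \<theta> x \<partial>tgt \<theta> \<partial>\<pi>T)"
  by (rule nn_integral_Kx_weighted[OF m])
 also have "... = (\<integral>\<^sup>+\<theta>. ennreal (2 * dirichlet (tgt \<theta>) (K \<theta>) f) \<partial>\<pi>T)"
 proof (rule nn_integral_cong_AE)
  note AE_space_\<pi>T
  with L2_tgt[OF f] show "AE \<theta> in \<pi>T. (\<integral>\<^sup>+x. \<integral>\<^sup>+y. ennreal ((f x - f y)\<^sup>2) \<partial>K \<theta> x \<partial>tgt \<theta>) = ennreal (2 * dirichlet (tgt \<theta>) (K \<theta>) f)"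
   by eventually_elim (rule rev_pos_kernel.dirichlet_nn_integral(1)[symmetric, OF K_rev_pos])
 qed
 finally show ?thesis .
qed

text \<open>Two moves in succession preserve \<pi>: redrawing \<theta> given x, and updating x by
  \<open>K \<theta>\<close>, which leaves \<open>tgt \<theta>\<close> invariant.\<close>

lemma nn_integral_S:
 assumes F: "F \<in> bm \<Theta>X"
 shows "(\<integral>\<^sup>+q. \<integral>\<^sup>+r. F r \<partial>S q \<partial>\<pi>) = nn_integral \<pi> F"
proof -
 have m1: "(\<lambda>x. \<integral>\<^sup>+r. F r \<partial>step x) \<in> bm X" by (rule nn_integral_kernel_measurable[OF step_measurable F])
 have m: "(\<lambda>q. \<integral>\<^sup>+y. F (fst q, y) \<partial>K (fst q) (snd q)) \<in> bm \<Theta>X"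
 proof (rule nn_integral_kernel_measurable2)
  show "(\<lambda>q. K (fst q) (snd q)) \<in> \<Theta>X \<leadsto> X" using K_measurable by (simp add: case_prod_beta')
  show "(\<lambda>(q, y). F (fst q, y)) \<in> bm (\<Theta>X \<Otimes>\<^sub>M X)"
   using measurable_compose[OF _ F, of "\<lambda>q. (fst (fst q), snd q)" "\<Theta>X \<Otimes>\<^sub>M X"] by (simp add: case_prod_beta')
 qed
 have "(\<integral>\<^sup>+q. \<integral>\<^sup>+r. F r \<partial>S q \<partial>\<pi>) = (\<integral>\<^sup>+q. \<integral>\<^sup>+r. F r \<partial>step (snd q) \<partial>\<pi>)" by (simp add: scan_kernel_def case_prod_beta')
 also have "... = (\<integral>\<^sup>+x. \<integral>\<^sup>+r. F r \<partial>step x \<partial>\<pi>X)"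
  unfolding \<pi>X by (rule nn_integral_distr[OF snd_measurable_\<pi>, symmetric]) (use m1 in simp)
 also have "... = (\<integral>\<^sup>+x. \<integral>\<^sup>+\<theta>. \<integral>\<^sup>+y. F (\<theta>, y) \<partial>K \<theta> x \<partial>\<kappa> x \<partial>\<pi>X)"
  by (intro nn_integral_cong nn_integral_step F) (simp add: space_\<pi>X)
 also have "... = (\<integral>\<^sup>+\<theta>. \<integral>\<^sup>+x. \<integral>\<^sup>+y. F (\<theta>, y) \<partial>K \<theta> x \<partial>tgt \<theta> \<partial>\<pi>T)"
  using nn_integral_\<pi>_\<kappa>[OF m] nn_integral_\<pi>_tgt[OF m] by simp
 also have "... = (\<integral>\<^sup>+\<theta>. \<integral>\<^sup>+x. F (\<theta>, x) \<partial>tgt \<theta> \<partial>\<pi>T)"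
 proof (rule nn_integral_cong)
  fix \<theta> assume "\<theta> \<in> space \<pi>T"
  then have t: "\<theta> \<in> space \<Theta>" by (simp add: space_\<pi>T)
  interpret k: rev_pos_kernel "tgt \<theta>" "K \<theta>" by (rule K_rev_pos[OF t])
  show "(\<integral>\<^sup>+x. \<integral>\<^sup>+y. F (\<theta>, y) \<partial>K \<theta> x \<partial>tgt \<theta>) = (\<integral>\<^sup>+x. F (\<theta>, x) \<partial>tgt \<theta>)"
   by (rule k.nn_integral_inv) (intro measurable_tgt[OF t] measurable_compose[OF measurable_Pair1'[OF t] F])
 qed
 also have "... = nn_integral \<pi> F" by (rule nn_integral_\<pi>_tgt[OF F, symmetric])
 finally show ?thesis .
qed

sublocale joint: invariant_kernel \<pi> S
proof (unfold invariant_kernel_def invariant_kernel_axioms_def, intro conjI prob_\<pi>)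
 show Sm: "S \<in> \<pi> \<leadsto> \<pi>"
  using S_measurable unfolding measurable_cong_sets[OF sets_\<pi> refl] prob_algebra_\<pi> .
 show "\<pi> \<bind> S = \<pi>"
 proof (rule measure_eqI)
  show s: "sets (\<pi> \<bind> S) = sets \<pi>" by (rule sets_kernel_bind[OF refl Sm not_empty(1)])
  fix A assume "A \<in> sets (\<pi> \<bind> S)"
  then have A: "A \<in> sets \<Theta>X" using s sets_\<pi> by simp
  have "emeasure (\<pi> \<bind> S) A = (\<integral>\<^sup>+q. \<integral>\<^sup>+r. indicator A r \<partial>S q \<partial>\<pi>)"
   using nn_integral_kernel_bind[OF refl Sm, of "indicator A"] A s sets_\<pi> by simp
  also have "... = emeasure \<pi> A" using nn_integral_S[of "indicator A"] A sets_\<pi> by simp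
  finally show "emeasure (\<pi> \<bind> S) A = emeasure \<pi> A" .
 qed
qed

lemma kernel_op_S_fst:
 assumes f: "f \<in> bm \<Theta>" and x: "x \<in> space X"
 shows "kernel_op S (lift f) (\<theta>0, x) = bar f x"
proof -
 have m: "fst \<in> step x \<rightarrow>\<^sub>M \<Theta>" unfolding measurable_cong_sets[OF prob_kernelD(2)[OF step_measurable x] refl] by simp
 have "kernel_op S (lift f) (\<theta>0, x) = integral\<^sup>L (distr (step x) \<Theta> fst) f"
  using integral_distr[OF m f] by (simp add: kernel_op_def scan_kernel_def case_prod_beta')
 then show ?thesis by (simp add: distr_step_fst[OF x] bar_def)
qed

lemma kernel_op_S_snd:
 assumes h: "h \<in> bm X" and x: "x \<in> space X"
 shows "kernel_op S (\<lambda>(\<theta>, x). h x) (\<theta>0, x) = kernel_op Kx h x"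
proof -
 have m: "snd \<in> step x \<rightarrow>\<^sub>M X" unfolding measurable_cong_sets[OF prob_kernelD(2)[OF step_measurable x] refl] by simp
 show ?thesis using integral_distr[OF m h] by (simp add: kernel_op_def scan_kernel_def scan_kernel_x_def case_prod_beta')
qed

lemma kernel_op_S_cong:
 assumes "\<And>\<theta> x. \<theta> \<in> space \<Theta> ==> x \<in> space X ==> F (\<theta>, x) = H (\<theta>, x)" "x \<in> space X"
 shows "kernel_op S F (\<theta>0, x) = kernel_op S H (\<theta>0, x)"
 unfolding kernel_op_def scan_kernel_def
 by (rule Bochner_Integration.integral_cong) (use assms prob_kernelD(3)[OF step_measurable] in \<open>auto simp: space_pair_measure\<close>)

text \<open>The innermost application of S turns f into \<open>bar f\<close>, because a step draws
  \<theta> from \<kappa> and then alters x only. From then on the functions depend on x, where S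
  acts as \<open>Kx\<close>.\<close>

lemma funpow_S:
 assumes f: "f \<in> L2 \<pi>T" and t: "\<theta> \<in> space \<Theta>" and x: "x \<in> space X"
 shows "(kernel_op S ^^ Suc k) (lift f) (\<theta>, x) = (kernel_op Kx ^^ k) (bar f) x"
 using t x
proof (induction k arbitrary: \<theta> x)
 case 0
 then show ?case using kernel_op_S_fst[OF L2_\<pi>T_measurable[OF f]] by simp
next
 case (Suc k)
 have "(kernel_op S ^^ Suc (Suc k)) (lift f) (\<theta>, x) = kernel_op S ((kernel_op S ^^ Suc k) (lift f)) (\<theta>, x)" by simp
 also have "... = kernel_op S (\<lambda>(\<theta>, x). (kernel_op Kx ^^ k) (bar f) x) (\<theta>, x)"
  by (rule kernel_op_S_cong) (use Suc in auto)
 also have "... = kernel_op Kx ((kernel_op Kx ^^ k) (bar f)) x"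
  by (rule kernel_op_S_snd[OF L2_\<pi>X_measurable[OF x.funpow_L2[OF bar_L2[OF f]]] Suc.prems(2)])
 finally show ?case by simp
qed

lemma inner_funpow_S:
 assumes f: "f \<in> L2 \<pi>T"
 shows "inner_L2 \<pi> (lift f) ((kernel_op S ^^ Suc k) (lift f)) = inner_L2 \<pi>X (bar f) ((kernel_op Kx ^^ k) (bar f))"
proof -
 have "inner_L2 \<pi> (lift f) ((kernel_op S ^^ Suc k) (lift f)) =
   inner_L2 \<pi> (lift f) (\<lambda>(\<theta>, x). (kernel_op Kx ^^ k) (bar f) x)"
  unfolding inner_L2_def
  by (rule Bochner_Integration.integral_cong[OF refl]) (auto simp: space_\<pi> funpow_S[OF f] simp del: funpow.simps)
 also have "... = inner_L2 \<pi>X (bar f) ((kernel_op Kx ^^ k) (bar f))"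
  by (rule inner_bar[OF f x.funpow_L2[OF bar_L2[OF f]]])
 finally show ?thesis .
qed

lemma joint_corr_Suc: "f \<in> L2 \<pi>T ==> joint.corr (lift f) (Suc k) = x.corr (bar f) k"
 unfolding joint.corr_def joint.inner_kernel_power[OF L2_\<pi>_fst L2_\<pi>_fst] inner_funpow_S x.corr_eq_funpow[OF bar_L2] ..

lemma var_\<pi>_fst: "f \<in> L2 \<pi>T ==> var \<pi> (lift f) = var \<pi>T f"
 using integral_\<pi>_fst[of f] integral_\<pi>_fst[of "\<lambda>x. (f x)\<^sup>2"] L2_\<pi>T_measurable[of f]
 by (simp add: var_def case_prod_beta')

text \<open>Let v be the variance of f and s the sum of the correlations of the centred
  \<open>bar f\<close> under \<open>Kx\<close>. Lag 0 contributes v and lag k + 1 what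
  \<open>Kx\<close> has at lag k, so the joint value is 2 (v + s) - v; for \<open>bar f\<close> it
  is 2 s minus the variance of \<open>bar f\<close>.\<close>

lemma asvar_joint:
 assumes f: "f \<in> L2 \<pi>T"
 shows "asvar \<pi> S (lift f) = ereal (var \<pi>T f) + ereal (var \<pi>X (bar f)) + asvar \<pi>X Kx (bar f)"
proof -
 interpret T: prob_space \<pi>T by (rule prob_\<pi>T)
 define c where "c = integral\<^sup>L \<pi>T f"
 define f0 where "f0 = (\<lambda>\<theta>. f \<theta> - c)"
 have f0: "f0 \<in> L2 \<pi>T" unfolding f0_def by (intro L2_diff f T.L2_const)
 let ?F = "\<lambda>(\<theta>, x). f \<theta>"
 have F: "?F \<in> L2 \<pi>" by (rule L2_\<pi>_fst[OF f])
 have cF: "integral\<^sup>L \<pi> ?F = c" using integral_\<pi>_fst[OF L2_\<pi>T_measurable[OF f]] by (simp add: c_def case_prod_beta')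
 have F0: "(\<lambda>q. ?F q - (integral\<^sup>L \<pi> ?F)) = (lift f0)" unfolding cF by (auto simp: f0_def)
 have i: "integrable \<pi>T f" by (rule T.L2_integrable[OF f])
 have cbar: "integral\<^sup>L \<pi>X (bar f) = c" using integral_bar(1)[OF i] by (simp add: c_def)
 \<comment> \<open>Centring commutes with \<open>bar\<close> only where f is integrable under
   \<kappa> x, hence almost everywhere.\<close>
 have bar0: "AE x in \<pi>X. bar f0 x = bar f x - c"
 proof -
  have "AE x in \<pi>X. x \<in> space X" by (rule AE_I2) (simp add: space_\<pi>X)
  with integral_bar(2)[OF i] show ?thesis
  proof eventually_elim
   case (elim x)
   interpret k: prob_space "\<kappa> x" by (rule prob_kernelD[OF \<kappa> elim(2)])
   show ?case using elim(1) by (simp add: bar_def f0_def k.prob_space)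
  qed
 qed
 have bc: "(\<lambda>x. bar f x - c) \<in> L2 \<pi>X" by (intro L2_diff bar_L2[OF f] x.L2_const)
 have corr_eq: "x.corr (bar f0) k = x.corr (\<lambda>x. bar f x - c) k" for k
 proof -
  interpret k: invariant_kernel \<pi>X "kernel_power \<pi>X Kx k" by (rule x.invariant_kernel_power)
  note m = L2_measurable[OF bar_L2[OF f0]] L2_measurable[OF bc]
  have "x.corr (bar f0) k = inner_L2 \<pi>X (bar f0) (kernel_op (kernel_power \<pi>X Kx k) (\<lambda>x. bar f x - c))"
   unfolding x.corr_def
   by (rule inner_L2_cong_AE) (intro m k.kernel_op_measurable k.kernel_op_cong_AE bar0)+
  also have "... = inner_L2 \<pi>X (kernel_op (kernel_power \<pi>X Kx k) (\<lambda>x. bar f x - c)) (\<lambda>x. bar f x - c)"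
   by (subst inner_L2_commute, rule inner_L2_cong_AE) (intro m k.kernel_op_measurable bar0)+
  finally show ?thesis unfolding x.corr_def by (subst inner_L2_commute)
 qed
 have c0: "joint.corr (lift f0) 0 = var \<pi>T f"
  using joint.var_eq_corr[OF F] unfolding F0 var_\<pi>_fst[OF f] by simp
 have cS: "joint.corr (lift f0) (Suc k) = x.corr (\<lambda>x. bar f x - c) k" for k
  unfolding joint_corr_Suc[OF f0] corr_eq ..
 have nn: "0 \<le> joint.corr (lift f0) k" for k
 proof (cases k)
  case 0
  have "0 \<le> var \<pi>T f" using T.variance_eq[OF i L2_square_integrable[OF f]] T.variance_positive[of f] by (simp add: var_def)
  then show ?thesis using c0 0 by simp
 next
  case (Suc j)
  then show ?thesis using cS x.corr_nonneg[OF bc] by simp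
 qed
 have sum: "(SUP n. ereal (\<Sum>k<n. joint.corr (lift f0) k)) = ereal (var \<pi>T f) + x.corr_sum (\<lambda>x. bar f x - c)"
 proof -
  have "(SUP n. ereal (\<Sum>k<n. joint.corr (lift f0) k)) = (SUP n. ereal (\<Sum>k<Suc n. joint.corr (lift f0) k))"
  proof (rule antisym)
   show "(SUP n. ereal (\<Sum>k<n. joint.corr (lift f0) k)) \<le> (SUP n. ereal (\<Sum>k<Suc n. joint.corr (lift f0) k))"
    by (rule SUP_mono, rule_tac x=n in bexI) (simp_all add: nn)
   show "(SUP n. ereal (\<Sum>k<Suc n. joint.corr (lift f0) k)) \<le> (SUP n. ereal (\<Sum>k<n. joint.corr (lift f0) k))"
    by (rule SUP_mono, rule_tac x="Suc n" in bexI) simp_all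
  qed
  also have "... = (SUP n. ereal (var \<pi>T f) + ereal (\<Sum>k<n. x.corr (\<lambda>x. bar f x - c) k))"
   unfolding sum.lessThan_Suc_shift c0 cS by simp
  also have "... = ereal (var \<pi>T f) + x.corr_sum (\<lambda>x. bar f x - c)"
   unfolding x.corr_sum_def by (rule SUP_ereal_add_right) auto
  finally show ?thesis .
 qed
 have "asvar \<pi> S ?F = 2 * (ereal (var \<pi>T f) + x.corr_sum (\<lambda>x. bar f x - c)) - ereal (var \<pi>T f)"
  using joint.asvar_eq[OF F] nn unfolding F0 c0 sum by simp
 moreover have "asvar \<pi>X Kx (bar f) = 2 * x.corr_sum (\<lambda>x. bar f x - c) - ereal (var \<pi>X (bar f))"
  using x.asvar_eq_corr_sum[OF bar_L2[OF f]] unfolding cbar .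
 moreover have "0 \<le> x.corr_sum (\<lambda>x. bar f x - c)"
  using x.corr_sum_ge[OF bc] x.corr_nonneg[OF bc, of 0] by (meson ereal_less_eq(5) order_trans)
 ultimately show ?thesis by (cases "x.corr_sum (\<lambda>x. bar f x - c)") auto
qed

lemma kernel_power_measurable_joint: "kernel_power \<Theta>X S k \<in> \<Theta>X \<leadsto> \<Theta>X"
 using joint.kernel_power_measurable[of k] kernel_power_cong_sets[OF sets_\<pi>, of S k]
 unfolding measurable_cong_sets[OF sets_\<pi> refl] prob_algebra_\<pi> by simp

lemma kernel_power_measurable_X: "kernel_power X Kx k \<in> X \<leadsto> X"
 using x.kernel_power_measurable[of k] kernel_power_cong_sets[OF sets_\<pi>X, of Kx k]
 unfolding measurable_cong_sets[OF sets_\<pi>X refl] prob_algebra_\<pi>X by simp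

text \<open>The x-component is itself a Markov chain with kernel \<open>Kx\<close>. The \<theta>
  drawn in step k + 1 is governed by x after k steps, hence the shift in the second claim.\<close>

lemma distr_kernel_power_snd:
 assumes \<nu>': "\<nu>' \<in> space (prob_algebra \<Theta>X)"
 shows "distr (\<nu>' \<bind> kernel_power \<Theta>X S k) X snd = distr \<nu>' X snd \<bind> kernel_power X Kx k"
  and "distr (\<nu>' \<bind> kernel_power \<Theta>X S (Suc k)) \<Theta> fst = (distr \<nu>' X snd \<bind> kernel_power X Kx k) \<bind> \<kappa>"
proof -
 let ?Y = "\<Theta> \<Otimes>\<^sub>M X"
 have s: "sets \<nu>' = sets ?Y" and p: "prob_space \<nu>'" using \<nu>' by (auto simp: space_prob_algebra)
 have ne: "space \<nu>' \<noteq> {}" using p by (rule prob_space.not_empty)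
 note KS = kernel_power_measurable_joint and KX = kernel_power_measurable_X
 define N where "N = (\<lambda>k. \<nu>' \<bind> kernel_power ?Y S k)"
 have sN: "sets (N k) = sets ?Y" for k unfolding N_def by (rule sets_kernel_bind[OF s KS ne])
 have pN: "prob_space (N k)" for k
  unfolding N_def by (rule prob_space_bind'[OF \<nu>' KS])
 have neN: "space (N k) \<noteq> {}" for k using pN by (rule prob_space.not_empty)
 have NS: "N (Suc k) = N k \<bind> S" for k
 proof -
  have "\<nu>' \<bind> kernel_power ?Y S (Suc k) = \<nu>' \<bind> (\<lambda>x. kernel_power ?Y S k x \<bind> S)" by (rule bind_cong) auto
  also have "... = (\<nu>' \<bind> kernel_power ?Y S k) \<bind> S"
   by (rule bind_assoc[symmetric])
     (use KS S_measurable s in \<open>auto intro!: measurable_prob_algebraD cong: measurable_cong_sets\<close>)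
  finally show ?thesis unfolding N_def .
 qed
 have Sm: "S \<in> N k \<rightarrow>\<^sub>M subprob_algebra ?Y" for k
  unfolding measurable_cong_sets[OF sN refl] by (rule measurable_prob_algebraD[OF S_measurable])
 have sndm: "snd \<in> N k \<rightarrow>\<^sub>M X" for k unfolding measurable_cong_sets[OF sN refl] by simp
 have ds: "distr (N (Suc k)) X snd = distr (N k) X snd \<bind> Kx" for k
 proof -
  have "distr (N (Suc k)) X snd = N k \<bind> (\<lambda>q. distr (S q) X snd)"
   unfolding NS by (rule distr_bind[OF Sm neN]) simp
  also have "... = N k \<bind> (\<lambda>q. Kx (snd q))"
   by (rule bind_cong) (auto simp: scan_kernel_def scan_kernel_x_def case_prod_beta')
  also have "... = distr (N k) X snd \<bind> Kx"
   by (rule bind_distr[OF sndm measurable_prob_algebraD[OF Kx_measurable] neN, symmetric])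
  finally show ?thesis .
 qed
 have s0: "sets (distr \<nu>' X snd) = sets X" by simp
 show A: "distr (\<nu>' \<bind> kernel_power ?Y S k) X snd = distr \<nu>' X snd \<bind> kernel_power X Kx k" for k
 proof (induction k)
  case 0
  have "\<nu>' \<bind> kernel_power ?Y S 0 = \<nu>' \<bind> return ?Y" by (rule bind_cong) auto
  then have "\<nu>' \<bind> kernel_power ?Y S 0 = \<nu>'" using bind_return''[OF s] by simp
  moreover have "distr \<nu>' X snd \<bind> kernel_power X Kx 0 = distr \<nu>' X snd \<bind> return X" by (rule bind_cong) auto
  then have "distr \<nu>' X snd \<bind> kernel_power X Kx 0 = distr \<nu>' X snd" using bind_return''[OF s0] by simp
  ultimately show ?case by (simp only:)
 next
  case (Suc k)
  have "distr \<nu>' X snd \<bind> kernel_power X Kx (Suc k) = distr \<nu>' X snd \<bind> (\<lambda>x. kernel_power X Kx k x \<bind> Kx)" by (rule bind_cong) auto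
  also have "... = (distr \<nu>' X snd \<bind> kernel_power X Kx k) \<bind> Kx"
   by (rule bind_assoc[symmetric])
     (use KX Kx_measurable in \<open>auto intro!: measurable_prob_algebraD cong: measurable_cong_sets\<close>)
  also have "... = distr (N k) X snd \<bind> Kx" using Suc by (simp add: N_def)
  finally show ?case using ds[of k] unfolding N_def by (simp only:)
 qed
 have "distr (N (Suc k)) \<Theta> fst = N k \<bind> (\<lambda>q. distr (S q) \<Theta> fst)"
  unfolding NS by (rule distr_bind[OF Sm neN]) simp
 also have "... = N k \<bind> (\<lambda>q. \<kappa> (snd q))"
  using sets_eq_imp_space_eq[OF sN[of k]]
  by (intro bind_cong) (auto simp: scan_kernel_def case_prod_beta' distr_step_fst space_pair_measure)
 also have "... = distr (N k) X snd \<bind> \<kappa>"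
  by (rule bind_distr[OF sndm measurable_prob_algebraD[OF \<kappa>] neN, symmetric])
 finally show "distr (\<nu>' \<bind> kernel_power ?Y S (Suc k)) \<Theta> fst = (distr \<nu>' X snd \<bind> kernel_power X Kx k) \<bind> \<kappa>"
  using A[of k] by (simp add: N_def)
qed

lemma integral_kernel_power_fst:
 assumes \<nu>': "\<nu>' \<in> space (prob_algebra \<Theta>X)" and f: "f \<in> bm \<Theta>"
  and i: "integrable (\<nu>' \<bind> kernel_power \<Theta>X S (Suc k)) (lift f)"
 shows "integrable (distr \<nu>' X snd \<bind> kernel_power X Kx k) (bar f)"
  and "(\<integral>(\<theta>, x). f \<theta> \<partial>(\<nu>' \<bind> kernel_power \<Theta>X S (Suc k))) = integral\<^sup>L (distr \<nu>' X snd \<bind> kernel_power X Kx k) (bar f)"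
proof -
 let ?Y = "\<Theta> \<Otimes>\<^sub>M X" and ?N = "\<nu>' \<bind> kernel_power \<Theta>X S (Suc k)" and ?M = "distr \<nu>' X snd \<bind> kernel_power X Kx k"
 have s: "sets \<nu>' = sets ?Y" and p: "prob_space \<nu>'" using \<nu>' by (auto simp: space_prob_algebra)
 have ne: "space \<nu>' \<noteq> {}" using p by (rule prob_space.not_empty)
 note KS = kernel_power_measurable_joint and KX = kernel_power_measurable_X
 have fstm: "fst \<in> ?N \<rightarrow>\<^sub>M \<Theta>" unfolding measurable_cong_sets[OF sets_kernel_bind[OF s KS ne] refl] by simp
 have "snd \<in> \<nu>' \<rightarrow>\<^sub>M X" unfolding measurable_cong_sets[OF s refl] by simp
 then have "prob_space (distr \<nu>' X snd)" by (rule prob_space.prob_space_distr[OF p])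
 then have \<nu>: "distr \<nu>' X snd \<in> space (prob_algebra X)" by (simp add: space_prob_algebra)
 have sM: "sets ?M = sets X" by (rule sets_bind'[OF \<nu> KX])
 have neM: "space ?M \<noteq> {}" using prob_space_bind'[OF \<nu> KX] by (rule prob_space.not_empty)
 note e = distr_kernel_power_snd(2)[OF \<nu>', of k]
 have "integrable (distr ?N \<Theta> fst) f" using integrable_distr_eq[OF fstm f] i by (simp add: case_prod_beta')
 note B = integral_kernel_bind[OF sM \<kappa> neM this[unfolded e]]
 show "integrable ?M (bar f)" using B(2) by (simp add: bar_def[abs_def])
 have "(\<integral>(\<theta>, x). f \<theta> \<partial>?N) = integral\<^sup>L (distr ?N \<Theta> fst) f" using integral_distr[OF fstm f] by (simp add: case_prod_beta')
 also have "... = integral\<^sup>L ?M (bar f)" unfolding e B(3) by (simp add: bar_def[abs_def])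
 finally show "(\<integral>(\<theta>, x). f \<theta> \<partial>?N) = integral\<^sup>L ?M (bar f)" .
qed

end

subsection \<open>Spectral gaps and comparison with the exact Gibbs sampler\<close>

lemma (in prob_space) var_nonneg: "f \<in> L2 M ==> 0 \<le> var M f"
 using variance_eq[OF L2_integrable L2_square_integrable, of f] variance_positive[of f] by (simp add: var_def)

lemma Gap_mono:
 assumes c: "0 \<le> c" and le: "\<And>f. f \<in> L2 \<mu> ==> c * dirichlet \<mu> L f \<le> dirichlet \<mu> K f"
 shows "ereal c * Gap \<mu> L \<le> Gap \<mu> K"
 unfolding Gap_def[of \<mu> K]
proof (rule INF_greatest)
 fix f assume f: "f \<in> {f \<in> L2 \<mu>. integral\<^sup>L \<mu> f = 0 \<and> \<not> (AE x in \<mu>. f x = 0)}"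
 have "0 \<le> inner_L2 \<mu> f f" unfolding inner_L2_def by (intro integral_nonneg_AE) simp
 have "Gap \<mu> L \<le> ereal (dirichlet \<mu> L f / inner_L2 \<mu> f f)" unfolding Gap_def using f by (rule INF_lower)
 then have "ereal c * Gap \<mu> L \<le> ereal c * ereal (dirichlet \<mu> L f / inner_L2 \<mu> f f)"
  using c by (intro ereal_mult_left_mono) auto
 also have "... \<le> ereal (dirichlet \<mu> K f / inner_L2 \<mu> f f)"
  using divide_right_mono[OF le[of f] \<open>0 \<le> inner_L2 \<mu> f f\<close>] f by simp
 finally show "ereal c * Gap \<mu> L \<le> ereal (dirichlet \<mu> K f / inner_L2 \<mu> f f)" .
qed

context rev_pos_kernel
begin

lemma Gap_nonneg: "0 \<le> Gap \<mu> K"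
 unfolding Gap_def
proof (rule INF_greatest)
 fix f assume f: "f \<in> {f \<in> L2 \<mu>. integral\<^sup>L \<mu> f = 0 \<and> \<not> (AE x in \<mu>. f x = 0)}"
 have "0 \<le> inner_L2 \<mu> f f" unfolding inner_L2_def by (intro integral_nonneg_AE) simp
 with dirichlet_nn_integral(2)[of f] f show "0 \<le> ereal (dirichlet \<mu> K f / inner_L2 \<mu> f f)" by simp
qed

lemma Gap_lower:
 assumes "\<And>f. f \<in> L2 \<mu> ==> \<epsilon> * var \<mu> f \<le> dirichlet \<mu> K f"
 shows "ereal \<epsilon> \<le> Gap \<mu> K"
 unfolding Gap_def
proof (rule INF_greatest)
 fix f assume f: "f \<in> {f \<in> L2 \<mu>. integral\<^sup>L \<mu> f = 0 \<and> \<not> (AE x in \<mu>. f x = 0)}"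
 then have L: "f \<in> L2 \<mu>" and m[measurable]: "f \<in> bm \<mu>" by (auto dest: L2_measurable)
 have v: "var \<mu> f = inner_L2 \<mu> f f" using f by (simp add: var_def inner_L2_def power2_eq_square)
 have "inner_L2 \<mu> f f \<noteq> 0"
 proof
  assume "inner_L2 \<mu> f f = 0"
  then have "AE x in \<mu>. (f x)\<^sup>2 = 0"
   using integral_nonneg_eq_0_iff_AE[OF L2_square_integrable[OF L]] by (simp add: inner_L2_def power2_eq_square)
  then have "AE x in \<mu>. f x = 0" by simp
  with f show False by simp
 qed
 moreover have "0 \<le> inner_L2 \<mu> f f" unfolding inner_L2_def by (intro integral_nonneg_AE) simp
 ultimately show "ereal \<epsilon> \<le> ereal (dirichlet \<mu> K f / inner_L2 \<mu> f f)"
  using assms[OF L] unfolding v by (simp add: field_simps)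
qed

text \<open>At variance 0 the gap may be \<infinity>, and the product is 0 in
  \<open>ennreal\<close>. Otherwise the centred f is a test function for the gap.\<close>

lemma var_times_Gap_le:
 assumes f: "f \<in> L2 \<mu>"
 shows "ennreal (var \<mu> f) * e2ennreal (Gap \<mu> K) \<le> ennreal (dirichlet \<mu> K f)"
proof (cases "var \<mu> f = 0")
 case False
 then have v: "0 < var \<mu> f" using var_nonneg[OF f] by simp
 let ?f0 = "\<lambda>x. f x - (integral\<^sup>L \<mu> f)"
 have f0: "?f0 \<in> L2 \<mu>" by (intro L2_diff f L2_const)
 have i: "inner_L2 \<mu> ?f0 ?f0 = var \<mu> f" by (rule inner_centered[OF f])
 have "\<not> (AE x in \<mu>. ?f0 x = 0)"
 proof
  assume "AE x in \<mu>. ?f0 x = 0"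
  then have "inner_L2 \<mu> ?f0 ?f0 = 0" unfolding inner_L2_def
   by (intro integral_eq_zero_AE) (auto elim!: eventually_mono)
  with i v show False by simp
 qed
 then have "Gap \<mu> K \<le> ereal (dirichlet \<mu> K ?f0 / inner_L2 \<mu> ?f0 ?f0)"
  unfolding Gap_def using f0 L2_integrable[OF f] by (intro INF_lower) (auto simp: prob_space)
 then have "Gap \<mu> K \<le> ereal (dirichlet \<mu> K f / var \<mu> f)" unfolding i dirichlet_shift[OF f] .
 then have "e2ennreal (Gap \<mu> K) \<le> ennreal (dirichlet \<mu> K f / var \<mu> f)"
  using e2ennreal_mono by fastforce
 then have "ennreal (var \<mu> f) * e2ennreal (Gap \<mu> K) \<le> ennreal (var \<mu> f) * ennreal (dirichlet \<mu> K f / var \<mu> f)"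
  by (intro mult_left_mono) auto
 also have "... = ennreal (dirichlet \<mu> K f)" using v by (simp flip: ennreal_mult')
 finally show ?thesis .
qed simp

end

lemma (in gibbs) gibbs_kernel_const: "gibbs_kernel \<Theta> X \<pi> \<pi>T \<pi>X tgt \<kappa> (\<lambda>\<theta> x. tgt \<theta>)"
proof (unfold gibbs_kernel_def gibbs_kernel_axioms_def, intro conjI allI impI)
 show "gibbs \<Theta> X \<pi> \<pi>T \<pi>X tgt \<kappa>" by (rule gibbs_axioms)
 show "(\<lambda>(\<theta>, x). tgt \<theta>) \<in> \<Theta>X \<leadsto> X"
  using comp_fst[OF tgt] by (simp add: case_prod_beta')
 fix \<theta> assume "\<theta> \<in> space \<Theta>"
 then show "rev_pos_kernel (tgt \<theta>) (\<lambda>x. tgt \<theta>)"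
  by (intro prob_space.rev_pos_kernel_const prob_kernelD[OF tgt])
qed

section \<open>Dirichlet forms as mixtures over \<theta>, and the ratio \<rho>\<close>

context gibbs_kernel
begin

abbreviation \<Gamma>x where "\<Gamma>x \<equiv> scan_kernel_x \<Theta> X \<kappa> (\<lambda>\<theta> x. tgt \<theta>)"

lemma rev_pos_\<Gamma>x: "rev_pos_kernel \<pi>X \<Gamma>x"
 by (rule gibbs_kernel.rev_pos_Kx[OF gibbs_kernel_const])

text \<open>To take the factor 2 out of the integral, the integrand is replaced by m, a measurable
  function of \<theta> that equals twice the Dirichlet form for almost every \<theta>.\<close>

lemma dirichlet_Kx:
 assumes f: "f \<in> L2 \<pi>X"
 shows "ennreal (dirichlet \<pi>X Kx f) = (\<integral>\<^sup>+\<theta>. ennreal (dirichlet (tgt \<theta>) (K \<theta>) f) \<partial>\<pi>T)"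
proof -
 define m where "m = (\<lambda>\<theta>. \<integral>\<^sup>+x. \<integral>\<^sup>+y. ennreal ((f x - f y)\<^sup>2) \<partial>K \<theta> x \<partial>tgt \<theta>)"
 have fm: "f \<in> bm X" by (rule L2_\<pi>X_measurable[OF f])
 have mm: "m \<in> bm \<pi>T"
 proof -
  have "(\<lambda>q. \<integral>\<^sup>+y. ennreal ((f (snd q) - f y)\<^sup>2) \<partial>K (fst q) (snd q)) \<in> bm \<Theta>X"
  proof (rule nn_integral_kernel_measurable2)
   show "(\<lambda>q. K (fst q) (snd q)) \<in> \<Theta>X \<leadsto> X" using K_measurable by (simp add: case_prod_beta')
   show "(\<lambda>(q, y). ennreal ((f (snd q) - f y)\<^sup>2)) \<in> bm (\<Theta>X \<Otimes>\<^sub>M X)"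
    unfolding case_prod_beta'
    by (intro comp_ennreal borel_measurable_power borel_measurable_diff
      comp_fst[OF comp_snd[OF fm]] comp_snd[OF fm])
  qed
  then have "(\<lambda>\<theta>. \<integral>\<^sup>+x. \<integral>\<^sup>+y. ennreal ((f x - f y)\<^sup>2) \<partial>K \<theta> x \<partial>tgt \<theta>) \<in> bm \<Theta>"
   by (intro nn_integral_kernel_measurable2[OF tgt]) (simp add: case_prod_beta')
  then show ?thesis unfolding m_def using sets_\<pi>T by (simp cong: measurable_cong_sets)
 qed
 have half: "ennreal (1/2) * ennreal (2 * d) = ennreal d" for d :: real
  using ennreal_mult'[of "1/2" "2 * d"] by simp
 note AE_space_\<pi>T
 with L2_tgt[OF f] have m_eq: "AE \<theta> in \<pi>T. ennreal (2 * dirichlet (tgt \<theta>) (K \<theta>) f) = m \<theta>"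
  by eventually_elim (auto simp: m_def rev_pos_kernel.dirichlet_nn_integral(1)[OF K_rev_pos])
 have "(\<integral>\<^sup>+\<theta>. ennreal (dirichlet (tgt \<theta>) (K \<theta>) f) \<partial>\<pi>T) = (\<integral>\<^sup>+\<theta>. ennreal (1/2) * m \<theta> \<partial>\<pi>T)"
 proof (rule nn_integral_cong_AE)
  show "AE \<theta> in \<pi>T. ennreal (dirichlet (tgt \<theta>) (K \<theta>) f) = ennreal (1/2) * m \<theta>"
   using m_eq by eventually_elim (use half in metis)
 qed
 also have "... = ennreal (1/2) * nn_integral \<pi>T m" by (rule nn_integral_cmult[OF mm])
 also have "nn_integral \<pi>T m = ennreal (2 * dirichlet \<pi>X Kx f)"
  unfolding dirichlet_mixture[OF f] using m_eq by (intro nn_integral_cong_AE) (auto elim!: eventually_mono)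
 finally show ?thesis using half by simp
qed

lemma dirichlet_\<Gamma>x:
 assumes f: "f \<in> L2 \<pi>X"
 shows "ennreal (dirichlet \<pi>X \<Gamma>x f) = (\<integral>\<^sup>+\<theta>. ennreal (var (tgt \<theta>) f) \<partial>\<pi>T)"
proof -
 note AE_space_\<pi>T
 with L2_tgt[OF f] have "AE \<theta> in \<pi>T. ennreal (dirichlet (tgt \<theta>) (\<lambda>x. tgt \<theta>) f) = ennreal (var (tgt \<theta>) f)"
  by eventually_elim (simp add: prob_space.dirichlet_const prob_kernelD(1)[OF tgt])
 then show ?thesis unfolding gibbs_kernel.dirichlet_Kx[OF gibbs_kernel_const f] by (rule nn_integral_cong_AE)
qed

lemma dirichlet_Kx_le_\<Gamma>x:
 assumes f: "f \<in> L2 \<pi>X"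
 shows "dirichlet \<pi>X Kx f \<le> dirichlet \<pi>X \<Gamma>x f"
proof -
 note AE_space_\<pi>T
 with L2_tgt[OF f] have "AE \<theta> in \<pi>T. ennreal (dirichlet (tgt \<theta>) (K \<theta>) f) \<le> ennreal (var (tgt \<theta>) f)"
  by eventually_elim (intro ennreal_leI rev_pos_kernel.dirichlet_le_var[OF K_rev_pos])
 then have "ennreal (dirichlet \<pi>X Kx f) \<le> ennreal (dirichlet \<pi>X \<Gamma>x f)"
  unfolding dirichlet_Kx[OF f] dirichlet_\<Gamma>x[OF f] by (rule nn_integral_mono_AE)
 then show ?thesis using rev_pos_kernel.dirichlet_nn_integral(2)[OF rev_pos_\<Gamma>x f] by simp
qed

abbreviation ratio where "ratio \<equiv> gap_ratio \<pi>T \<pi>X tgt K"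

definition mean_var where "mean_var f = (\<integral>\<^sup>+ \<theta>. ennreal (var (tgt \<theta>) f) \<partial>\<pi>T)"
definition mean_var_gap where
 "mean_var_gap f = (\<integral>\<^sup>+ \<theta>. ennreal (var (tgt \<theta>) f) * e2ennreal (Gap (tgt \<theta>) (K \<theta>)) \<partial>\<pi>T)"

lemma ratio_eq:
 "ratio = (let F = {f \<in> L2 \<pi>X. mean_var f \<noteq> 0} in if F = {} then 1 else enn2real (INF f\<in>F. mean_var_gap f / mean_var f))"
 unfolding gap_ratio_def mean_var_def mean_var_gap_def ..

text \<open>The gap may depend non-measurably on \<theta>; its lower integral is compared with other
  integrals through monotonicity alone.\<close>

lemma mean_var_gap_le: "f \<in> L2 \<pi>X ==> mean_var_gap f \<le> ennreal (dirichlet \<pi>X Kx f)"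
proof -
 assume f: "f \<in> L2 \<pi>X"
 note AE_space_\<pi>T
 with L2_tgt[OF f] show ?thesis unfolding mean_var_gap_def dirichlet_Kx[OF f]
  by (intro nn_integral_mono_AE, eventually_elim) (rule rev_pos_kernel.var_times_Gap_le[OF K_rev_pos])
qed

lemma mean_var_eq: "f \<in> L2 \<pi>X ==> mean_var f = ennreal (dirichlet \<pi>X \<Gamma>x f)"
 by (simp add: mean_var_def dirichlet_\<Gamma>x)

text \<open>The numerator is at most the form of particle Gibbs, hence at most that of the Gibbs
  sampler, which is the denominator. The infimum is thus finite and survives
  \<open>enn2real\<close>.\<close>

lemma Inf_ratio_le_1:
 assumes f: "f \<in> L2 \<pi>X" "mean_var f \<noteq> 0"
 shows "(INF f\<in>{f \<in> L2 \<pi>X. mean_var f \<noteq> 0}. mean_var_gap f / mean_var f) \<le> 1"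
proof -
 have "mean_var_gap f \<le> mean_var f"
  using mean_var_gap_le[OF f(1)] mean_var_eq[OF f(1)] dirichlet_Kx_le_\<Gamma>x[OF f(1)]
  by (auto intro: order_trans ennreal_leI)
 then have "mean_var_gap f / mean_var f \<le> mean_var f / mean_var f" by (rule divide_right_mono_ennreal)
 also have "... = 1" using f mean_var_eq[OF f(1)] by (intro ennreal_divide_self) auto
 finally show ?thesis using f by (intro INF_lower2[of f]) auto
qed

lemma ratio_bounds: "0 \<le> ratio" "ratio \<le> 1"
proof -
 show "0 \<le> ratio" unfolding ratio_eq by (simp add: Let_def)
 show "ratio \<le> 1"
 proof (cases "{f \<in> L2 \<pi>X. mean_var f \<noteq> 0} = {}")
  case True
  have "ratio = 1" unfolding ratio_eq Let_def by (rule if_P[OF True])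
  then show ?thesis by simp
 next
  case False
  then obtain f where f: "f \<in> L2 \<pi>X" "mean_var f \<noteq> 0" by auto
  have "ratio = enn2real (INF f\<in>{f \<in> L2 \<pi>X. mean_var f \<noteq> 0}. mean_var_gap f / mean_var f)"
   unfolding ratio_eq Let_def by (rule if_not_P[OF False])
  then show ?thesis using enn2real_mono[OF Inf_ratio_le_1[OF f]] by simp
 qed
qed

lemma ratio_dirichlet_le:
 assumes f: "f \<in> L2 \<pi>X"
 shows "ratio * dirichlet \<pi>X \<Gamma>x f \<le> dirichlet \<pi>X Kx f"
proof (cases "mean_var f = 0")
 \<comment> \<open>Such f are excluded from the infimum; for them the form of the exact sampler
   vanishes.\<close>
 case True
 then have "dirichlet \<pi>X \<Gamma>x f = 0"
  using mean_var_eq[OF f] rev_pos_kernel.dirichlet_nn_integral(2)[OF rev_pos_\<Gamma>x f] by simp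
 then show ?thesis using x.dirichlet_nn_integral(2)[OF f] by simp
next
 case False
 then have F: "{f \<in> L2 \<pi>X. mean_var f \<noteq> 0} \<noteq> {}" using f by auto
 let ?I = "INF f\<in>{f \<in> L2 \<pi>X. mean_var f \<noteq> 0}. mean_var_gap f / mean_var f"
 have top: "mean_var f \<noteq> \<top>" using mean_var_eq[OF f] by simp
 have "?I < \<top>" using Inf_ratio_le_1[OF f False] by (rule le_less_trans) simp
 moreover have "ratio = enn2real ?I" unfolding ratio_eq Let_def by (rule if_not_P[OF F])
 ultimately have "ennreal ratio = ?I" by (simp only: ennreal_enn2real)
 also have "... \<le> mean_var_gap f / mean_var f" using f False by (intro INF_lower) auto
 finally have "ennreal ratio * mean_var f \<le> mean_var_gap f / mean_var f * mean_var f" by (rule mult_right_mono) simp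
 also have "... = mean_var_gap f * (mean_var f / mean_var f)" by (simp add: ennreal_times_divide mult.commute)
 also have "mean_var f / mean_var f = 1" using False top by (intro ennreal_divide_self) (auto simp: less_top)
 also have "mean_var_gap f * 1 = mean_var_gap f" by simp
 also have "... \<le> ennreal (dirichlet \<pi>X Kx f)" by (rule mean_var_gap_le[OF f])
 finally have "ennreal (ratio * dirichlet \<pi>X \<Gamma>x f) \<le> ennreal (dirichlet \<pi>X Kx f)"
  using mean_var_eq[OF f] ratio_bounds(1) by (simp add: ennreal_mult')
 then show ?thesis using x.dirichlet_nn_integral(2)[OF f] by simp
qed

text \<open>The bound \<epsilon> \<le> 1 serves the case of an empty set of test functions, where
  the ratio is 1 by convention.\<close>

lemma ratio_lower:
 assumes e: "0 \<le> \<epsilon>" "\<epsilon> \<le> 1"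
  and le: "AE \<theta> in \<pi>T. \<forall>f\<in>L2 (tgt \<theta>). \<epsilon> * var (tgt \<theta>) f \<le> dirichlet (tgt \<theta>) (K \<theta>) f"
 shows "\<epsilon> \<le> ratio"
proof (cases "{f \<in> L2 \<pi>X. mean_var f \<noteq> 0} = {}")
 case True
 have "ratio = 1" unfolding ratio_eq Let_def by (rule if_P[OF True])
 then show ?thesis using e by simp
next
 case False
 let ?I = "INF f\<in>{f \<in> L2 \<pi>X. mean_var f \<noteq> 0}. mean_var_gap f / mean_var f"
 from False obtain f0 where f0: "f0 \<in> L2 \<pi>X" "mean_var f0 \<noteq> 0" by auto
 have "ennreal \<epsilon> \<le> ?I"
 proof (rule INF_greatest)
  fix f assume "f \<in> {f \<in> L2 \<pi>X. mean_var f \<noteq> 0}"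
  then have f: "f \<in> L2 \<pi>X" "mean_var f \<noteq> 0" by auto
  have fm: "f \<in> bm X" by (rule L2_\<pi>X_measurable[OF f(1)])
  have "(\<lambda>\<theta>. var (tgt \<theta>) f) \<in> bm \<Theta>"
   unfolding var_def using fm
   by (intro borel_measurable_diff borel_measurable_power integral_kernel_measurable[OF tgt]) auto
  then have vm: "(\<lambda>\<theta>. ennreal (var (tgt \<theta>) f)) \<in> bm \<pi>T"
   using sets_\<pi>T by (simp cong: measurable_cong_sets)
  have "ennreal \<epsilon> * mean_var f = (\<integral>\<^sup>+\<theta>. ennreal \<epsilon> * ennreal (var (tgt \<theta>) f) \<partial>\<pi>T)"
   unfolding mean_var_def by (rule nn_integral_cmult[OF vm, symmetric])
  also have "... \<le> mean_var_gap f"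
   unfolding mean_var_gap_def
  proof (rule nn_integral_mono_AE)
   note AE_space_\<pi>T
   with le show "AE \<theta> in \<pi>T. ennreal \<epsilon> * ennreal (var (tgt \<theta>) f) \<le> ennreal (var (tgt \<theta>) f) * e2ennreal (Gap (tgt \<theta>) (K \<theta>))"
   proof eventually_elim
    case (elim \<theta>)
    have "ereal \<epsilon> \<le> Gap (tgt \<theta>) (K \<theta>)"
     by (rule rev_pos_kernel.Gap_lower[OF K_rev_pos[OF elim(2)]]) (use elim(1) in auto)
    then have "ennreal \<epsilon> \<le> e2ennreal (Gap (tgt \<theta>) (K \<theta>))" using e2ennreal_mono by fastforce
    then show ?case by (subst mult.commute) (rule mult_left_mono, auto)
   qed
  qed
  finally have "ennreal \<epsilon> * mean_var f / mean_var f \<le> mean_var_gap f / mean_var f" by (rule divide_right_mono_ennreal)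
  moreover have "ennreal \<epsilon> * mean_var f / mean_var f = ennreal \<epsilon> * (mean_var f / mean_var f)"
   by (simp add: ennreal_times_divide)
  moreover have "mean_var f / mean_var f = 1" using f mean_var_eq[OF f(1)] by (intro ennreal_divide_self) auto
  ultimately show "ennreal \<epsilon> \<le> mean_var_gap f / mean_var f" by simp
 qed
 moreover have "?I < \<top>" using Inf_ratio_le_1[OF f0] by (rule le_less_trans) simp
 ultimately have "enn2real (ennreal \<epsilon>) \<le> enn2real ?I" by (intro enn2real_mono)
 moreover have "ratio = enn2real ?I" unfolding ratio_eq Let_def by (rule if_not_P[OF False])
 ultimately show ?thesis using e by simp
qed

lemma Gap_bounds: "Gap \<pi>X Kx \<le> Gap \<pi>X \<Gamma>x" "ereal ratio * Gap \<pi>X \<Gamma>x \<le> Gap \<pi>X Kx"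
proof -
 show "Gap \<pi>X Kx \<le> Gap \<pi>X \<Gamma>x" using Gap_mono[of 1 \<pi>X Kx \<Gamma>x] dirichlet_Kx_le_\<Gamma>x by (simp add: one_ereal_def[symmetric])
 show "ereal ratio * Gap \<pi>X \<Gamma>x \<le> Gap \<pi>X Kx" by (rule Gap_mono[OF ratio_bounds(1) ratio_dirichlet_le])
qed

text \<open>Each asymptotic variance is 2 s - v, with v the variance and s the sum of correlations,
  and s is at least its term v at lag 0. The two sums are compared by \<open>corr_sum_mono\<close>
  with the constants 1 and \<rho>; for the last bound, 2 s / \<rho> - v = (1 / \<rho> - 1) v + (2 s
  - v) / \<rho>.\<close>

lemma asvar_bounds:
 assumes f: "f \<in> L2 \<pi>X"
 shows "ereal (var \<pi>X f) \<le> asvar \<pi>X \<Gamma>x f" "asvar \<pi>X \<Gamma>x f \<le> asvar \<pi>X Kx f"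
  and "0 < ratio ==> asvar \<pi>X Kx f \<le> ereal ((1 / ratio - 1) * var \<pi>X f) + ereal (1 / ratio) * asvar \<pi>X \<Gamma>x f"
proof -
 interpret g: rev_pos_kernel \<pi>X \<Gamma>x by (rule rev_pos_\<Gamma>x)
 let ?f0 = "\<lambda>x. f x - (integral\<^sup>L \<pi>X f)"
 have f0: "?f0 \<in> L2 \<pi>X" by (intro L2_diff f x.L2_const)
 have v: "0 \<le> var \<pi>X f" by (rule x.var_nonneg[OF f])
 have vg: "ereal (var \<pi>X f) \<le> g.corr_sum ?f0" using g.corr_sum_ge[OF f0] g.var_eq_corr[OF f] by simp
 have gk: "g.corr_sum ?f0 \<le> x.corr_sum ?f0"
  using corr_sum_mono[OF rev_pos_\<Gamma>x rev_pos_Kx f0, of 1] dirichlet_Kx_le_\<Gamma>x by (simp add: one_ereal_def[symmetric])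
 show "ereal (var \<pi>X f) \<le> asvar \<pi>X \<Gamma>x f"
  unfolding g.asvar_eq_corr_sum[OF f] using vg by (cases "g.corr_sum ?f0") auto
 show "asvar \<pi>X \<Gamma>x f \<le> asvar \<pi>X Kx f"
  unfolding g.asvar_eq_corr_sum[OF f] x.asvar_eq_corr_sum[OF f] using gk vg v
  by (cases "g.corr_sum ?f0"; cases "x.corr_sum ?f0") auto
 assume r: "0 < ratio"
 have kg: "x.corr_sum ?f0 \<le> ereal (1 / ratio) * g.corr_sum ?f0"
  by (rule corr_sum_mono[OF rev_pos_Kx rev_pos_\<Gamma>x f0 r ratio_dirichlet_le])
 show "asvar \<pi>X Kx f \<le> ereal ((1 / ratio - 1) * var \<pi>X f) + ereal (1 / ratio) * asvar \<pi>X \<Gamma>x f"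
 proof (cases "g.corr_sum ?f0")
  case (real s)
  then obtain t where t: "x.corr_sum ?f0 = ereal t" using kg gk by (cases "x.corr_sum ?f0") auto
  have "t \<le> s / ratio" using kg real t by simp
  then have "2 * t - var \<pi>X f \<le> (1 / ratio - 1) * var \<pi>X f + 1 / ratio * (2 * s - var \<pi>X f)"
   using r by (simp add: field_simps)
  then show ?thesis unfolding g.asvar_eq_corr_sum[OF f] x.asvar_eq_corr_sum[OF f]
   using real t by simp
 next
  case PInf
  then show ?thesis unfolding g.asvar_eq_corr_sum[OF f] using r by simp
 next
  case MInf
  then show ?thesis using vg by simp
 qed
qed

end

subsection \<open>Finite products of kernels and index selection\<close>

text \<open>Boxes generate the product, and the mass of a box is a finite product of measurable
  functions of the parameter.\<close>

lemma PiM_kernel_measurable: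
 assumes I: "finite I" and k: "\<And>i. i \<in> I ==> k i \<in> \<Omega> \<leadsto> (L i)"
 shows "(\<lambda>\<omega>. PiM I (\<lambda>i. k i \<omega>)) \<in> \<Omega> \<leadsto> (PiM I L)"
proof (rule measurable_prob_algebra_generated[OF sets_PiM Int_stable_prod_algebra prod_algebra_sets_into_space])
 fix \<omega> assume w: "\<omega> \<in> space \<Omega>"
 show "prob_space (PiM I (\<lambda>i. k i \<omega>))" by (intro prob_space_PiM prob_kernelD(1)[OF k w])
 show "sets (PiM I (\<lambda>i. k i \<omega>)) = sets (PiM I L)" by (intro sets_PiM_cong refl prob_kernelD(2)[OF k w])
next
 fix A assume "A \<in> prod_algebra I L"
 then obtain B where A: "A = (\<Pi>\<^sub>E i\<in>I. B i)" and B: "\<And>i. i \<in> I ==> B i \<in> sets (L i)"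
  unfolding prod_algebra_eq_finite[OF I] by auto
 have "emeasure (PiM I (\<lambda>i. k i \<omega>)) A = (\<Prod>i\<in>I. emeasure (k i \<omega>) (B i))" if w: "\<omega> \<in> space \<Omega>" for \<omega>
 proof -
  have Bk: "B i \<in> sets (k i \<omega>)" if "i \<in> I" for i using B prob_kernelD(2)[OF k w] that by auto
  have "A = prod_emb I (\<lambda>i. k i \<omega>) I (\<Pi>\<^sub>E i\<in>I. B i)"
   unfolding A by (rule prod_emb_PiE_same_index[symmetric]) (use Bk in \<open>auto dest: sets.sets_into_space\<close>)
  then show ?thesis
   using emeasure_PiM_emb[of I "\<lambda>i. k i \<omega>" I B] prob_kernelD(1)[OF k w] I Bk by auto
 qed
 then have "(\<lambda>\<omega>. emeasure (PiM I (\<lambda>i. k i \<omega>)) A) \<in> bm \<Omega> \<longleftrightarrow> (\<lambda>\<omega>. \<Prod>i\<in>I. emeasure (k i \<omega>) (B i)) \<in> bm \<Omega>"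
  by (rule measurable_cong)
 moreover have "(\<lambda>\<omega>. \<Prod>i\<in>I. emeasure (k i \<omega>) (B i)) \<in> bm \<Omega>"
  by (intro borel_measurable_prod_ennreal measurable_compose[OF measurable_prob_algebraD[OF k]] measurable_emeasure_subprob_algebra B)
 ultimately show "(\<lambda>\<omega>. emeasure (PiM I (\<lambda>i. k i \<omega>)) A) \<in> bm \<Omega>" by simp
qed

lemma nn_integral_PiM_insert:
 assumes I: "finite I" "i \<notin> I" and M: "\<And>j. j \<in> insert i I ==> prob_space (M j)"
  and f: "f \<in> bm (PiM (insert i I) M)"
 shows "nn_integral (PiM (insert i I) M) f = (\<integral>\<^sup>+y. \<integral>\<^sup>+x. f (x(i := y)) \<partial>PiM I M \<partial>M i)"
proof -
 \<comment> \<open>Indices outside the set are filled in with a copy of \<open>M i\<close>, because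
   \<open>product_prob_space\<close> asks for a probability at every index.\<close>
 define N where "N = (\<lambda>j. if j \<in> insert i I then M j else M i)"
 have p: "prob_space (N j)" for j using M by (auto simp: N_def)
 interpret N: product_prob_space N by (rule product_prob_spaceI) (rule p)
 have e: "PiM (insert i I) M = PiM (insert i I) N" "PiM I M = PiM I N" "M i = N i"
  using I by (auto simp: N_def intro!: PiM_cong)
 show ?thesis unfolding e using f I by (intro N.product_nn_integral_insert_rev) (auto simp: e)
qed

lemma nn_integral_PiM_component:
 assumes I: "finite I" "i \<in> I" and M: "\<And>j. j \<in> I ==> prob_space (M j)" and f: "f \<in> bm (M i)"
 shows "(\<integral>\<^sup>+x. f (x i) \<partial>PiM I M) = nn_integral (M i) f"
proof -
 have "(\<lambda>x. x i) \<in> PiM I M \<rightarrow>\<^sub>M M i" using I by (rule_tac measurable_component_singleton)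
 then show ?thesis using distr_PiM_component[of I M i, OF M I(2)] nn_integral_distr[of "\<lambda>x. x i" "PiM I M" "M i" f] f by simp
qed

lemma sets_select_index [measurable_cong]: "sets (select_index N w) = sets (count_space {1..N})"
 and space_select_index: "space (select_index N w) = {1..N}"
 by (simp_all add: select_index_def sets_point_measure space_point_measure)

lemma nn_integral_select_index:
 assumes w: "\<And>k. k \<in> {1..N} ==> 0 \<le> w k" and N: "1 \<le> N"
 shows "nn_integral (select_index N w) h =
  (if (\<Sum>k=1..N. ennreal (w k)) = 0 then h 1 else (\<Sum>k=1..N. ennreal (w k) * h k) * inverse (\<Sum>k=1..N. ennreal (w k)))"
proof -
 have S: "(\<Sum>k=1..N. ennreal (w k)) = ennreal (\<Sum>k=1..N. w k)" using w by (intro sum_ennreal) auto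
 have S0: "0 \<le> (\<Sum>k=1..N. w k)" using w by (intro sum_nonneg) auto
 show ?thesis
 proof (cases "(\<Sum>k=1..N. w k) = 0")
  case True
  have "nn_integral (select_index N w) h = (\<Sum>k\<in>{1..N}. (if k = 1 then 1 else 0) * h k)"
   unfolding select_index_def using True by (simp add: nn_integral_point_measure_finite)
  also have "... = (\<Sum>k\<in>{1..N}. if k = 1 then h 1 else 0)" by (intro sum.cong) auto
  also have "... = h 1" using N by simp
  finally show ?thesis using S True by simp
 next
  case False
  then have pos: "0 < (\<Sum>k=1..N. w k)" using S0 by simp
  have "nn_integral (select_index N w) h = (\<Sum>k\<in>{1..N}. ennreal (w k / (\<Sum>j=1..N. w j)) * h k)"
   unfolding select_index_def using False by (simp add: nn_integral_point_measure_finite)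
  also have "... = (\<Sum>k\<in>{1..N}. ennreal (w k) * h k * inverse (\<Sum>k=1..N. ennreal (w k)))"
   unfolding S using w pos
   by (intro sum.cong refl) (simp add: divide_ennreal[symmetric] ennreal_divide_times divide_ennreal_def ac_simps)
  finally show ?thesis using S False pos by (simp add: sum_distrib_right)
 qed
qed

lemma prob_space_select_index:
 assumes w: "\<And>k. k \<in> {1..N} ==> 0 \<le> w k" and N: "1 \<le> N"
 shows "prob_space (select_index N w)"
proof
 have "emeasure (select_index N w) (space (select_index N w)) = (\<integral>\<^sup>+k. 1 \<partial>select_index N w)" by simp
 also have "... = 1"
 proof -
  let ?S = "\<Sum>k=1..N. ennreal (w k)"
  have "?S < \<top>" by (simp add: less_top[symmetric])
  then have "?S * inverse ?S = 1" if "?S \<noteq> 0"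
   using ennreal_divide_self[of ?S] that unfolding divide_ennreal_def by blast
  moreover have "(\<integral>\<^sup>+k. 1 \<partial>select_index N w) = (if ?S = 0 then 1 else (\<Sum>k=1..N. ennreal (w k) * 1) * inverse ?S)"
   by (rule nn_integral_select_index[OF w N])
  ultimately show ?thesis by (simp only: mult_1_right split: if_split) simp
 qed
 finally show "emeasure (select_index N w) (space (select_index N w)) = 1" .
qed

lemma select_index_measurable:
 assumes w: "\<And>k. k \<in> {1..N} ==> (\<lambda>\<omega>. w \<omega> k) \<in> bm \<Omega>"
  and nn: "\<And>k \<omega>. \<omega> \<in> space \<Omega> ==> k \<in> {1..N} ==> 0 \<le> w \<omega> k" and N: "1 \<le> N"
 shows "(\<lambda>\<omega>. select_index N (w \<omega>)) \<in> \<Omega> \<leadsto> (count_space {1..N})"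
proof (rule measurable_prob_algebra_generated[where \<Omega>="{1..N}" and G="Pow {1..N}"])
 show "sets (count_space {1..N}) = sigma_sets {1..N} (Pow {1..N})" using sets.sigma_sets_eq[of "count_space {1..N}"] by simp
 show "Int_stable (Pow {1..N})" by (auto simp: Int_stable_def)
 fix \<omega> assume "\<omega> \<in> space \<Omega>"
 then show "prob_space (select_index N (w \<omega>))" using nn N by (intro prob_space_select_index)
 show "sets (select_index N (w \<omega>)) = sets (count_space {1..N})" by (rule sets_select_index)
next
 fix A assume A: "A \<in> Pow {1..N}"
 have "emeasure (select_index N (w \<omega>)) A = (\<Sum>a\<in>A. if (\<Sum>j=1..N. w \<omega> j) = 0 then (if a = 1 then 1 else 0) else ennreal (w \<omega> a / (\<Sum>j=1..N. w \<omega> j)))" for \<omega>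
  unfolding select_index_def using A by (intro emeasure_point_measure_finite) auto
 moreover have "(\<lambda>\<omega>. \<Sum>a\<in>A. if (\<Sum>j=1..N. w \<omega> j) = 0 then (if a = 1 then 1 else 0) else ennreal (w \<omega> a / (\<Sum>j=1..N. w \<omega> j))) \<in> bm \<Omega>"
 proof (rule borel_measurable_sum)
  fix a assume "a \<in> A"
  have S[measurable]: "(\<lambda>\<omega>. \<Sum>j=1..N. w \<omega> j) \<in> bm \<Omega>" by (intro borel_measurable_sum w)
  have [measurable]: "(\<lambda>\<omega>. w \<omega> a) \<in> bm \<Omega>" using A \<open>a \<in> A\<close> by (intro w) auto
  show "(\<lambda>\<omega>. if (\<Sum>j=1..N. w \<omega> j) = 0 then (if a = 1 then 1 else 0) else ennreal (w \<omega> a / (\<Sum>j=1..N. w \<omega> j))) \<in> bm \<Omega>"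
   by measurable
 qed
 ultimately show "(\<lambda>\<omega>. emeasure (select_index N (w \<omega>)) A) \<in> bm \<Omega>" by (simp only:)
qed auto

lemma measurable_pair_count_space:
 assumes "finite A" "\<And>k. k \<in> A ==> (\<lambda>\<omega>. f \<omega> k) \<in> \<Omega> \<rightarrow>\<^sub>M L"
 shows "(\<lambda>(\<omega>, k). f \<omega> k) \<in> \<Omega> \<Otimes>\<^sub>M count_space A \<rightarrow>\<^sub>M L"
proof -
 have "(\<lambda>(k, \<omega>). f \<omega> k) \<in> count_space A \<Otimes>\<^sub>M \<Omega> \<rightarrow>\<^sub>M L"
  using assms by (intro measurable_pair_measure_countable1) (auto intro: countable_finite)
 from measurable_compose[OF measurable_pair_swap' this] show ?thesis by (simp add: case_prod_beta')
qed

subsection \<open>Measurability of the conditional particle filter\<close>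

lemma Pair_particle_measurable: "k \<in> {1..N} ==> Pair k \<in> Z \<rightarrow>\<^sub>M particle_space N Z"
 unfolding particle_space_def by (rule measurable_Pair1') simp

text \<open>The hypotheses on \<open>prev\<close>, M and G are restricted to t \<ge> 2: at time 1
  there is no previous generation, and the history at time 0 is an undefined value.\<close>

lemma particle_law_measurable:
 assumes N: "1 \<le> N" and t: "1 \<le> t"
  and x: "(\<lambda>\<omega>. x \<omega> t) \<in> \<Omega> \<rightarrow>\<^sub>M Z"
  and M1: "M1 \<in> \<Omega> \<leadsto> Z"
  and prev: "\<And>k. 2 \<le> t ==> k \<in> {1..N} ==> (\<lambda>\<omega>. snd (prev \<omega> k)) \<in> \<Omega> \<rightarrow>\<^sub>M Z"
  and M: "2 \<le> t ==> (\<lambda>(\<omega>, z). M \<omega> t z) \<in> \<Omega> \<Otimes>\<^sub>M Z \<leadsto> Z"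
  and G: "2 \<le> t ==> (\<lambda>(\<omega>, z). G \<omega> (t - 1) z) \<in> bm (\<Omega> \<Otimes>\<^sub>M Z)"
  and Gnn: "\<And>\<omega> z. 2 \<le> t ==> \<omega> \<in> space \<Omega> ==> z \<in> space Z ==> 0 \<le> G \<omega> (t - 1) z"
 shows "(\<lambda>\<omega>. particle_law Z N (M1 \<omega>) (M \<omega>) (G \<omega>) (x \<omega>) t (prev \<omega>) i) \<in> \<Omega> \<leadsto> (particle_space N Z)"
proof -
 have 1: "(\<lambda>\<omega>. return (particle_space N Z) (1, x \<omega> t)) \<in> \<Omega> \<leadsto> (particle_space N Z)"
  using measurable_compose[OF measurable_compose[OF x Pair_particle_measurable[of 1 N]] measurable_return_prob_space] N by simp
 have 2: "(\<lambda>\<omega>. distr (M1 \<omega>) (particle_space N Z) (\<lambda>z. (1, z))) \<in> \<Omega> \<leadsto> (particle_space N Z)"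
  using measurable_compose[OF M1 measurable_distr_prob_space[OF Pair_particle_measurable[of 1 N]]] N by simp
 have 3: "(\<lambda>\<omega>. select_index N (\<lambda>k. G \<omega> (t - 1) (snd (prev \<omega> k))) \<bind>
       (\<lambda>k. distr (M \<omega> t (snd (prev \<omega> k))) (particle_space N Z) (\<lambda>z. (k, z)))) \<in> \<Omega> \<leadsto> (particle_space N Z)" if t2: "2 \<le> t"
 proof (rule measurable_bind_prob_space2)
  have c: "(\<lambda>\<omega>. (\<omega>, snd (prev \<omega> k))) \<in> \<Omega> \<rightarrow>\<^sub>M \<Omega> \<Otimes>\<^sub>M Z" if "k \<in> {1..N}" for k
   using prev[OF t2 that] by simp
  show "(\<lambda>\<omega>. select_index N (\<lambda>k. G \<omega> (t - 1) (snd (prev \<omega> k)))) \<in> \<Omega> \<leadsto> (count_space {1..N})"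
  proof (rule select_index_measurable[OF _ _ N])
   fix k assume k: "k \<in> {1..N}"
   show "(\<lambda>\<omega>. G \<omega> (t - 1) (snd (prev \<omega> k))) \<in> bm \<Omega>"
    using measurable_compose[OF c[OF k] G[OF t2]] by simp
   fix \<omega> assume "\<omega> \<in> space \<Omega>"
   then show "0 \<le> G \<omega> (t - 1) (snd (prev \<omega> k))" using measurable_space[OF prev[OF t2 k]] by (intro Gnn[OF t2]) auto
  qed
  show "(\<lambda>(\<omega>, k). distr (M \<omega> t (snd (prev \<omega> k))) (particle_space N Z) (\<lambda>z. (k, z))) \<in> \<Omega> \<Otimes>\<^sub>M count_space {1..N} \<leadsto> (particle_space N Z)"
  proof (rule measurable_pair_count_space)
   fix k assume k: "k \<in> {1..N}"
   have "(\<lambda>\<omega>. M \<omega> t (snd (prev \<omega> k))) \<in> \<Omega> \<leadsto> Z"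
    using measurable_compose[OF c[OF k] M[OF t2]] by simp
   from measurable_compose[OF this measurable_distr_prob_space[OF Pair_particle_measurable[OF k]]]
   show "(\<lambda>\<omega>. distr (M \<omega> t (snd (prev \<omega> k))) (particle_space N Z) (\<lambda>z. (k, z))) \<in> \<Omega> \<leadsto> (particle_space N Z)" .
  qed simp
 qed
 show ?thesis unfolding particle_law_def using 1 2 3 t
  by (cases "i = 1"; cases "t = 1") (auto simp del: One_nat_def)
qed

lemma csmc_history_measurable:
 assumes N: "1 \<le> N" and M1: "M1 \<in> \<Theta> \<leadsto> Z"
  and M: "\<And>t. t \<in> {2..T} ==> (\<lambda>(\<theta>, z). M \<theta> t z) \<in> \<Theta> \<Otimes>\<^sub>M Z \<leadsto> Z"
  and G: "\<And>t. t \<in> {1..T} ==> (\<lambda>(\<theta>, z). G \<theta> t z) \<in> bm (\<Theta> \<Otimes>\<^sub>M Z)"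
  and Gnn: "\<And>\<theta> t z. \<theta> \<in> space \<Theta> ==> t \<in> {1..T} ==> z \<in> space Z ==> 0 \<le> G \<theta> t z"
  and t: "t \<le> T"
 shows "(\<lambda>(\<theta>, x). csmc_history Z N (M1 \<theta>) (M \<theta>) (G \<theta>) x t) \<in> \<Theta> \<Otimes>\<^sub>M PiM {1..T} (\<lambda>_. Z)
   \<leadsto> (PiM {1..t} (\<lambda>_. generation_space N Z))"
 using t
proof (induction t)
 case 0
 have "(\<lambda>_. undefined) \<in> space (PiM {1..(0::nat)} (\<lambda>_. generation_space N Z))" by (simp add: space_PiM)
 then have "return (PiM {1..(0::nat)} (\<lambda>_. generation_space N Z)) (\<lambda>_. undefined) \<in> space (prob_algebra (PiM {1..(0::nat)} (\<lambda>_. generation_space N Z)))"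
  by (rule measurable_space[OF measurable_return_prob_space])
 then show ?case unfolding csmc_history.simps(1) case_prod_beta' by (rule measurable_const)
next
 case (Suc t)
 let ?\<Omega> = "\<Theta> \<Otimes>\<^sub>M PiM {1..T} (\<lambda>_. Z)" and ?H = "PiM {1..t} (\<lambda>_. generation_space N Z)"
 let ?H' = "PiM {1..Suc t} (\<lambda>_. generation_space N Z)"
 have IH: "(\<lambda>q. csmc_history Z N (M1 (fst q)) (M (fst q)) (G (fst q)) (snd q) t) \<in> ?\<Omega> \<leadsto> ?H"
  using Suc by (simp add: case_prod_beta')
 have proj: "(\<lambda>r. (fst (fst (fst r)), snd r)) \<in> (?\<Omega> \<Otimes>\<^sub>M ?H) \<Otimes>\<^sub>M Z \<rightarrow>\<^sub>M \<Theta> \<Otimes>\<^sub>M Z" by simp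
 have xm: "(\<lambda>r. snd (fst r) (Suc t)) \<in> ?\<Omega> \<Otimes>\<^sub>M ?H \<rightarrow>\<^sub>M Z"
  by (rule measurable_compose[OF comp_fst[OF measurable_snd] measurable_component_singleton]) (use Suc in auto)
 have PL: "(\<lambda>r. PiM {1..N} (\<lambda>i. particle_law Z N (M1 (fst (fst r))) (M (fst (fst r))) (G (fst (fst r))) (snd (fst r)) (Suc t) (snd r t) i))
   \<in> ?\<Omega> \<Otimes>\<^sub>M ?H \<leadsto> (generation_space N Z)"
  unfolding generation_space_def
 proof (rule PiM_kernel_measurable)
  fix i
  show "(\<lambda>r. particle_law Z N (M1 (fst (fst r))) (M (fst (fst r))) (G (fst (fst r))) (snd (fst r)) (Suc t) (snd r t) i)
    \<in> ?\<Omega> \<Otimes>\<^sub>M PiM {1..t} (\<lambda>_. PiM {1..N} (\<lambda>_. particle_space N Z)) \<leadsto> (particle_space N Z)"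
   unfolding generation_space_def[symmetric]
  proof (rule particle_law_measurable[OF N])
   show "(\<lambda>r. M1 (fst (fst r))) \<in> ?\<Omega> \<Otimes>\<^sub>M ?H \<leadsto> Z"
    by (rule measurable_compose[OF comp_fst[OF measurable_fst] M1])
   show "(\<lambda>r. snd (fst r) (Suc t)) \<in> ?\<Omega> \<Otimes>\<^sub>M ?H \<rightarrow>\<^sub>M Z" by (rule xm)
   assume t2: "2 \<le> Suc t"
   show "(\<lambda>(r, z). M (fst (fst r)) (Suc t) z) \<in> (?\<Omega> \<Otimes>\<^sub>M ?H) \<Otimes>\<^sub>M Z \<leadsto> Z"
    using measurable_compose[OF proj M[of "Suc t"]] Suc t2 by (simp add: case_prod_beta')
   show "(\<lambda>(r, z). G (fst (fst r)) (Suc t - 1) z) \<in> bm ((?\<Omega> \<Otimes>\<^sub>M ?H) \<Otimes>\<^sub>M Z)"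
    using measurable_compose[OF proj G[of t]] Suc t2 by (simp add: case_prod_beta')
   fix k assume k: "k \<in> {1..N}"
   have "(\<lambda>h. h t) \<in> ?H \<rightarrow>\<^sub>M generation_space N Z" using t2 by (intro measurable_component_singleton) auto
   note a = this
   have b: "(\<lambda>g. g k) \<in> generation_space N Z \<rightarrow>\<^sub>M particle_space N Z"
    unfolding generation_space_def using k by (rule measurable_component_singleton)
   have c: "snd \<in> particle_space N Z \<rightarrow>\<^sub>M Z" unfolding particle_space_def by simp
   have "(\<lambda>h. snd (h t k)) \<in> ?H \<rightarrow>\<^sub>M Z" by (rule measurable_compose[OF measurable_compose[OF a b] c])
   then show "(\<lambda>r. snd (snd r t k)) \<in> ?\<Omega> \<Otimes>\<^sub>M ?H \<rightarrow>\<^sub>M Z" by (rule comp_snd)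
  next
   fix r z assume "2 \<le> Suc t" "r \<in> space (?\<Omega> \<Otimes>\<^sub>M ?H)" "z \<in> space Z"
   then show "0 \<le> G (fst (fst r)) (Suc t - 1) z" using Suc by (intro Gnn) (auto simp: space_pair_measure)
  qed simp
 qed simp
 have "{1..Suc t} = insert (Suc t) {1..t}" by auto
 then have u: "(\<lambda>(h, g). h(Suc t := g)) \<in> ?H \<Otimes>\<^sub>M generation_space N Z \<rightarrow>\<^sub>M ?H'"
  using measurable_fun_upd_PiM[of "Suc t" "{1..t}" "\<lambda>_. generation_space N Z"] by simp
 have "(\<lambda>r. (snd (fst r), snd r)) \<in> (?\<Omega> \<Otimes>\<^sub>M ?H) \<Otimes>\<^sub>M generation_space N Z \<rightarrow>\<^sub>M ?H \<Otimes>\<^sub>M generation_space N Z" by simp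
 from measurable_compose[OF this u]
 have u': "(\<lambda>(r, g). (snd r)(Suc t := g)) \<in> (?\<Omega> \<Otimes>\<^sub>M ?H) \<Otimes>\<^sub>M generation_space N Z \<rightarrow>\<^sub>M ?H'" by (simp add: case_prod_beta')
 have step: "(\<lambda>(q, h). distr (PiM {1..N} (particle_law Z N (M1 (fst q)) (M (fst q)) (G (fst q)) (snd q) (Suc t) (h t))) ?H' (\<lambda>g. h(Suc t := g)))
   \<in> ?\<Omega> \<Otimes>\<^sub>M ?H \<leadsto> ?H'"
  using measurable_distr_prob_space2[OF PL u'] by (simp add: case_prod_beta')
 show ?case using measurable_bind_prob_space2[OF IH step] by (simp add: case_prod_beta')
qed

lemma ancestor_measurable:
 assumes k: "k \<in> {1..N}"
 shows "j < T ==> (\<lambda>h. ancestor h T k j) \<in> PiM {1..T} (\<lambda>_. generation_space N Z) \<rightarrow>\<^sub>M count_space {1..N}"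
proof (induction j)
 case 0
 then show ?case using k by simp
next
 case (Suc j)
 have IH: "(\<lambda>h. ancestor h T k j) \<in> PiM {1..T} (\<lambda>_. generation_space N Z) \<rightarrow>\<^sub>M count_space {1..N}" using Suc by simp
 have "(\<lambda>h. fst (h (T - j) i)) \<in> PiM {1..T} (\<lambda>_. generation_space N Z) \<rightarrow>\<^sub>M count_space {1..N}" if "i \<in> {1..N}" for i
 proof -
  have "(\<lambda>h. h (T - j)) \<in> PiM {1..T} (\<lambda>_. generation_space N Z) \<rightarrow>\<^sub>M generation_space N Z"
   using Suc by (intro measurable_component_singleton) auto
  note a = this
  have b: "(\<lambda>g. g i) \<in> generation_space N Z \<rightarrow>\<^sub>M particle_space N Z"
   unfolding generation_space_def using that by (rule measurable_component_singleton)
  have c: "fst \<in> particle_space N Z \<rightarrow>\<^sub>M count_space {1..N}" unfolding particle_space_def by simp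
  show ?thesis by (rule measurable_compose[OF measurable_compose[OF a b] c])
 qed
 then show ?case unfolding ancestor.simps
  by (rule measurable_compose_countable'[of "{1..N}" "\<lambda>i h. fst (h (T - j) i)", OF _ IH]) (simp_all add: countable_finite)
qed

lemma lineage_measurable:
 assumes k: "k \<in> {1..N}" and s: "s \<in> {1..T}"
 shows "(\<lambda>h. snd (h s (ancestor h T k (T - s)))) \<in> PiM {1..T} (\<lambda>_. generation_space N Z) \<rightarrow>\<^sub>M Z"
proof (rule measurable_compose_countable'[of "{1..N}" "\<lambda>i h. snd (h s i)"])
 show "(\<lambda>h. ancestor h T k (T - s)) \<in> PiM {1..T} (\<lambda>_. generation_space N Z) \<rightarrow>\<^sub>M count_space {1..N}"
  using s by (intro ancestor_measurable[OF k]) auto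
 fix i assume i: "i \<in> {1..N}"
 have "(\<lambda>h. h s) \<in> PiM {1..T} (\<lambda>_. generation_space N Z) \<rightarrow>\<^sub>M generation_space N Z"
  using s by (intro measurable_component_singleton) auto
 note a = this
 have b: "(\<lambda>g. g i) \<in> generation_space N Z \<rightarrow>\<^sub>M particle_space N Z"
  unfolding generation_space_def using i by (rule measurable_component_singleton)
 have c: "snd \<in> particle_space N Z \<rightarrow>\<^sub>M Z" unfolding particle_space_def by simp
 show "(\<lambda>h. snd (h s i)) \<in> PiM {1..T} (\<lambda>_. generation_space N Z) \<rightarrow>\<^sub>M Z" by (rule measurable_compose[OF measurable_compose[OF a b] c])
qed (simp add: countable_finite)

lemma terminal_selection_measurable:
 assumes N: "1 \<le> N" and T: "1 \<le> T"
  and G: "(\<lambda>(\<theta>, z). G \<theta> T z) \<in> bm (\<Theta> \<Otimes>\<^sub>M Z)"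
  and Gnn: "\<And>\<theta> z. \<theta> \<in> space \<Theta> ==> z \<in> space Z ==> 0 \<le> G \<theta> T z"
 shows "(\<lambda>(\<theta>, h). select_index N (\<lambda>k. G \<theta> T (snd (h T k))) \<bind>
     (\<lambda>k. return (PiM {1..T} (\<lambda>_. Z)) (\<lambda>t\<in>{1..T}. snd (h t (ancestor h T k (T - t))))))
   \<in> \<Theta> \<Otimes>\<^sub>M PiM {1..T} (\<lambda>_. generation_space N Z) \<leadsto> (PiM {1..T} (\<lambda>_. Z))"
 unfolding case_prod_beta'
proof (rule measurable_bind_prob_space2)
 let ?H = "PiM {1..T} (\<lambda>_. generation_space N Z)"
 have L: "(\<lambda>h. snd (h T k)) \<in> ?H \<rightarrow>\<^sub>M Z" if "k \<in> {1..N}" for k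
  using lineage_measurable[OF that, of T T] T by simp
 show "(\<lambda>q. select_index N (\<lambda>k. G (fst q) T (snd (snd q T k)))) \<in> \<Theta> \<Otimes>\<^sub>M ?H \<leadsto> (count_space {1..N})"
 proof (rule select_index_measurable[OF _ _ N])
  fix k assume k: "k \<in> {1..N}"
  have "(\<lambda>q. (fst q, snd (snd q T k))) \<in> \<Theta> \<Otimes>\<^sub>M ?H \<rightarrow>\<^sub>M \<Theta> \<Otimes>\<^sub>M Z"
   by (intro measurable_Pair measurable_fst comp_snd[OF L[OF k]])
  from measurable_compose[OF this G] show "(\<lambda>q. G (fst q) T (snd (snd q T k))) \<in> bm (\<Theta> \<Otimes>\<^sub>M ?H)" by simp
  fix q assume "q \<in> space (\<Theta> \<Otimes>\<^sub>M ?H)"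
  then show "0 \<le> G (fst q) T (snd (snd q T k))" using measurable_space[OF L[OF k]] by (intro Gnn) (auto simp: space_pair_measure)
 qed
 show "(\<lambda>(q, k). return (PiM {1..T} (\<lambda>_. Z)) (\<lambda>t\<in>{1..T}. snd (snd q t (ancestor (snd q) T k (T - t)))))
   \<in> (\<Theta> \<Otimes>\<^sub>M ?H) \<Otimes>\<^sub>M count_space {1..N} \<leadsto> (PiM {1..T} (\<lambda>_. Z))"
 proof (rule measurable_pair_count_space)
  fix k assume k: "k \<in> {1..N}"
  have "(\<lambda>h. \<lambda>t\<in>{1..T}. snd (h t (ancestor h T k (T - t)))) \<in> ?H \<rightarrow>\<^sub>M PiM {1..T} (\<lambda>_. Z)"
   by (intro measurable_restrict lineage_measurable k)
  from measurable_compose[OF comp_snd[OF this] measurable_return_prob_space]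
  show "(\<lambda>q. return (PiM {1..T} (\<lambda>_. Z)) (\<lambda>t\<in>{1..T}. snd (snd q t (ancestor (snd q) T k (T - t))))) \<in> \<Theta> \<Otimes>\<^sub>M ?H \<leadsto> (PiM {1..T} (\<lambda>_. Z))" .
 qed simp
qed

lemma icsmc_measurable:
 assumes N: "1 \<le> N" and T: "1 \<le> T" and M1: "M1 \<in> \<Theta> \<leadsto> Z"
  and M: "\<And>t. t \<in> {2..T} ==> (\<lambda>(\<theta>, z). M \<theta> t z) \<in> \<Theta> \<Otimes>\<^sub>M Z \<leadsto> Z"
  and G: "\<And>t. t \<in> {1..T} ==> (\<lambda>(\<theta>, z). G \<theta> t z) \<in> bm (\<Theta> \<Otimes>\<^sub>M Z)"
  and Gnn: "\<And>\<theta> t z. \<theta> \<in> space \<Theta> ==> t \<in> {1..T} ==> z \<in> space Z ==> 0 \<le> G \<theta> t z"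
 shows "(\<lambda>(\<theta>, x). icsmc Z T N (M1 \<theta>) (M \<theta>) (G \<theta>) x) \<in> \<Theta> \<Otimes>\<^sub>M PiM {1..T} (\<lambda>_. Z) \<leadsto> (PiM {1..T} (\<lambda>_. Z))"
 unfolding icsmc_def case_prod_beta'
proof (rule measurable_bind_prob_space2)
 let ?\<Omega> = "\<Theta> \<Otimes>\<^sub>M PiM {1..T} (\<lambda>_. Z)" and ?H = "PiM {1..T} (\<lambda>_. generation_space N Z)"
 show "(\<lambda>q. csmc_history Z N (M1 (fst q)) (M (fst q)) (G (fst q)) (snd q) T) \<in> ?\<Omega> \<leadsto> ?H"
  using csmc_history_measurable[OF N M1 M G Gnn order_refl] by (simp add: case_prod_beta')
 have "(\<lambda>(\<theta>, h). select_index N (\<lambda>k. G \<theta> T (snd (h T k))) \<bind>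
     (\<lambda>k. return (PiM {1..T} (\<lambda>_. Z)) (\<lambda>t\<in>{1..T}. snd (h t (ancestor h T k (T - t))))))
   \<in> \<Theta> \<Otimes>\<^sub>M ?H \<leadsto> (PiM {1..T} (\<lambda>_. Z))"
  using T by (intro terminal_selection_measurable[OF N T G] Gnn) auto
 from measurable_compose[OF _ this, of "\<lambda>r. (fst (fst r), snd r)" "?\<Omega> \<Otimes>\<^sub>M ?H"]
 show "(\<lambda>(q, h). select_index N (\<lambda>k. G (fst q) T (snd (h T k))) \<bind>
     (\<lambda>k. return (PiM {1..T} (\<lambda>_. Z)) (\<lambda>t\<in>{1..T}. snd (h t (ancestor h T k (T - t))))))
   \<in> ?\<Omega> \<Otimes>\<^sub>M ?H \<leadsto> (PiM {1..T} (\<lambda>_. Z))" by (simp add: case_prod_beta')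
qed

subsection \<open>The particle system in terms of ancestral paths\<close>

declare One_nat_def [simp del]

text \<open>
 A particle at time \<open>t\<close> is represented by its whole ancestral path, an element of \<open>Z\<^sup>T\<close> whose
 coordinates after \<open>t\<close> are filled with \<open>z0\<close>. The potential at time \<open>0\<close> is \<open>1\<close>, so that
 the initial draw is also a move from time \<open>0\<close> to time \<open>1\<close>.
\<close>

locale particle_model =
 fixes Z :: "'z measure" and T N :: nat and M1 :: "'z measure" and M :: "nat => 'z => 'z measure"
  and G :: "nat => 'z => real" and z0 :: 'z
 assumes T: "1 \<le> T" and N: "1 \<le> N" and M1: "M1 \<in> space (prob_algebra Z)"
  and M: "\<And>t. t \<in> {2..T} ==> M t \<in> Z \<leadsto> Z"
  and G: "\<And>t. t \<in> {1..T} ==> G t \<in> bm Z"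
  and Gnn: "\<And>t z. t \<in> {1..T} ==> z \<in> space Z ==> 0 \<le> G t z"
  and z0: "z0 \<in> space Z"
begin

abbreviation X where "X \<equiv> PiM {1..T} (\<lambda>_. Z)"
abbreviation "PS \<equiv> particle_space N Z"
abbreviation "GS \<equiv> generation_space N Z"
abbreviation "hist \<equiv> csmc_history Z N M1 M G"
abbreviation "plaw \<equiv> particle_law Z N M1 M G"
abbreviation "Pk \<equiv> icsmc Z T N M1 M G"
abbreviation Tup where "Tup \<equiv> PiM {1..N} (\<lambda>_. X)"

definition base where "base = (\<lambda>s\<in>{1..T}. z0)"
definition trunc where "trunc t x = (\<lambda>s\<in>{1..T}. if s \<le> t then x s else z0)"
definition wt where "wt t e = (if t = 0 then 1 else G t (e t))"
definition mv where "mv t e = distr (if t = 0 then M1 else M (Suc t) (e t)) X (\<lambda>w. e(Suc t := w))"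
definition mix where "mix t u = select_index N (\<lambda>k. wt t (u k)) \<bind> (\<lambda>k. mv t (u k))"
definition stp where
 "stp t w u = PiM {1..N} (\<lambda>i. if i = 1 then return X ((u 1)(Suc t := w)) else mix t u)"

text \<open>The conditional particle system without its genealogy: only the tuple of ancestral paths
  is kept. \<open>distr_history_lineages\<close> identifies it with the image of the
  history.\<close>

primrec C where
 "C 0 x = return Tup (\<lambda>i\<in>{1..N}. base)"
| "C (Suc t) x = C t x \<bind> stp t (x (Suc t))"

lemma base_space: "base \<in> space X" using z0 by (auto simp: base_def space_PiM)

lemma trunc_0: "trunc 0 x = base" by (auto simp: trunc_def base_def fun_eq_iff)

lemma trunc_Suc: "Suc t \<le> T ==> trunc (Suc t) x = (trunc t x)(Suc t := x (Suc t))"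
 by (auto simp: trunc_def fun_eq_iff le_Suc_eq)

lemma trunc_T:
 assumes "x \<in> space X"
 shows "trunc T x = x"
proof -
 have "trunc T x = restrict x {1..T}" unfolding trunc_def by (rule restrict_ext) simp
 also have "... = x" using assms unfolding space_PiM by (rule PiE_restrict)
 finally show ?thesis .
qed

lemma trunc_measurable: "t \<le> t' ==> trunc t \<in> PiM {1..t'} (\<lambda>_. Z) \<rightarrow>\<^sub>M X"
 unfolding trunc_def[abs_def]
proof (rule measurable_restrict)
 fix s assume "t \<le> t'" "s \<in> {1..T}"
 then show "(\<lambda>x. if s \<le> t then x s else z0) \<in> PiM {1..t'} (\<lambda>_. Z) \<rightarrow>\<^sub>M Z"
  using z0 by (cases "s \<le> t") (auto intro: measurable_component_singleton)
qed

lemma coord_measurable: "t \<in> {1..T} ==> (\<lambda>e. e t) \<in> X \<rightarrow>\<^sub>M Z"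
 by (rule measurable_component_singleton)

lemma particle_coord_measurable: "k \<in> {1..N} ==> (\<lambda>u. u k) \<in> Tup \<rightarrow>\<^sub>M X"
 by (rule measurable_component_singleton)

lemma coord_space: "e \<in> space X ==> t \<in> {1..T} ==> e t \<in> space Z"
 by (auto simp: space_PiM)

lemma particle_space_Tup: "u \<in> space Tup ==> k \<in> {1..N} ==> u k \<in> space X"
 using measurable_space[OF particle_coord_measurable] by blast

lemma upd_measurable: "s \<in> {1..T} ==> (\<lambda>(e, w). e(s := w)) \<in> X \<Otimes>\<^sub>M Z \<rightarrow>\<^sub>M X"
 unfolding case_prod_beta' by (rule measurable_fun_upd[where J="{1..T}"]) auto

lemma upd_space: "s \<in> {1..T} ==> e \<in> space X ==> w \<in> space Z ==> e(s := w) \<in> space X"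
 using measurable_space[OF upd_measurable, of s "(e, w)"] by (simp add: space_pair_measure)

lemma upd_measurable1: "s \<in> {1..T} ==> e \<in> space X ==> (\<lambda>w. e(s := w)) \<in> Z \<rightarrow>\<^sub>M X"
 using measurable_param_section[of "\<lambda>e w. e(s := w)" X Z X e] upd_measurable by simp

lemma wt_measurable: "t \<le> T ==> wt t \<in> bm X"
proof (cases "t = 0")
 case False
 assume "t \<le> T"
 then have t: "t \<in> {1..T}" using False by (auto simp: One_nat_def)
 have "(\<lambda>e. G t (e t)) \<in> bm X" by (rule measurable_compose[OF coord_measurable[OF t] G[OF t]])
 then show ?thesis using False by (simp add: wt_def[abs_def])
qed (simp add: wt_def[abs_def])

lemma wt_nonneg: "t \<le> T ==> e \<in> space X ==> 0 \<le> wt t e"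
proof (cases "t = 0")
 case False
 assume "t \<le> T" "e \<in> space X"
 moreover from this have "t \<in> {1..T}" using False by simp
 ultimately show ?thesis using False by (simp only: wt_def if_False) (intro Gnn coord_space)
qed (simp add: wt_def)

lemma move_law_measurable: "t < T ==> (\<lambda>e. if t = 0 then M1 else M (Suc t) (e t)) \<in> X \<leadsto> Z"
proof (cases "t = 0")
 case False
 assume "t < T"
 then have "t \<in> {1..T}" "Suc t \<in> {2..T}" using False by auto
 then have "(\<lambda>e. M (Suc t) (e t)) \<in> X \<leadsto> Z" by (intro measurable_compose[OF coord_measurable M])
 then show ?thesis using False by simp
qed (use M1 in simp)

lemma mv_measurable: "t < T ==> mv t \<in> X \<leadsto> X"
 unfolding mv_def[abs_def]
 by (rule measurable_distr_prob_space2[OF move_law_measurable upd_measurable]) auto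

lemma nn_integral_mv:
 assumes t: "t < T" and e: "e \<in> space X" and f: "f \<in> bm X"
 shows "nn_integral (mv t e) f = (\<integral>\<^sup>+w. f (e(Suc t := w)) \<partial>(if t = 0 then M1 else M (Suc t) (e t)))"
proof -
 have "sets (if t = 0 then M1 else M (Suc t) (e t)) = sets Z" by (rule prob_kernelD(2)[OF move_law_measurable[OF t] e])
 then have "(\<lambda>w. e(Suc t := w)) \<in> (if t = 0 then M1 else M (Suc t) (e t)) \<rightarrow>\<^sub>M X"
  using upd_measurable1[of "Suc t" e] t e by (simp cong: measurable_cong_sets)
 then show ?thesis unfolding mv_def by (rule nn_integral_distr) (use f in simp)
qed

lemma select_wt_measurable: "t \<le> T ==> (\<lambda>u. select_index N (\<lambda>k. wt t (u k))) \<in> Tup \<leadsto> (count_space {1..N})"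
 by (rule select_index_measurable[OF _ _ N])
   (blast intro: measurable_compose[OF particle_coord_measurable wt_measurable] wt_nonneg particle_space_Tup)+

lemma mix_measurable: "t < T ==> mix t \<in> Tup \<leadsto> X"
 unfolding mix_def[abs_def]
proof (rule measurable_bind_prob_space2[OF select_wt_measurable])
 assume t: "t < T"
 show "(\<lambda>(u, k). mv t (u k)) \<in> Tup \<Otimes>\<^sub>M count_space {1..N} \<leadsto> X"
  by (rule measurable_pair_count_space) (auto intro: measurable_compose[OF particle_coord_measurable mv_measurable[OF t]])
qed simp

definition tot :: "nat => (nat => nat => 'z) => ennreal" where
 "tot t u = (\<Sum>k=1..N. ennreal (wt t (u k)))"

lemma tot_measurable: "t \<le> T ==> tot t \<in> bm Tup"
 unfolding tot_def[abs_def]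
 by (intro borel_measurable_sum comp_ennreal measurable_compose[OF particle_coord_measurable wt_measurable])

lemma tot_finite: "tot t u < \<top>"
 unfolding tot_def by (simp add: less_top[symmetric])

lemma nn_integral_mix:
 assumes t: "t < T" and u: "u \<in> space Tup" and f: "f \<in> bm X" and nz: "tot t u \<noteq> 0"
 shows "nn_integral (mix t u) f = (\<Sum>k=1..N. ennreal (wt t (u k)) * nn_integral (mv t (u k)) f) * inverse (tot t u)"
proof -
 have "(\<lambda>k. mv t (u k)) \<in> count_space {1..N} \<leadsto> X"
  using measurable_space[OF mv_measurable[OF t] particle_space_Tup[OF u]] by auto
 then have "nn_integral (mix t u) f = (\<integral>\<^sup>+k. \<integral>\<^sup>+y. f y \<partial>mv t (u k) \<partial>select_index N (\<lambda>k. wt t (u k)))"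
  unfolding mix_def by (rule nn_integral_kernel_bind[OF sets_select_index _ f])
 also have "... = (\<Sum>k=1..N. ennreal (wt t (u k)) * nn_integral (mv t (u k)) f) * inverse (tot t u)"
  using nz t unfolding tot_def by (subst nn_integral_select_index[OF _ N]) (auto intro!: wt_nonneg particle_space_Tup[OF u])
 finally show ?thesis .
qed

lemma index_set: "{1..N} = insert 1 {2..N}" using N by auto

lemma stp_measurable: "t < T ==> (\<lambda>(w, u). stp t w u) \<in> Z \<Otimes>\<^sub>M Tup \<leadsto> Tup"
 unfolding stp_def[abs_def] case_prod_beta'
proof (rule PiM_kernel_measurable)
 fix i assume t: "t < T"
 have "(\<lambda>q. (snd q 1, fst q)) \<in> Z \<Otimes>\<^sub>M Tup \<rightarrow>\<^sub>M X \<Otimes>\<^sub>M Z"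
  using N by (intro measurable_Pair measurable_fst comp_snd[OF particle_coord_measurable]) auto
 from measurable_compose[OF this upd_measurable[of "Suc t"]] t
 have "(\<lambda>q. (snd q 1)(Suc t := fst q)) \<in> Z \<Otimes>\<^sub>M Tup \<rightarrow>\<^sub>M X" by simp
 from measurable_compose[OF this measurable_return_prob_space] comp_snd[OF mix_measurable[OF t]]
 show "(\<lambda>q. if i = 1 then return X ((snd q 1)(Suc t := fst q)) else mix t (snd q)) \<in> Z \<Otimes>\<^sub>M Tup \<leadsto> X"
  by (cases "i = 1") (simp_all del: One_nat_def)
qed simp

lemma stp_measurable1: "t < T ==> w \<in> space Z ==> stp t w \<in> Tup \<leadsto> Tup"
 by (rule measurable_param_section[OF stp_measurable])

lemma upd_tuple_measurable: "(\<lambda>(e, p). p(i := e)) \<in> X \<Otimes>\<^sub>M PiM I (\<lambda>_. X) \<rightarrow>\<^sub>M PiM (insert i I) (\<lambda>_. X)"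
 unfolding case_prod_beta' by (rule measurable_fun_upd[where J=I]) auto

lemma nn_integral_stp:
 assumes t: "t < T" and w: "w \<in> space Z" and u: "u \<in> space Tup" and H: "H \<in> bm Tup"
 shows "nn_integral (stp t w u) H = (\<integral>\<^sup>+p. H (p(1 := (u 1)(Suc t := w))) \<partial>PiM {2..N} (\<lambda>_. mix t u))"
proof -
 let ?e = "(u 1)(Suc t := w)"
 let ?L = "\<lambda>i::nat. if i = 1 then return X ?e else mix t u"
 have e: "?e \<in> space X" using t w u N by (intro upd_space particle_space_Tup) auto
 note m = prob_kernelD[OF mix_measurable[OF t] u]
 have s: "sets (?L i) = sets X" and p: "prob_space (?L i)" for i using m e by (auto intro: prob_space_return)
 have HL: "H \<in> bm (PiM (insert 1 {2..N}) ?L)"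
 proof -
  have "sets (PiM (insert 1 {2..N}) ?L) = sets Tup"
   unfolding index_set by (intro sets_PiM_cong refl s)
  then show ?thesis using H by (simp cong: measurable_cong_sets)
 qed
 have eqI: "PiM {2..N} ?L = PiM {2..N} (\<lambda>_. mix t u)" by (intro PiM_cong) auto
 have sI: "sets (PiM {2..N} (\<lambda>_. mix t u)) = sets (PiM {2..N} (\<lambda>_. X))" by (intro sets_PiM_cong refl m)
 have "nn_integral (stp t w u) H = (\<integral>\<^sup>+y. \<integral>\<^sup>+p. H (p(1 := y)) \<partial>PiM {2..N} ?L \<partial>?L 1)"
  unfolding stp_def index_set by (rule nn_integral_PiM_insert[OF _ _ p HL]) auto
 also have "... = (\<integral>\<^sup>+y. \<integral>\<^sup>+p. H (p(1 := y)) \<partial>PiM {2..N} (\<lambda>_. mix t u) \<partial>return X ?e)" unfolding eqI by simp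
 also have "... = (\<integral>\<^sup>+p. H (p(1 := ?e)) \<partial>PiM {2..N} (\<lambda>_. mix t u))"
 proof (rule nn_integral_return[OF e])
  have pp: "PiM {2..N} (\<lambda>_. mix t u) \<in> space (prob_algebra (PiM {2..N} (\<lambda>_. X)))"
   using sI by (simp add: space_prob_algebra prob_space_PiM m)
  have "(\<lambda>(y, p). H (p(1 := y))) \<in> bm (X \<Otimes>\<^sub>M PiM {2..N} (\<lambda>_. X))"
   using measurable_compose[OF upd_tuple_measurable[of 1 "{2..N}"] H[unfolded index_set]] by (simp add: case_prod_beta')
  then show "(\<lambda>y. \<integral>\<^sup>+p. H (p(1 := y)) \<partial>PiM {2..N} (\<lambda>_. mix t u)) \<in> bm X"
   by (rule nn_integral_kernel_measurable2[OF measurable_const[OF pp]])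
 qed
 finally show ?thesis .
qed

lemma C_measurable: "t \<le> t' ==> t' \<le> T ==> C t \<in> PiM {1..t'} (\<lambda>_. Z) \<leadsto> Tup"
proof (induction t)
 case 0
 have "(\<lambda>i\<in>{1..N}. base) \<in> space Tup" using base_space by (auto simp: space_PiM[of "{1..N}"])
 then have "return Tup (\<lambda>i\<in>{1..N}. base) \<in> space (prob_algebra Tup)"
  by (rule measurable_space[OF measurable_return_prob_space])
 then show ?case unfolding C.simps(1)[abs_def] by (rule measurable_const)
next
 case (Suc t)
 have x: "(\<lambda>x. x (Suc t)) \<in> PiM {1..t'} (\<lambda>_. Z) \<rightarrow>\<^sub>M Z" using Suc.prems by (intro measurable_component_singleton) auto
 have "(\<lambda>q. (fst q (Suc t), snd q)) \<in> PiM {1..t'} (\<lambda>_. Z) \<Otimes>\<^sub>M Tup \<rightarrow>\<^sub>M Z \<Otimes>\<^sub>M Tup"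
  by (intro measurable_Pair measurable_snd comp_fst[OF x])
 from measurable_compose[OF this stp_measurable[of t]]
 have "(\<lambda>(x, u). stp t (x (Suc t)) u) \<in> PiM {1..t'} (\<lambda>_. Z) \<Otimes>\<^sub>M Tup \<leadsto> Tup"
  using Suc.prems by (simp add: case_prod_beta')
 with Suc show ?case unfolding C.simps(2)[abs_def] by (intro measurable_bind_prob_space2) auto
qed

lemma C_cong: "(\<And>s. s \<in> {1..t} ==> x s = y s) ==> C t x = C t y"
 by (induction t) auto

lemma nn_integral_C_Suc:
 assumes t: "Suc t \<le> t'" "t' \<le> T" and x: "x \<in> space (PiM {1..t'} (\<lambda>_. Z))" and H: "H \<in> bm Tup"
 shows "nn_integral (C (Suc t) x) H = (\<integral>\<^sup>+u. \<integral>\<^sup>+p. H (p(1 := (u 1)(Suc t := x (Suc t)))) \<partial>PiM {2..N} (\<lambda>_. mix t u) \<partial>C t x)"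
proof -
 have xt: "x (Suc t) \<in> space Z" using x t by (auto simp: space_PiM)
 have s: "sets (C t x) = sets Tup" using C_measurable[of t t'] t x by (intro prob_kernelD(2)) auto
 have "nn_integral (C (Suc t) x) H = (\<integral>\<^sup>+u. \<integral>\<^sup>+p. H p \<partial>stp t (x (Suc t)) u \<partial>C t x)"
  using t xt by (simp add: nn_integral_kernel_bind[OF s stp_measurable1 H])
 also have "... = (\<integral>\<^sup>+u. \<integral>\<^sup>+p. H (p(1 := (u 1)(Suc t := x (Suc t)))) \<partial>PiM {2..N} (\<lambda>_. mix t u) \<partial>C t x)"
  using t xt H sets_eq_imp_space_eq[OF s] by (intro nn_integral_cong nn_integral_stp) auto
 finally show ?thesis .
qed

lemma PiM_mix_measurable: "t < T ==> finite I ==> (\<lambda>u. PiM I (\<lambda>_. mix t u)) \<in> Tup \<leadsto> (PiM I (\<lambda>_. X))"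
 by (intro PiM_kernel_measurable mix_measurable)

text \<open>
 Under \<open>C t x\<close> the first particle is the reference path up to \<open>t\<close>. This is stated for integrals
 since singletons of \<open>Z\<close> need not be measurable.
\<close>

lemma nn_integral_C_reference:
 assumes t: "t \<le> t'" "t' \<le> T" and x: "x \<in> space (PiM {1..t'} (\<lambda>_. Z))"
  and F: "(\<lambda>(e, u). F e u) \<in> bm (X \<Otimes>\<^sub>M Tup)"
 shows "(\<integral>\<^sup>+u. F (u 1) u \<partial>C t x) = (\<integral>\<^sup>+u. F (trunc t x) u \<partial>C t x)"
 using t F
proof (induction t arbitrary: F)
 case 0
 have b: "(\<lambda>i\<in>{1..N}. base) \<in> space Tup" using base_space by (auto simp: space_PiM[of "{1..N}"])
 have "(\<lambda>u. (u 1, u)) \<in> Tup \<rightarrow>\<^sub>M X \<Otimes>\<^sub>M Tup" using N by (intro measurable_Pair particle_coord_measurable) auto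
 from measurable_compose[OF this 0(3)] have 1: "(\<lambda>u. F (u 1) u) \<in> bm Tup" by simp
 have 2: "F base \<in> bm Tup" by (rule measurable_param_section[OF 0(3) base_space])
 show ?case unfolding C.simps(1) trunc_0 nn_integral_return[OF b 1] nn_integral_return[OF b 2] using N by simp
next
 case (Suc t)
 then have tT: "t < T" by simp
 let ?x = "x (Suc t)"
 have xt: "?x \<in> space Z" using x Suc.prems by (auto simp: space_PiM)
 have trm: "trunc (Suc t) x \<in> space X" by (rule measurable_space[OF trunc_measurable x]) (use Suc in auto)
 \<comment> \<open>The reference path enters twice, as the argument a of F and as b inside the
   tuple. The induction hypothesis is to replace the first occurrence only.\<close>
 define \<Phi> where "\<Phi> = (\<lambda>a b u. \<integral>\<^sup>+p. F (a(Suc t := ?x)) (p(1 := b(Suc t := ?x))) \<partial>PiM {2..N} (\<lambda>_. mix t u))"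
 have um: "(\<lambda>e. e(Suc t := ?x)) \<in> X \<rightarrow>\<^sub>M X"
  using measurable_compose[OF measurable_Pair2'[OF xt] upd_measurable[of "Suc t"]] tT by simp
 have m1: "(\<lambda>u. F (u 1) u) \<in> bm Tup"
 proof -
  have "(\<lambda>u. (u 1, u)) \<in> Tup \<rightarrow>\<^sub>M X \<Otimes>\<^sub>M Tup" using N by (intro measurable_Pair particle_coord_measurable) auto
  from measurable_compose[OF this Suc.prems(3)] show ?thesis by simp
 qed
 have \<Phi>m: "(\<lambda>(a, u). \<Phi> a (u 1) u) \<in> bm (X \<Otimes>\<^sub>M Tup)"
  unfolding \<Phi>_def case_prod_beta'
 proof (rule nn_integral_kernel_measurable2[OF comp_snd[OF PiM_mix_measurable[OF tT]]])
  have z1: "(\<lambda>q. (snd (fst q)) 1) \<in> (X \<Otimes>\<^sub>M Tup) \<Otimes>\<^sub>M PiM {2..N} (\<lambda>_. X) \<rightarrow>\<^sub>M X"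
   using N by (intro measurable_compose[OF comp_fst[OF measurable_snd] particle_coord_measurable]) auto
  have "(\<lambda>q. ((fst (fst q))(Suc t := ?x), (snd q)(1 := (snd (fst q) 1)(Suc t := ?x)))) \<in> (X \<Otimes>\<^sub>M Tup) \<Otimes>\<^sub>M PiM {2..N} (\<lambda>_. X) \<rightarrow>\<^sub>M X \<Otimes>\<^sub>M Tup"
   unfolding index_set
   by (intro measurable_Pair measurable_compose[OF comp_fst[OF measurable_fst] um]
     measurable_fun_upd[where J="{2..N}"] measurable_compose[OF z1[unfolded index_set] um] measurable_snd) auto
  from measurable_compose[OF this Suc.prems(3)]
  show "(\<lambda>(q, p). F ((fst q)(Suc t := ?x)) (p(1 := (snd q 1)(Suc t := ?x)))) \<in> bm ((X \<Otimes>\<^sub>M Tup) \<Otimes>\<^sub>M PiM {2..N} (\<lambda>_. X))"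
   by (simp add: case_prod_beta')
 qed simp
 have "(\<integral>\<^sup>+u. F (u 1) u \<partial>C (Suc t) x) = (\<integral>\<^sup>+u. \<Phi> (u 1) (u 1) u \<partial>C t x)"
  unfolding \<Phi>_def using nn_integral_C_Suc[OF Suc.prems(1,2) x m1] by simp
 also have "... = (\<integral>\<^sup>+u. \<Phi> (trunc t x) (u 1) u \<partial>C t x)"
  using Suc.IH[OF _ _ \<Phi>m] Suc.prems by simp
 also have "... = (\<integral>\<^sup>+u. F (trunc (Suc t) x) u \<partial>C (Suc t) x)"
  unfolding nn_integral_C_Suc[OF Suc.prems(1,2) x measurable_param_section[OF Suc.prems(3) trm]] \<Phi>_def
  using trunc_Suc[of t x] tT by simp
 finally show ?case .
qed

definition lineages where
 "lineages t h = (\<lambda>i\<in>{1..N}. \<lambda>s\<in>{1..T}. if s \<le> t then snd (h s (ancestor h t i (t - s))) else z0)"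

abbreviation Hist where "Hist (t::nat) \<equiv> PiM {1..t} (\<lambda>_. GS)"

lemma lineages_measurable: "lineages t \<in> Hist t \<rightarrow>\<^sub>M Tup"
 unfolding lineages_def[abs_def]
proof (intro measurable_restrict)
 fix i s assume i: "i \<in> {1..N}" and s: "s \<in> {1..T}"
 show "(\<lambda>h. if s \<le> t then snd (h s (ancestor h t i (t - s))) else z0) \<in> Hist t \<rightarrow>\<^sub>M Z"
  using lineage_measurable[OF i, of s t] s z0 by (cases "s \<le> t") auto
qed

lemma ancestor_upd: "j \<le> t ==> ancestor (h(Suc t := g)) (Suc t) i (Suc j) = ancestor h t (fst (g i)) j"
 by (induction j) (auto simp: Suc_diff_le)

lemma lineages_upd:
 assumes t: "t < T" and i: "i \<in> {1..N}" and a: "fst (g i) \<in> {1..N}"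
 shows "lineages (Suc t) (h(Suc t := g)) i = (lineages t h (fst (g i)))(Suc t := snd (g i))"
proof
 fix s
 consider "s \<notin> {1..T}" | "s = Suc t" | "s \<in> {1..T}" "s \<le> t" | "s \<in> {1..T}" "Suc t < s" by fastforce
 then show "lineages (Suc t) (h(Suc t := g)) i s = ((lineages t h (fst (g i)))(Suc t := snd (g i))) s"
 proof cases
  case 1
  then have s: "s \<noteq> Suc t" using t by auto
  have "lineages (Suc t) (h(Suc t := g)) i s = undefined" "lineages t h (fst (g i)) s = undefined"
   unfolding lineages_def using 1 i a by (simp_all only: restrict_apply if_True if_False)
  then show ?thesis using s by simp
 next
  case 2
  then show ?thesis using t i by (simp add: lineages_def)
 next
  case 3
  then show ?thesis using i a ancestor_upd[of "t - s" t h g i] by (simp add: lineages_def Suc_diff_le)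
 next
  case 4
  then show ?thesis using i a by (simp add: lineages_def)
 qed
qed

lemma history_prob: "t \<le> T ==> x \<in> space X ==> hist x t \<in> space (prob_algebra (Hist t))"
 using measurable_space[OF csmc_history_measurable[of N "\<lambda>_. M1" "count_space {()}" Z T "\<lambda>_. M" "\<lambda>_. G" t], of "((), x)"]
  N M1 M G Gnn by (auto simp: space_pair_measure intro!: measurable_param_const)

lemma particle_law_prob:
 assumes t: "t < T" and x: "x \<in> space X" and h: "h \<in> space (Hist t)"
 shows "plaw x (Suc t) (h t) i \<in> space (prob_algebra (PS))"
proof -
 have "(\<lambda>_. plaw x (Suc t) (h t) i) \<in> count_space {()} \<leadsto> (PS)"
 proof (rule particle_law_measurable[OF N, where ?M1.0="\<lambda>_. M1" and M="\<lambda>_. M" and G="\<lambda>_. G" and x="\<lambda>_. x" and prev="\<lambda>_. h t"])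
  show "(\<lambda>_. x (Suc t)) \<in> count_space {()} \<rightarrow>\<^sub>M Z" using coord_space[OF x, of "Suc t"] t by simp
  fix k assume "2 \<le> Suc t" "k \<in> {1..N}"
  then have "h t k \<in> space (PS)"
   using h by (auto simp: space_PiM generation_space_def dest!: PiE_mem[of h _ _ t])
  then show "(\<lambda>_. snd (h t k)) \<in> count_space {()} \<rightarrow>\<^sub>M Z" by (auto simp: particle_space_def space_pair_measure)
 qed (use t M1 M G Gnn in \<open>auto intro!: measurable_param_const\<close>)
 from measurable_space[OF this] show ?thesis by simp
qed

lemma distr_particle_law:
 assumes t: "t < T" and x: "x \<in> space X" and h: "h \<in> space (Hist t)"
 defines "\<phi> \<equiv> \<lambda>q. (lineages t h (fst q))(Suc t := snd q)"
 shows "\<phi> \<in> PS \<rightarrow>\<^sub>M X"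
  and "distr (plaw x (Suc t) (h t) i) X \<phi> =
    (if i = 1 then return X ((lineages t h 1)(Suc t := x (Suc t))) else mix t (lineages t h))"
proof -
 have L: "lineages t h \<in> space Tup" by (rule measurable_space[OF lineages_measurable h])
 have Lk: "lineages t h k \<in> space X" if "k \<in> {1..N}" for k by (rule particle_space_Tup[OF L that])
 have St: "Suc t \<in> {1..T}" using t by auto
 have "(\<lambda>(k, w). (lineages t h k)(Suc t := w)) \<in> count_space {1..N} \<Otimes>\<^sub>M Z \<rightarrow>\<^sub>M X"
  by (rule measurable_pair_measure_countable1) (auto intro!: upd_measurable1 St Lk simp: countable_finite)
 then show \<phi>: "\<phi> \<in> PS \<rightarrow>\<^sub>M X" by (simp add: \<phi>_def particle_space_def case_prod_beta')
 have one: "1 \<in> {1..N}" using N by auto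
 have mvd: "distr (distr Q (PS) (\<lambda>z. (k, z))) X \<phi> = distr Q X (\<lambda>w. (lineages t h k)(Suc t := w))"
  if "sets Q = sets Z" "k \<in> {1..N}" for Q k
 proof -
  have "Pair k \<in> Q \<rightarrow>\<^sub>M PS" using Pair_particle_measurable[OF that(2)] that(1) by (simp cong: measurable_cong_sets)
  from distr_distr[OF \<phi> this] show ?thesis by (simp add: comp_def \<phi>_def)
 qed
 show "distr (plaw x (Suc t) (h t) i) X \<phi> =
    (if i = 1 then return X ((lineages t h 1)(Suc t := x (Suc t))) else mix t (lineages t h))"
 proof (cases "i = 1")
  case True
  have "(1, x (Suc t)) \<in> space (PS)"
   using one coord_space[OF x St] by (auto simp: particle_space_def space_pair_measure)
  from distr_return[OF \<phi> this] show ?thesis using True by (simp add: particle_law_def \<phi>_def)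
 next
  case i: False
  show ?thesis
  proof (cases "t = 0")
   case True
   \<comment> \<open>At time 0 all lineages are \<open>base\<close> and all weights are 1, so the
     selection has no effect and \<open>mix\<close> is the initial draw.\<close>
   have Lb: "lineages t h k = base" if "k \<in> {1..N}" for k
    using that True by (auto simp: lineages_def base_def fun_eq_iff)
   have "distr (plaw x (Suc t) (h t) i) X \<phi> = distr M1 X (\<lambda>w. (lineages t h 1)(Suc t := w))"
    using mvd[OF _ one, of M1] i True M1 by (simp add: particle_law_def space_prob_algebra)
   also have "... = mv 0 base" using Lb[OF one] True by (simp add: mv_def)
   also have "... = mix t (lineages t h)"
   proof -
    have s: "select_index N (\<lambda>k. wt t (lineages t h k)) \<in> space (prob_algebra (count_space {1..N}))"
     by (rule measurable_space[OF select_wt_measurable L]) (use t in simp)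
    have "mix t (lineages t h) = select_index N (\<lambda>k. wt t (lineages t h k)) \<bind> (\<lambda>k. mv 0 base)"
     unfolding mix_def by (rule bind_cong) (use Lb True in \<open>auto simp: space_select_index\<close>)
    also have "... = mv 0 base"
     using prob_kernelD(1)[OF mv_measurable[of 0] base_space] T s
     by (intro bind_const') (auto simp: space_prob_algebra intro: prob_space_imp_subprob_space)
    finally show ?thesis by simp
   qed
   finally show ?thesis using i by simp
  next
   case False
   then have tt: "t \<in> {1..T}" "Suc t \<in> {2..T}" using t by auto
   have snd_eq: "snd (h t k) = lineages t h k t" if "k \<in> {1..N}" for k
    using that tt by (simp add: lineages_def)
   let ?s = "select_index N (\<lambda>k. wt t (lineages t h k))"
   have sel: "select_index N (\<lambda>k. G t (snd (h t k))) = ?s"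
   proof -
    have "(\<Sum>j=1..N. G t (snd (h t j))) = (\<Sum>j=1..N. wt t (lineages t h j))"
     using snd_eq False by (intro sum.cong) (auto simp: wt_def)
    then show ?thesis unfolding select_index_def point_measure_def
     by (intro density_cong) (use snd_eq False in \<open>auto simp: AE_count_space wt_def\<close>)
   qed
   have s: "?s \<in> space (prob_algebra (count_space {1..N}))"
    by (rule measurable_space[OF select_wt_measurable L]) (use t in simp)
   have Mk: "M (Suc t) (snd (h t k)) \<in> space (prob_algebra Z)" if "k \<in> {1..N}" for k
    using measurable_space[OF M[OF tt(2)] coord_space[OF Lk[OF that] tt(1)]] snd_eq[OF that] by simp
   have km: "(\<lambda>k. distr (M (Suc t) (snd (h t k))) (PS) (\<lambda>z. (k, z))) \<in> ?s \<rightarrow>\<^sub>M subprob_algebra (PS)"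
   proof (rule measurable_prob_algebraD)
    have "distr (M (Suc t) (snd (h t k))) (PS) (\<lambda>z. (k, z)) \<in> space (prob_algebra (PS))" if "k \<in> {1..N}" for k
     by (rule measurable_space[OF measurable_distr_prob_space[OF Pair_particle_measurable[OF that]] Mk[OF that]])
    then show "(\<lambda>k. distr (M (Suc t) (snd (h t k))) (PS) (\<lambda>z. (k, z))) \<in> ?s \<leadsto> (PS)"
     unfolding measurable_cong_sets[OF sets_select_index refl] by auto
   qed
   have "distr (plaw x (Suc t) (h t) i) X \<phi> =
     distr (?s \<bind> (\<lambda>k. distr (M (Suc t) (snd (h t k))) (PS) (\<lambda>z. (k, z)))) X \<phi>"
    using i False sel by (simp add: particle_law_def)
   also have "... = ?s \<bind> (\<lambda>k. distr (distr (M (Suc t) (snd (h t k))) (PS) (\<lambda>z. (k, z))) X \<phi>)"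
    by (rule distr_bind[OF km _ \<phi>]) (use N in \<open>auto simp: space_select_index\<close>)
   also have "... = mix t (lineages t h)"
    unfolding mix_def
    by (rule bind_cong) (use mvd Mk snd_eq False in \<open>auto simp: space_select_index mv_def space_prob_algebra\<close>)
   finally show ?thesis using i by simp
  qed
 qed
qed

text \<open>Given the history, the new particles are independent and each determines its own lineage
  through one and the same map. Hence the image of their product law is the product of the images
  found in \<open>distr_particle_law\<close>.\<close>

lemma distr_history_lineages:
 "t \<le> T ==> x \<in> space X ==> distr (hist x t) Tup (lineages t) = C t x"
proof (induction t)
 case 0
 have "{1..0::nat} = {}" by simp
 then have u: "(\<lambda>_. undefined) \<in> space (Hist 0)" unfolding space_PiM by (simp only: \<open>{1..0::nat} = {}\<close> PiE_empty_domain singletonI)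
 have "lineages 0 (\<lambda>_. undefined) = (\<lambda>i\<in>{1..N}. base)" by (auto simp: lineages_def base_def fun_eq_iff)
 then show ?case using distr_return[OF lineages_measurable u] by simp
next
 case (Suc t)
 then have t: "t < T" by simp
 let ?P = "hist x t"
 let ?K = "\<lambda>h. distr (PiM {1..N} (plaw x (Suc t) (h t))) (Hist (Suc t)) (\<lambda>g. h(Suc t := g))"
 have P: "?P \<in> space (prob_algebra (Hist t))" using history_prob[of t x] Suc by simp
 have sP: "sets ?P = sets (Hist t)" and pP: "prob_space ?P" using P by (auto simp: space_prob_algebra)
 have neP: "space ?P \<noteq> {}" using pP by (rule prob_space.not_empty)
 have xt: "x (Suc t) \<in> space Z" using coord_space[OF Suc.prems(2), of "Suc t"] t by simp
 have PLp: "PiM {1..N} (plaw x (Suc t) (h t)) \<in> space (prob_algebra (GS))" if "h \<in> space (Hist t)" for h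
  using particle_law_prob[OF t Suc.prems(2) that] unfolding space_prob_algebra generation_space_def
  by (auto intro!: prob_space_PiM sets_PiM_cong)
 have upd: "(\<lambda>(h, g). h(Suc t := g)) \<in> Hist t \<Otimes>\<^sub>M GS \<rightarrow>\<^sub>M Hist (Suc t)"
  using measurable_fun_upd_PiM[of "Suc t" "{1..t}" "\<lambda>_. GS"] by (simp add: atLeastAtMostSuc_conv)
 have Km: "?K \<in> Hist t \<leadsto> (Hist (Suc t))"
 proof (rule measurable_distr_prob_space2[OF _ upd])
  show "(\<lambda>h. PiM {1..N} (plaw x (Suc t) (h t))) \<in> Hist t \<leadsto> (GS)"
   unfolding generation_space_def
  proof (rule PiM_kernel_measurable)
   fix i
   show "(\<lambda>h. plaw x (Suc t) (h t) i) \<in> PiM {1..t} (\<lambda>_. PiM {1..N} (\<lambda>_. PS)) \<leadsto> (PS)"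
    unfolding generation_space_def[symmetric]
   proof (rule particle_law_measurable[OF N, where ?M1.0="\<lambda>_. M1" and M="\<lambda>_. M" and G="\<lambda>_. G" and x="\<lambda>_. x" and prev="\<lambda>h. h t"])
    fix k assume k: "2 \<le> Suc t" "k \<in> {1..N}"
    have a: "(\<lambda>h. h t) \<in> Hist t \<rightarrow>\<^sub>M GS" using k by (intro measurable_component_singleton) auto
    have b: "(\<lambda>g. g k) \<in> GS \<rightarrow>\<^sub>M PS"
     unfolding generation_space_def using k by (intro measurable_component_singleton)
    have c: "snd \<in> PS \<rightarrow>\<^sub>M Z" unfolding particle_space_def by simp
    show "(\<lambda>h. snd (h t k)) \<in> Hist t \<rightarrow>\<^sub>M Z" by (rule measurable_compose[OF measurable_compose[OF a b] c])
   qed (use t M1 M G Gnn xt in \<open>auto intro!: measurable_param_const\<close>)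
  qed simp
 qed
 have "distr (hist x (Suc t)) Tup (lineages (Suc t)) = ?P \<bind> (\<lambda>h. distr (?K h) Tup (lineages (Suc t)))"
  unfolding csmc_history.simps(2)
  by (rule distr_bind[OF _ neP lineages_measurable])
    (use Km sP in \<open>auto intro!: measurable_prob_algebraD cong: measurable_cong_sets\<close>)
 also have "... = ?P \<bind> (\<lambda>h. stp t (x (Suc t)) (lineages t h))"
 proof (rule bind_cong[OF refl])
  fix h assume "h \<in> space ?P"
  then have h: "h \<in> space (Hist t)" using sets_eq_imp_space_eq[OF sP] by simp
  let ?PL = "plaw x (Suc t) (h t)"
  let ?\<phi> = "\<lambda>q. (lineages t h (fst q))(Suc t := snd q)"
  note D = distr_particle_law[OF t Suc.prems(2) h]
  have PL: "prob_space (?PL i)" "sets (?PL i) = sets (PS)" for i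
   using particle_law_prob[OF t Suc.prems(2) h, of i] by (auto simp: space_prob_algebra)
  have sPL: "sets (PiM {1..N} ?PL) = sets (GS)" using PLp[OF h] by (simp add: space_prob_algebra)
  have um: "(\<lambda>g. h(Suc t := g)) \<in> PiM {1..N} ?PL \<rightarrow>\<^sub>M Hist (Suc t)"
   unfolding measurable_cong_sets[OF sPL refl] by (rule measurable_param_section[OF upd h])
  have "distr (?K h) Tup (lineages (Suc t)) = distr (PiM {1..N} ?PL) Tup (\<lambda>g. lineages (Suc t) (h(Suc t := g)))"
   using distr_distr[OF lineages_measurable um] by (simp add: comp_def)
  also have "... = distr (PiM {1..N} ?PL) Tup (compose {1..N} ?\<phi>)"
  proof (rule distr_cong[OF refl refl])
   fix g assume "g \<in> space (PiM {1..N} ?PL)"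
   then have g: "g \<in> space (GS)" using sets_eq_imp_space_eq[OF sPL] by simp
   show "lineages (Suc t) (h(Suc t := g)) = compose {1..N} ?\<phi> g"
   proof
    fix i
    show "lineages (Suc t) (h(Suc t := g)) i = compose {1..N} ?\<phi> g i"
    proof (cases "i \<in> {1..N}")
     case True
     then have "g i \<in> space (PS)" using g by (auto simp: generation_space_def space_PiM)
     then have "fst (g i) \<in> {1..N}" by (auto simp: particle_space_def space_pair_measure)
     from lineages_upd[OF t True, of g h, OF this] show ?thesis using True by (simp add: compose_def)
    next
     case False
     then show ?thesis unfolding compose_def lineages_def by (simp only: restrict_apply if_False)
    qed
   qed
  qed
  also have "... = PiM {1..N} (\<lambda>i. distr (?PL i) X ?\<phi>)"
  proof -
   \<comment> \<open>Only the sigma-algebra of this measure matters: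
     \<open>distr_PiM_finite_prob_space'\<close> wants a probability on the target space.\<close>
   let ?R = "return X base"
   have "distr (PiM {1..N} ?PL) Tup (compose {1..N} ?\<phi>) = distr (PiM {1..N} ?PL) (PiM {1..N} (\<lambda>_. ?R)) (compose {1..N} ?\<phi>)"
    by (intro distr_cong sets_PiM_cong) auto
   also have "... = PiM {1..N} (\<lambda>i. distr (?PL i) ?R ?\<phi>)"
   proof (rule distr_PiM_finite_prob_space')
    show "?\<phi> \<in> ?PL i \<rightarrow>\<^sub>M ?R" for i
     using D(1) PL(2)[of i] by (simp cong: measurable_cong_sets)
   qed (use PL base_space in \<open>auto intro: prob_space_return\<close>)
   also have "... = PiM {1..N} (\<lambda>i. distr (?PL i) X ?\<phi>)"
    by (intro PiM_cong distr_cong) auto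
   finally show ?thesis .
  qed
  also have "... = stp t (x (Suc t)) (lineages t h)" unfolding stp_def D(2) ..
  finally show "distr (?K h) Tup (lineages (Suc t)) = stp t (x (Suc t)) (lineages t h)" .
 qed
 also have "... = distr ?P Tup (lineages t) \<bind> stp t (x (Suc t))"
  by (rule bind_distr[symmetric, OF _ measurable_prob_algebraD[OF stp_measurable1[OF t xt]] neP])
    (use lineages_measurable[of t] sP in \<open>simp cong: measurable_cong_sets\<close>)
 also have "... = C (Suc t) x" using Suc by simp
 finally show ?case .
qed

text \<open>The conditional expectation of f at the output path, given the N paths at time
  T.\<close>

definition Sel :: "((nat => 'z) => ennreal) => (nat => nat => 'z) => ennreal" where
 "Sel f u = (\<integral>\<^sup>+k. f (u k) \<partial>select_index N (\<lambda>k. wt T (u k)))"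

lemma Sel_eq:
 assumes "u \<in> space Tup" "tot T u \<noteq> 0"
 shows "Sel f u = (\<Sum>k=1..N. ennreal (wt T (u k)) * f (u k)) * inverse (tot T u)"
 using assms unfolding Sel_def tot_def
 by (subst nn_integral_select_index[OF _ N]) (auto intro!: wt_nonneg particle_space_Tup)

lemma Sel_measurable: "f \<in> bm X ==> Sel f \<in> bm Tup"
 unfolding Sel_def[abs_def]
 by (rule nn_integral_kernel_measurable2[OF select_wt_measurable])
   (auto intro!: measurable_pair_count_space measurable_compose[OF particle_coord_measurable])

text \<open>Removes histories and ancestor indices: from here on the kernel is handled through C and
  \<open>Sel\<close>.\<close>

lemma nn_integral_icsmc:
 assumes x: "x \<in> space X" and f: "f \<in> bm X"
 shows "nn_integral (Pk x) f = nn_integral (C T x) (Sel f)"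
proof -
 let ?P = "hist x T"
 let ?traj = "\<lambda>h k. \<lambda>t\<in>{1..T}. snd (h t (ancestor h T k (T - t)))"
 have sP: "sets ?P = sets (Hist T)" using history_prob[OF order_refl x] by (simp add: space_prob_algebra)
 have km: "(\<lambda>h. select_index N (\<lambda>k. G T (snd (h T k))) \<bind> (\<lambda>k. return X (?traj h k))) \<in> Hist T \<leadsto> X"
  using T G Gnn
  by (intro measurable_param_section[OF terminal_selection_measurable[of N T "\<lambda>_. G" "count_space {()}" Z], of "()"])
    (auto simp: N intro!: measurable_param_const)
 have "nn_integral (Pk x) f =
   (\<integral>\<^sup>+h. \<integral>\<^sup>+y. f y \<partial>(select_index N (\<lambda>k. G T (snd (h T k))) \<bind> (\<lambda>k. return X (?traj h k))) \<partial>?P)"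
  unfolding icsmc_def by (rule nn_integral_kernel_bind[OF sP km f])
 also have "... = (\<integral>\<^sup>+h. Sel f (lineages T h) \<partial>?P)"
 proof (rule nn_integral_cong)
  fix h assume "h \<in> space ?P"
  then have h: "h \<in> space (Hist T)" using sets_eq_imp_space_eq[OF sP] by simp
  have L: "lineages T h \<in> space Tup" by (rule measurable_space[OF lineages_measurable h])
  have tr: "?traj h k = lineages T h k" if "k \<in> {1..N}" for k
   using that by (auto simp: lineages_def fun_eq_iff)
  have trs: "?traj h k \<in> space X" if "k \<in> {1..N}" for k
   using particle_space_Tup[OF L that] tr[OF that] by simp
  have sel: "select_index N (\<lambda>k. G T (snd (h T k))) = select_index N (\<lambda>k. wt T (lineages T h k))"
  proof -
   have snd_eq: "snd (h T k) = lineages T h k T" if "k \<in> {1..N}" for k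
    using that T by (simp add: lineages_def)
   have "(\<Sum>j=1..N. G T (snd (h T j))) = (\<Sum>j=1..N. wt T (lineages T h j))"
    using snd_eq T by (intro sum.cong) (auto simp: wt_def)
   then show ?thesis unfolding select_index_def point_measure_def
    by (intro density_cong) (use snd_eq T in \<open>auto simp: AE_count_space wt_def\<close>)
  qed
  have "(\<lambda>k. return X (?traj h k)) \<in> count_space {1..N} \<leadsto> X"
   using measurable_space[OF measurable_return_prob_space trs] by auto
  then have "nn_integral (select_index N (\<lambda>k. G T (snd (h T k))) \<bind> (\<lambda>k. return X (?traj h k))) f =
    (\<integral>\<^sup>+k. \<integral>\<^sup>+y. f y \<partial>return X (?traj h k) \<partial>select_index N (\<lambda>k. G T (snd (h T k))))"
   by (rule nn_integral_kernel_bind[OF sets_select_index _ f])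
  also have "... = (\<integral>\<^sup>+k. f (lineages T h k) \<partial>select_index N (\<lambda>k. G T (snd (h T k))))"
   by (intro nn_integral_cong) (simp add: nn_integral_return[OF particle_space_Tup[OF L] f] tr space_select_index)
  also have "... = (\<integral>\<^sup>+k. f (lineages T h k) \<partial>select_index N (\<lambda>k. wt T (lineages T h k)))" by (simp only: sel)
  finally show "nn_integral (select_index N (\<lambda>k. G T (snd (h T k))) \<bind> (\<lambda>k. return X (?traj h k))) f = Sel f (lineages T h)"
   unfolding Sel_def .
 qed
 also have "... = nn_integral (distr ?P Tup (lineages T)) (Sel f)"
  by (rule nn_integral_distr[symmetric]) (use lineages_measurable[of T] sP Sel_measurable[OF f] in \<open>auto cong: measurable_cong_sets\<close>)
 also have "... = nn_integral (C T x) (Sel f)" unfolding distr_history_lineages[OF order_refl x] ..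
 finally show ?thesis .
qed

end

subsection \<open>Reversibility and positivity\<close>

lemma measurable_param_section2:
 assumes "(\<lambda>(a, z). f a z) \<in> A \<Otimes>\<^sub>M B \<rightarrow>\<^sub>M L" "z \<in> space B" shows "(\<lambda>a. f a z) \<in> A \<rightarrow>\<^sub>M L"
 using measurable_compose[OF measurable_Pair2'[OF assms(2)] assms(1)] by simp

context particle_model
begin

abbreviation "XX \<equiv> X \<Otimes>\<^sub>M X"
abbreviation "XTup \<equiv> X \<Otimes>\<^sub>M Tup"

text \<open>The law of the underlying Markov chain up to time t, as a path padded with
  \<open>z0\<close>.\<close>

primrec Y where
 "Y 0 = return X base"
| "Y (Suc t) = Y t \<bind> mv t"

definition Wp where "Wp t e = (\<Prod>s<t. ennreal (wt s e))"

lemma Wp_Suc: "Wp (Suc t) e = Wp t e * ennreal (wt t e)"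
 by (simp add: Wp_def)

lemma wt_upd: "s \<le> t ==> wt s (e(Suc t := w)) = wt s e"
 by (simp add: wt_def)

lemma Wp_upd: "s \<le> Suc t ==> Wp s (e(Suc t := w)) = Wp s e"
 unfolding Wp_def by (intro prod.cong) (auto simp: wt_upd)

lemma wt_trunc: "t \<le> T ==> wt t (trunc t e) = wt t e"
 by (auto simp: wt_def trunc_def One_nat_def)

lemma Wp_measurable: "t \<le> Suc T ==> Wp t \<in> bm X"
 unfolding Wp_def[abs_def]
 by (intro borel_measurable_prod_ennreal comp_ennreal wt_measurable) auto

lemma Y_prob: "t \<le> T ==> Y t \<in> space (prob_algebra X)"
proof (induction t)
 case 0
 then show ?case using measurable_space[OF measurable_return_prob_space base_space] by simp
next
 case (Suc t)
 then have y: "Y t \<in> space (prob_algebra X)" and m: "mv t \<in> X \<leadsto> X" by (auto intro: mv_measurable)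
 show ?case using prob_space_bind'[OF y m] sets_bind'[OF y m] by (simp add: space_prob_algebra)
qed

lemma sets_Y: "t \<le> T ==> sets (Y t) = sets X" using Y_prob[of t] by (simp add: space_prob_algebra)

lemma space_Y: "t \<le> T ==> space (Y t) = space X" by (rule sets_eq_imp_space_eq[OF sets_Y])

lemma nn_integral_Y_Suc: "t < T ==> F \<in> bm X ==> nn_integral (Y (Suc t)) F = (\<integral>\<^sup>+e. \<integral>\<^sup>+a. F a \<partial>mv t e \<partial>Y t)"
 using nn_integral_kernel_bind[OF sets_Y mv_measurable] by simp

lemma nn_integral_path_law:
 assumes t: "1 \<le> t" "t \<le> T" and F: "F \<in> bm X"
 shows "(\<integral>\<^sup>+y. F (trunc t y) \<partial>path_law Z t M1 M) = nn_integral (Y t) F"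
 using t F
proof (induction t arbitrary: F)
 case (Suc t)
 then have tT: "t < T" by simp
 have trF: "(\<lambda>y. F (trunc (Suc t) y)) \<in> bm (PiM {1..Suc t} (\<lambda>_. Z))"
  by (rule measurable_compose[OF trunc_measurable Suc.prems(3)]) simp
 show ?case
 proof (cases "t = 0")
  case True
  have "(\<integral>\<^sup>+y. F (trunc (Suc t) y) \<partial>path_law Z (Suc t) M1 M) = (\<integral>\<^sup>+z. F (trunc (Suc t) (\<lambda>i\<in>{1}. z)) \<partial>M1)"
   using nn_integral_path_law_1[OF M1, of "\<lambda>y. F (trunc (Suc t) y)" M] trF True by (simp add: One_nat_def)
  also have "... = (\<integral>\<^sup>+z. F (base(Suc t := z)) \<partial>M1)"
  proof -
   have "trunc (Suc t) (\<lambda>i\<in>{1}. z) = base(Suc t := z)" for z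
    using tT True trunc_Suc[of t "\<lambda>i\<in>{1}. z"] trunc_0[of "\<lambda>i\<in>{1}. z"] by (simp add: One_nat_def)
   then show ?thesis by simp
  qed
  also have "... = nn_integral (Y (Suc t)) F"
  proof -
   have m: "(\<lambda>e. \<integral>\<^sup>+a. F a \<partial>mv t e) \<in> bm X"
    by (rule nn_integral_kernel_measurable[OF mv_measurable[OF tT] Suc.prems(3)])
   have e: "nn_integral (mv t base) F = (\<integral>\<^sup>+w. F (base(Suc t := w)) \<partial>M1)"
    using nn_integral_mv[OF tT base_space Suc.prems(3)] unfolding if_P[OF True] .
   have "Y t = return X base" using True by simp
   then show ?thesis unfolding nn_integral_Y_Suc[OF tT Suc.prems(3)]
    by (simp only: nn_integral_return[OF base_space m] e)
  qed
  finally show ?thesis .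
 next
  case False
  then have t1: "1 \<le> t" by simp
  have "(\<integral>\<^sup>+y. F (trunc (Suc t) y) \<partial>path_law Z (Suc t) M1 M) =
    (\<integral>\<^sup>+y. \<integral>\<^sup>+w. F (trunc (Suc t) (y(Suc t := w))) \<partial>M (Suc t) (y t) \<partial>path_law Z t M1 M)"
   by (rule nn_integral_path_law_Suc[OF t1 M1 M trF]) (use tT in auto)
  also have "... = (\<integral>\<^sup>+y. \<integral>\<^sup>+a. F a \<partial>mv t (trunc t y) \<partial>path_law Z t M1 M)"
  proof (rule nn_integral_cong)
   fix y assume "y \<in> space (path_law Z t M1 M)"
   moreover have "path_law Z t M1 M \<in> space (prob_algebra (PiM {1..t} (\<lambda>_. Z)))"
    by (rule path_law_prob[OF t1 M1 M]) (use tT in auto)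
   ultimately have y: "y \<in> space (PiM {1..t} (\<lambda>_. Z))"
    by (auto simp: space_prob_algebra dest: sets_eq_imp_space_eq)
   have ty: "trunc t y \<in> space X" by (rule measurable_space[OF trunc_measurable y]) simp
   have "trunc (Suc t) (y(Suc t := w)) = (trunc t y)(Suc t := w)" for w
    using tT by (auto simp: trunc_def fun_eq_iff)
   moreover have "trunc t y t = y t" using t1 tT by (simp add: trunc_def)
   moreover have "nn_integral (mv t (trunc t y)) F = (\<integral>\<^sup>+w. F ((trunc t y)(Suc t := w)) \<partial>M (Suc t) (trunc t y t))"
    using nn_integral_mv[OF tT ty Suc.prems(3)] unfolding if_not_P[OF False] .
   ultimately show "(\<integral>\<^sup>+w. F (trunc (Suc t) (y(Suc t := w))) \<partial>M (Suc t) (y t)) = nn_integral (mv t (trunc t y)) F"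
    by (simp only:)
  qed
  also have "... = nn_integral (Y (Suc t)) F"
   unfolding nn_integral_Y_Suc[OF tT Suc.prems(3)]
   by (rule Suc.IH[OF t1]) (use tT in \<open>auto intro: nn_integral_kernel_measurable[OF mv_measurable[OF tT] Suc.prems(3)]\<close>)
  finally show ?thesis .
 qed
qed simp

lemma path_law_eq_Y: "F \<in> bm X ==> nn_integral (path_law Z T M1 M) F = nn_integral (Y T) F"
proof -
 assume F: "F \<in> bm X"
 have "path_law Z T M1 M \<in> space (prob_algebra X)" by (rule path_law_prob[OF T M1 M])
 then have "space (path_law Z T M1 M) = space X" by (auto simp: space_prob_algebra dest: sets_eq_imp_space_eq)
 then have "nn_integral (path_law Z T M1 M) F = (\<integral>\<^sup>+y. F (trunc T y) \<partial>path_law Z T M1 M)"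
  by (intro nn_integral_cong) (simp add: trunc_T)
 then show ?thesis using nn_integral_path_law[OF T order_refl F] by simp
qed

lemma C_prob: "t \<le> T ==> e \<in> space X ==> prob_space (C t e)" "t \<le> T ==> e \<in> space X ==> sets (C t e) = sets Tup"
 "t \<le> T ==> e \<in> space X ==> space (C t e) = space Tup"
 using prob_kernelD[OF C_measurable[of t T]] by auto

text \<open>
 \<open>\<Lambda> t F\<close> integrates \<open>F\<close> over the reference path together with the particles generated conditionally on
 it, weighted with the potentials of the reference path before time \<open>t\<close>.
\<close>

definition \<Lambda> :: "nat => ((nat => 'z) => (nat => nat => 'z) => ennreal) => ennreal" where
 "\<Lambda> t F = (\<integral>\<^sup>+e. Wp t e * (\<integral>\<^sup>+u. F (u 1) u \<partial>C t e) \<partial>Y t)"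

text \<open>The backward form of one time step: a path b serves as reference with weight
  \<open>wt t b\<close>, is moved to a, and a is planted as particle 1 of the next generation.
  Tuples of total weight 0 are discarded, since the default index would spoil symmetry
  there.\<close>

definition Lop :: "nat => ((nat => 'z) => (nat => nat => 'z) => ennreal) => (nat => 'z) => (nat => nat => 'z) => ennreal" where
 "Lop t F b u = (if tot t u = 0 then 0 else
   ennreal (wt t b) * (\<integral>\<^sup>+a. \<integral>\<^sup>+p. F a (p(1 := a)) \<partial>PiM {2..N} (\<lambda>_. mix t u) \<partial>mv t b))"

lemma diag_measurable:
 assumes F: "(\<lambda>(a, u). F a u) \<in> bm XTup"
 shows "(\<lambda>u. F (u 1) u) \<in> bm Tup"
proof -
 have "(\<lambda>u. (u 1, u)) \<in> Tup \<rightarrow>\<^sub>M X \<Otimes>\<^sub>M Tup" using N by (intro measurable_Pair particle_coord_measurable) auto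
 from measurable_compose[OF this F] show ?thesis by simp
qed

lemma inner_measurable:
 assumes F: "(\<lambda>(a, u). F a u) \<in> bm XTup" and t: "t < T"
 shows "(\<lambda>(a, u). \<integral>\<^sup>+p. F a (p(1 := a)) \<partial>PiM {2..N} (\<lambda>_. mix t u)) \<in> bm XTup"
 unfolding case_prod_beta'
proof (rule nn_integral_kernel_measurable2[OF comp_snd[OF PiM_mix_measurable[OF t]]])
 have "(\<lambda>q. (fst (fst q), (snd q)(1 := fst (fst q)))) \<in> XTup \<Otimes>\<^sub>M PiM {2..N} (\<lambda>_. X) \<rightarrow>\<^sub>M X \<Otimes>\<^sub>M Tup"
  unfolding index_set
  by (intro measurable_Pair comp_fst[OF measurable_fst]
    measurable_fun_upd[where J="{2..N}"] measurable_snd) auto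
 from measurable_compose[OF this F]
 show "(\<lambda>(q, p). F (fst q) (p(1 := fst q))) \<in> bm (XTup \<Otimes>\<^sub>M PiM {2..N} (\<lambda>_. X))"
  by (simp add: case_prod_beta')
qed simp

lemma Lop_measurable:
 assumes F: "(\<lambda>(a, u). F a u) \<in> bm XTup" and t: "t < T"
 shows "(\<lambda>(b, u). Lop t F b u) \<in> bm XTup"
proof -
 have "(\<lambda>q. \<integral>\<^sup>+a. \<integral>\<^sup>+p. F a (p(1 := a)) \<partial>PiM {2..N} (\<lambda>_. mix t (snd q)) \<partial>mv t (fst q)) \<in> bm XTup"
 proof (rule nn_integral_kernel_measurable2[OF comp_fst[OF mv_measurable[OF t]]])
  have "(\<lambda>r. (snd r, snd (fst r))) \<in> XTup \<Otimes>\<^sub>M X \<rightarrow>\<^sub>M X \<Otimes>\<^sub>M Tup"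
   by (intro measurable_Pair measurable_snd comp_fst[OF measurable_snd])
  from measurable_compose[OF this inner_measurable[OF F t]]
  show "(\<lambda>(q, a). \<integral>\<^sup>+p. F a (p(1 := a)) \<partial>PiM {2..N} (\<lambda>_. mix t (snd q))) \<in> bm (XTup \<Otimes>\<^sub>M X)"
   by (simp add: case_prod_beta')
 qed
 moreover have "(\<lambda>q. ennreal (wt t (fst q))) \<in> bm XTup"
  using t by (intro comp_ennreal comp_fst[OF wt_measurable]) simp
 moreover have "Measurable.pred XTup (\<lambda>q. tot t (snd q) = 0)"
  using t comp_snd[OF tot_measurable[of t], of X]
  by (intro pred_eq_const1) auto
 ultimately show ?thesis unfolding Lop_def case_prod_beta' by (intro measurable_If borel_measurable_times_ennreal) auto
qed

lemma tot_0_iff: "t \<le> T ==> u \<in> space Tup ==> tot t u = 0 ==> k \<in> {1..N} ==> ennreal (wt t (u k)) = 0"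
 unfolding tot_def by (simp add: sum_eq_0_iff)

text \<open>The particles up to time t depend on the reference path only up to t, so by Fubini they
  can be drawn before the reference path is moved on. The reference at time t is then read off as
  particle 1.\<close>

lemma \<Lambda>_Suc:
 assumes F: "(\<lambda>(a, u). F a u) \<in> bm XTup" and t: "t < T"
 shows "\<Lambda> (Suc t) F = \<Lambda> t (Lop t F)"
proof -
 let ?m = "\<lambda>e. if t = 0 then M1 else M (Suc t) (e t)"
 define \<Psi> where "\<Psi> = (\<lambda>w a u. \<integral>\<^sup>+p. F (a(Suc t := w)) (p(1 := a(Suc t := w))) \<partial>PiM {2..N} (\<lambda>_. mix t u))"
 \<comment> \<open>The argument b holds the reference path for the weight and the move. It is kept
   apart from the tuple so that \<open>nn_integral_C_reference\<close> can trade it for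
   \<open>u 1\<close>.\<close>
 define Kf where "Kf = (\<lambda>b u. ennreal (wt t b) * (\<integral>\<^sup>+w. \<Psi> w (u 1) u \<partial>?m b))"
 have tT: "t \<le> T" "Suc t \<le> T" "Suc t \<in> {1..T}" using t by auto
 have \<Psi>m: "(\<lambda>(q, w). \<Psi> w (fst q) (snd q)) \<in> bm (XTup \<Otimes>\<^sub>M Z)"
 proof -
  have "(\<lambda>r. (fst (fst r), snd r)) \<in> XTup \<Otimes>\<^sub>M Z \<rightarrow>\<^sub>M X \<Otimes>\<^sub>M Z"
   by (intro measurable_Pair measurable_snd comp_fst[OF measurable_fst])
  from measurable_compose[OF this upd_measurable[OF tT(3)]]
  have "(\<lambda>r. ((fst (fst r))(Suc t := snd r), snd (fst r))) \<in> XTup \<Otimes>\<^sub>M Z \<rightarrow>\<^sub>M X \<Otimes>\<^sub>M Tup"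
   by (intro measurable_Pair) (auto simp: case_prod_beta')
  from measurable_compose[OF this inner_measurable[OF F t]] show ?thesis by (simp add: \<Psi>_def case_prod_beta')
 qed
 have \<Psi>d: "(\<lambda>(w, u). \<Psi> w (u 1) u) \<in> bm (Z \<Otimes>\<^sub>M Tup)"
 proof -
  have "(\<lambda>r. ((snd r 1, snd r), fst r)) \<in> Z \<Otimes>\<^sub>M Tup \<rightarrow>\<^sub>M XTup \<Otimes>\<^sub>M Z"
   using N by (intro measurable_Pair measurable_snd measurable_fst comp_snd[OF particle_coord_measurable]) auto
  from measurable_compose[OF this \<Psi>m] show ?thesis by (simp add: case_prod_beta')
 qed
 have Kfm: "(\<lambda>(b, u). Kf b u) \<in> bm XTup"
  unfolding Kf_def case_prod_beta'
 proof (intro borel_measurable_times_ennreal)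
  show "(\<lambda>q. ennreal (wt t (fst q))) \<in> bm XTup"
   using t by (intro comp_ennreal comp_fst[OF wt_measurable]) simp
  have "(\<lambda>r. (snd r, snd (fst r))) \<in> XTup \<Otimes>\<^sub>M Z \<rightarrow>\<^sub>M Z \<Otimes>\<^sub>M Tup"
   by (intro measurable_Pair measurable_snd comp_fst[OF measurable_snd])
  from measurable_compose[OF this \<Psi>d]
  show "(\<lambda>q. \<integral>\<^sup>+w. \<Psi> w (snd q 1) (snd q) \<partial>?m (fst q)) \<in> bm XTup"
   by (intro nn_integral_kernel_measurable2[OF comp_fst[OF move_law_measurable[OF t]]])
     (simp add: case_prod_beta')
 qed
 have CFm: "(\<lambda>e. Wp (Suc t) e * (\<integral>\<^sup>+u. F (u 1) u \<partial>C (Suc t) e)) \<in> bm X"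
  using t by (intro borel_measurable_times_ennreal Wp_measurable nn_integral_kernel_measurable[OF C_measurable] diag_measurable F) auto
 have "\<Lambda> (Suc t) F = (\<integral>\<^sup>+e. \<integral>\<^sup>+a. Wp (Suc t) a * (\<integral>\<^sup>+u. F (u 1) u \<partial>C (Suc t) a) \<partial>mv t e \<partial>Y t)"
  unfolding \<Lambda>_def by (rule nn_integral_Y_Suc[OF t CFm])
 also have "... = (\<integral>\<^sup>+e. Wp t e * (\<integral>\<^sup>+u. Kf (trunc t e) u \<partial>C t e) \<partial>Y t)"
 proof (rule nn_integral_cong)
  fix e assume "e \<in> space (Y t)"
  then have e: "e \<in> space X" using space_Y tT by simp
  note m = prob_kernelD[OF move_law_measurable[OF t] e]
  have C1: "(\<integral>\<^sup>+u. F (u 1) u \<partial>C (Suc t) (e(Suc t := w))) = (\<integral>\<^sup>+u. \<Psi> w (u 1) u \<partial>C t e)" if w: "w \<in> space Z" for w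
  proof -
   have ew: "e(Suc t := w) \<in> space X" by (rule upd_space[OF tT(3) e w])
   have "C t (e(Suc t := w)) = C t e" by (rule C_cong) auto
   then show ?thesis unfolding \<Psi>_def using nn_integral_C_Suc[OF tT(2) order_refl ew diag_measurable[OF F]] by simp
  qed
  have \<Psi>de: "(\<lambda>(w, u). \<Psi> w (u 1) u) \<in> bm (?m e \<Otimes>\<^sub>M C t e)"
   using \<Psi>d sets_pair_measure_cong[OF m(2) C_prob(2)[OF tT(1) e]] by (simp cong: measurable_cong_sets)
  have "(\<integral>\<^sup>+a. Wp (Suc t) a * (\<integral>\<^sup>+u. F (u 1) u \<partial>C (Suc t) a) \<partial>mv t e) =
    (\<integral>\<^sup>+w. Wp (Suc t) (e(Suc t := w)) * (\<integral>\<^sup>+u. F (u 1) u \<partial>C (Suc t) (e(Suc t := w))) \<partial>?m e)"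
   by (rule nn_integral_mv[OF t e CFm])
  also have "... = (\<integral>\<^sup>+w. Wp t e * ennreal (wt t e) * (\<integral>\<^sup>+u. \<Psi> w (u 1) u \<partial>C t e) \<partial>?m e)"
   using m(3) by (intro nn_integral_cong) (simp add: C1 Wp_upd Wp_Suc wt_upd del: C.simps fun_upd_apply)
  also have "... = Wp t e * ennreal (wt t e) * (\<integral>\<^sup>+w. \<integral>\<^sup>+u. \<Psi> w (u 1) u \<partial>C t e \<partial>?m e)"
  proof (rule nn_integral_cmult)
   interpret c: sigma_finite_measure "C t e"
    by (rule prob_space_imp_sigma_finite[OF C_prob(1)[OF tT(1) e]])
   show "(\<lambda>w. \<integral>\<^sup>+u. \<Psi> w (u 1) u \<partial>C t e) \<in> bm (?m e)"
    by (rule c.borel_measurable_nn_integral[OF \<Psi>de])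
  qed
  also have "(\<integral>\<^sup>+w. \<integral>\<^sup>+u. \<Psi> w (u 1) u \<partial>C t e \<partial>?m e) = (\<integral>\<^sup>+u. \<integral>\<^sup>+w. \<Psi> w (u 1) u \<partial>?m e \<partial>C t e)"
  proof -
   interpret p: pair_sigma_finite "?m e" "C t e"
    by (intro pair_sigma_finite.intro prob_space_imp_sigma_finite m(1) C_prob(1)[OF tT(1) e])
   show ?thesis using p.Fubini'[OF \<Psi>de] by simp
  qed
  also have "Wp t e * ennreal (wt t e) * ... = Wp t e * (\<integral>\<^sup>+u. ennreal (wt t e) * (\<integral>\<^sup>+w. \<Psi> w (u 1) u \<partial>?m e) \<partial>C t e)"
  proof -
   have "(\<lambda>u. \<integral>\<^sup>+w. \<Psi> w (u 1) u \<partial>?m e) \<in> bm (C t e)"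
   proof -
    interpret c: sigma_finite_measure "?m e" by (rule prob_space_imp_sigma_finite[OF m(1)])
    have "(\<lambda>(u, w). \<Psi> w (u 1) u) \<in> bm (C t e \<Otimes>\<^sub>M ?m e)"
     using measurable_compose[OF measurable_pair_swap' \<Psi>de] by (simp add: case_prod_beta')
    then show ?thesis by (rule c.borel_measurable_nn_integral)
   qed
   then show ?thesis by (simp add: nn_integral_cmult mult.assoc)
  qed
  also have "... = Wp t e * (\<integral>\<^sup>+u. Kf (trunc t e) u \<partial>C t e)"
  proof -
   have "?m (trunc t e) = ?m e" using tT by (auto simp: trunc_def One_nat_def)
   then show ?thesis unfolding Kf_def wt_trunc[OF tT(1)] by simp
  qed
  finally show "(\<integral>\<^sup>+a. Wp (Suc t) a * (\<integral>\<^sup>+u. F (u 1) u \<partial>C (Suc t) a) \<partial>mv t e) = Wp t e * (\<integral>\<^sup>+u. Kf (trunc t e) u \<partial>C t e)" .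
 qed
 also have "... = (\<integral>\<^sup>+e. Wp t e * (\<integral>\<^sup>+u. Kf (u 1) u \<partial>C t e) \<partial>Y t)"
  using nn_integral_C_reference[OF tT(1) order_refl _ Kfm] space_Y[OF tT(1)]
  by (intro nn_integral_cong) simp
 also have "... = \<Lambda> t (Lop t F)"
  unfolding \<Lambda>_def
 proof (intro nn_integral_cong arg_cong2[where f="(*)"] refl)
  fix e u assume "e \<in> space (Y t)" "u \<in> space (C t e)"
  then have z: "u \<in> space Tup" using space_Y C_prob(3) tT by auto
  have one: "1 \<in> {1..N}" using N by simp
  have z1: "u 1 \<in> space X" by (rule particle_space_Tup[OF z one])
  have m: "(\<lambda>a. \<integral>\<^sup>+p. F a (p(1 := a)) \<partial>PiM {2..N} (\<lambda>_. mix t u)) \<in> bm X"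
   by (rule measurable_param_section2[OF inner_measurable[OF F t] z])
  \<comment> \<open>If the total weight is 0, so is the weight of particle 1, and both sides
    vanish.\<close>
  show "Kf (u 1) u = Lop t F (u 1) u"
   using tot_0_iff[OF tT(1) z _ one] unfolding Kf_def Lop_def \<Psi>_def nn_integral_mv[OF t z1 m] by simp
 qed
 finally show ?thesis .
qed

text \<open>In every step the average weight of the particles enters as a density, so S t need not
  be a probability. Tuples of total weight 0 get density 0, and the default index is never
  seen.\<close>

primrec S where
 "S 0 = return Tup (\<lambda>i\<in>{1..N}. base)"
| "S (Suc t) = density (S t) (\<lambda>u. tot t u / ennreal N) \<bind> (\<lambda>u. PiM {1..N} (\<lambda>_. mix t u))"

lemma base_tuple_space: "(\<lambda>i\<in>{1..N}. base) \<in> space Tup"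
 using base_space by (auto simp: space_PiM[of "{1..N}"])

lemma sets_S: "t \<le> T ==> sets (S t) = sets Tup"
proof (induction t)
 case (Suc t)
 have "space (S t) \<noteq> {}" using sets_eq_imp_space_eq[OF Suc.IH] Suc.prems base_tuple_space by (metis Suc_leD empty_iff)
 then show ?case
  unfolding S.simps by (intro sets_kernel_bind[OF _ PiM_mix_measurable]) (use Suc in auto)
qed simp

lemma space_S: "t \<le> T ==> space (S t) = space Tup" by (rule sets_eq_imp_space_eq[OF sets_S])

lemma nn_integral_S_Suc:
 assumes t: "t < T" and H: "H \<in> bm Tup"
 shows "nn_integral (S (Suc t)) H = (\<integral>\<^sup>+u. tot t u / ennreal N * nn_integral (PiM {1..N} (\<lambda>_. mix t u)) H \<partial>S t)"
proof -
 have s: "sets (S t) = sets Tup" by (rule sets_S) (use t in simp)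
 have km: "(\<lambda>u. PiM {1..N} (\<lambda>_. mix t u)) \<in> Tup \<leadsto> Tup" by (rule PiM_mix_measurable[OF t]) simp
 have "nn_integral (S (Suc t)) H = (\<integral>\<^sup>+u. nn_integral (PiM {1..N} (\<lambda>_. mix t u)) H \<partial>density (S t) (\<lambda>u. tot t u / ennreal N))"
  unfolding S.simps by (rule nn_integral_kernel_bind[OF _ km H]) (use s in simp)
 also have "... = (\<integral>\<^sup>+u. tot t u / ennreal N * nn_integral (PiM {1..N} (\<lambda>_. mix t u)) H \<partial>S t)"
  using t tot_measurable[of t] nn_integral_kernel_measurable[OF km H] s
  by (intro nn_integral_density) (auto cong: measurable_cong_sets)
 finally show ?thesis .
qed

section \<open>Exchangeability of the particles\<close>

definition swp :: "nat => nat => (nat => nat => 'z) => nat => nat => 'z" where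
 "swp j i u = (\<lambda>k\<in>{1..N}. u (Transposition.transpose j i k))"

lemma transpose_mem: "i \<in> {1..N} ==> j \<in> {1..N} ==> k \<in> {1..N} ==> Transposition.transpose j i k \<in> {1..N}"
 by (auto simp: Transposition.transpose_def)

lemma swp_measurable: "i \<in> {1..N} ==> j \<in> {1..N} ==> swp j i \<in> Tup \<rightarrow>\<^sub>M Tup"
 unfolding swp_def[abs_def] by (intro measurable_restrict particle_coord_measurable transpose_mem)

lemma swp_space: "i \<in> {1..N} ==> j \<in> {1..N} ==> u \<in> space Tup ==> swp j i u \<in> space Tup"
 by (rule measurable_space[OF swp_measurable])

lemma sum_swp:
 fixes f :: "_ => ennreal"
 assumes "i \<in> {1..N}" "j \<in> {1..N}"
 shows "(\<Sum>k=1..N. f (swp j i u k)) = (\<Sum>k=1..N. f (u k))"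
 by (rule sum.reindex_bij_witness[of _ "Transposition.transpose j i" "Transposition.transpose j i"])
   (use assms transpose_mem in \<open>auto simp: swp_def\<close>)

lemma tot_swp: "i \<in> {1..N} ==> j \<in> {1..N} ==> tot t (swp j i u) = tot t u"
 unfolding tot_def by (rule sum_swp)

text \<open>A total weight of 0 has to be excluded, since the default selection of index 1 is not
  symmetric in the particles.\<close>

lemma mix_swp:
 assumes i: "i \<in> {1..N}" "j \<in> {1..N}" and t: "t < T" and z: "u \<in> space Tup" and nz: "tot t u \<noteq> 0"
 shows "mix t (swp j i u) = mix t u"
proof (rule measure_eqI)
 have z': "swp j i u \<in> space Tup" by (rule swp_space[OF i z])
 have nz': "tot t (swp j i u) \<noteq> 0" using nz tot_swp[OF i] by simp
 note s = prob_kernelD(2)[OF mix_measurable[OF t] z] prob_kernelD(2)[OF mix_measurable[OF t] z']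
 show "sets (mix t (swp j i u)) = sets (mix t u)" using s by simp
 fix A assume "A \<in> sets (mix t (swp j i u))"
 then have A: "A \<in> sets X" using s by simp
 then have m: "indicator A \<in> bm X" by simp
 have "nn_integral (mix t (swp j i u)) (indicator A) = nn_integral (mix t u) (indicator A)"
  unfolding nn_integral_mix[OF t z' m nz'] nn_integral_mix[OF t z m nz] tot_swp[OF i]
  using sum_swp[OF i, of "\<lambda>e. ennreal (wt t e) * nn_integral (mv t e) (indicator A)"] by simp
 then show "emeasure (mix t (swp j i u)) A = emeasure (mix t u) A" using A s by simp
qed

lemma PiM_iid_swp:
 assumes i: "i \<in> {1..N}" "j \<in> {1..N}" and p: "\<And>k. k \<in> {1..N} ==> prob_space (Q k)" and s: "\<And>k. k \<in> {1..N} ==> sets (Q k) = sets X"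
  and inv: "\<And>k. k \<in> {1..N} ==> Q (Transposition.transpose j i k) = Q k" and H: "H \<in> bm Tup"
 shows "(\<integral>\<^sup>+p. H (swp j i p) \<partial>PiM {1..N} Q) = nn_integral (PiM {1..N} Q) H"
proof -
 have sQ: "sets (PiM {1..N} Q) = sets Tup" by (intro sets_PiM_cong refl s)
 have "distr (PiM {1..N} Q) (PiM {1..N} (\<lambda>k. Q (Transposition.transpose j i k))) (\<lambda>\<omega>. \<lambda>n\<in>{1..N}. \<omega> (Transposition.transpose j i n))
   = PiM {1..N} (\<lambda>k. Q (Transposition.transpose j i k))"
  by (rule distr_PiM_reindex[OF p]) (use transpose_mem[OF i] in \<open>auto simp: inj_on_def dest: arg_cong[where f="Transposition.transpose j i"]\<close>)
 moreover have "PiM {1..N} (\<lambda>k. Q (Transposition.transpose j i k)) = PiM {1..N} Q" by (intro PiM_cong refl inv)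
 ultimately have d: "distr (PiM {1..N} Q) (PiM {1..N} Q) (swp j i) = PiM {1..N} Q" by (simp add: swp_def[abs_def])
 have m: "swp j i \<in> PiM {1..N} Q \<rightarrow>\<^sub>M PiM {1..N} Q" using swp_measurable[OF i] sQ by (simp cong: measurable_cong_sets)
 have "(\<integral>\<^sup>+p. H (swp j i p) \<partial>PiM {1..N} Q) = nn_integral (distr (PiM {1..N} Q) (PiM {1..N} Q) (swp j i)) H"
  by (rule nn_integral_distr[OF m, symmetric]) (use H sQ in \<open>simp cong: measurable_cong_sets\<close>)
 then show ?thesis using d by simp
qed

text \<open>At time 0 all particles coincide; later they are independent draws from one mixture,
  given the previous generation.\<close>

lemma S_exchangeable:
 assumes i: "i \<in> {1..N}" and t: "t \<le> T" and H: "H \<in> bm Tup"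
 shows "(\<integral>\<^sup>+u. H (swp 1 i u) \<partial>S t) = nn_integral (S t) H"
proof -
 have one: "1 \<in> {1..N}" using N by simp
 have Hs: "(\<lambda>u. H (swp 1 i u)) \<in> bm Tup" by (rule measurable_compose[OF swp_measurable[OF i one] H])
 show ?thesis
 proof (cases t)
  case 0
  have "swp 1 i (\<lambda>i\<in>{1..N}. base) = (\<lambda>i\<in>{1..N}. base)"
   unfolding swp_def by (rule restrict_ext) (use transpose_mem[OF i one] in simp)
  then show ?thesis using 0 by (simp add: nn_integral_return[OF base_tuple_space Hs] nn_integral_return[OF base_tuple_space H])
 next
  case (Suc s)
  then have sT: "s < T" using t by simp
  show ?thesis unfolding Suc nn_integral_S_Suc[OF sT Hs] nn_integral_S_Suc[OF sT H]
  proof (rule nn_integral_cong, rule arg_cong2[where f="(*)", OF refl])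
   fix u assume "u \<in> space (S s)"
   then have z: "u \<in> space Tup" using space_S[of s] sT by simp
   note m = prob_kernelD[OF mix_measurable[OF sT] z]
   show "(\<integral>\<^sup>+p. H (swp 1 i p) \<partial>PiM {1..N} (\<lambda>_. mix s u)) = nn_integral (PiM {1..N} (\<lambda>_. mix s u)) H"
    by (rule PiM_iid_swp[OF i one m(1) m(2) refl H])
  qed
 qed
qed

definition symm where
 "symm F \<longleftrightarrow> (\<forall>i\<in>{1..N}. \<forall>b\<in>space X. \<forall>u\<in>space Tup. F b (swp 1 i u) = (F b u :: ennreal))"

text \<open>Apart from the path b, the operator sees the tuple only through its total weight and the
  mixture.\<close>

lemma symm_Lop: "t < T ==> symm (Lop t F)"
proof -
 assume t: "t < T"
 have one: "1 \<in> {1..N}" using N by simp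
 show ?thesis
  unfolding symm_def Lop_def using tot_swp[OF _ one] mix_swp[OF _ one t] by simp
qed

lemma sum_over_particles:
 assumes F: "(\<lambda>(a, u). F a u) \<in> bm XTup" and sym: "symm F" and t: "t \<le> T"
 shows "ennreal N * (\<integral>\<^sup>+u. F (u 1) u \<partial>S t) = (\<integral>\<^sup>+u. (\<Sum>i=1..N. F (u i) u) \<partial>S t)"
proof -
 have one: "1 \<in> {1..N}" using N by simp
 have m: "(\<lambda>u. F (u i) u) \<in> bm Tup" if "i \<in> {1..N}" for i
 proof -
  have "(\<lambda>u. (u i, u)) \<in> Tup \<rightarrow>\<^sub>M X \<Otimes>\<^sub>M Tup" using that by (intro measurable_Pair particle_coord_measurable) auto
  from measurable_compose[OF this F] show ?thesis by simp
 qed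
 have "(\<integral>\<^sup>+u. (\<Sum>i=1..N. F (u i) u) \<partial>S t) = (\<Sum>i=1..N. \<integral>\<^sup>+u. F (u i) u \<partial>S t)"
  by (rule nn_integral_sum) (use m sets_S[OF t] in \<open>simp cong: measurable_cong_sets\<close>)
 also have "... = (\<Sum>i=1..N. \<integral>\<^sup>+u. F (u 1) u \<partial>S t)"
 proof (rule sum.cong[OF refl])
  fix i assume i: "i \<in> {1..N}"
  have "(\<integral>\<^sup>+u. F (u 1) u \<partial>S t) = (\<integral>\<^sup>+u. F (swp 1 i u 1) (swp 1 i u) \<partial>S t)"
   by (rule S_exchangeable[OF i t m[OF one], symmetric])
  also have "... = (\<integral>\<^sup>+u. F (u i) u \<partial>S t)"
  proof (rule nn_integral_cong)
   fix u assume "u \<in> space (S t)"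
   then have z: "u \<in> space Tup" using space_S[OF t] by simp
   have "swp 1 i u 1 = u i" using one by (simp add: swp_def)
   then show "F (swp 1 i u 1) (swp 1 i u) = F (u i) u"
    using sym i z particle_space_Tup[OF z i] by (simp add: symm_def)
  qed
  finally show "(\<integral>\<^sup>+u. F (u i) u \<partial>S t) = (\<integral>\<^sup>+u. F (u 1) u \<partial>S t)" by simp
 qed
 also have "... = ennreal N * (\<integral>\<^sup>+u. F (u 1) u \<partial>S t)" by (simp add: ennreal_of_nat_eq_real_of_nat)
 finally show ?thesis by simp
qed

lemma N_pos: "ennreal N \<noteq> 0" "ennreal N \<noteq> \<top>" using N by auto

lemma N_cancel: "ennreal N * (a / ennreal N * b) = a * b"
proof -
 have "ennreal N * (a / ennreal N * b) = (ennreal N / ennreal N) * (a * b)"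
  by (simp add: divide_ennreal_def ac_simps)
 then show ?thesis using N_pos by (simp add: ennreal_divide_self less_top)
qed

lemma tot_cancel: "tot t u \<noteq> 0 ==> tot t u * (a * inverse (tot t u)) = a"
proof -
 assume "tot t u \<noteq> 0"
 then have "tot t u / tot t u = 1" using tot_finite[of t u] by (intro ennreal_divide_self) auto
 then show ?thesis by (simp add: divide_ennreal_def ac_simps)
qed

text \<open>\<open>S t\<close> is the weighted law of the unconditional particle system; a uniformly chosen particle plays the reference path.\<close>

lemma \<Lambda>_eq_S:
 assumes "t \<le> T" "(\<lambda>(a, u). F a u) \<in> bm XTup" "symm F"
 shows "\<Lambda> t F = (\<integral>\<^sup>+u. F (u 1) u \<partial>S t)"
 using assms
proof (induction t arbitrary: F)
 case 0
 have m: "(\<lambda>u. F (u 1) u) \<in> bm Tup" by (rule diag_measurable[OF 0(2)])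
 have "(\<lambda>e. Wp 0 e * (\<integral>\<^sup>+u. F (u 1) u \<partial>C 0 e)) \<in> bm X" by (simp add: Wp_def)
 from nn_integral_return[OF base_space this] show ?case by (simp add: \<Lambda>_def Wp_def)
next
 case (Suc t)
 then have t: "t < T" "t \<le> T" by auto
 note F = Suc.prems(2)
 have Fd: "(\<lambda>u. F (u 1) u) \<in> bm Tup" by (rule diag_measurable[OF F])
 have "ennreal N * \<Lambda> (Suc t) F = ennreal N * (\<integral>\<^sup>+u. Lop t F (u 1) u \<partial>S t)"
  unfolding \<Lambda>_Suc[OF F t(1)] using Suc.IH[OF t(2) Lop_measurable[OF F t(1)] symm_Lop[OF t(1)]] by simp
 also have "... = (\<integral>\<^sup>+u. (\<Sum>i=1..N. Lop t F (u i) u) \<partial>S t)"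
  by (rule sum_over_particles[OF Lop_measurable[OF F t(1)] symm_Lop[OF t(1)] t(2)])
 also have "... = (\<integral>\<^sup>+u. ennreal N * (tot t u / ennreal N * (\<integral>\<^sup>+p. F (p 1) p \<partial>PiM {1..N} (\<lambda>_. mix t u))) \<partial>S t)"
 proof (rule nn_integral_cong)
  fix u assume "u \<in> space (S t)"
  then have z: "u \<in> space Tup" using space_S[OF t(2)] by simp
  note m = prob_kernelD[OF mix_measurable[OF t(1)] z]
  show "(\<Sum>i=1..N. Lop t F (u i) u) = ennreal N * (tot t u / ennreal N * (\<integral>\<^sup>+p. F (p 1) p \<partial>PiM {1..N} (\<lambda>_. mix t u)))"
  proof (cases "tot t u = 0")
   case True
   then show ?thesis by (simp add: Lop_def)
  next
   case False
   \<comment> \<open>Weighting every particle by its potential, moving it and summing is, up to the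
     total weight, one draw from \<open>mix\<close>. So the planted particle becomes one more
     independent draw like the other N - 1.\<close>
   define \<Phi> where "\<Phi> = (\<lambda>a. \<integral>\<^sup>+p. F a (p(1 := a)) \<partial>PiM {2..N} (\<lambda>_. mix t u))"
   have \<Phi>m: "\<Phi> \<in> bm X"
    unfolding \<Phi>_def by (rule measurable_param_section2[OF inner_measurable[OF F t(1)] z])
   have sm: "sets (PiM (insert 1 {2..N}) (\<lambda>_. mix t u)) = sets Tup"
    unfolding index_set by (intro sets_PiM_cong refl m)
   have "(\<integral>\<^sup>+p. F (p 1) p \<partial>PiM {1..N} (\<lambda>_. mix t u)) = nn_integral (mix t u) \<Phi>"
    unfolding \<Phi>_def index_set
    by (subst nn_integral_PiM_insert) (use m Fd sm in \<open>auto cong: measurable_cong_sets\<close>)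
   also have "tot t u * ... = (\<Sum>k=1..N. ennreal (wt t (u k)) * nn_integral (mv t (u k)) \<Phi>)"
    unfolding nn_integral_mix[OF t(1) z \<Phi>m False] by (rule tot_cancel[OF False])
   finally show ?thesis unfolding N_cancel using False by (simp add: Lop_def \<Phi>_def)
  qed
 qed
 also have "... = ennreal N * (\<integral>\<^sup>+u. F (u 1) u \<partial>S (Suc t))"
  unfolding nn_integral_S_Suc[OF t(1) Fd]
 proof (rule nn_integral_cmult)
  have "(\<lambda>u. tot t u / ennreal N * (\<integral>\<^sup>+p. F (p 1) p \<partial>PiM {1..N} (\<lambda>_. mix t u))) \<in> bm Tup"
   using tot_measurable[OF t(2)] nn_integral_kernel_measurable[OF PiM_mix_measurable[OF t(1)] Fd]
   by (intro borel_measurable_times_ennreal borel_measurable_divide_ennreal) auto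
  then show "(\<lambda>u. tot t u / ennreal N * (\<integral>\<^sup>+p. F (p 1) p \<partial>PiM {1..N} (\<lambda>_. mix t u))) \<in> bm (S t)"
   using sets_S[OF t(2)] by (simp cong: measurable_cong_sets)
 qed
 finally show ?case using N_pos by (simp add: ennreal_mult_cancel_left)
qed

text \<open>Given the unconditional particles, the old and the new path are two independent
  selections by the terminal weights. The right-hand side is symmetric in f and g, and for f = g the
  integral of a square.\<close>

lemma two_point_formula:
 assumes f: "f \<in> bm X" and g: "g \<in> bm X"
 shows "(\<integral>\<^sup>+x. Wp (Suc T) x * (f x * nn_integral (Pk x) g) \<partial>Y T)
  = (\<integral>\<^sup>+u. tot T u / ennreal N * (Sel f u * Sel g u) \<partial>S T)"
proof -
 define F where "F = (\<lambda>b u. ennreal (wt T b) * (f b * Sel g u))"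
 \<comment> \<open>The value 0 at total weight 0 restores the symmetry broken by the default index.
   The integral is unaffected, because the weight of particle 1 is 0 there.\<close>
 define F' where "F' = (\<lambda>b u. if tot T u = 0 then 0 else F b u)"
 have Fm: "(\<lambda>(b, u). F b u) \<in> bm XTup"
  unfolding F_def case_prod_beta'
  by (intro borel_measurable_times_ennreal comp_ennreal comp_fst[OF wt_measurable]
    comp_fst[OF f] comp_snd[OF Sel_measurable[OF g]]) simp
 have F'm: "(\<lambda>(b, u). F' b u) \<in> bm XTup"
 proof -
  have "Measurable.pred XTup (\<lambda>q. tot T (snd q) = 0)"
   using comp_snd[OF tot_measurable[of T], of X] by (intro pred_eq_const1) auto
  then show ?thesis using Fm unfolding F'_def case_prod_beta' by (intro measurable_If) auto
 qed
 have one: "1 \<in> {1..N}" using N by simp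
 have symF: "symm F'"
  unfolding symm_def F'_def F_def
 proof (intro ballI)
  fix i b u assume i: "i \<in> {1..N}" and "b \<in> space X" and z: "u \<in> space Tup"
  have "Sel g (swp 1 i u) = Sel g u" if nz: "tot T u \<noteq> 0"
   using Sel_eq[OF z nz] Sel_eq[OF swp_space[OF i one z]] tot_swp[OF i one] nz
    sum_swp[OF i one, of "\<lambda>e. ennreal (wt T e) * g e" u] by simp
  then show "(if tot T (swp 1 i u) = 0 then 0 else ennreal (wt T b) * (f b * Sel g (swp 1 i u))) =
    (if tot T u = 0 then 0 else ennreal (wt T b) * (f b * Sel g u))"
   using tot_swp[OF i one] by simp
 qed
 have "(\<integral>\<^sup>+x. Wp (Suc T) x * (f x * nn_integral (Pk x) g) \<partial>Y T) = \<Lambda> T F'"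
  unfolding \<Lambda>_def
 proof (rule nn_integral_cong)
  fix x assume "x \<in> space (Y T)"
  then have x: "x \<in> space X" using space_Y by simp
  have Sm: "Sel g \<in> bm (C T x)" using Sel_measurable[OF g] C_prob(2)[OF order_refl x] by (simp cong: measurable_cong_sets)
  have "f x * nn_integral (Pk x) g = (\<integral>\<^sup>+u. f x * Sel g u \<partial>C T x)"
   unfolding nn_integral_icsmc[OF x g] by (rule nn_integral_cmult[OF Sm, symmetric])
  then have "Wp (Suc T) x * (f x * nn_integral (Pk x) g) = Wp T x * (ennreal (wt T x) * (\<integral>\<^sup>+u. f x * Sel g u \<partial>C T x))"
   by (simp add: Wp_Suc mult.assoc)
  also have "ennreal (wt T x) * (\<integral>\<^sup>+u. f x * Sel g u \<partial>C T x) = (\<integral>\<^sup>+u. F (trunc T x) u \<partial>C T x)"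
   unfolding F_def trunc_T[OF x] using Sm by (intro nn_integral_cmult[symmetric]) measurable
  also have "... = (\<integral>\<^sup>+u. F (u 1) u \<partial>C T x)"
   by (rule nn_integral_C_reference[OF order_refl order_refl x Fm, symmetric])
  also have "... = (\<integral>\<^sup>+u. F' (u 1) u \<partial>C T x)"
  proof (rule nn_integral_cong)
   fix u assume "u \<in> space (C T x)"
   then have z: "u \<in> space Tup" using C_prob(3)[OF order_refl x] by simp
   show "F (u 1) u = F' (u 1) u" using tot_0_iff[OF order_refl z _ one] by (simp add: F'_def F_def)
  qed
  finally show "Wp (Suc T) x * (f x * nn_integral (Pk x) g) = Wp T x * (\<integral>\<^sup>+u. F' (u 1) u \<partial>C T x)" .
 qed
 then have "ennreal N * (\<integral>\<^sup>+x. Wp (Suc T) x * (f x * nn_integral (Pk x) g) \<partial>Y T) = (\<integral>\<^sup>+u. (\<Sum>i=1..N. F' (u i) u) \<partial>S T)"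
  using \<Lambda>_eq_S[OF order_refl F'm symF] sum_over_particles[OF F'm symF order_refl] by simp
 also have "... = (\<integral>\<^sup>+u. ennreal N * (tot T u / ennreal N * (Sel f u * Sel g u)) \<partial>S T)"
 proof (rule nn_integral_cong)
  fix u assume "u \<in> space (S T)"
  then have z: "u \<in> space Tup" using space_S by simp
  show "(\<Sum>i=1..N. F' (u i) u) = ennreal N * (tot T u / ennreal N * (Sel f u * Sel g u))"
  proof (cases "tot T u = 0")
   case True
   then show ?thesis by (simp add: F'_def)
  next
   case False
   have "(\<Sum>i=1..N. F' (u i) u) = (\<Sum>i=1..N. ennreal (wt T (u i)) * f (u i)) * Sel g u"
    using False by (simp add: F'_def F_def sum_distrib_right mult.assoc)
   also have "(\<Sum>i=1..N. ennreal (wt T (u i)) * f (u i)) = tot T u * Sel f u"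
    unfolding Sel_eq[OF z False] by (rule tot_cancel[OF False, symmetric])
   finally show ?thesis unfolding N_cancel by (simp add: mult.assoc)
  qed
 qed
 also have "... = ennreal N * (\<integral>\<^sup>+u. tot T u / ennreal N * (Sel f u * Sel g u) \<partial>S T)"
 proof (rule nn_integral_cmult)
  have "(\<lambda>u. tot T u / ennreal N * (Sel f u * Sel g u)) \<in> bm Tup"
   by (intro borel_measurable_times_ennreal borel_measurable_divide_ennreal tot_measurable Sel_measurable f g) auto
  then show "(\<lambda>u. tot T u / ennreal N * (Sel f u * Sel g u)) \<in> bm (S T)"
   using sets_S by (simp cong: measurable_cong_sets)
 qed
 finally show ?thesis using N_pos by (simp add: ennreal_mult_cancel_left)
qed

section \<open>The target law, and reversibility of the filter with respect to it\<close>

abbreviation "gam \<equiv> gamma_T Z T M1 M G"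
abbreviation "target \<equiv> fk_target Z T M1 M G"

lemma Wp_full: "Wp (Suc T) x = (\<Prod>t=1..T. ennreal (G t (x t)))"
proof -
 have "{..<Suc T} = insert 0 {1..T}" using T by auto
 then show ?thesis unfolding Wp_def by (simp add: wt_def)
qed

lemma sets_path_law: "sets (path_law Z T M1 M) = sets X"
 using path_law_prob[OF T M1 M] by (simp add: space_prob_algebra)

lemma gam_eq: "gam = (\<integral>\<^sup>+x. Wp (Suc T) x \<partial>Y T)"
 unfolding gamma_T_def Wp_full[symmetric] by (rule path_law_eq_Y[OF Wp_measurable]) simp

lemma nn_integral_target:
 assumes f: "f \<in> bm X"
 shows "nn_integral target f = inverse gam * (\<integral>\<^sup>+x. Wp (Suc T) x * f x \<partial>Y T)"
proof -
 have Wm: "Wp (Suc T) \<in> bm X" by (rule Wp_measurable) simp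
 have "nn_integral target f = (\<integral>\<^sup>+x. Wp (Suc T) x / gam * f x \<partial>path_law Z T M1 M)"
  unfolding fk_target_def Wp_full[symmetric]
  by (rule nn_integral_density) (use Wm f sets_path_law in \<open>auto cong: measurable_cong_sets\<close>)
 also have "... = (\<integral>\<^sup>+x. inverse gam * (Wp (Suc T) x * f x) \<partial>Y T)"
 proof -
  have "(\<integral>\<^sup>+x. Wp (Suc T) x / gam * f x \<partial>path_law Z T M1 M) = (\<integral>\<^sup>+x. Wp (Suc T) x / gam * f x \<partial>Y T)"
   using Wm f by (intro path_law_eq_Y borel_measurable_times_ennreal borel_measurable_divide_ennreal) auto
  then show ?thesis by (simp add: divide_ennreal_def ac_simps)
 qed
 also have "... = inverse gam * (\<integral>\<^sup>+x. Wp (Suc T) x * f x \<partial>Y T)"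
  using Wm f sets_Y by (intro nn_integral_cmult) (auto cong: measurable_cong_sets)
 finally show ?thesis .
qed

lemma sets_target: "sets target = sets X"
 unfolding fk_target_def using sets_path_law by simp

lemma prob_target:
 assumes "0 < gam" "gam < \<top>"
 shows "prob_space target"
proof
 have "emeasure target (space target) = (\<integral>\<^sup>+x. 1 \<partial>target)" by simp
 also have "... = inverse gam * gam" unfolding gam_eq using nn_integral_target[of "\<lambda>_. 1"] by (simp add: gam_eq)
 also have "... = 1" using assms ennreal_divide_self[of gam] by (simp add: divide_ennreal_def mult.commute)
 finally show "emeasure target (space target) = 1" .
qed

lemma icsmc_kernel: "Pk \<in> X \<leadsto> X"
 by (rule measurable_param_section[OF icsmc_measurable[of N T "\<lambda>_. M1" "count_space {()}" Z "\<lambda>_. M" "\<lambda>_. G"], of "()"])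
   (use N T M1 M G Gnn in \<open>auto intro!: measurable_param_const\<close>)

text \<open>By \<open>two_point_formula\<close> all terms are integrals of products of
  \<open>Sel a\<close> and \<open>Sel b\<close> against one measure, where
  \<open>ennreal_two_mult_le\<close> applies pointwise.\<close>

lemma rev_pos_icsmc:
 assumes "0 < gam" "gam < \<top>"
 shows "rev_pos_kernel target (Pk)"
proof (unfold rev_pos_kernel_def rev_pos_kernel_axioms_def, intro conjI allI impI prob_target[OF assms])
 let ?P = "Pk"
 show "?P \<in> target \<leadsto> target"
  using icsmc_kernel unfolding measurable_cong_sets[OF sets_target refl] sets_prob_algebra_cong[OF sets_target] .
 fix a b :: "(nat => 'z) => ennreal" assume "a \<in> bm target" "b \<in> bm target"
 then have a: "a \<in> bm X" and b: "b \<in> bm X" using sets_target by (auto cong: measurable_cong_sets)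
 have eq: "(\<integral>\<^sup>+x. f x * nn_integral (?P x) g \<partial>target) = inverse gam * (\<integral>\<^sup>+u. tot T u / ennreal N * (Sel f u * Sel g u) \<partial>S T)"
  if f: "f \<in> bm X" and g: "g \<in> bm X" for f g
  unfolding two_point_formula[OF f g, symmetric]
  by (intro nn_integral_target borel_measurable_times_ennreal f nn_integral_kernel_measurable[OF icsmc_kernel g])
 show "(\<integral>\<^sup>+x. a x * nn_integral (?P x) b \<partial>target) = (\<integral>\<^sup>+x. b x * nn_integral (?P x) a \<partial>target)"
  unfolding eq[OF a b] eq[OF b a] by (simp add: mult.commute[of "Sel a _"])
 have m: "(\<lambda>u. tot T u / ennreal N * (Sel f u * Sel g u)) \<in> bm (S T)"
  if f: "f \<in> bm X" and g: "g \<in> bm X" for f g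
 proof -
  have "(\<lambda>u. tot T u / ennreal N * (Sel f u * Sel g u)) \<in> bm Tup"
   by (intro borel_measurable_times_ennreal borel_measurable_divide_ennreal tot_measurable Sel_measurable f g) auto
  then show ?thesis using sets_S by (simp cong: measurable_cong_sets)
 qed
 have "2 * (\<integral>\<^sup>+u. tot T u / ennreal N * (Sel a u * Sel b u) \<partial>S T) = (\<integral>\<^sup>+u. 2 * (tot T u / ennreal N * (Sel a u * Sel b u)) \<partial>S T)"
  by (rule nn_integral_cmult[OF m[OF a b], symmetric])
 also have "... \<le> (\<integral>\<^sup>+u. tot T u / ennreal N * (Sel a u * Sel a u) + tot T u / ennreal N * (Sel b u * Sel b u) \<partial>S T)"
 proof (rule nn_integral_mono)
  fix u
  have "tot T u / ennreal N * (2 * (Sel a u * Sel b u)) \<le> tot T u / ennreal N * (Sel a u * Sel a u + Sel b u * Sel b u)"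
   by (intro mult_left_mono ennreal_two_mult_le) simp
  then show "2 * (tot T u / ennreal N * (Sel a u * Sel b u)) \<le> tot T u / ennreal N * (Sel a u * Sel a u) + tot T u / ennreal N * (Sel b u * Sel b u)"
   by (simp add: distrib_left mult.left_commute[of 2])
 qed
 also have "... = (\<integral>\<^sup>+u. tot T u / ennreal N * (Sel a u * Sel a u) \<partial>S T) + (\<integral>\<^sup>+u. tot T u / ennreal N * (Sel b u * Sel b u) \<partial>S T)"
  by (rule nn_integral_add[OF m[OF a a] m[OF b b]])
 finally show "2 * (\<integral>\<^sup>+x. a x * nn_integral (?P x) b \<partial>target)
   \<le> (\<integral>\<^sup>+x. a x * nn_integral (?P x) a \<partial>target) + (\<integral>\<^sup>+x. b x * nn_integral (?P x) b \<partial>target)"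
  unfolding eq[OF a b] eq[OF a a] eq[OF b b]
  by (simp add: mult.left_commute[of 2 "inverse gam"] flip: distrib_left) (intro mult_left_mono, auto)
qed

end

subsection \<open>A minorization of the conditional particle filter\<close>

lemma ennreal_mult_divide_cancel: "a \<noteq> 0 ==> a < \<top> ==> a * inverse a = (1::ennreal)"
 using ennreal_divide_self[of a] by (simp add: divide_ennreal_def)

lemma ennreal_inverse_mult_pos:
 assumes "a \<noteq> 0" "a < \<top>" shows "inverse (a * b) = inverse a * inverse (b :: ennreal)"
proof (cases "b = \<top>")
 case True
 then show ?thesis using assms by (simp add: ennreal_mult_top)
next
 case False
 then show ?thesis using assms by (intro ennreal_inverse_mult) (auto simp: less_top)
qed

text \<open>The tangent of 1 / u at m lies below the curve; its linear term is moved to the right,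
  since subtraction in \<open>ennreal\<close> is truncated.\<close>

lemma ennreal_inverse_add_ge:
 fixes g m :: ennreal
 assumes m: "0 < m" "m < \<top>"
 shows "2 * inverse m \<le> inverse g + inverse m * inverse m * g"
proof -
 obtain r where r: "m = ennreal r" "0 < r" using m by (cases m) (auto simp: ennreal_less_iff)
 consider "g = 0" | "g = \<top>" | s where "g = ennreal s" "0 < s"
  by (cases g) (auto simp: ennreal_less_iff order_le_less)
 then show ?thesis
 proof cases
  case 1
  then show ?thesis by simp
 next
  case 2
  have "inverse m * inverse m \<noteq> 0" using r by (simp add: inverse_ennreal)
  then show ?thesis using 2 by (simp add: ennreal_mult_top)
 next
  case 3
  have "0 \<le> (s - r)\<^sup>2" by simp
  then have "2 / r \<le> 1 / s + 1 / r * (1 / r) * s"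
   using r 3 by (simp add: field_simps power2_eq_square)
  then have "ennreal (2 * inverse r) \<le> ennreal (inverse s + inverse r * inverse r * s)"
   by (intro ennreal_leI) (simp add: field_simps)
  then show ?thesis using r 3 by (simp add: inverse_ennreal ennreal_mult ennreal_plus)
 qed
qed

text \<open>Jensen's inequality, by integrating the tangent at the mean. A mean of 0 forces g = 0
  almost everywhere, and then the right-hand side is \<infinity>.\<close>

lemma nn_integral_inverse_ge:
 fixes g :: "'a => ennreal"
 assumes M: "prob_space M" and g[measurable]: "g \<in> bm M"
 shows "inverse (nn_integral M g) \<le> (\<integral>\<^sup>+x. inverse (g x) \<partial>M)"
proof -
 interpret prob_space M by (rule M)
 let ?m = "\<integral>\<^sup>+x. g x \<partial>M"
 consider "?m = \<top>" | "?m = 0" | "0 < ?m" "?m < \<top>"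
  by (metis less_top not_gr_zero)
 then show ?thesis
 proof cases
  case 1
  then show ?thesis by simp
 next
  case 2
  then have "AE x in M. g x = 0" by (simp add: nn_integral_0_iff_AE)
  then have "(\<integral>\<^sup>+x. inverse (g x) \<partial>M) = (\<integral>\<^sup>+x. \<top> \<partial>M)" by (intro nn_integral_cong_AE) (auto elim!: eventually_mono)
  then show ?thesis by (simp add: emeasure_space_1)
 next
  case 3
  let ?i = "inverse ?m"
  have fin: "?i < \<top>" using 3 by (simp add: less_top[symmetric] ennreal_inverse_eq_top_iff)
  have "2 * ?i = (\<integral>\<^sup>+x. 2 * ?i \<partial>M)" by (simp add: emeasure_space_1)
  also have "... \<le> (\<integral>\<^sup>+x. inverse (g x) + ?i * ?i * g x \<partial>M)"
   by (intro nn_integral_mono ennreal_inverse_add_ge 3)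
  also have "... = (\<integral>\<^sup>+x. inverse (g x) \<partial>M) + ?i * ?i * ?m"
   by (simp add: nn_integral_add nn_integral_cmult)
  also have "?i * ?i * ?m = ?i * (?m * ?i)" by (simp only: ac_simps)
  also have "?m * ?i = 1" using 3 by (intro ennreal_mult_divide_cancel) auto
  finally have "?i + ?i \<le> (\<integral>\<^sup>+x. inverse (g x) \<partial>M) + ?i" by (simp add: mult_2 del: nn_integral_const)
  then show ?thesis using fin 3 by (auto simp: ennreal_add_left_cancel_le add.commute)
 qed
qed

lemma measurable_diag:
 assumes "(\<lambda>(a, b). f a b) \<in> A \<Otimes>\<^sub>M A \<rightarrow>\<^sub>M L" shows "(\<lambda>a. f a a) \<in> A \<rightarrow>\<^sub>M L"
 using measurable_compose[of "\<lambda>a. (a, a)", OF _ assms] by simp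

locale particle_model2 = particle_model +
 fixes x :: "nat => 'a" and f :: "(nat => 'a) => ennreal"
 assumes N2: "2 \<le> N" and x: "x \<in> space X" and f: "f \<in> bm X"
begin

abbreviation "Tup3 \<equiv> PiM {3..N} (\<lambda>_. X)"

text \<open>In \<open>ennreal\<close> the inverse of 0 is \<infinity>. The value 0 drops tuples of
  total weight 0 instead, which is harmless for a lower bound.\<close>

definition rinv where "rinv t u = (if tot t u = 0 then 0 else inverse (tot t u))"

text \<open>
 \<open>V\<close> is the contribution of a second path which never selects an ancestor on the reference path
 \<open>x\<close>; it is given by a backward recursion in \<open>t = T - j\<close>.
\<close>

definition put where
 "put t u p a = p(1 := (u 1)(Suc t := x (Suc t)), 2 := a)" for a :: "nat => 'a" and p u :: "nat => nat => 'a"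

primrec V where
 "V 0 e u = ennreal (wt T e) * f e * rinv T u"
| "V (Suc j) e u = ennreal (wt (T - Suc j) e) * rinv (T - Suc j) u *
   (\<integral>\<^sup>+a. \<integral>\<^sup>+p. V j a (put (T - Suc j) u p a) \<partial>PiM {3..N} (\<lambda>_. mix (T - Suc j) u) \<partial>mv (T - Suc j) e)"

lemma index_set2: "{2..N} = insert 2 {3..N}" using N2 by auto

lemma index_set3: "{1..N} = insert 2 (insert 1 {3..N})" using N2 by auto

lemma rinv_measurable: "t \<le> T ==> rinv t \<in> bm Tup"
 unfolding rinv_def[abs_def]
proof (rule measurable_If)
 assume t: "t \<le> T"
 show "(\<lambda>u. inverse (tot t u)) \<in> bm Tup"
  using tot_measurable[OF t] by measurable
 show "{u \<in> space Tup. tot t u = 0} \<in> sets Tup"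
  using tot_measurable[OF t] by measurable
qed simp

lemma put_measurable:
 assumes t: "t < T"
 shows "(\<lambda>(q, p). put t (snd q) p (fst q)) \<in> XTup \<Otimes>\<^sub>M Tup3 \<rightarrow>\<^sub>M Tup"
proof -
 have St: "Suc t \<in> {1..T}" using t by auto
 have um: "(\<lambda>e. e(Suc t := x (Suc t))) \<in> X \<rightarrow>\<^sub>M X"
  by (rule measurable_param_section2[OF upd_measurable[OF St] coord_space[OF x St]])
 have z1: "(\<lambda>r. (snd (fst r)) 1) \<in> XTup \<Otimes>\<^sub>M Tup3 \<rightarrow>\<^sub>M X"
  using N by (intro measurable_compose[OF comp_fst[OF measurable_snd] particle_coord_measurable]) auto
 show ?thesis
  unfolding put_def case_prod_beta' index_set3
  by (intro measurable_fun_upd[where J="insert 1 {3..N}"] measurable_fun_upd[where J="{3..N}"] measurable_snd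
    measurable_compose[OF z1[unfolded index_set3] um] comp_fst[OF measurable_fst]) auto
qed

lemma put_space:
 assumes t: "t < T" and z: "u \<in> space Tup" and a: "a \<in> space X" and p: "p \<in> space Tup3"
 shows "put t u p a \<in> space Tup"
 using measurable_space[OF put_measurable[OF t], of "((a, u), p)"] assms by (simp add: space_pair_measure)

lemma put_simps: "put t u p a 1 = (u 1)(Suc t := x (Suc t))" "put t u p a 2 = a" "3 \<le> k ==> put t u p a k = p k"
 by (auto simp: put_def)

lemma put_integral_measurable:
 assumes t: "t < T" and F: "(\<lambda>(e, u). F e u) \<in> bm XTup"
 shows "(\<lambda>(a, u). \<integral>\<^sup>+p. F a (put t u p a) \<partial>PiM {3..N} (\<lambda>_. mix t u)) \<in> bm XTup"
 unfolding case_prod_beta'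
proof (rule nn_integral_kernel_measurable2[OF comp_snd[OF PiM_mix_measurable[OF t]]])
 have "(\<lambda>r. (fst (fst r), put t (snd (fst r)) (snd r) (fst (fst r)))) \<in> XTup \<Otimes>\<^sub>M Tup3 \<rightarrow>\<^sub>M X \<Otimes>\<^sub>M Tup"
  by (intro measurable_Pair comp_fst[OF measurable_fst] put_measurable[OF t, unfolded case_prod_beta'])
 from measurable_compose[OF this F]
 show "(\<lambda>(q, p). F (fst q) (put t (snd q) p (fst q))) \<in> bm (XTup \<Otimes>\<^sub>M Tup3)"
  by (simp add: case_prod_beta')
qed simp

lemma V_measurable: "j \<le> T ==> (\<lambda>(e, u). V j e u) \<in> bm XTup"
proof (induction j)
 case 0
 show ?case unfolding V.simps case_prod_beta'
  by (intro borel_measurable_times_ennreal comp_ennreal comp_fst[OF wt_measurable]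
    comp_fst[OF f] comp_snd[OF rinv_measurable]) auto
next
 case (Suc j)
 define t where "t = T - Suc j"
 have t: "t < T" "t \<le> T" using Suc.prems by (auto simp: t_def)
 have IH: "(\<lambda>(e, u). V j e u) \<in> bm XTup" using Suc by simp
 note inner = put_integral_measurable[OF t(1) IH, unfolded case_prod_beta']
 have "(\<lambda>q. \<integral>\<^sup>+a. \<integral>\<^sup>+p. V j a (put t (snd q) p a) \<partial>PiM {3..N} (\<lambda>_. mix t (snd q)) \<partial>mv t (fst q)) \<in> bm XTup"
 proof (rule nn_integral_kernel_measurable2[OF comp_fst[OF mv_measurable[OF t(1)]]])
  have "(\<lambda>r. (snd r, snd (fst r))) \<in> XTup \<Otimes>\<^sub>M X \<rightarrow>\<^sub>M X \<Otimes>\<^sub>M Tup"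
   by (intro measurable_Pair measurable_snd comp_fst[OF measurable_snd])
  from measurable_compose[OF this inner]
  show "(\<lambda>(q, a). \<integral>\<^sup>+p. V j a (put t (snd q) p a) \<partial>PiM {3..N} (\<lambda>_. mix t (snd q))) \<in> bm (XTup \<Otimes>\<^sub>M X)"
   by (simp add: case_prod_beta')
 qed
 then show ?case unfolding V.simps t_def[symmetric] case_prod_beta'
  using t by (intro borel_measurable_times_ennreal comp_ennreal comp_fst[OF wt_measurable]
    comp_snd[OF rinv_measurable]) auto
qed

text \<open>Apart from e, the tuple enters through its total weight, the mixture and particle 1,
  none of which notices a swap of two other particles. At total weight 0, where the mixture might,
  \<open>rinv\<close> is 0.\<close>

lemma V_swp:
 assumes i: "k \<in> {2..N}" and j: "j \<le> T" and z: "u \<in> space Tup"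
 shows "V j e (swp 2 k u) = V j e u"
proof -
 have k: "k \<in> {1..N}" "2 \<in> {1..N}" using i N2 by auto
 have r: "rinv t (swp 2 k u) = rinv t u" for t using tot_swp[OF k] by (simp add: rinv_def)
 show ?thesis
 proof (cases j)
  case 0
  then show ?thesis using r by simp
 next
  case (Suc l)
  show ?thesis
  proof (cases "tot (T - Suc l) u = 0")
   case True
   then have "rinv (T - Suc l) u = 0" by (simp add: rinv_def)
   then show ?thesis using r Suc by simp
  next
   case False
   have "swp 2 k u 1 = u 1" using i N by (auto simp: swp_def Transposition.transpose_def)
   then have "put (T - Suc l) (swp 2 k u) p a = put (T - Suc l) u p a" for p a by (simp add: put_def)
   then show ?thesis using r Suc j mix_swp[OF k _ z False] by simp
  qed
 qed
qed

text \<open>Given the previous generation, particles 2 to N are independent with a common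
  law.\<close>

lemma C_swp:
 assumes k: "k \<in> {2..N}" and t: "1 \<le> t" "t \<le> T" and H: "H \<in> bm Tup"
 shows "(\<integral>\<^sup>+u. H (swp 2 k u) \<partial>C t x) = nn_integral (C t x) H"
proof -
 have k': "k \<in> {1..N}" "2 \<in> {1..N}" using k N2 by auto
 obtain s where s: "t = Suc s" using t by (cases t) auto
 have sT: "s < T" "s \<le> T" using t s by auto
 have Hs: "(\<lambda>u. H (swp 2 k u)) \<in> bm Tup" by (rule measurable_compose[OF swp_measurable[OF k'] H])
 have xs: "x (Suc s) \<in> space Z" using coord_space[OF x, of "Suc s"] sT by simp
 have e: "nn_integral (C t x) H = (\<integral>\<^sup>+u. \<integral>\<^sup>+p. H p \<partial>stp s (x (Suc s)) u \<partial>C s x)" if "H \<in> bm Tup" for H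
  unfolding s C.simps by (rule nn_integral_kernel_bind[OF C_prob(2)[OF sT(2) x] stp_measurable1[OF sT(1) xs] that])
 show ?thesis unfolding e[OF H] e[OF Hs]
 proof (rule nn_integral_cong)
  fix u assume "u \<in> space (C s x)"
  then have z: "u \<in> space Tup" using C_prob(3)[OF sT(2) x] by simp
  note m = prob_kernelD[OF mix_measurable[OF sT(1)] z]
  have e': "(u 1)(Suc s := x (Suc s)) \<in> space X"
   using N xs sT by (intro upd_space particle_space_Tup[OF z]) auto
  show "(\<integral>\<^sup>+p. H (swp 2 k p) \<partial>stp s (x (Suc s)) u) = nn_integral (stp s (x (Suc s)) u) H"
   unfolding stp_def
  proof (rule PiM_iid_swp[OF k' _ _ _ H])
   fix l assume "l \<in> {1..N}"
   have "Transposition.transpose 2 k l = 1 \<longleftrightarrow> l = 1" using k by (auto simp: Transposition.transpose_def)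
   then show "(if Transposition.transpose 2 k l = 1 then return X ((u 1)(Suc s := x (Suc s))) else mix s u) =
     (if l = 1 then return X ((u 1)(Suc s := x (Suc s))) else mix s u)" by simp
  qed (use m e' in \<open>auto intro: prob_space_return\<close>)
 qed
qed

lemma coord_V_measurable: "j \<le> T ==> k \<in> {1..N} ==> (\<lambda>u. V j (u k) u) \<in> bm Tup"
proof -
 assume j: "j \<le> T" and k: "k \<in> {1..N}"
 have "(\<lambda>u. (u k, u)) \<in> Tup \<rightarrow>\<^sub>M X \<Otimes>\<^sub>M Tup" using k by (intro measurable_Pair particle_coord_measurable) auto
 from measurable_compose[OF this V_measurable[OF j]] show ?thesis by simp
qed

text \<open>The source of the factors N - 1: each particle other than the reference may play the
  part of particle 2.\<close>

lemma sum_V_exchange: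
 assumes j: "j < T"
 shows "(\<integral>\<^sup>+u. (\<Sum>k=2..N. V j (u k) u) \<partial>C (T - j) x) = of_nat (N - 1) * (\<integral>\<^sup>+u. V j (u 2) u \<partial>C (T - j) x)"
proof -
 have jT: "j \<le> T" "1 \<le> T - j" "T - j \<le> T" using j by auto
 have two: "2 \<in> {1..N}" using N2 by simp
 have "(\<integral>\<^sup>+u. (\<Sum>k=2..N. V j (u k) u) \<partial>C (T - j) x) = (\<Sum>k=2..N. \<integral>\<^sup>+u. V j (u k) u \<partial>C (T - j) x)"
  using coord_V_measurable[OF jT(1)] C_prob(2)[OF jT(3) x] by (intro nn_integral_sum) (auto cong: measurable_cong_sets)
 also have "... = (\<Sum>k=2..N. \<integral>\<^sup>+u. V j (u 2) u \<partial>C (T - j) x)"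
 proof (rule sum.cong[OF refl])
  fix k assume k: "k \<in> {2..N}"
  have "(\<integral>\<^sup>+u. V j (u 2) u \<partial>C (T - j) x) = (\<integral>\<^sup>+u. V j (swp 2 k u 2) (swp 2 k u) \<partial>C (T - j) x)"
   by (rule C_swp[OF k jT(2,3) coord_V_measurable[OF jT(1) two], symmetric])
  also have "... = (\<integral>\<^sup>+u. V j (u k) u \<partial>C (T - j) x)"
  proof (rule nn_integral_cong)
   fix u assume "u \<in> space (C (T - j) x)"
   then have z: "u \<in> space Tup" using C_prob(3)[OF jT(3) x] by simp
   have "swp 2 k u 2 = u k" using two by (simp add: swp_def)
   then show "V j (swp 2 k u 2) (swp 2 k u) = V j (u k) u" using V_swp[OF k jT(1) z] by simp
  qed
  finally show "(\<integral>\<^sup>+u. V j (u k) u \<partial>C (T - j) x) = (\<integral>\<^sup>+u. V j (u 2) u \<partial>C (T - j) x)" by simp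
 qed
 also have "... = of_nat (N - 1) * (\<integral>\<^sup>+u. V j (u 2) u \<partial>C (T - j) x)"
 proof -
  have "card {2..N} = N - 1" by simp
  then show ?thesis by (simp only: sum_constant)
 qed
 finally show ?thesis .
qed

text \<open>Particle 2 of the next generation is a draw from the mixture; expanding over its
  ancestor k gives the sum, in which k = 1 is the reference path. Only tuples of total weight 0 can
  make the inequality strict.\<close>

lemma V_step:
 assumes j: "Suc j \<le> T"
 shows "(\<integral>\<^sup>+u. (\<Sum>k=1..N. V (Suc j) (u k) u) \<partial>C (T - Suc j) x) \<le> (\<integral>\<^sup>+u. V j (u 2) u \<partial>C (T - j) x)"
proof -
 define t where "t = T - Suc j"
 have t: "t < T" "t \<le> T" "Suc t \<le> T" "T - j = Suc t" "j \<le> T" using j by (auto simp: t_def)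
 have two: "2 \<in> {1..N}" using N2 by simp
 let ?b = "\<lambda>u. (u 1)(Suc t := x (Suc t))"
 have "(\<integral>\<^sup>+u. V j (u 2) u \<partial>C (T - j) x) =
   (\<integral>\<^sup>+u. \<integral>\<^sup>+p. V j (p 2) (p(1 := ?b u)) \<partial>PiM {2..N} (\<lambda>_. mix t u) \<partial>C t x)"
  unfolding t(4) using nn_integral_C_Suc[OF t(3) order_refl x coord_V_measurable[OF t(5) two]] by simp
 also have "... \<ge> (\<integral>\<^sup>+u. (\<Sum>k=1..N. V (Suc j) (u k) u) \<partial>C t x)"
 proof (rule nn_integral_mono)
  fix u assume "u \<in> space (C t x)"
  then have z: "u \<in> space Tup" using C_prob(3)[OF t(2) x] by simp
  note m = prob_kernelD[OF mix_measurable[OF t(1)] z]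
  have b: "?b u \<in> space X" using N t coord_space[OF x, of "Suc t"] by (intro upd_space particle_space_Tup[OF z]) auto
  show "(\<Sum>k=1..N. V (Suc j) (u k) u) \<le> (\<integral>\<^sup>+p. V j (p 2) (p(1 := ?b u)) \<partial>PiM {2..N} (\<lambda>_. mix t u))"
  proof (cases "tot t u = 0")
   case True
   then show ?thesis by (simp add: t_def[symmetric] rinv_def)
  next
   case False
   define \<Phi> where "\<Phi> = (\<lambda>a. \<integral>\<^sup>+p. V j a (put t u p a) \<partial>PiM {3..N} (\<lambda>_. mix t u))"
   have \<Phi>m: "\<Phi> \<in> bm X"
    unfolding \<Phi>_def by (rule measurable_param_section2[OF put_integral_measurable[OF t(1) V_measurable[OF t(5)]] z])
   have "(\<Sum>k=1..N. V (Suc j) (u k) u) = (\<Sum>k=1..N. ennreal (wt t (u k)) * nn_integral (mv t (u k)) \<Phi>) * inverse (tot t u)"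
    using False unfolding sum_distrib_right by (intro sum.cong) (simp_all add: t_def[symmetric] \<Phi>_def rinv_def ac_simps)
   also have "... = nn_integral (mix t u) \<Phi>" by (rule nn_integral_mix[OF t(1) z \<Phi>m False, symmetric])
   also have "... = (\<integral>\<^sup>+p. V j (p 2) (p(1 := ?b u)) \<partial>PiM (insert 2 {3..N}) (\<lambda>_. mix t u))"
   proof -
    have pm: "(\<lambda>p. V j (p 2) (p(1 := ?b u))) \<in> bm (PiM (insert 2 {3..N}) (\<lambda>_. X))"
    proof -
     have "(\<lambda>p. (p 2, p(1 := ?b u))) \<in> PiM {2..N} (\<lambda>_. X) \<rightarrow>\<^sub>M X \<Otimes>\<^sub>M Tup"
      unfolding index_set using b N2
      by (intro measurable_Pair measurable_component_singleton measurable_fun_upd[where J="{2..N}"] measurable_const) (auto simp: measurable_ident_sets)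
     from measurable_compose[OF this V_measurable[OF t(5)]] show ?thesis unfolding index_set2 by simp
    qed
    have "(\<integral>\<^sup>+p. V j (p 2) (p(1 := ?b u)) \<partial>PiM (insert 2 {3..N}) (\<lambda>_. mix t u)) =
     (\<integral>\<^sup>+a. \<integral>\<^sup>+p. V j ((p(2 := a)) 2) ((p(2 := a))(1 := ?b u)) \<partial>PiM {3..N} (\<lambda>_. mix t u) \<partial>mix t u)"
    proof (rule nn_integral_PiM_insert)
     have "sets (PiM (insert 2 {3..N}) (\<lambda>_. mix t u)) = sets (PiM (insert 2 {3..N}) (\<lambda>_. X))" by (intro sets_PiM_cong refl m)
     then show "(\<lambda>p. V j (p 2) (p(1 := ?b u))) \<in> bm (PiM (insert 2 {3..N}) (\<lambda>_. mix t u))"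
      using pm by (simp cong: measurable_cong_sets)
    qed (use m in auto)
    then show ?thesis unfolding \<Phi>_def put_def by (simp add: fun_upd_twist)
   qed
   finally show ?thesis unfolding index_set2 by simp
  qed
 qed
 finally show ?thesis unfolding t_def .
qed

lemma icsmc_ge_V: "(\<integral>\<^sup>+u. (\<Sum>k=2..N. V 0 (u k) u) \<partial>C T x) \<le> nn_integral (Pk x) f"
 unfolding nn_integral_icsmc[OF x f]
proof (rule nn_integral_mono)
 fix u assume "u \<in> space (C T x)"
 then have z: "u \<in> space Tup" using C_prob(3)[OF order_refl x] by simp
 show "(\<Sum>k=2..N. V 0 (u k) u) \<le> Sel f u"
 proof (cases "tot T u = 0")
  case True
  then show ?thesis by (simp add: rinv_def)
 next
  case False
  have "(\<Sum>k=2..N. V 0 (u k) u) = (\<Sum>k=2..N. ennreal (wt T (u k)) * f (u k)) * inverse (tot T u)"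
   using False by (simp add: rinv_def sum_distrib_right)
  also have "... \<le> (\<Sum>k=1..N. ennreal (wt T (u k)) * f (u k)) * inverse (tot T u)"
   by (intro mult_right_mono sum_mono2) auto
  also have "... = Sel f u" by (rule Sel_eq[OF z False, symmetric])
  finally show ?thesis .
 qed
qed

text \<open>At each time the ancestor k = 1, which would merge the new path with the reference path,
  is dropped; exchangeability collects the others into a factor N - 1.\<close>

lemma icsmc_ge_V_iter:
 "j < T ==> of_nat (N - 1) ^ j * (\<integral>\<^sup>+u. (\<Sum>k=2..N. V j (u k) u) \<partial>C (T - j) x) \<le> nn_integral (Pk x) f"
proof (induction j)
 case 0
 then show ?case using icsmc_ge_V by simp
next
 case (Suc j)
 have "(\<integral>\<^sup>+u. (\<Sum>k=2..N. V (Suc j) (u k) u) \<partial>C (T - Suc j) x) \<le> (\<integral>\<^sup>+u. (\<Sum>k=1..N. V (Suc j) (u k) u) \<partial>C (T - Suc j) x)"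
  by (intro nn_integral_mono sum_mono2) auto
 also have "... \<le> (\<integral>\<^sup>+u. V j (u 2) u \<partial>C (T - j) x)" using Suc.prems by (intro V_step) simp
 finally have "of_nat (N - 1) ^ Suc j * (\<integral>\<^sup>+u. (\<Sum>k=2..N. V (Suc j) (u k) u) \<partial>C (T - Suc j) x)
   \<le> of_nat (N - 1) ^ Suc j * (\<integral>\<^sup>+u. V j (u 2) u \<partial>C (T - j) x)" by (intro mult_left_mono) auto
 also have "... = of_nat (N - 1) ^ j * (\<integral>\<^sup>+u. (\<Sum>k=2..N. V j (u k) u) \<partial>C (T - j) x)"
  using sum_V_exchange[of j] Suc.prems by (simp add: ac_simps)
 also have "... \<le> nn_integral (Pk x) f" using Suc by simp
 finally show ?case .
qed

abbreviation btup where "btup \<equiv> \<lambda>i\<in>{1..N}. base"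

text \<open>At time 0 all N particles are \<open>base\<close> and no ancestor is excluded, so the
  factor is N there. It cancels in \<open>icsmc_lower\<close> against \<open>U T\<close>, of which
  every particle holds the same share.\<close>

lemma icsmc_ge_V_base: "of_nat (N - 1) ^ T * (of_nat N * V T base btup) \<le> nn_integral (Pk x) f"
proof -
 have T1: "T - 1 < T" "T - (T - 1) = 1" "Suc (T - 1) = T" using T by auto
 have "(\<lambda>u. \<Sum>k=1..N. V T (u k) u) \<in> bm Tup"
  by (intro borel_measurable_sum coord_V_measurable) auto
 then have "(\<integral>\<^sup>+u. (\<Sum>k=1..N. V T (u k) u) \<partial>C 0 x) = (\<Sum>k=1..N. V T (btup k) btup)"
  unfolding C.simps by (rule nn_integral_return[OF base_tuple_space])
 also have "... = of_nat N * V T base btup" by simp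
 finally have e: "(\<integral>\<^sup>+u. (\<Sum>k=1..N. V T (u k) u) \<partial>C 0 x) = of_nat N * V T base btup" .
 have "of_nat N * V T base btup \<le> (\<integral>\<^sup>+u. V (T - 1) (u 2) u \<partial>C 1 x)"
  using V_step[of "T - 1"] e T1 by simp
 then have "of_nat (N - 1) ^ T * (of_nat N * V T base btup) \<le> of_nat (N - 1) ^ T * (\<integral>\<^sup>+u. V (T - 1) (u 2) u \<partial>C 1 x)"
  by (intro mult_left_mono) auto
 also have "... = of_nat (N - 1) ^ (T - 1) * (of_nat (N - 1) * (\<integral>\<^sup>+u. V (T - 1) (u 2) u \<partial>C 1 x))"
 proof -
  have "of_nat (N - 1) ^ T = of_nat (N - 1) ^ (T - 1) * (of_nat (N - 1) :: ennreal)" using T1(3) power_Suc2 by metis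
  then show ?thesis by (simp add: mult.assoc)
 qed
 also have "... \<le> nn_integral (Pk x) f"
  using icsmc_ge_V_iter[OF T1(1)] sum_V_exchange[OF T1(1)] T1(2) by simp
 finally show ?thesis .
qed

text \<open>The law of a path that agrees with e up to time T - j and is continued to time T by the
  moves alone, without selection.\<close>

primrec fu where
 "fu 0 e = return X e"
| "fu (Suc j) e = mv (T - Suc j) e \<bind> fu j"

lemma fu_measurable: "j \<le> T ==> fu j \<in> X \<leadsto> X"
proof (induction j)
 case 0
 show ?case unfolding fu.simps(1)[abs_def] by (rule measurable_return_prob_space)
next
 case (Suc j)
 then show ?case unfolding fu.simps(2)[abs_def] by (intro measurable_bind_prob_space[OF mv_measurable]) auto
qed

lemma nn_integral_fu_Suc:
 assumes j: "Suc j \<le> T" and e: "e \<in> space X" and F: "F \<in> bm X"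
 shows "nn_integral (fu (Suc j) e) F = (\<integral>\<^sup>+a. \<integral>\<^sup>+y. F y \<partial>fu j a \<partial>mv (T - Suc j) e)"
 unfolding fu.simps
 by (rule nn_integral_kernel_bind[OF prob_kernelD(2)[OF mv_measurable e] fu_measurable F]) (use j in auto)

lemma nn_integral_Y_fu:
 assumes F: "F \<in> bm X"
 shows "j \<le> T ==> (\<integral>\<^sup>+e. \<integral>\<^sup>+y. F y \<partial>fu j e \<partial>Y (T - j)) = nn_integral (Y T) F"
proof (induction j)
 case 0
 have "nn_integral (fu 0 e) F = F e" if "e \<in> space (Y T)" for e
  using that space_Y[of T] F by (simp add: nn_integral_return)
 then show ?case unfolding diff_zero by (rule nn_integral_cong)
next
 case (Suc j)
 have t: "T - Suc j < T" "Suc (T - Suc j) = T - j" using Suc.prems by auto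
 have "(\<integral>\<^sup>+e. \<integral>\<^sup>+y. F y \<partial>fu (Suc j) e \<partial>Y (T - Suc j)) = (\<integral>\<^sup>+e. \<integral>\<^sup>+a. \<integral>\<^sup>+y. F y \<partial>fu j a \<partial>mv (T - Suc j) e \<partial>Y (T - Suc j))"
  using Suc.prems F space_Y[of "T - Suc j"] by (intro nn_integral_cong nn_integral_fu_Suc) auto
 also have "... = (\<integral>\<^sup>+a. \<integral>\<^sup>+y. F y \<partial>fu j a \<partial>Y (T - j))"
  using nn_integral_Y_Suc[OF t(1) nn_integral_kernel_measurable[OF fu_measurable F, of j]] Suc.prems t(2) by simp
 also have "... = nn_integral (Y T) F" using Suc by simp
 finally show ?case .
qed

text \<open>Moves after time s leave the coordinates up to s alone. As in
  \<open>nn_integral_C_reference\<close>, integrals avoid the measurability of singletons.\<close>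

lemma nn_integral_fu_past:
 assumes "s + j \<le> T" "e \<in> space X" "(\<lambda>(b, y). F b y) \<in> bm XX"
 shows "(\<integral>\<^sup>+y. F (trunc s e) y \<partial>fu j e) = (\<integral>\<^sup>+y. F (trunc s y) y \<partial>fu j e)"
 using assms
proof (induction j arbitrary: e)
 case 0
 have ts: "trunc s \<in> X \<rightarrow>\<^sub>M X" using 0 by (intro trunc_measurable) simp
 then have "(\<lambda>y. (trunc s y, y)) \<in> X \<rightarrow>\<^sub>M X \<Otimes>\<^sub>M X" by simp
 from measurable_compose[OF this 0(3)] have m: "(\<lambda>y. F (trunc s y) y) \<in> bm X" by simp
 have "F (trunc s e) \<in> bm X" by (rule measurable_param_section[OF 0(3) measurable_space[OF ts 0(2)]])
 then show ?case using m 0 by (simp add: nn_integral_return)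
next
 case (Suc j)
 define t where "t = T - Suc j"
 have t: "t < T" "Suc t \<in> {1..T}" using Suc.prems by (auto simp: t_def)
 have ts: "trunc s \<in> X \<rightarrow>\<^sub>M X" using Suc.prems by (intro trunc_measurable) simp
 then have "(\<lambda>y. (trunc s y, y)) \<in> X \<rightarrow>\<^sub>M X \<Otimes>\<^sub>M X" by simp
 from measurable_compose[OF this Suc.prems(3)] have m: "(\<lambda>y. F (trunc s y) y) \<in> bm X" by simp
 have m2: "F (trunc s e) \<in> bm X" by (rule measurable_param_section[OF Suc.prems(3) measurable_space[OF ts Suc.prems(2)]])
 have fm: "(\<lambda>a. \<integral>\<^sup>+y. H y \<partial>fu j a) \<in> bm X" if "H \<in> bm X" for H
  using Suc.prems by (intro nn_integral_kernel_measurable[OF fu_measurable that]) simp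
 have tr: "trunc s (e(Suc t := w)) = trunc s e" for w
  using Suc.prems by (auto simp: trunc_def t_def fun_eq_iff)
 have "(\<integral>\<^sup>+y. F (trunc s e) y \<partial>fu (Suc j) e) = (\<integral>\<^sup>+w. \<integral>\<^sup>+y. F (trunc s e) y \<partial>fu j (e(Suc t := w)) \<partial>(if t = 0 then M1 else M (Suc t) (e t)))"
  using nn_integral_fu_Suc[OF _ Suc.prems(2) m2, of j] Suc.prems
  by (simp add: t_def[symmetric] nn_integral_mv[OF t(1) Suc.prems(2) fm[OF m2]] del: fu.simps split del: if_split)
 also have "... = (\<integral>\<^sup>+w. \<integral>\<^sup>+y. F (trunc s y) y \<partial>fu j (e(Suc t := w)) \<partial>(if t = 0 then M1 else M (Suc t) (e t)))"
 proof (rule nn_integral_cong)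
  fix w assume "w \<in> space (if t = 0 then M1 else M (Suc t) (e t))"
  then have w: "w \<in> space Z" using prob_kernelD(3)[OF move_law_measurable[OF t(1)] Suc.prems(2)] by simp
  have ew: "e(Suc t := w) \<in> space X" by (rule upd_space[OF t(2) Suc.prems(2) w])
  show "(\<integral>\<^sup>+y. F (trunc s e) y \<partial>fu j (e(Suc t := w))) = (\<integral>\<^sup>+y. F (trunc s y) y \<partial>fu j (e(Suc t := w)))"
  proof -
   have "s + j \<le> T" using Suc.prems(1) by simp
   from Suc.IH[OF this ew Suc.prems(3)] show ?thesis unfolding tr .
  qed
 qed
 also have "... = (\<integral>\<^sup>+y. F (trunc s y) y \<partial>fu (Suc j) e)"
  using nn_integral_fu_Suc[OF _ Suc.prems(2) m, of j] Suc.prems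
  by (simp add: t_def[symmetric] nn_integral_mv[OF t(1) Suc.prems(2) fm[OF m]] del: fu.simps split del: if_split)
 finally show ?case .
qed

text \<open>
 With two fixed paths \<open>x\<close> and \<open>y\<close>, the expectation of the product of the sums of the weights from
 time \<open>t = T - j\<close> on is \<open>\<Sum>i. hh j y (u i)\<close>, given the particles \<open>u\<close> at time \<open>t\<close>.
\<close>

primrec hh where
 "hh 0 y e = ennreal (wt T e)"
| "hh (Suc j) y e = ennreal (wt (T - Suc j) e) *
   (hh j y x + hh j y y + of_nat (N - 2) * nn_integral (mv (T - Suc j) e) (hh j y))"

lemma hh_measurable: "j \<le> T ==> (\<lambda>(y, e). hh j y e) \<in> bm XX"
proof (induction j)
 case 0
 show ?case unfolding hh.simps case_prod_beta'
  by (intro comp_ennreal comp_snd[OF wt_measurable]) simp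
next
 case (Suc j)
 define t where "t = T - Suc j"
 have t: "t < T" "t \<le> T" using Suc.prems by (auto simp: t_def)
 have IH: "(\<lambda>(y, e). hh j y e) \<in> bm XX" using Suc by simp
 have 1: "(\<lambda>y. hh j y x) \<in> bm X" by (rule measurable_param_section2[OF IH x])
 have 2: "(\<lambda>y. hh j y y) \<in> bm X" by (rule measurable_diag[OF IH])
 have 3: "(\<lambda>q. \<integral>\<^sup>+a. hh j (fst q) a \<partial>mv t (snd q)) \<in> bm XX"
 proof (rule nn_integral_kernel_measurable2[OF comp_snd[OF mv_measurable[OF t(1)]]])
  have "(\<lambda>r. (fst (fst r), snd r)) \<in> XX \<Otimes>\<^sub>M X \<rightarrow>\<^sub>M X \<Otimes>\<^sub>M X"
   by (intro measurable_Pair measurable_snd comp_fst[OF measurable_fst])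
  from measurable_compose[OF this IH]
  show "(\<lambda>(q, a). hh j (fst q) a) \<in> bm (XX \<Otimes>\<^sub>M X)" by (simp add: case_prod_beta')
 qed
 show ?case unfolding hh.simps t_def[symmetric] case_prod_beta'
  by (intro borel_measurable_times_ennreal borel_measurable_add comp_ennreal
    comp_snd[OF wt_measurable[OF t(2)]] comp_fst[OF 1]
    comp_fst[OF 2] measurable_const 3) simp
qed

lemma hh_measurable1: "j \<le> T ==> y \<in> space X ==> hh j y \<in> bm X"
 by (rule measurable_param_section[OF hh_measurable])

definition agree where "agree t e e' \<longleftrightarrow> t = 0 \<or> e t = (e' t :: 'a)"

lemma wt_agree: "agree t e e' ==> wt t e = wt t e'"
 by (auto simp: agree_def wt_def)

text \<open>The Markov property: the weight and the moves from time T - j on look at the coordinate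
  of that time only.\<close>

lemma hh_agree:
 "j \<le> T ==> y \<in> space X ==> e \<in> space X ==> e' \<in> space X ==> agree (T - j) e e' ==> hh j y e = hh j y e'"
proof (induction j arbitrary: e e')
 case 0
 then show ?case by (simp add: wt_agree)
next
 case (Suc j)
 define t where "t = T - Suc j"
 have t: "t < T" "Suc t \<in> {1..T}" "T - j = Suc t" using Suc.prems by (auto simp: t_def)
 have hm: "hh j y \<in> bm X" using Suc.prems by (intro hh_measurable1) auto
 have ag: "agree t e e'" using Suc.prems by (simp add: t_def)
 have law: "(if t = 0 then M1 else M (Suc t) (e t)) = (if t = 0 then M1 else M (Suc t) (e' t))"
  using ag by (auto simp: agree_def)
 have "nn_integral (mv t e) (hh j y) = nn_integral (mv t e') (hh j y)"
  unfolding nn_integral_mv[OF t(1) Suc.prems(3) hm] nn_integral_mv[OF t(1) Suc.prems(4) hm] law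
 proof (rule nn_integral_cong)
  fix w assume "w \<in> space (if t = 0 then M1 else M (Suc t) (e' t))"
  then have w: "w \<in> space Z" using prob_kernelD(3)[OF move_law_measurable[OF t(1)] Suc.prems(4)] by simp
  show "hh j y (e(Suc t := w)) = hh j y (e'(Suc t := w))"
   using Suc.prems by (intro Suc.IH upd_space[OF t(2) _ w]) (auto simp: agree_def t(3))
 qed
 then show ?case using wt_agree[OF ag] by (simp add: t_def[symmetric])
qed

definition U where "U j y u = (\<Sum>i=1..N. hh j y (u i))"

lemma U_measurable:
 assumes "j \<le> T"
 shows "(\<lambda>(y, u). U j y u) \<in> bm XTup"
 unfolding U_def case_prod_beta'
proof (rule borel_measurable_sum)
 fix i assume i: "i \<in> {1..N}"
 have "(\<lambda>q. (fst q, snd q i)) \<in> X \<Otimes>\<^sub>M Tup \<rightarrow>\<^sub>M X \<Otimes>\<^sub>M X"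
  using i by (intro measurable_Pair measurable_fst comp_snd[OF particle_coord_measurable])
 from measurable_compose[OF this hh_measurable[OF assms]]
 show "(\<lambda>q. hh j (fst q) (snd q i)) \<in> bm XTup" by simp
qed

text \<open>The total weight factors out. What remains is the mean sum over the next generation: two
  fixed paths and N - 2 draws from the mixture.\<close>

lemma U_Suc:
 assumes j: "Suc j \<le> T" and y: "y \<in> space X" and z: "u \<in> space Tup" and nz: "tot (T - Suc j) u \<noteq> 0"
 shows "U (Suc j) y u = tot (T - Suc j) u * (hh j y x + hh j y y + of_nat (N - 2) * nn_integral (mix (T - Suc j) u) (hh j y))"
proof -
 let ?t = "T - Suc j"
 have t: "?t < T" using j by simp
 have hm: "hh j y \<in> bm X" using j y by (intro hh_measurable1) auto
 have "tot ?t u * nn_integral (mix ?t u) (hh j y) = (\<Sum>k=1..N. ennreal (wt ?t (u k)) * nn_integral (mv ?t (u k)) (hh j y))"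
  unfolding nn_integral_mix[OF t z hm nz] by (rule tot_cancel[OF nz])
 then have "tot ?t u * (hh j y x + hh j y y + of_nat (N - 2) * nn_integral (mix ?t u) (hh j y)) =
   (\<Sum>k=1..N. ennreal (wt ?t (u k))) * (hh j y x + hh j y y) + of_nat (N - 2) * (\<Sum>k=1..N. ennreal (wt ?t (u k)) * nn_integral (mv ?t (u k)) (hh j y))"
  unfolding tot_def by (simp add: distrib_left mult.left_commute)
 also have "... = U (Suc j) y u"
  unfolding U_def hh.simps sum_distrib_right sum_distrib_left sum.distrib[symmetric]
  by (intro sum.cong refl) (simp add: distrib_left mult.left_commute)
 finally show ?thesis by simp
qed

definition Wf where "Wf j y = (\<Prod>s\<in>{T-j..T}. ennreal (wt s y))"

lemma Wf_Suc: "Suc j \<le> T ==> Wf (Suc j) y = ennreal (wt (T - Suc j) y) * Wf j y"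
proof -
 assume j: "Suc j \<le> T"
 have "{T - Suc j..T} = insert (T - Suc j) {T - j..T}" using j by auto
 then show ?thesis unfolding Wf_def using j by simp
qed

lemma Wf_measurable: "Wf j \<in> bm X"
 unfolding Wf_def[abs_def]
 by (intro borel_measurable_prod_ennreal comp_ennreal wt_measurable) auto

text \<open>The same expression as in \<open>U_Suc\<close>, except for the path at position 2.
  Together they show that \<open>U (Suc j) y u\<close> is the total weight times the mean of
  \<open>U j y\<close> over the next generation, if a and y agree at that time.\<close>

lemma nn_integral_U_put:
 assumes j: "Suc j \<le> T" and y: "y \<in> space X" and z: "u \<in> space Tup" and a: "a \<in> space X"
 defines "t \<equiv> T - Suc j"
 shows "(\<integral>\<^sup>+p. U j y (put t u p a) \<partial>PiM {3..N} (\<lambda>_. mix t u)) = hh j y x + hh j y a + of_nat (N - 2) * nn_integral (mix t u) (hh j y)"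
proof -
 have t: "t < T" "Suc t \<in> {1..T}" "T - j = Suc t" using j by (auto simp: t_def)
 note m = prob_kernelD[OF mix_measurable[OF t(1)] z]
 interpret P: prob_space "PiM {3..N} (\<lambda>_. mix t u)" by (rule prob_space_PiM) (rule m)
 have hm: "hh j y \<in> bm X" using j y by (intro hh_measurable1) auto
 have hm': "hh j y \<in> bm (mix t u)" using hm m(2) by (simp cong: measurable_cong_sets)
 have cm: "(\<lambda>p. hh j y (p i)) \<in> bm (PiM {3..N} (\<lambda>_. mix t u))" if "i \<in> {3..N}" for i
  by (rule measurable_compose[where f="\<lambda>p. p i", OF measurable_component_singleton[OF that] hm'])
 have x1: "hh j y ((u 1)(Suc t := x (Suc t))) = hh j y x"
 proof (rule hh_agree[OF _ y])
  show "(u 1)(Suc t := x (Suc t)) \<in> space X"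
   using N by (intro upd_space[OF t(2)] particle_space_Tup[OF z] coord_space[OF x t(2)]) auto
  show "agree (T - j) ((u 1)(Suc t := x (Suc t))) x" unfolding t(3) by (simp add: agree_def)
 qed (use j x in auto)
 have "U j y (put t u p a) = hh j y x + hh j y a + (\<Sum>i=3..N. hh j y (p i))" for p
 proof -
  have "(\<Sum>i=3..N. hh j y (put t u p a i)) = (\<Sum>i=3..N. hh j y (p i))" by (intro sum.cong) (auto simp: put_simps)
  then show ?thesis unfolding U_def index_set3 by (simp add: put_simps x1 ac_simps)
 qed
 then have "(\<integral>\<^sup>+p. U j y (put t u p a) \<partial>PiM {3..N} (\<lambda>_. mix t u)) =
   (\<integral>\<^sup>+p. (hh j y x + hh j y a) + (\<Sum>i=3..N. hh j y (p i)) \<partial>PiM {3..N} (\<lambda>_. mix t u))" by simp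
 also have "... = (hh j y x + hh j y a) + (\<Sum>i=3..N. \<integral>\<^sup>+p. hh j y (p i) \<partial>PiM {3..N} (\<lambda>_. mix t u))"
  by (subst nn_integral_add, (auto intro!: borel_measurable_sum cm)[2])
   (simp add: P.emeasure_space_1, subst nn_integral_sum, auto intro: cm)
 also have "(\<Sum>i=3..N. \<integral>\<^sup>+p. hh j y (p i) \<partial>PiM {3..N} (\<lambda>_. mix t u)) = (\<Sum>i=3..N. \<integral>\<^sup>+a. hh j y a \<partial>mix t u)"
  by (intro sum.cong refl nn_integral_PiM_component m(1) hm') auto
 also have "... = of_nat (N - 2) * nn_integral (mix t u) (hh j y)"
 proof -
  have "card {3..N} = N - 2" by simp
  then show ?thesis by (simp only: sum_constant)
 qed
 finally show ?thesis .
qed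

lemma trunc_agree: "s \<le> T ==> agree s (trunc s e) e"
 by (auto simp: agree_def trunc_def One_nat_def)

text \<open>By \<open>U_Suc\<close> the inverse of \<open>U (Suc j) y u\<close> splits into the
  inverse of the total weight and the inverse of a mean over the free particles of the next
  generation. Jensen's inequality moves the second inverse inside the mean, and the induction
  hypothesis applies for fixed free particles.\<close>

lemma V_lower:
 "j \<le> T ==> u \<in> space Tup ==> u 2 = e ==> agree (T - j) (u 1) x ==>
  (\<integral>\<^sup>+y. Wf j y * f y * inverse (U j y u) \<partial>fu j e) \<le> V j e u"
proof (induction j arbitrary: e u)
 case 0
 have two: "2 \<in> {1..N}" using N2 by simp
 have e: "e \<in> space X" using particle_space_Tup[OF 0(2) two] 0(3) by simp
 have U0: "U 0 y u = tot T u" for y by (simp add: U_def tot_def)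
 have W0: "Wf 0 y = ennreal (wt T y)" for y by (simp add: Wf_def)
 have "(\<lambda>y. Wf 0 y * f y * inverse (tot T u)) \<in> bm X"
  by (intro borel_measurable_times_ennreal Wf_measurable f measurable_const) simp
 from nn_integral_return[OF e this]
 have "(\<integral>\<^sup>+y. Wf 0 y * f y * inverse (U 0 y u) \<partial>fu 0 e) = ennreal (wt T e) * f e * inverse (tot T u)"
  by (simp add: U0 W0)
 also have "... \<le> V 0 e u"
  using tot_0_iff[OF order_refl 0(2) _ two] 0(3) by (auto simp: rinv_def)
 finally show ?case .
next
 case (Suc j)
 define t where "t = T - Suc j"
 have t: "t < T" "t \<le> T" "Suc t \<in> {1..T}" "T - j = Suc t" "Suc t \<le> T" "j \<le> T" "Suc j \<le> T" "t + Suc j \<le> T" "Suc t + j \<le> T"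
  using Suc.prems by (auto simp: t_def)
 note z = Suc.prems(2)
 have two: "2 \<in> {1..N}" using N2 by simp
 have e: "e \<in> space X" using particle_space_Tup[OF z two] Suc.prems(3) by simp
 note m = prob_kernelD[OF mix_measurable[OF t(1)] z]
 let ?P = "PiM {3..N} (\<lambda>_. mix t u)"
 have sP: "sets ?P = sets Tup3" by (intro sets_PiM_cong refl m)
 have pP: "prob_space ?P" by (rule prob_space_PiM) (rule m)
 have spP: "space ?P = space Tup3" by (rule sets_eq_imp_space_eq[OF sP])
 have Um: "(\<lambda>y. U k y u) \<in> bm X" if "k \<le> T" for k by (rule measurable_param_section2[OF U_measurable[OF that] z])
 define R where "R = (\<lambda>y. Wf j y * f y * inverse (U (Suc j) y u))"
 have Rm: "R \<in> bm X" unfolding R_def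
  using Um[OF t(7)] by (intro borel_measurable_times_ennreal Wf_measurable f) measurable
 \<comment> \<open>Under \<open>fu (Suc j) e\<close> the path y still agrees with e at time t, so
   its weight at time t is the constant \<open>wt t e\<close>.\<close>
 have pull: "(\<integral>\<^sup>+y. Wf (Suc j) y * f y * inverse (U (Suc j) y u) \<partial>fu (Suc j) e) = ennreal (wt t e) * nn_integral (fu (Suc j) e) R"
 proof -
  have Fm: "(\<lambda>(b, y). ennreal (wt t b) * R y) \<in> bm XX"
   unfolding case_prod_beta'
   by (intro borel_measurable_times_ennreal comp_ennreal
     comp_fst[OF wt_measurable[OF t(2)]] comp_snd[OF Rm])
  have "(\<integral>\<^sup>+y. Wf (Suc j) y * f y * inverse (U (Suc j) y u) \<partial>fu (Suc j) e) = (\<integral>\<^sup>+y. ennreal (wt t (trunc t y)) * R y \<partial>fu (Suc j) e)"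
   unfolding Wf_Suc[OF t(7)] R_def t_def[symmetric] wt_trunc[OF t(2)] by (simp add: mult.assoc)
  also have "... = (\<integral>\<^sup>+y. ennreal (wt t (trunc t e)) * R y \<partial>fu (Suc j) e)"
   by (rule nn_integral_fu_past[OF t(8) e Fm, symmetric])
  also have "... = ennreal (wt t e) * nn_integral (fu (Suc j) e) R"
   unfolding wt_trunc[OF t(2)]
   by (rule nn_integral_cmult) (use Rm prob_kernelD(2)[OF fu_measurable[OF t(7)] e] in \<open>simp cong: measurable_cong_sets\<close>)
  finally show ?thesis .
 qed
 show ?case
 proof (cases "tot t u = 0")
  case True
  then have "ennreal (wt t e) = 0" using tot_0_iff[OF t(2) z True two] Suc.prems(3) by simp
  then show ?thesis unfolding pull by simp
 next
  case False
  have r: "rinv t u = inverse (tot t u)" using False by (simp add: rinv_def)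
  \<comment> \<open>The mean of \<open>U j y\<close> over the next generation when its second
    particle is b. Separating b from y allows the passage from \<open>D y y\<close> to
    \<open>D a y\<close>: under \<open>fu j a\<close> the paths a and y agree at time t + 1.\<close>
  define D where "D = (\<lambda>b y. hh j y x + hh j y b + of_nat (N - 2) * nn_integral (mix t u) (hh j y))"
  have mixc: "(\<lambda>_. mix t u) \<in> X \<leadsto> X" by (intro measurable_const measurable_space[OF mix_measurable[OF t(1)] z])
  have hj: "(\<lambda>(y, e). hh j y e) \<in> bm XX" by (rule hh_measurable[OF t(6)])
  have Dm: "(\<lambda>(b, y). D b y) \<in> bm XX"
   unfolding D_def case_prod_beta'
  proof (intro borel_measurable_add borel_measurable_times_ennreal measurable_const)
   show "(\<lambda>q. hh j (snd q) x) \<in> bm XX"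
    by (rule comp_snd[OF measurable_param_section2[OF hj x]])
   show "(\<lambda>q. hh j (snd q) (fst q)) \<in> bm XX"
    using measurable_compose[OF measurable_pair_swap' hj] by (simp add: case_prod_beta')
   have "(\<lambda>y. \<integral>\<^sup>+a. hh j y a \<partial>mix t u) \<in> bm X" by (rule nn_integral_kernel_measurable2[OF mixc hj])
   then show "(\<lambda>q. \<integral>\<^sup>+a. hh j (snd q) a \<partial>mix t u) \<in> bm XX" by (rule comp_snd)
  qed simp
  have R_eq: "R y = inverse (tot t u) * (Wf j y * f y * inverse (D y y))" if y: "y \<in> space X" for y
  proof -
   have "inverse (tot t u * D y y) = inverse (tot t u) * inverse (D y y)"
    using False tot_finite[of t u] by (intro ennreal_inverse_mult_pos) auto
   then show ?thesis unfolding R_def U_Suc[OF t(7) y z False[unfolded t_def]] t_def[symmetric] D_def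
    by (simp add: ac_simps)
  qed
  have key: "inverse (tot t u) * (\<integral>\<^sup>+p. V j a (put t u p a) \<partial>?P) \<ge> (nn_integral (fu j a) R)" if a: "a \<in> space X" for a
  proof -
   note fa = prob_kernelD[OF fu_measurable[OF t(6)] a]
   define Q where "Q = (\<lambda>p y. Wf j y * f y * inverse (U j y (put t u p a)))"
   have pm: "(\<lambda>p. put t u p a) \<in> Tup3 \<rightarrow>\<^sub>M Tup"
   proof -
    have "Pair (a, u) \<in> Tup3 \<rightarrow>\<^sub>M XTup \<Otimes>\<^sub>M Tup3"
     using a z by (intro measurable_Pair1') (simp add: space_pair_measure)
    from measurable_compose[OF this put_measurable[OF t(1)]] show ?thesis by simp
   qed
   have Up: "(\<lambda>(p, y). U j y (put t u p a)) \<in> bm (Tup3 \<Otimes>\<^sub>M X)"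
   proof -
    have "(\<lambda>q. (snd q, put t u (fst q) a)) \<in> Tup3 \<Otimes>\<^sub>M X \<rightarrow>\<^sub>M X \<Otimes>\<^sub>M Tup"
     by (intro measurable_Pair measurable_snd comp_fst[OF pm])
    from measurable_compose[OF this U_measurable[OF t(6)]] show ?thesis by (simp add: case_prod_beta')
   qed
   have Qm: "(\<lambda>(p, y). Q p y) \<in> bm (Tup3 \<Otimes>\<^sub>M X)"
    unfolding Q_def case_prod_beta'
    using Up[unfolded case_prod_beta'] comp_snd[OF Wf_measurable] comp_snd[OF f]
    by measurable
   have Qm': "(\<lambda>(p, y). Q p y) \<in> bm (?P \<Otimes>\<^sub>M fu j a)"
    using Qm sets_pair_measure_cong[OF sP fa(2)] by (simp cong: measurable_cong_sets)
   have "nn_integral (fu j a) R = inverse (tot t u) * (\<integral>\<^sup>+y. Wf j y * f y * inverse (D y y) \<partial>fu j a)"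
   proof -
    have "(\<lambda>y. D y y) \<in> bm X" by (rule measurable_diag[OF Dm])
    then have "(\<lambda>y. Wf j y * f y * inverse (D y y)) \<in> bm X"
     by (intro borel_measurable_times_ennreal Wf_measurable f) measurable
    then have "(\<lambda>y. Wf j y * f y * inverse (D y y)) \<in> bm (fu j a)" using fa(2) by (simp cong: measurable_cong_sets)
    note c = nn_integral_cmult[OF this, of "inverse (tot t u)"]
    have "nn_integral (fu j a) R = (\<integral>\<^sup>+y. inverse (tot t u) * (Wf j y * f y * inverse (D y y)) \<partial>fu j a)"
     by (rule nn_integral_cong) (simp add: R_eq fa(3))
    then show ?thesis using c by simp
   qed
   also have "(\<integral>\<^sup>+y. Wf j y * f y * inverse (D y y) \<partial>fu j a) = (\<integral>\<^sup>+y. Wf j y * f y * inverse (D a y) \<partial>fu j a)"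
   proof -
    have Fm: "(\<lambda>(b, y). Wf j y * f y * inverse (D b y)) \<in> bm XX"
     unfolding case_prod_beta'
     using Dm[unfolded case_prod_beta'] comp_snd[OF Wf_measurable] comp_snd[OF f]
     by measurable
    have Dt: "D (trunc (Suc t) b) y = D b y" if "b \<in> space X" "y \<in> space X" for b y
    proof -
     have "trunc (Suc t) b \<in> space X" using measurable_space[OF trunc_measurable[OF t(5)] that(1)] .
     then show ?thesis unfolding D_def
      using hh_agree[OF t(6) that(2) _ that(1), of "trunc (Suc t) b"] trunc_agree[OF t(5)] t(4) by simp
    qed
    have "(\<integral>\<^sup>+y. Wf j y * f y * inverse (D a y) \<partial>fu j a) = (\<integral>\<^sup>+y. Wf j y * f y * inverse (D (trunc (Suc t) a) y) \<partial>fu j a)"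
     by (rule nn_integral_cong) (simp add: Dt[OF a] fa(3))
    also have "... = (\<integral>\<^sup>+y. Wf j y * f y * inverse (D (trunc (Suc t) y) y) \<partial>fu j a)"
     by (rule nn_integral_fu_past[OF t(9) a Fm])
    also have "... = (\<integral>\<^sup>+y. Wf j y * f y * inverse (D y y) \<partial>fu j a)"
     by (rule nn_integral_cong) (simp add: Dt fa(3))
    finally show ?thesis by simp
   qed
   also have "... \<le> (\<integral>\<^sup>+y. \<integral>\<^sup>+p. Q p y \<partial>?P \<partial>fu j a)"
   proof (rule nn_integral_mono)
    fix y assume "y \<in> space (fu j a)"
    then have y: "y \<in> space X" using fa(3) by simp
    have Uy: "(\<lambda>p. U j y (put t u p a)) \<in> bm ?P"
     using measurable_param_section2[OF Up y] sP by (simp cong: measurable_cong_sets)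
    have "inverse (D a y) = inverse (\<integral>\<^sup>+p. U j y (put t u p a) \<partial>?P)"
     unfolding D_def using nn_integral_U_put[OF t(7) y z a] by (simp add: t_def[symmetric])
    also have "... \<le> (\<integral>\<^sup>+p. inverse (U j y (put t u p a)) \<partial>?P)"
     by (rule nn_integral_inverse_ge[OF pP Uy])
    finally have "Wf j y * f y * inverse (D a y) \<le> Wf j y * f y * (\<integral>\<^sup>+p. inverse (U j y (put t u p a)) \<partial>?P)"
     by (intro mult_left_mono) auto
    also have "... = (\<integral>\<^sup>+p. Q p y \<partial>?P)"
     unfolding Q_def using Uy by (intro nn_integral_cmult[symmetric]) measurable
    finally show "Wf j y * f y * inverse (D a y) \<le> (\<integral>\<^sup>+p. Q p y \<partial>?P)" .
   qed
   \<comment> \<open>Fubini: the free particles are drawn first and the path y afterwards, as in the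
     induction hypothesis.\<close>
   also have "... = (\<integral>\<^sup>+p. \<integral>\<^sup>+y. Q p y \<partial>fu j a \<partial>?P)"
   proof -
    interpret p: pair_sigma_finite ?P "fu j a"
     by (intro pair_sigma_finite.intro prob_space_imp_sigma_finite pP fa)
    show ?thesis by (rule p.Fubini'[OF Qm'])
   qed
   also have "... \<le> (\<integral>\<^sup>+p. V j a (put t u p a) \<partial>?P)"
   proof (rule nn_integral_mono)
    fix p assume "p \<in> space ?P"
    then have p: "p \<in> space Tup3" using spP by simp
    show "nn_integral (fu j a) (Q p) \<le> V j a (put t u p a)"
     unfolding Q_def
     by (rule Suc.IH[OF t(6) put_space[OF t(1) z a p]]) (auto simp: put_simps agree_def t(4))
   qed
   finally show ?thesis by (simp add: mult_left_mono)
  qed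
  have "nn_integral (fu (Suc j) e) R = (\<integral>\<^sup>+a. \<integral>\<^sup>+y. R y \<partial>fu j a \<partial>mv t e)"
   unfolding t_def by (rule nn_integral_fu_Suc[OF t(7) e Rm])
  also have "... \<le> (\<integral>\<^sup>+a. inverse (tot t u) * (\<integral>\<^sup>+p. V j a (put t u p a) \<partial>?P) \<partial>mv t e)"
   using prob_kernelD(3)[OF mv_measurable[OF t(1)] e] by (intro nn_integral_mono key) simp
  also have "... = inverse (tot t u) * (\<integral>\<^sup>+a. (\<integral>\<^sup>+p. V j a (put t u p a) \<partial>?P) \<partial>mv t e)"
  proof (rule nn_integral_cmult)
   have "(\<lambda>a. \<integral>\<^sup>+p. V j a (put t u p a) \<partial>?P) \<in> bm X"
    by (rule measurable_param_section2[OF put_integral_measurable[OF t(1) V_measurable[OF t(6)]] z])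
   then show "(\<lambda>a. \<integral>\<^sup>+p. V j a (put t u p a) \<partial>?P) \<in> bm (mv t e)"
    using prob_kernelD(2)[OF mv_measurable[OF t(1)] e] by (simp cong: measurable_cong_sets)
  qed
  finally have "ennreal (wt t e) * nn_integral (fu (Suc j) e) R \<le> ennreal (wt t e) * (inverse (tot t u) * (\<integral>\<^sup>+a. (\<integral>\<^sup>+p. V j a (put t u p a) \<partial>?P) \<partial>mv t e))"
   by (intro mult_left_mono) auto
  then show ?thesis unfolding pull V.simps t_def[symmetric] r by (simp add: mult.assoc)
 qed
qed

text \<open>The recursion is started at time 0, where the free continuation of \<open>base\<close>
  has the law \<open>Y T\<close> of the Markov chain.\<close>

lemma icsmc_lower:
 "of_nat (N - 1) ^ T * (\<integral>\<^sup>+y. Wp (Suc T) y * f y * inverse (hh T y base) \<partial>Y T) \<le> nn_integral (Pk x) f"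
proof -
 have two: "2 \<in> {1..N}" using N2 by simp
 have b2: "btup 2 = base" using two by simp
 have ag: "agree (T - T) (btup 1) x" by (simp add: agree_def)
 have "{T - T..T} = {..<Suc T}" by auto
 then have W: "Wf T y = Wp (Suc T) y" for y by (simp add: Wf_def Wp_def)
 have U: "U T y btup = of_nat N * hh T y base" for y by (simp add: U_def)
 have hm: "(\<lambda>y. hh T y base) \<in> bm X" by (rule measurable_param_section2[OF hh_measurable[OF order_refl] base_space])
 define F where "F = (\<lambda>y. Wp (Suc T) y * f y * inverse (hh T y base))"
 have Fm: "F \<in> bm X"
  unfolding F_def using hm by (intro borel_measurable_times_ennreal Wp_measurable f) measurable
 have n: "of_nat N * inverse (of_nat N * h) = inverse h" for h :: ennreal
 proof -
  have "(of_nat N :: ennreal) \<noteq> 0" "(of_nat N :: ennreal) < \<top>" using N by (auto simp: of_nat_less_top)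
  then show ?thesis using ennreal_mult_divide_cancel[of "of_nat N"]
   by (simp add: ennreal_inverse_mult_pos mult.assoc[symmetric])
 qed
 have "nn_integral (Y T) F = nn_integral (fu T base) F"
  using nn_integral_Y_fu[OF Fm order_refl] nn_integral_return[OF base_space nn_integral_kernel_measurable[OF fu_measurable[OF order_refl] Fm]] by simp
 also have "... = (\<integral>\<^sup>+y. of_nat N * (Wf T y * f y * inverse (U T y btup)) \<partial>fu T base)"
  unfolding F_def W U by (simp add: n mult.left_commute[of "of_nat N"])
 also have "... = of_nat N * (\<integral>\<^sup>+y. Wf T y * f y * inverse (U T y btup) \<partial>fu T base)"
 proof (rule nn_integral_cmult)
  have "(\<lambda>y. Wf T y * f y * inverse (U T y btup)) \<in> bm X"
   unfolding U using hm by (intro borel_measurable_times_ennreal Wf_measurable f) measurable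
  then show "(\<lambda>y. Wf T y * f y * inverse (U T y btup)) \<in> bm (fu T base)"
   using prob_kernelD(2)[OF fu_measurable[OF order_refl] base_space] by (simp cong: measurable_cong_sets)
 qed
 also have "... \<le> of_nat N * V T base btup"
  by (intro mult_left_mono V_lower[OF order_refl base_tuple_space b2 ag]) simp
 finally have "of_nat (N - 1) ^ T * nn_integral (Y T) F \<le> of_nat (N - 1) ^ T * (of_nat N * V T base btup)"
  by (intro mult_left_mono) auto
 also have "... \<le> nn_integral (Pk x) f" by (rule icsmc_ge_V_base)
 finally show ?thesis unfolding F_def .
qed

end

subsection \<open>Feynman--Kac semigroups and bounds on the minorization constant\<close>

abbreviation (input) "one \<equiv> \<lambda>_. 1"

lemma ennreal_inverse_le:
 assumes "a \<le> b" shows "inverse b \<le> inverse (a :: ennreal)"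
proof (cases "a = 0 \<or> b = \<top>")
 case False
 then obtain r s where "a = ennreal r" "b = ennreal s" "0 < r" "r \<le> s"
  using assms by (cases a; cases b) (auto simp: top_unique less_le)
 then show ?thesis by (auto simp: inverse_ennreal intro!: ennreal_leI le_imp_inverse_le)
qed auto

text \<open>Clears the denominators of the mixing condition, where c stands for Q_{0,p}(1) and may
  be \<infinity>. If b / c = 0, the finite \<alpha> forces a = 0, as a / 0 = \<infinity> otherwise;
  if b = \<infinity>, the right-hand side is infinite because \<alpha> > 0.\<close>

lemma ennreal_mult_le_of_divide_le:
 fixes a b c \<alpha> :: ennreal
 assumes le: "a / (b / c) \<le> \<alpha>" and \<alpha>: "0 < \<alpha>" "\<alpha> < \<top>"
 shows "c * a \<le> \<alpha> * b"
proof (cases "b / c = 0")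
 case True
 have "a = 0"
 proof (rule ccontr)
  assume "a \<noteq> 0"
  then have "a / (b / c) = \<top>" unfolding True by (simp add: divide_ennreal_def ennreal_mult_top)
  then show False using le \<alpha> by (simp add: top_unique)
 qed
 then show ?thesis by simp
next
 case nz: False
 then have c: "c < \<top>" by (auto simp: less_top[symmetric])
 show ?thesis
 proof (cases "b = \<top> \<or> c = 0")
  case True
  then show ?thesis using \<alpha> by (auto simp: ennreal_mult_top)
 next
  case False
  then have "b / c < \<top>"
   by (auto simp: divide_ennreal_def less_top[symmetric] ennreal_mult_eq_top_iff ennreal_inverse_eq_top_iff)
  have "a = a / (b / c) * (b / c)"
   using ennreal_mult_divide_cancel[OF nz \<open>b / c < \<top>\<close>] by (simp add: divide_ennreal_def[of a] mult.assoc mult.commute[of "inverse _"])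
  also have "... \<le> \<alpha> * (b / c)" using le by (rule mult_right_mono) simp
  finally have "c * a \<le> c * (\<alpha> * (b / c))" by (rule mult_left_mono) simp
  also have "... = \<alpha> * (b * (c * inverse c))" by (simp add: divide_ennreal_def ac_simps)
  also have "... = \<alpha> * b" using ennreal_mult_divide_cancel[of c] c False by simp
  finally show ?thesis .
 qed
qed

context particle_model
begin

text \<open>\<open>Lx t\<close> maps \<open>F\<close> to \<open>Q\<^bsub>t,t+1\<^esub>(F)\<close>, and \<open>br t F\<close> is \<open>Q\<^bsub>0,t\<^esub>(F)\<close>, both for functions of the path.\<close>

definition Lx where "Lx t F e = ennreal (wt t e) * (if t = T then F e else \<integral>\<^sup>+a. F a \<partial>mv t e)"

text \<open>\<open>It p k F\<close> is Q_{p,p+k}(F), for functions of the path.\<close>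

primrec It where
 "It p 0 F = F"
| "It p (Suc k) F = It p k (Lx (p + k) F)"

declare It.simps(2) [simp del]

definition br where "br t F = (\<integral>\<^sup>+e. Wp t e * F e \<partial>Y (min t T))"

lemma Lx_measurable:
 assumes "t \<le> T" "F \<in> bm X"
 shows "Lx t F \<in> bm X"
proof (cases "t = T")
 case True
 then show ?thesis unfolding Lx_def[abs_def] using assms
  by (auto intro!: borel_measurable_times_ennreal comp_ennreal wt_measurable)
next
 case False
 then show ?thesis unfolding Lx_def[abs_def] using assms
  by (auto intro!: borel_measurable_times_ennreal comp_ennreal wt_measurable
    nn_integral_kernel_measurable[OF mv_measurable])
qed

lemma It_measurable: "p + k \<le> Suc T ==> F \<in> bm X ==> It p k F \<in> bm X"
 by (induction k arbitrary: F) (auto simp: It.simps intro: Lx_measurable)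

lemma It_Suc: "It p (Suc k) F = Lx p (It (Suc p) k F)"
 by (induction k arbitrary: F) (auto simp: It.simps)

text \<open>At t = T no move is left and both sides only multiply by the last potential; this is why
  \<open>br\<close> runs the chain up to \<open>min t T\<close>.\<close>

lemma br_Suc:
 assumes t: "t \<le> T" and F: "F \<in> bm X"
 shows "br (Suc t) F = br t (Lx t F)"
proof (cases "t = T")
 case True
 then show ?thesis by (simp add: br_def Lx_def Wp_Suc mult.assoc)
next
 case False
 then have tT: "t < T" "Suc t \<le> T" using t by auto
 have m: "(\<lambda>a. Wp (Suc t) a * F a) \<in> bm X"
  using F t by (intro borel_measurable_times_ennreal Wp_measurable) auto
 have "br (Suc t) F = (\<integral>\<^sup>+e. \<integral>\<^sup>+a. Wp (Suc t) a * F a \<partial>mv t e \<partial>Y t)"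
  using tT nn_integral_Y_Suc[OF tT(1) m] by (simp add: br_def min_absorb1)
 also have "... = (\<integral>\<^sup>+e. Wp t e * Lx t F e \<partial>Y t)"
 proof (rule nn_integral_cong)
  fix e assume "e \<in> space (Y t)"
  then have e: "e \<in> space X" using space_Y t by simp
  let ?M = "if t = 0 then M1 else M (Suc t) (e t)"
  have um: "(\<lambda>w. F (e(Suc t := w))) \<in> bm ?M"
   using measurable_compose[OF upd_measurable1[of "Suc t", OF _ e] F] tT prob_kernelD(2)[OF move_law_measurable[OF tT(1)] e]
   by (simp cong: measurable_cong_sets)
  have "(\<integral>\<^sup>+a. Wp (Suc t) a * F a \<partial>mv t e) = (\<integral>\<^sup>+w. Wp (Suc t) e * F (e(Suc t := w)) \<partial>?M)"
   unfolding nn_integral_mv[OF tT(1) e m] Wp_upd[OF order_refl] ..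
  also have "... = Wp (Suc t) e * (\<integral>\<^sup>+w. F (e(Suc t := w)) \<partial>?M)" by (rule nn_integral_cmult[OF um])
  also have "... = Wp t e * Lx t F e"
   unfolding nn_integral_mv[OF tT(1) e F, symmetric] using False by (simp add: Wp_Suc Lx_def mult.assoc)
  finally show "(\<integral>\<^sup>+a. Wp (Suc t) a * F a \<partial>mv t e) = Wp t e * Lx t F e" .
 qed
 finally show ?thesis using t by (simp add: br_def min_absorb1)
qed

lemma br_It: "p + k \<le> Suc T ==> F \<in> bm X ==> br (p + k) F = br p (It p k F)"
proof (induction k arbitrary: F)
 case (Suc k)
 then have "br (p + Suc k) F = br (p + k) (Lx (p + k) F)" using br_Suc[of "p + k" F] by simp
 then show ?case using Suc Lx_measurable[of "p + k" F] by (simp add: It.simps)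
qed simp

lemma br_0: "F \<in> bm X ==> br 0 F = F base"
 by (simp add: br_def Wp_def nn_integral_return base_space)

lemma br_gam: "br (Suc T) one = gam"
 by (simp add: br_def gam_eq)

lemma br_cong: "t \<le> Suc T ==> (\<And>e. e \<in> space X ==> F e = F' e) ==> br t F = br t F'"
 unfolding br_def by (rule nn_integral_cong) (simp add: space_Y)

lemma br_measurable: "t \<le> Suc T ==> F \<in> bm X ==> (\<lambda>e. Wp t e * F e) \<in> bm (Y (min t T))"
 using Wp_measurable[of t] sets_Y[of "min t T"] by (auto intro: borel_measurable_times_ennreal cong: measurable_cong_sets)

lemma br_cmult: "t \<le> Suc T ==> F \<in> bm X ==> br t (\<lambda>e. c * F e) = c * br t F"
 unfolding br_def by (subst nn_integral_cmult[symmetric]) (auto intro: br_measurable simp: mult.left_commute)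

lemma br_add: "t \<le> Suc T ==> F \<in> bm X ==> F' \<in> bm X ==> br t (\<lambda>e. F e + F' e) = br t F + br t F'"
 unfolding br_def by (subst nn_integral_add[symmetric]) (auto intro: br_measurable simp: distrib_left)

lemma br_sum:
 "finite I ==> t \<le> Suc T ==> (\<And>i. i \<in> I ==> F i \<in> bm X) ==> br t (\<lambda>e. \<Sum>i\<in>I. F i e) = (\<Sum>i\<in>I. br t (F i))"
proof (induction I rule: finite_induct)
 case empty
 then show ?case by (simp add: br_def)
next
 case (insert i I)
 then show ?case by (simp add: br_add borel_measurable_sum)
qed

lemma Lx_1:
 assumes "t \<le> T" "e \<in> space X"
 shows "Lx t one e = ennreal (wt t e)"
 using assms prob_space.emeasure_space_1[OF prob_kernelD(1)[OF mv_measurable]] by (cases "t = T") (simp_all add: Lx_def)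

text \<open>\<open>fk_Q\<close> integrates over a segment of coordinates, while \<open>It\<close>
  acts on whole paths; pasting the segment into e lets one test function serve both.\<close>

lemma nn_integral_chain_from:
 assumes "1 \<le> p" "p + k \<le> T" "e \<in> space X" "F \<in> bm X"
 shows "(\<integral>\<^sup>+y. (\<Prod>s=p..<p+k. ennreal (G s (y s))) * F (\<lambda>s\<in>{1..T}. if s \<in> {p..p+k} then y s else e s)
   \<partial>chain_from Z M p (e p) k) = It p k F e"
proof -
 have mgm: "(\<lambda>y. \<lambda>s\<in>{1..T}. if s \<in> J then y s else e s) \<in> PiM J (\<lambda>_. Z) \<rightarrow>\<^sub>M X" for J
 proof (rule measurable_restrict)
  fix s assume "s \<in> {1..T}"
  then have "e s \<in> space Z" using assms by (intro coord_space) auto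
  then show "(\<lambda>y. if s \<in> J then y s else e s) \<in> PiM J (\<lambda>_. Z) \<rightarrow>\<^sub>M Z"
   by (cases "s \<in> J") (auto intro: measurable_component_singleton)
 qed
 show ?thesis using assms
proof (induction k arbitrary: F)
 case 0
 have ep: "e p \<in> space Z" using 0 by (intro coord_space) auto
 from measurable_compose[OF mgm 0(4)]
 have m: "(\<lambda>y. F (\<lambda>s\<in>{1..T}. if s \<in> {p..p} then y s else e s)) \<in> bm (PiM {p..p} (\<lambda>_. Z))" .
 have "(\<lambda>s\<in>{1..T}. if s \<in> {p..p} then (\<lambda>i\<in>{p}. e p) s else e s) = restrict e {1..T}" by (rule restrict_ext) auto
 also have "... = e" using 0(3) unfolding space_PiM by (rule PiE_restrict)
 finally have r: "(\<lambda>s\<in>{1..T}. if s \<in> {p..p} then (\<lambda>i\<in>{p}. e p) s else e s) = e" .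
 have "(\<lambda>i\<in>{p}. e p) \<in> space (PiM {p..p} (\<lambda>_. Z))" using ep by (simp add: space_PiM)
 from nn_integral_return[OF this m] show ?case
  unfolding r by (simp only: chain_from.simps It.simps add_0_right atLeastLessThan_empty order_refl prod.empty mult_1)
next
 case (Suc k)
 let ?q = "p + Suc k"
 define mg where "mg = (\<lambda>y::nat => 'z. \<lambda>s\<in>{1..T}. if s \<in> {p..p+k} then y s else e s)"
 define mg' where "mg' = (\<lambda>y::nat => 'z. \<lambda>s\<in>{1..T}. if s \<in> {p..?q} then y s else e s)"
 have ep: "e p \<in> space Z" using Suc.prems by (intro coord_space) auto
 have pk: "p + k \<le> T" "p + k < T" "p + k \<noteq> T" "?q \<in> {1..T}" "p + k \<noteq> 0" using Suc.prems by auto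
 have MM: "M t \<in> Z \<leadsto> Z" if "t \<in> {p+1..?q}" for t using that Suc.prems by (intro M) auto
 have Gm: "(\<lambda>y. ennreal (G s (y s))) \<in> bm (PiM J (\<lambda>_. Z))" if "s \<in> J" "s \<in> {1..T}" for s J
  by (intro measurable_compose[where f="\<lambda>y. y s", OF measurable_component_singleton[OF that(1)]] measurable_compose[OF G[OF that(2)]]) simp
 have m: "(\<lambda>y. (\<Prod>s=p..<?q. ennreal (G s (y s))) * F (mg' y)) \<in> bm (PiM {p..?q} (\<lambda>_. Z))"
  using Suc.prems unfolding mg'_def
  by (intro borel_measurable_times_ennreal borel_measurable_prod_ennreal Gm measurable_compose[OF mgm]) auto
 have "chain_from Z M p (e p) k \<in> space (prob_algebra (PiM {p..p+k} (\<lambda>_. Z)))"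
  by (rule measurable_space[OF chain_from_measurable1 ep]) (use MM in auto)
 then have sp: "space (chain_from Z M p (e p) k) = space (PiM {p..p+k} (\<lambda>_. Z))"
  by (auto simp: space_prob_algebra dest: sets_eq_imp_space_eq)
 have "(\<integral>\<^sup>+y. (\<Prod>s=p..<?q. ennreal (G s (y s))) * F (mg' y) \<partial>chain_from Z M p (e p) (Suc k)) =
   (\<integral>\<^sup>+y. \<integral>\<^sup>+w. (\<Prod>s=p..<?q. ennreal (G s ((y(?q := w)) s))) * F (mg' (y(?q := w))) \<partial>M ?q (y (p + k)) \<partial>chain_from Z M p (e p) k)"
  by (rule nn_integral_chain_from_Suc[OF ep MM m])
 also have "... = (\<integral>\<^sup>+y. (\<Prod>s=p..<p+k. ennreal (G s (y s))) * Lx (p + k) F (mg y) \<partial>chain_from Z M p (e p) k)"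
 proof (rule nn_integral_cong)
  fix y assume "y \<in> space (chain_from Z M p (e p) k)"
  then have y: "y \<in> space (PiM {p..p+k} (\<lambda>_. Z))" using sp by simp
  have my: "mg y \<in> space X" unfolding mg_def by (rule measurable_space[OF mgm y])
  have u: "mg' (y(?q := w)) = (mg y)(Suc (p + k) := w)" for w
   unfolding mg'_def mg_def using pk by (auto simp: fun_eq_iff)
  have yk: "mg y (p + k) = y (p + k)" using pk Suc.prems(1) by (simp add: mg_def)
  let ?W = "\<Prod>s=p..<?q. ennreal (G s (y s))"
  have W: "(\<Prod>s=p..<?q. ennreal (G s ((y(?q := w)) s))) = ?W" for w by (rule prod.cong) auto
  have sM: "sets (M (Suc (p + k)) (y (p + k))) = sets Z"
   using prob_kernelD(2)[OF move_law_measurable[OF pk(2)] my] unfolding if_not_P[OF pk(5)] yk .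
  have "(\<lambda>w. F ((mg y)(Suc (p + k) := w))) \<in> bm Z"
   by (rule measurable_compose[OF upd_measurable1[OF _ my] Suc.prems(4)]) (use pk in auto)
  then have "(\<lambda>w. F ((mg y)(Suc (p + k) := w))) \<in> bm (M (Suc (p + k)) (y (p + k)))"
   unfolding measurable_cong_sets[OF sM refl] .
  then have "(\<integral>\<^sup>+w. (\<Prod>s=p..<?q. ennreal (G s ((y(?q := w)) s))) * F (mg' (y(?q := w))) \<partial>M ?q (y (p + k))) =
    ?W * (\<integral>\<^sup>+w. F ((mg y)(Suc (p + k) := w)) \<partial>M (Suc (p + k)) (y (p + k)))"
   unfolding W u by (subst nn_integral_cmult[symmetric]) simp_all
  also have "(\<integral>\<^sup>+w. F ((mg y)(Suc (p + k) := w)) \<partial>M (Suc (p + k)) (y (p + k))) = nn_integral (mv (p + k) (mg y)) F"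
   using nn_integral_mv[OF pk(2) my Suc.prems(4)] unfolding if_not_P[OF pk(5)] yk by (rule sym)
  also have "?W * nn_integral (mv (p + k) (mg y)) F = (\<Prod>s=p..<p+k. ennreal (G s (y s))) * Lx (p + k) F (mg y)"
  proof -
   have "wt (p + k) (mg y) = G (p + k) (y (p + k))" unfolding wt_def if_not_P[OF pk(5)] yk ..
   then show ?thesis using pk(3) Suc.prems(1) by (simp add: Lx_def mult.assoc)
  qed
  finally show "(\<integral>\<^sup>+w. (\<Prod>s=p..<?q. ennreal (G s ((y(?q := w)) s))) * F (mg' (y(?q := w))) \<partial>M ?q (y (p + k))) =
    (\<Prod>s=p..<p+k. ennreal (G s (y s))) * Lx (p + k) F (mg y)" .
 qed
 also have "... = It p k (Lx (p + k) F) e"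
  unfolding mg_def by (rule Suc.IH[OF Suc.prems(1) pk(1) Suc.prems(3) Lx_measurable[OF pk(1) Suc.prems(4)]])
 finally show ?case unfolding mg'_def It.simps .
qed
qed

lemma fk_Q_eq:
 assumes p: "1 \<le> p" "1 \<le> k" "p + k \<le> Suc T" and e: "e \<in> space X"
 shows "fk_Q Z T M G p (p + k) one (e p) = It p k one e"
proof (cases "p + k \<le> T")
 case True
 then show ?thesis
  using nn_integral_chain_from[OF p(1) True e, of "\<lambda>_. 1"] by (simp add: fk_Q_def min_absorb1)
next
 case False
 \<comment> \<open>Here p + k = T + 1: the chain stops at time T, and the last potential is applied
   without a further move.\<close>
 obtain l where k: "k = Suc l" using p by (cases k) (auto simp: One_nat_def)
 then have l: "k = Suc l" "p + l = T" using False p by auto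
 have lT: "p + l \<le> T" using l by simp
 have It1: "It p k one = It p l (\<lambda>e. ennreal (wt T e))"
  unfolding l It.simps l(2) by (rule arg_cong[where f="It p l"]) (simp add: Lx_def fun_eq_iff)
 have m: "(\<lambda>e. ennreal (wt T e)) \<in> bm X" by (rule measurable_compose[OF wt_measurable measurable_ennreal]) simp
 have "fk_Q Z T M G p (p + k) one (e p) = (\<integral>\<^sup>+y. (\<Prod>s=p..<Suc T. ennreal (G s (y s))) \<partial>chain_from Z M p (e p) l)"
 proof -
  have "T - p = l" "min (p + k) T = T" "p + k = Suc T" using l by auto
  then show ?thesis by (simp add: fk_Q_def)
 qed
 also have "... = (\<integral>\<^sup>+y. (\<Prod>s=p..<p+l. ennreal (G s (y s))) * ennreal (wt T (\<lambda>s\<in>{1..T}. if s \<in> {p..p+l} then y s else e s)) \<partial>chain_from Z M p (e p) l)"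
 proof -
  have "p \<le> T" using l by simp
  then have "(\<Prod>s=p..<Suc T. ennreal (G s (y s))) = (\<Prod>s=p..<T. ennreal (G s (y s))) * ennreal (G T (y T))" for y by simp
  then show ?thesis using T \<open>p \<le> T\<close> by (simp add: wt_def l(2))
 qed
 also have "... = It p k one e" unfolding It1 by (rule nn_integral_chain_from[OF p(1) lT e m])
 finally show ?thesis .
qed

lemma fk_Q_measurable:
 assumes p: "1 \<le> p" "p \<le> q" "q \<le> Suc T" "p \<le> T" and F: "q \<le> T ==> F \<in> bm Z" "T < q ==> F = one"
 shows "fk_Q Z T M G p q F \<in> bm Z"
proof -
 let ?k = "min q T - p"
 have k: "p + ?k = min q T" using p by auto
 have c: "(\<lambda>z. chain_from Z M p z ?k) \<in> Z \<leadsto> (PiM {p..p + ?k} (\<lambda>_. Z))"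
  using p by (intro chain_from_measurable1 M) auto
 have Gm: "(\<lambda>y. ennreal (G s (y s))) \<in> bm (PiM {p..p + ?k} (\<lambda>_. Z))" if "s \<in> {p..<q}" for s
 proof -
  have s: "s \<in> {p..p + ?k}" "s \<in> {1..T}" using that p unfolding k by auto
  show ?thesis by (intro measurable_compose[where f="\<lambda>y. y s", OF measurable_component_singleton[OF s(1)]] measurable_compose[OF G[OF s(2)]]) simp
 qed
 have Fm: "(\<lambda>y. F (y q)) \<in> bm (PiM {p..p + ?k} (\<lambda>_. Z))"
 proof (cases "q \<le> T")
  case True
  then have "q \<in> {p..p + ?k}" using p unfolding k by auto
  then show ?thesis by (intro measurable_compose[where f="\<lambda>y. y q", OF measurable_component_singleton F(1)[OF True]])
 next
  case False
  then show ?thesis using F(2) by simp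
 qed
 show ?thesis unfolding fk_Q_def[abs_def]
  by (intro nn_integral_kernel_measurable[OF c] borel_measurable_times_ennreal borel_measurable_prod_ennreal Gm Fm)
qed

lemma fk_Q0_eq:
 assumes p: "1 \<le> p" "p \<le> T" and F: "F \<in> bm Z"
 shows "fk_Q0 Z T M1 M G p F = br p (\<lambda>e. F (e p))"
proof -
 let ?f = "\<lambda>y. F (y p) * (\<Prod>k=1..<p. ennreal (G k (y k)))"
 have Fm: "(\<lambda>e. F (e p)) \<in> bm (PiM J (\<lambda>_. Z))" if "p \<in> J" for J
  by (rule measurable_compose[where f="\<lambda>y. y p", OF measurable_component_singleton[OF that] F])
 have Gm: "(\<lambda>y. ennreal (G s (y s))) \<in> bm (PiM {1..p} (\<lambda>_. Z))" if "s \<in> {1..<p}" for s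
 proof -
  have s: "s \<in> {1..p}" "s \<in> {1..T}" using that p by auto
  show ?thesis by (intro measurable_compose[where f="\<lambda>y. y s", OF measurable_component_singleton[OF s(1)]] measurable_compose[OF G[OF s(2)]]) simp
 qed
 have fm: "?f \<in> bm (PiM {1..p} (\<lambda>_. Z))"
  using p by (intro borel_measurable_times_ennreal borel_measurable_prod_ennreal Gm Fm) auto
 have s1: "sets M1 = sets Z" using M1 by (simp add: space_prob_algebra)
 have c: "(\<lambda>z. chain_from Z M 1 z (p - 1)) \<in> Z \<leadsto> (PiM {1..p} (\<lambda>_. Z))"
  using chain_from_measurable1[of 1 "p - 1" M Z] M p by simp
 have "fk_Q0 Z T M1 M G p F = nn_integral (path_law Z p M1 M) ?f"
  unfolding fk_Q0_def fk_Q_def path_law_def using nn_integral_kernel_bind[OF s1 c fm] p by (simp add: min_absorb1)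
 also have "... = (\<integral>\<^sup>+y. (\<lambda>e. Wp p e * F (e p)) (trunc p y) \<partial>path_law Z p M1 M)"
 proof (rule nn_integral_cong)
  fix y :: "nat => 'z"
  have "{..<p} = insert 0 {1..<p}" using p by auto
  then have "Wp p (trunc p y) = (\<Prod>k=1..<p. ennreal (wt k (trunc p y)))" unfolding Wp_def by (simp add: wt_def)
  also have "... = (\<Prod>k=1..<p. ennreal (G k (y k)))" using p by (intro prod.cong) (auto simp: wt_def trunc_def)
  finally show "?f y = (\<lambda>e. Wp p e * F (e p)) (trunc p y)" using p by (simp add: trunc_def mult.commute)
 qed
 also have "... = (\<integral>\<^sup>+e. Wp p e * F (e p) \<partial>Y p)"
  by (rule nn_integral_path_law[OF p]) (use p in \<open>intro borel_measurable_times_ennreal Wp_measurable Fm; auto\<close>)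
 finally show ?thesis using p by (simp add: br_def min_absorb1)
qed

lemma fk_eta_eq:
 assumes p: "1 \<le> p" "1 \<le> k" "p + k \<le> Suc T"
 shows "fk_eta Z T M1 M G p (fk_Q Z T M G p (p + k) one) = br (p + k) one / br p one"
proof -
 have pT: "p \<le> T" using p by simp
 have "fk_Q0 Z T M1 M G p (fk_Q Z T M G p (p + k) one) = br p (\<lambda>e. fk_Q Z T M G p (p + k) one (e p))"
  by (rule fk_Q0_eq[OF p(1) pT fk_Q_measurable]) (use p in auto)
 also have "... = br p (It p k one)" using pT by (intro br_cong fk_Q_eq p) auto
 also have "... = br (p + k) one" using p by (intro br_It[symmetric]) auto
 finally show ?thesis unfolding fk_eta_def using fk_Q0_eq[OF p(1) pT, of "\<lambda>_. 1"] by simp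
qed

text \<open>The mixing condition along the path x with its denominators cleared, a form that can be
  summed with nonnegative coefficients.\<close>

definition mixes where
 "mixes \<alpha> x \<longleftrightarrow> (\<forall>p k. 1 \<le> p --> 1 \<le> k --> p + k \<le> Suc T -->
   br p one * It p k one x \<le> \<alpha> * br (p + k) one)"

lemma mixesI:
 assumes x: "x \<in> space X" and \<alpha>: "0 < \<alpha>" "\<alpha> < \<top>"
  and le: "\<And>p k. 1 \<le> p ==> 1 \<le> k ==> p + k \<le> Suc T ==>
   fk_Q Z T M G p (p + k) one (x p) / fk_eta Z T M1 M G p (fk_Q Z T M G p (p + k) one) \<le> \<alpha>"
 shows "mixes \<alpha> x"
 unfolding mixes_def
proof (intro allI impI)
 fix p k :: nat assume p: "1 \<le> p" "1 \<le> k" "p + k \<le> Suc T"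
 show "br p one * It p k one x \<le> \<alpha> * br (p + k) one"
  using le[OF p] unfolding fk_eta_eq[OF p] fk_Q_eq[OF p x] by (rule ennreal_mult_le_of_divide_le[OF _ \<alpha>])
qed

section \<open>Bounds from the suprema of the potentials\<close>

definition Gb where "Gb s = (if s = 0 then 1 else SUP z\<in>space Z. ennreal (G s z))"

lemma wt_le_Gb: "t \<le> T ==> e \<in> space X ==> ennreal (wt t e) \<le> Gb t"
proof (cases "t = 0")
 case False
 assume "t \<le> T" "e \<in> space X"
 then have "e t \<in> space Z" using False by (intro coord_space) (auto simp: One_nat_def)
 then show ?thesis using False by (auto simp: wt_def Gb_def intro: SUP_upper)
qed (simp add: wt_def Gb_def)

definition PG where "PG j = (\<Prod>s\<in>{T-j..T}. Gb s)"

lemma PG_Suc: "Suc j \<le> T ==> PG (Suc j) = Gb (T - Suc j) * PG j"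
proof -
 assume j: "Suc j \<le> T"
 have "{T - Suc j..T} = insert (T - Suc j) {T - j..T}" using j by auto
 then show ?thesis unfolding PG_def using j by simp
qed

lemma It_le_PG: "j \<le> T ==> e \<in> space X ==> It (T - j) (Suc j) one e \<le> PG j"
proof (induction j arbitrary: e)
 case 0
 then show ?case using wt_le_Gb[of T e] Lx_1[of T e] by (simp add: PG_def It.simps)
next
 case (Suc j)
 define t where "t = T - Suc j"
 have t: "t < T" "t \<noteq> T" "Suc t = T - j" using Suc.prems by (auto simp: t_def)
 note m = prob_kernelD[OF mv_measurable[OF t(1)] Suc.prems(2)]
 have "(\<integral>\<^sup>+a. It (T - j) (Suc j) one a \<partial>mv t e) \<le> (\<integral>\<^sup>+a. PG j \<partial>mv t e)"
  using Suc m(3) by (intro nn_integral_mono) auto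
 also have "... = PG j" using prob_space.emeasure_space_1[OF m(1)] by simp
 finally have "ennreal (wt t e) * (\<integral>\<^sup>+a. It (T - j) (Suc j) one a \<partial>mv t e) \<le> Gb t * PG j"
  using t Suc.prems by (intro mult_mono wt_le_Gb) auto
 then show ?case unfolding PG_Suc[OF Suc.prems(1)] t_def[symmetric] It_Suc[of t] Lx_def t(3) using t(2) by simp
qed

lemma PG_T: "PG T = (\<Prod>t=1..T. SUP z\<in>space Z. ennreal (G t z))"
proof -
 have "{0..T} = insert 0 {1..T}" by auto
 then show ?thesis unfolding PG_def by (simp add: Gb_def)
qed

lemma gam_eq_It: "gam = It 0 (Suc T) one base"
proof -
 have "gam = br 0 (It 0 (Suc T) one)" using br_It[of 0 "Suc T" "\<lambda>_. 1"] br_gam by simp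
 also have "... = It 0 (Suc T) one base" by (intro br_0 It_measurable) auto
 finally show ?thesis .
qed

text \<open>This is the reason why R \<ge> 1 in case (a).\<close>

lemma gam_le_potential_bound: "gam \<le> (\<Prod>t=1..T. SUP z\<in>space Z. ennreal (G t z))"
 using It_le_PG[OF order_refl base_space] by (simp add: PG_T gam_eq_It)

end

context particle_model2
begin

text \<open>Puts the recursion of \<open>hh\<close> in the form to which \<open>br_Suc\<close>
  applies.\<close>

lemma hh_Suc_eq:
 assumes j: "Suc j \<le> T" and y: "y \<in> space X" and e: "e \<in> space X"
 shows "hh (Suc j) y e = Lx (T - Suc j) (\<lambda>a. (hh j y x + hh j y y) + of_nat (N - 2) * hh j y a) e"
proof -
 let ?t = "T - Suc j"
 have t: "?t < T" "?t \<noteq> T" using j by auto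
 note m = prob_kernelD[OF mv_measurable[OF t(1)] e]
 have hm: "hh j y \<in> bm (mv ?t e)" using hh_measurable1[of j y] j y m(2) by (simp cong: measurable_cong_sets)
 have "(\<integral>\<^sup>+a. (hh j y x + hh j y y) + of_nat (N - 2) * hh j y a \<partial>mv ?t e) =
   (hh j y x + hh j y y) + of_nat (N - 2) * nn_integral (mv ?t e) (hh j y)"
 proof -
  have "(\<integral>\<^sup>+a. c + n * hh j y a \<partial>mv ?t e) = c + n * nn_integral (mv ?t e) (hh j y)" for c n
   using hm prob_space.emeasure_space_1[OF m(1)] by (simp add: nn_integral_add nn_integral_cmult)
  then show ?thesis .
 qed
 then show ?thesis using t by (simp add: Lx_def)
qed

text \<open>Expanded, \<open>hh j y e\<close> has N^j terms, one for each choice of a particle at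
  the j later times. The (N - 2)^j choices of free particles make up the semigroup; every other term
  is bounded by the product of the suprema.\<close>

lemma hh_bounded:
 assumes y: "y \<in> space X"
 shows "j \<le> T ==> e \<in> space X ==>
   hh j y e \<le> of_nat ((N - 2) ^ j) * It (T - j) (Suc j) one e + of_nat (N ^ j - (N - 2) ^ j) * PG j"
proof (induction j arbitrary: e)
 case 0
 then show ?case using Lx_1[of T e] by (simp add: It.simps)
next
 case (Suc j)
 define t where "t = T - Suc j"
 have t: "t < T" "t \<le> T" "t \<noteq> T" "Suc t = T - j" "j \<le> T" using Suc.prems by (auto simp: t_def)
 let ?Q = "It (T - j) (Suc j) one" and ?n = "(N - 2) ^ j" and ?d = "N ^ j - (N - 2) ^ j"
 note m = prob_kernelD[OF mv_measurable[OF t(1)] Suc.prems(2)]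
 have le: "(N - 2) ^ j \<le> N ^ j" by (rule power_mono) auto
 have Qm: "?Q \<in> bm (mv t e)"
  using It_measurable[of "T - j" "Suc j" "\<lambda>_. 1"] t(5) m(2) by (simp cong: measurable_cong_sets)
 have all: "hh j y a \<le> of_nat (N ^ j) * PG j" if a: "a \<in> space X" for a
 proof -
  have "hh j y a \<le> of_nat ?n * PG j + of_nat ?d * PG j"
   using Suc.IH[OF t(5) a] It_le_PG[OF t(5) a] by (meson add_right_mono mult_left_mono order_trans zero_le)
  also have "... = of_nat (?n + ?d) * PG j" by (simp only: of_nat_add distrib_right)
  finally show ?thesis using le by simp
 qed
 have "nn_integral (mv t e) (hh j y) \<le> (\<integral>\<^sup>+a. of_nat ?n * ?Q a + of_nat ?d * PG j \<partial>mv t e)"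
  using m(3) by (intro nn_integral_mono Suc.IH t) auto
 also have "... = of_nat ?n * nn_integral (mv t e) ?Q + of_nat ?d * PG j"
  using Qm prob_space.emeasure_space_1[OF m(1)] by (simp add: nn_integral_add nn_integral_cmult del: of_nat_power)
 finally have i: "nn_integral (mv t e) (hh j y) \<le> of_nat ?n * nn_integral (mv t e) ?Q + of_nat ?d * PG j" .
 \<comment> \<open>Counts the other choices: a fixed path at the next time followed by anything, or
   a free particle followed by a choice that is not free throughout.\<close>
 have d: "N ^ Suc j - (N - 2) ^ Suc j = 2 * N ^ j + (N - 2) * ?d"
 proof -
  obtain n where n: "N = n + 2" using N2 by (metis le_add_diff_inverse2)
  have "n ^ j \<le> (n + 2) ^ j" by (rule power_mono) auto
  then show ?thesis unfolding n by (simp add: algebra_simps)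
 qed
 have "hh (Suc j) y e \<le> ennreal (wt t e) * ((of_nat (N ^ j) * PG j + of_nat (N ^ j) * PG j) +
    of_nat (N - 2) * (of_nat ?n * nn_integral (mv t e) ?Q + of_nat ?d * PG j))"
  unfolding hh.simps t_def[symmetric] by (intro mult_left_mono add_mono all x y i) auto
 also have "... = of_nat (N - 2) * of_nat ?n * (ennreal (wt t e) * nn_integral (mv t e) ?Q) +
   (of_nat (N ^ j) + of_nat (N ^ j) + of_nat (N - 2) * of_nat ?d) * (ennreal (wt t e) * PG j)"
  by (simp add: distrib_left distrib_right ac_simps del: of_nat_power)
 also have "... \<le> of_nat (N - 2) * of_nat ?n * (ennreal (wt t e) * nn_integral (mv t e) ?Q) +
   (of_nat (N ^ j) + of_nat (N ^ j) + of_nat (N - 2) * of_nat ?d) * (Gb t * PG j)"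
  using wt_le_Gb[OF t(2) Suc.prems(2)] by (intro add_left_mono mult_left_mono mult_right_mono) auto
 also have "... = of_nat ((N - 2) ^ Suc j) * It (T - Suc j) (Suc (Suc j)) one e + of_nat (N ^ Suc j - (N - 2) ^ Suc j) * PG (Suc j)"
  unfolding d PG_Suc[OF Suc.prems(1)] t_def[symmetric] It_Suc[of t] Lx_def t(4)
  using t(3) by (simp add: mult_2)
 finally show ?case .
qed

lemma hh_le_potential_bound:
 assumes "y \<in> space X"
 shows "hh T y base \<le> of_nat ((N - 2) ^ T) * gam + of_nat (N ^ T - (N - 2) ^ T) * (\<Prod>t=1..T. SUP z\<in>space Z. ennreal (G t z))"
 using hh_bounded[OF assms order_refl base_space] by (simp add: PG_T gam_eq_It)

text \<open>Follow free particles until a fixed path is chosen for the first time: the continuation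
  from there no longer depends on e. What depends on e is therefore Q_{t,t+k+1}(1) with t = T - j,
  and the coefficients involve the fixed paths only.\<close>

lemma hh_expansion:
 assumes y: "y \<in> space X"
 shows "j \<le> T ==> \<exists>b. \<forall>e\<in>space X. hh j y e = (\<Sum>k<Suc j. b k * It (T - j) (Suc k) one e)"
proof (induction j)
 case 0
 show ?case by (rule exI[of _ "\<lambda>_. 1"]) (simp add: Lx_1 It.simps)
next
 case (Suc j)
 define t where "t = T - Suc j"
 have t: "t < T" "t \<le> T" "t \<noteq> T" "T - j = Suc t" using Suc.prems by (auto simp: t_def)
 obtain b where b: "\<forall>e\<in>space X. hh j y e = (\<Sum>k<Suc j. b k * It (Suc t) (Suc k) one e)"
  using Suc t(4) by auto
 define c where "c = hh j y x + hh j y y"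
 let ?b = "\<lambda>k. if k = 0 then c else of_nat (N - 2) * b (k - 1)"
 show ?case
 proof (intro exI[of _ ?b] ballI)
  fix e assume e: "e \<in> space X"
  note m = prob_kernelD[OF mv_measurable[OF t(1)] e]
  have Im: "It (Suc t) (Suc k) one \<in> bm (mv t e)" if "k < Suc j" for k
  proof -
   have "It (Suc t) (Suc k) one \<in> bm X" by (rule It_measurable) (use that t in auto)
   then show ?thesis using m(2) by (simp cong: measurable_cong_sets)
  qed
  have "nn_integral (mv t e) (hh j y) = (\<integral>\<^sup>+a. (\<Sum>k<Suc j. b k * It (Suc t) (Suc k) one a) \<partial>mv t e)"
   using b m(3) by (intro nn_integral_cong) blast
  also have "... = (\<Sum>k<Suc j. \<integral>\<^sup>+a. b k * It (Suc t) (Suc k) one a \<partial>mv t e)"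
   using Im by (intro nn_integral_sum borel_measurable_times_ennreal) auto
  also have "... = (\<Sum>k<Suc j. b k * (\<integral>\<^sup>+a. It (Suc t) (Suc k) one a \<partial>mv t e))"
   using Im by (intro sum.cong refl nn_integral_cmult) auto
  finally have i: "nn_integral (mv t e) (hh j y) = (\<Sum>k<Suc j. b k * (\<integral>\<^sup>+a. It (Suc t) (Suc k) one a \<partial>mv t e))" .
  have It1: "It t (Suc 0) one e = ennreal (wt t e)" using Lx_1[OF t(2) e] by (simp add: It.simps)
  have "hh (Suc j) y e = c * ennreal (wt t e) + of_nat (N - 2) * (\<Sum>k<Suc j. b k * (ennreal (wt t e) * (\<integral>\<^sup>+a. It (Suc t) (Suc k) one a \<partial>mv t e)))"
   unfolding hh.simps t_def[symmetric] i c_def[symmetric]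
   by (simp add: distrib_left sum_distrib_left ac_simps del: sum.lessThan_Suc)
  also have "... = ?b 0 * It t (Suc 0) one e + (\<Sum>k<Suc j. ?b (Suc k) * It t (Suc (Suc k)) one e)"
   unfolding It_Suc[of t "Suc _"] using t(3) It1
   by (simp add: Lx_def[of t "It _ _ _"] sum_distrib_left mult.assoc del: sum.lessThan_Suc)
  also have "... = (\<Sum>k<Suc (Suc j). ?b k * It t (Suc k) one e)"
   by (rule sum.lessThan_Suc_shift[symmetric])
  finally show "hh (Suc j) y e = (\<Sum>k<Suc (Suc j). ?b k * It (T - Suc j) (Suc k) one e)" unfolding t_def .
 qed
qed

text \<open>Mixing is applied to each semigroup in the expansion of \<open>hh\<close>. It bounds the
  value at a fixed path u by \<alpha> times the mean over the weighted chain at time T - j.\<close>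

lemma hh_mixes:
 assumes y: "y \<in> space X" and j: "j < T" and u: "u \<in> space X" "mixes \<alpha> u"
 shows "br (T - j) one * hh j y u \<le> \<alpha> * br (T - j) (hh j y)"
proof -
 define t where "t = T - j"
 have t: "1 \<le> t" "t + j = T" "t \<le> Suc T" using j by (auto simp: t_def)
 obtain b where b: "\<forall>e\<in>space X. hh j y e = (\<Sum>k<Suc j. b k * It t (Suc k) one e)"
  using hh_expansion[OF y, of j] j t_def by auto
 have Im: "It t (Suc k) one \<in> bm X" if "k < Suc j" for k
  by (rule It_measurable) (use that t in auto)
 have "br t one * hh j y u = (\<Sum>k<Suc j. b k * (br t one * It t (Suc k) one u))"
  using b u(1) by (simp add: sum_distrib_left mult.left_commute del: sum.lessThan_Suc)
 also have "... \<le> (\<Sum>k<Suc j. b k * (\<alpha> * br t (It t (Suc k) one)))"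
 proof (intro sum_mono mult_left_mono)
  fix k assume "k \<in> {..<Suc j}"
  then have k: "t + Suc k \<le> Suc T" using t by auto
  have "br t one * It t (Suc k) one u \<le> \<alpha> * br (t + Suc k) one"
   by (rule u(2)[unfolded mixes_def, rule_format]) (use t(1) k in auto)
  also have "br (t + Suc k) one = br t (It t (Suc k) one)" by (rule br_It[OF k]) simp
  finally show "br t one * It t (Suc k) one u \<le> \<alpha> * br t (It t (Suc k) one)" .
 qed simp
 also have "... = \<alpha> * (\<Sum>k<Suc j. br t (\<lambda>e. b k * It t (Suc k) one e))"
  unfolding sum_distrib_left using Im by (intro sum.cong refl) (simp add: br_cmult[OF t(3)] mult.left_commute)
 also have "(\<Sum>k<Suc j. br t (\<lambda>e. b k * It t (Suc k) one e)) = br t (\<lambda>e. \<Sum>k<Suc j. b k * It t (Suc k) one e)"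
  by (rule br_sum[symmetric, OF _ t(3)]) (use Im in \<open>auto simp del: It.simps\<close>)
 also have "... = br t (hh j y)" using b by (intro br_cong t) auto
 finally show ?thesis unfolding t_def .
qed

text \<open>Integrated against the weighted chain, the N - 2 free particles continue it exactly,
  while each of the two fixed paths costs a factor \<alpha>. The condition is therefore used for x
  and for y alike.\<close>

lemma hh_le_mixing_bound:
 assumes y: "y \<in> space X" and mix: "mixes \<alpha> x" "mixes \<alpha> y"
 shows "hh T y base \<le> (of_nat (N - 2) + 2 * \<alpha>) ^ T * gam"
proof -
 have "br (T - j) (hh j y) \<le> (of_nat (N - 2) + 2 * \<alpha>) ^ j * gam" if "j \<le> T" for j
  using that
 proof (induction j)
  case 0
  have "br T (hh 0 y) = br T (Lx T one)" by (rule br_cong) (auto simp: Lx_1)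
  then have "br T (hh 0 y) = gam" using br_Suc[of T "\<lambda>_. 1"] br_gam by (simp del: hh.simps)
  then show ?case by (simp del: hh.simps)
 next
  case (Suc j)
  define t where "t = T - Suc j"
  have t: "t < T" "t \<le> T" "Suc t = T - j" "Suc t \<le> Suc T" "t \<le> Suc T" "j < T" using Suc.prems by (auto simp: t_def)
  have hm: "hh j y \<in> bm X" by (rule hh_measurable1) (use t y in auto)
  define c where "c = hh j y x + hh j y y"
  have "br t (hh (Suc j) y) = br t (Lx t (\<lambda>a. c + of_nat (N - 2) * hh j y a))"
   unfolding t_def c_def by (rule br_cong) (auto intro: hh_Suc_eq[OF Suc.prems y] simp del: hh.simps)
  also have "... = br (Suc t) (\<lambda>a. c * 1 + of_nat (N - 2) * hh j y a)"
   using br_Suc[OF t(2), of "\<lambda>a. c + of_nat (N - 2) * hh j y a"] hm by simp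
  also have "... = c * br (Suc t) one + of_nat (N - 2) * br (Suc t) (hh j y)"
   using hm by (subst br_add[OF t(4)]) (auto simp only: br_cmult[OF t(4) borel_measurable_const] br_cmult[OF t(4) hm] intro!: borel_measurable_times_ennreal borel_measurable_const)
  also have "... \<le> (\<alpha> * br (Suc t) (hh j y) + \<alpha> * br (Suc t) (hh j y)) + of_nat (N - 2) * br (Suc t) (hh j y)"
   using hh_mixes[OF y t(6) x mix(1)] hh_mixes[OF y t(6) y mix(2)] unfolding c_def t(3)
   by (intro add_right_mono) (simp only: distrib_right mult.commute[of "hh _ _ _"] add_mono)
  also have "... = (of_nat (N - 2) + 2 * \<alpha>) * br (Suc t) (hh j y)" by (simp add: distrib_right mult_2 add.commute)
  also have "... \<le> (of_nat (N - 2) + 2 * \<alpha>) * ((of_nat (N - 2) + 2 * \<alpha>) ^ j * gam)"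
   using Suc.IH t by (intro mult_left_mono) auto
  finally show ?case by (simp add: t_def mult.assoc del: hh.simps)
 qed
 from this[of T] show ?thesis using br_0[OF hh_measurable1[OF order_refl y]] by simp
qed

text \<open>In \<open>icsmc_lower\<close> the integral weighted with \<open>Wp\<close> is
  \<open>gam\<close> times an integral against the target, so the quotient of \<open>hh\<close> by
  \<open>gam\<close> is what has to be bounded.\<close>

lemma icsmc_minorization:
 assumes gam: "0 < gam" "gam < \<top>" and D: "0 < D" and h: "AE y in target. hh T y base \<le> gam * D"
 shows "of_nat (N - 1) ^ T * inverse D * nn_integral target f \<le> nn_integral (Pk x) f"
proof -
 have hm: "(\<lambda>y. hh T y base) \<in> bm X" by (rule measurable_param_section2[OF hh_measurable[OF order_refl] base_space])
 have fm: "f \<in> bm target" using f sets_target by (simp cong: measurable_cong_sets)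
 have im: "(\<lambda>y. f y * inverse (hh T y base)) \<in> bm X"
  using hm by (intro borel_measurable_times_ennreal f) measurable
 have g: "gam * inverse gam = 1" using gam by (intro ennreal_mult_divide_cancel) auto
 have "inverse D * nn_integral target f = gam * (inverse (gam * D) * nn_integral target f)"
  using gam g by (simp add: ennreal_inverse_mult_pos mult.assoc[symmetric])
 also have "inverse (gam * D) * nn_integral target f = (\<integral>\<^sup>+y. inverse (gam * D) * f y \<partial>target)"
  by (rule nn_integral_cmult[OF fm, symmetric])
 also have "... \<le> (\<integral>\<^sup>+y. f y * inverse (hh T y base) \<partial>target)"
 proof (rule nn_integral_mono_AE)
  show "AE y in target. inverse (gam * D) * f y \<le> f y * inverse (hh T y base)"
   using h by eventually_elim (simp add: mult.commute[of "f _"] mult_right_mono ennreal_inverse_le)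
 qed
 also have "... = inverse gam * (\<integral>\<^sup>+y. Wp (Suc T) y * (f y * inverse (hh T y base)) \<partial>Y T)"
  by (rule nn_integral_target[OF im])
 finally have "inverse D * nn_integral target f \<le> (\<integral>\<^sup>+y. Wp (Suc T) y * f y * inverse (hh T y base) \<partial>Y T)"
  using g by (simp add: mult_left_mono mult.assoc[symmetric])
 then have "of_nat (N - 1) ^ T * (inverse D * nn_integral target f) \<le> of_nat (N - 1) ^ T * (\<integral>\<^sup>+y. Wp (Suc T) y * f y * inverse (hh T y base) \<partial>Y T)"
  by (rule mult_left_mono) simp
 also have "... \<le> nn_integral (Pk x) f" by (rule icsmc_lower)
 finally show ?thesis by (simp add: mult.assoc)
qed

end

lemma (in particle_model) minorization_bounded_potentials:
 assumes N2: "2 \<le> N" and gam: "0 < gam" "gam < \<top>" and r: "0 < r"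
  and le: "(\<Prod>t=1..T. SUP z\<in>space Z. ennreal (G t z)) \<le> r * gam"
  and x: "x \<in> space X" and f: "f \<in> bm X"
 shows "of_nat (N - 1) ^ T * inverse (of_nat ((N - 2) ^ T) + of_nat (N ^ T - (N - 2) ^ T) * r) * nn_integral target f
   \<le> nn_integral (Pk x) f"
proof -
 interpret particle_model2 Z T N M1 M G z0 x f by unfold_locales (use N2 x f in auto)
 show ?thesis
 proof (rule icsmc_minorization[OF gam])
  have "(N - 2) ^ T < N ^ T" using N2 T by (intro power_strict_mono) auto
  then have "0 < (of_nat (N ^ T - (N - 2) ^ T) :: ennreal)" by (simp only: of_nat_0_less_iff zero_less_diff)
  then have "0 < of_nat (N ^ T - (N - 2) ^ T) * r" using r by (simp only: ennreal_zero_less_mult_iff)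
  then show "0 < of_nat ((N - 2) ^ T) + of_nat (N ^ T - (N - 2) ^ T) * r"
by (rule add_nonneg_pos[OF zero_le])
  show "AE y in target. hh T y base \<le> gam * (of_nat ((N - 2) ^ T) + of_nat (N ^ T - (N - 2) ^ T) * r)"
  proof (rule AE_I2)
   fix y assume "y \<in> space target"
   then have "y \<in> space X" using sets_eq_imp_space_eq[OF sets_target] by simp
   from hh_le_potential_bound[OF this]
   have "hh T y base \<le> of_nat ((N - 2) ^ T) * gam + of_nat (N ^ T - (N - 2) ^ T) * (r * gam)"
    using le by (meson add_left_mono mult_left_mono order_trans zero_le)
   then show "hh T y base \<le> gam * (of_nat ((N - 2) ^ T) + of_nat (N ^ T - (N - 2) ^ T) * r)"
    by (simp add: distrib_left ac_simps del: of_nat_power)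
  qed
 qed
qed

lemma (in particle_model) minorization_mixing:
 assumes N2: "2 \<le> N" and gam: "0 < gam" "gam < \<top>" and \<alpha>: "0 < \<alpha>"
  and x: "x \<in> space X" "mixes \<alpha> x" and y: "AE y in target. mixes \<alpha> y" and f: "f \<in> bm X"
 shows "of_nat (N - 1) ^ T * inverse ((of_nat (N - 2) + 2 * \<alpha>) ^ T) * nn_integral target f \<le> nn_integral (Pk x) f"
proof -
 note mx = x(2)
 interpret particle_model2 Z T N M1 M G z0 x f by unfold_locales (use N2 x f in auto)
 show ?thesis
 proof (rule icsmc_minorization[OF gam])
  have "of_nat (N - 2) + 2 * \<alpha> \<noteq> 0" using \<alpha> by auto
  then show "0 < (of_nat (N - 2) + 2 * \<alpha>) ^ T" by (metis power_not_zero not_gr_zero)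
  have "AE y in target. y \<in> space X" using sets_eq_imp_space_eq[OF sets_target] by (auto intro: AE_I2)
  with y show "AE y in target. hh T y base \<le> gam * (of_nat (N - 2) + 2 * \<alpha>) ^ T"
   by eventually_elim (use hh_le_mixing_bound[OF _ mx] in \<open>simp only: mult.commute[of gam]\<close>)
 qed
qed

subsection \<open>The particle Gibbs sampler\<close>

text \<open>The infimum is the limit of a sequence of almost sure bounds, and countably many null
  sets can be united; f may be non-measurable.\<close>

lemma AE_le_ess_sup: "AE x in \<mu>. f x \<le> ess_sup \<mu> f"
proof -
 let ?A = "{c. AE x in \<mu>. f x \<le> c}"
 have "\<top> \<in> ?A" by simp
 then have "?A \<noteq> {}" by blast
 then obtain c :: "nat => ennreal" where c: "range c \<subseteq> ?A" "Inf ?A = (INF i. c i)"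
  using ennreal_Inf_countable_INF by meson
 then have "AE x in \<mu>. f x \<le> c i" for i by blast
 then have "AE x in \<mu>. \<forall>i. f x \<le> c i" by (simp add: AE_all_countable)
 then show ?thesis unfolding ess_sup_def c(2) by eventually_elim (auto intro: INF_greatest)
qed

lemma tendsto_ereal_mult_1:
 assumes r: "r \<longlonglongrightarrow> 1" and c: "0 \<le> c"
 shows "(\<lambda>n. ereal (r n) * c) \<longlonglongrightarrow> c"
proof (cases c)
 case (real x)
 have "(\<lambda>n. ereal (r n * x)) \<longlonglongrightarrow> ereal (1 * x)" by (intro tendsto_intros r)
 then show ?thesis using real by simp
next
 case PInf
 have "eventually (\<lambda>n. 0 < r n) sequentially" using r by (rule order_tendstoD) simp
 then have "eventually (\<lambda>n. ereal (r n) * c = \<infinity>) sequentially" by eventually_elim (simp add: PInf)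
 then show ?thesis unfolding PInf by (rule tendsto_eventually)
qed (use c in simp)

locale particle_gibbs =
 fixes \<Theta> :: "'th measure" and Z :: "'z measure" and T :: nat
  and M1 :: "'th => 'z measure" and M :: "'th => nat => 'z => 'z measure" and G :: "'th => nat => 'z => real"
  and X :: "(nat => 'z) measure" and \<gamma> :: "'th => ennreal" and \<pi> :: "('th \<times> (nat => 'z)) measure"
  and \<pi>T :: "'th measure" and \<pi>X :: "(nat => 'z) measure" and tgt :: "'th => (nat => 'z) measure"
  and \<kappa> :: "(nat => 'z) => 'th measure" and P :: "nat => 'th => (nat => 'z) => (nat => 'z) measure"
 assumes T1: "1 \<le> T" and X_eq: "X = PiM {1..T} (\<lambda>_. Z)"
  and M1: "M1 \<in> \<Theta> \<leadsto> Z"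
  and M: "\<And>t. t \<in> {2..T} ==> (\<lambda>(\<theta>, z). M \<theta> t z) \<in> \<Theta> \<Otimes>\<^sub>M Z \<leadsto> Z"
  and G: "\<And>t. t \<in> {1..T} ==> (\<lambda>(\<theta>, z). G \<theta> t z) \<in> bm (\<Theta> \<Otimes>\<^sub>M Z)"
  and G_nonneg: "\<And>\<theta> t z. \<theta> \<in> space \<Theta> ==> t \<in> {1..T} ==> z \<in> space Z ==> 0 \<le> G \<theta> t z"
  and \<gamma>: "\<And>\<theta>. \<gamma> \<theta> = gamma_T Z T (M1 \<theta>) (M \<theta>) (G \<theta>)"
  and \<gamma>_pos_finite: "\<And>\<theta>. \<theta> \<in> space \<Theta> ==> 0 < \<gamma> \<theta> \<and> \<gamma> \<theta> < \<infinity>"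
  and \<pi>_prob: "\<pi> \<in> space (prob_algebra (\<Theta> \<Otimes>\<^sub>M X))"
  and \<pi>T_eq: "\<pi>T = distr \<pi> \<Theta> fst" and \<pi>X_eq: "\<pi>X = distr \<pi> X snd"
  and tgt_eq: "\<And>\<theta>. tgt \<theta> = fk_target Z T (M1 \<theta>) (M \<theta>) (G \<theta>)"
  and tgt_disintegration: "\<And>A B. A \<in> sets \<Theta> ==> B \<in> sets X ==>
     emeasure \<pi> (A \<times> B) = (\<integral>\<^sup>+ \<theta>. emeasure (tgt \<theta>) B * indicator A \<theta> \<partial>\<pi>T)"
  and \<kappa>_measurable: "\<kappa> \<in> X \<leadsto> \<Theta>"
  and \<kappa>_disintegration: "\<And>A B. A \<in> sets \<Theta> ==> B \<in> sets X ==>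
     emeasure \<pi> (A \<times> B) = (\<integral>\<^sup>+ x. emeasure (\<kappa> x) A * indicator B x \<partial>\<pi>X)"
  and P: "\<And>N \<theta>. P N \<theta> = icsmc Z T N (M1 \<theta>) (M \<theta>) (G \<theta>)"
begin

lemma model:
 assumes \<theta>: "\<theta> \<in> space \<Theta>" and N: "1 \<le> N"
 shows "particle_model Z T N (M1 \<theta>) (M \<theta>) (G \<theta>) (SOME z. z \<in> space Z)"
proof
 show "M1 \<theta> \<in> space (prob_algebra Z)" by (rule measurable_space[OF M1 \<theta>])
 then have "space Z \<noteq> {}" using prob_space.not_empty[OF prob_kernelD(1)[OF M1 \<theta>]] prob_kernelD(3)[OF M1 \<theta>] by simp
 then show "(SOME z. z \<in> space Z) \<in> space Z" by (rule some_in_eq[THEN iffD2])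
qed (use T1 N \<theta> M G G_nonneg in \<open>auto intro: measurable_param_section\<close>)

lemma sets_tgt: "\<theta> \<in> space \<Theta> ==> sets (tgt \<theta>) = sets X"
 using particle_model.sets_target[OF model[OF _ order_refl]] by (simp add: tgt_eq X_eq)

lemma tgt_measurable: "tgt \<in> \<Theta> \<leadsto> X"
proof (rule measurable_prob_algebraI)
 show p: "prob_space (tgt \<theta>)" if \<theta>: "\<theta> \<in> space \<Theta>" for \<theta>
  using particle_model.prob_target[OF model[OF \<theta> order_refl]] \<gamma>_pos_finite[OF \<theta>] by (simp add: tgt_eq \<gamma>)
 let ?K = "\<lambda>\<theta>. path_law Z T (M1 \<theta>) (M \<theta>)" and ?W = "\<lambda>\<theta> x. \<Prod>t=1..T. ennreal (G \<theta> t (x t))"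
 have K: "?K \<in> \<Theta> \<leadsto> X" unfolding X_eq by (rule path_law_measurable[OF T1 M1 M])
 have W: "(\<lambda>(\<theta>, x). ?W \<theta> x) \<in> bm (\<Theta> \<Otimes>\<^sub>M X)"
  unfolding case_prod_beta'
 proof (rule borel_measurable_prod_ennreal)
  fix t assume t: "t \<in> {1..T}"
  have "(\<lambda>q. (fst q, snd q t)) \<in> \<Theta> \<Otimes>\<^sub>M X \<rightarrow>\<^sub>M \<Theta> \<Otimes>\<^sub>M Z"
   unfolding X_eq by (intro measurable_Pair measurable_fst comp_snd[OF measurable_component_singleton[OF t]])
  from measurable_compose[OF this G[OF t]]
  show "(\<lambda>q. ennreal (G (fst q) t (snd q t))) \<in> bm (\<Theta> \<Otimes>\<^sub>M X)" by simp
 qed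
 have \<gamma>m: "\<gamma> \<in> bm \<Theta>"
  unfolding \<gamma>[abs_def] gamma_T_def by (rule nn_integral_kernel_measurable2[OF K W])
 show "tgt \<in> \<Theta> \<rightarrow>\<^sub>M subprob_algebra X"
 proof (rule measurable_subprob_algebra)
  fix \<theta> assume \<theta>: "\<theta> \<in> space \<Theta>"
  show "sets (tgt \<theta>) = sets X" by (rule sets_tgt[OF \<theta>])
  show "subprob_space (tgt \<theta>)" by (rule prob_space_imp_subprob_space[OF p[OF \<theta>]])
 next
  fix A assume A: "A \<in> sets X"
  have "(\<lambda>\<theta>. \<integral>\<^sup>+x. ?W \<theta> x / \<gamma> \<theta> * indicator A x \<partial>?K \<theta>) \<in> bm \<Theta>"
  proof (rule nn_integral_kernel_measurable2[OF K], unfold case_prod_beta')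
   show "(\<lambda>q. ?W (fst q) (snd q) / \<gamma> (fst q) * indicator A (snd q)) \<in> bm (\<Theta> \<Otimes>\<^sub>M X)"
    using W A by (intro borel_measurable_times_ennreal borel_measurable_divide_ennreal comp_fst[OF \<gamma>m]
      comp_snd[OF borel_measurable_indicator]) (auto simp: case_prod_beta')
  qed
  moreover have "emeasure (tgt \<theta>) A = (\<integral>\<^sup>+x. ?W \<theta> x / \<gamma> \<theta> * indicator A x \<partial>?K \<theta>)" if \<theta>: "\<theta> \<in> space \<Theta>" for \<theta>
   unfolding tgt_eq fk_target_def \<gamma>[symmetric]
   by (rule emeasure_density) (use measurable_param_section[OF W \<theta>] A prob_kernelD(2)[OF K \<theta>] in \<open>auto cong: measurable_cong_sets\<close>)
  ultimately show "(\<lambda>\<theta>. emeasure (tgt \<theta>) A) \<in> bm \<Theta>" by (simp cong: measurable_cong)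
 qed
qed

sublocale gibbs \<Theta> X \<pi> \<pi>T \<pi>X tgt \<kappa>
 by unfold_locales (fact \<pi>_prob \<pi>T_eq \<pi>X_eq tgt_measurable tgt_disintegration \<kappa>_measurable \<kappa>_disintegration)+

lemma gibbs_kernel_P:
 assumes N: "1 \<le> N"
 shows "gibbs_kernel \<Theta> X \<pi> \<pi>T \<pi>X tgt \<kappa> (P N)"
proof (unfold gibbs_kernel_def gibbs_kernel_axioms_def, intro conjI allI impI gibbs_axioms)
 show "(\<lambda>(\<theta>, x). P N \<theta> x) \<in> \<Theta> \<Otimes>\<^sub>M X \<leadsto> X"
  unfolding P X_eq by (rule icsmc_measurable[OF N T1 M1 M G G_nonneg])
 fix \<theta> assume \<theta>: "\<theta> \<in> space \<Theta>"
 then show "rev_pos_kernel (tgt \<theta>) (P N \<theta>)"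
  using particle_model.rev_pos_icsmc[OF model[OF \<theta> N]] \<gamma>_pos_finite[OF \<theta>] by (simp add: tgt_eq \<gamma> P)
qed

abbreviation \<rho> where "\<rho> N \<equiv> gap_ratio \<pi>T \<pi>X tgt (P N)"

lemma ratio_ge_minorization:
 assumes N: "1 \<le> N" and e: "0 \<le> \<epsilon>"
  and le: "AE \<theta> in \<pi>T. AE x in tgt \<theta>. \<forall>h\<in>bm X. ennreal \<epsilon> * nn_integral (tgt \<theta>) h \<le> nn_integral (P N \<theta> x) h"
 shows "\<epsilon> \<le> \<rho> N"
proof -
 interpret K: gibbs_kernel \<Theta> X \<pi> \<pi>T \<pi>X tgt \<kappa> "P N" by (rule gibbs_kernel_P[OF N])
 interpret T: prob_space \<pi>T by (rule prob_\<pi>T)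
 note sp = AE_space_\<pi>T
 \<comment> \<open>The minorization at h = 1 compares total masses; \<open>ratio_lower\<close> asks
   for this bound.\<close>
 have "AE \<theta> in \<pi>T. \<epsilon> \<le> 1"
  using le sp
 proof eventually_elim
  case (elim \<theta>)
  interpret t: prob_space "tgt \<theta>" by (rule prob_kernelD[OF tgt elim(2)])
  have "AE x in tgt \<theta>. x \<in> space X" by (rule AE_I2) (simp add: prob_kernelD[OF tgt elim(2)])
  with elim(1) have "AE x in tgt \<theta>. ennreal \<epsilon> \<le> 1"
  proof eventually_elim
   case (elim x)
   have "prob_space (P N \<theta> x)"
    using prob_kernelD(1)[OF K.K_measurable, of "(\<theta>, x)"] \<open>\<theta> \<in> space \<Theta>\<close> elim by (simp add: space_pair_measure)
   then show ?case using bspec[OF elim(1), of "\<lambda>_. 1"] by (simp add: t.emeasure_space_1 prob_space.emeasure_space_1)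
  qed
  then show "\<epsilon> \<le> 1" by simp
 qed
 then have e1: "\<epsilon> \<le> 1" by simp
 show ?thesis
 proof (rule K.ratio_lower[OF e e1])
  show "AE \<theta> in \<pi>T. \<forall>f\<in>L2 (tgt \<theta>). \<epsilon> * var (tgt \<theta>) f \<le> dirichlet (tgt \<theta>) (P N \<theta>) f"
   using le sp
  proof eventually_elim
   case (elim \<theta>)
   have "bm (tgt \<theta>) = (bm X :: ((nat => 'z) => ennreal) set)"
    by (rule measurable_cong_sets[OF sets_tgt[OF elim(2)] refl])
   then show ?case
    using rev_pos_kernel.minorization_dirichlet[OF K.K_rev_pos[OF elim(2)] _ e] elim(1) by auto
  qed
 qed
qed

lemma space_tgt: "\<theta> \<in> space \<Theta> ==> AE x in tgt \<theta>. x \<in> space X"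
 by (rule AE_I2) (simp add: prob_kernelD(3)[OF tgt])

lemma gap_ratio_bounded_potentials:
 assumes N: "2 \<le> N" and R: "R = ess_sup \<pi>T (\<lambda>\<theta>. (\<Prod>t=1..T. SUP z\<in>space Z. ennreal (G \<theta> t z)) / \<gamma> \<theta>)" and fin: "R < \<infinity>"
 shows "1 \<le> enn2real R"
  and "(1 - 1 / N) ^ T / (1 + (1 - (1 - 2 / N) ^ T) * (enn2real R - 1)) \<le> \<rho> N"
proof -
 interpret T: prob_space \<pi>T by (rule prob_\<pi>T)
 have N1: "1 \<le> N" using N by simp
 let ?B = "\<lambda>\<theta>. \<Prod>t=1..T. SUP z\<in>space Z. ennreal (G \<theta> t z)"
 define r where "r = enn2real R"
 have r: "R = ennreal r" "0 \<le> r" using fin by (auto simp: r_def less_top)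
 note sp = AE_space_\<pi>T
 \<comment> \<open>The claim 1 \<le> R is carried along: it keeps the denominator \<open>?D\<close>
   below positive, as it makes \<open>?D\<close> at least N^T.\<close>
 have B: "AE \<theta> in \<pi>T. \<theta> \<in> space \<Theta> \<and> ?B \<theta> \<le> R * \<gamma> \<theta> \<and> 1 \<le> R"
  using AE_le_ess_sup[of "\<lambda>\<theta>. ?B \<theta> / \<gamma> \<theta>" \<pi>T, folded R] sp
 proof eventually_elim
  case (elim \<theta>)
  interpret m: particle_model Z T N "M1 \<theta>" "M \<theta>" "G \<theta>" "SOME z. z \<in> space Z" by (rule model[OF elim(2) N1])
  have g: "0 < \<gamma> \<theta>" "\<gamma> \<theta> < \<top>" using \<gamma>_pos_finite[OF elim(2)] by auto
  have "?B \<theta> = ?B \<theta> / \<gamma> \<theta> * \<gamma> \<theta>"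
   using ennreal_mult_divide_cancel[of "\<gamma> \<theta>"] g by (simp add: divide_ennreal_def mult.assoc mult.commute[of "inverse _"])
  also have "... \<le> R * \<gamma> \<theta>" using elim(1) by (rule mult_right_mono) simp
  finally have 1: "?B \<theta> \<le> R * \<gamma> \<theta>" .
  have "1 = \<gamma> \<theta> * inverse (\<gamma> \<theta>)" using ennreal_mult_divide_cancel[of "\<gamma> \<theta>"] g by simp
  also have "... \<le> ?B \<theta> / \<gamma> \<theta>"
   unfolding divide_ennreal_def \<gamma> by (intro mult_right_mono m.gam_le_potential_bound) simp
  finally show ?case using elim 1 by (simp add: order_trans)
 qed
 then have "AE \<theta> in \<pi>T. 1 \<le> R" by eventually_elim simp
 then have r1: "1 \<le> r" using r by simp
 then show "1 \<le> enn2real R" by (simp add: r_def)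
 let ?D = "(real N - 2) ^ T + (real N ^ T - (real N - 2) ^ T) * r"
 have le: "(real N - 2) ^ T \<le> real N ^ T" using N by (intro power_mono) auto
 have "real N ^ T \<le> ?D" using mult_left_mono[OF r1, of "real N ^ T - (real N - 2) ^ T"] le by simp
 moreover have Np: "0 < real N ^ T" using N by simp
 ultimately have D: "0 < ?D" by linarith
 have nat: "real (N ^ T - (N - 2) ^ T) = real N ^ T - (real N - 2) ^ T" "real ((N - 2) ^ T) = (real N - 2) ^ T"
  using N by (simp_all add: of_nat_diff power_mono)
 have eD: "of_nat ((N - 2) ^ T) + of_nat (N ^ T - (N - 2) ^ T) * R = ennreal ?D"
  unfolding ennreal_of_nat_eq_real_of_nat nat r(1) using le r(2) N by (simp add: ennreal_plus ennreal_mult)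
 have "(real N - 1) ^ T / ?D \<le> \<rho> N"
 proof (rule ratio_ge_minorization[OF N1])
  show "0 \<le> (real N - 1) ^ T / ?D" using D N by simp
  have e: "ennreal ((real N - 1) ^ T / ?D) = of_nat (N - 1) ^ T * inverse (ennreal ?D)"
   unfolding ennreal_of_nat_eq_real_of_nat using D N
   by (simp add: divide_inverse ennreal_mult inverse_ennreal ennreal_power of_nat_diff)
  show "AE \<theta> in \<pi>T. AE x in tgt \<theta>. \<forall>h\<in>bm X.
    ennreal ((real N - 1) ^ T / ?D) * nn_integral (tgt \<theta>) h \<le> nn_integral (P N \<theta> x) h"
   using B
  proof eventually_elim
   case (elim \<theta>)
   interpret m: particle_model Z T N "M1 \<theta>" "M \<theta>" "G \<theta>" "SOME z. z \<in> space Z" by (rule model) (use elim N1 in auto)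
   have g: "0 < \<gamma> \<theta>" "\<gamma> \<theta> < \<top>" using \<gamma>_pos_finite elim by auto
   show ?case
    using space_tgt[OF elim[THEN conjunct1]]
   proof eventually_elim
    case x: (elim x)
    then show ?case
     using elim m.minorization_bounded_potentials[OF N, of R x] g r1 r(1)
     unfolding e eD[symmetric] X_eq tgt_eq P \<gamma> by auto
   qed
  qed
 qed
 \<comment> \<open>Numerator and denominator are divided by N^T.\<close>
 also have "(real N - 1) ^ T / ?D = (1 - 1 / N) ^ T / (1 + (1 - (1 - 2 / N) ^ T) * (r - 1))"
 proof -
  have "(real N - 1) ^ T = real N ^ T * (1 - 1 / N) ^ T" "(real N - 2) ^ T = real N ^ T * (1 - 2 / N) ^ T"
   using N by (simp_all add: power_mult_distrib[symmetric] right_diff_distrib)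
  then have "?D = real N ^ T * (1 + (1 - (1 - 2 / N) ^ T) * (r - 1))" by (simp add: algebra_simps)
  then show ?thesis using \<open>(real N - 1) ^ T = _\<close> Np by (simp only: mult_divide_mult_cancel_left_if) simp
 qed
 finally show "(1 - 1 / N) ^ T / (1 + (1 - (1 - 2 / N) ^ T) * (enn2real R - 1)) \<le> \<rho> N" by (simp add: r_def)
qed

definition mixing where
 "mixing \<alpha> \<longleftrightarrow> 0 \<le> \<alpha> \<and>
   (\<forall>p\<ge>1. \<forall>k\<ge>1. p + k \<le> T + 1 -->
    ess_sup (distr \<pi> (\<Theta> \<Otimes>\<^sub>M Z) (\<lambda>(\<theta>, x). (\<theta>, x p)))
     (\<lambda>(\<theta>, z). fk_Q Z T (M \<theta>) (G \<theta>) p (p + k) (\<lambda>_. 1) z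
      / fk_eta Z T (M1 \<theta>) (M \<theta>) (G \<theta>) p (fk_Q Z T (M \<theta>) (G \<theta>) p (p + k) (\<lambda>_. 1)))
    \<le> ennreal \<alpha>)"

text \<open>The assumption \<alpha> > 0 is what clearing the denominators requires, and for N = 2 it
  makes the constant N - 2 + 2 \<alpha> positive.\<close>

lemma gap_ratio_mixing_pos:
 assumes N: "2 \<le> N" and mix: "mixing \<alpha>" and pos: "0 < \<alpha>"
 shows "((1 - 1 / N) / (1 + 2 * (\<alpha> - 1) / N)) ^ T \<le> \<rho> N"
proof -
 have N1: "1 \<le> N" using N by simp
 let ?F = "\<lambda>p k \<theta> z. fk_Q Z T (M \<theta>) (G \<theta>) p (p + k) (\<lambda>_. 1) z
      / fk_eta Z T (M1 \<theta>) (M \<theta>) (G \<theta>) p (fk_Q Z T (M \<theta>) (G \<theta>) p (p + k) (\<lambda>_. 1))"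
 \<comment> \<open>The restrictions on p and k are put inside the almost sure statement, so that
   countably many null sets can be united and almost every path satisfies all conditions at
   once.\<close>
 have "AE q in \<pi>. 1 \<le> p --> 1 \<le> k --> p + k \<le> Suc T --> ?F p k (fst q) (snd q p) \<le> ennreal \<alpha>" for p k
 proof (cases "1 \<le> p \<and> 1 \<le> k \<and> p + k \<le> Suc T")
  case True
  then have p: "p \<in> {1..T}" by auto
  have h: "(\<lambda>(\<theta>, x). (\<theta>, x p)) \<in> \<pi> \<rightarrow>\<^sub>M \<Theta> \<Otimes>\<^sub>M Z"
   unfolding measurable_cong_sets[OF sets_\<pi> refl] X_eq case_prod_beta'
   by (intro measurable_Pair measurable_fst comp_snd[OF measurable_component_singleton[OF p]])
  let ?D = "distr \<pi> (\<Theta> \<Otimes>\<^sub>M Z) (\<lambda>(\<theta>, x). (\<theta>, x p))" and ?f = "\<lambda>(\<theta>, z). ?F p k \<theta> z"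
  have "ess_sup ?D ?f \<le> ennreal \<alpha>" using mix True unfolding mixing_def by auto
  moreover have "AE w in ?D. ?f w \<le> ess_sup ?D ?f" by (rule AE_le_ess_sup)
  ultimately have "AE w in ?D. ?f w \<le> ennreal \<alpha>" by (auto elim!: eventually_mono)
  from AE_distrD[OF h this] show ?thesis by eventually_elim (auto split: prod.splits)
 qed auto
 then have "AE q in \<pi>. \<forall>p k. 1 \<le> p --> 1 \<le> k --> p + k \<le> Suc T --> ?F p k (fst q) (snd q p) \<le> ennreal \<alpha>"
  by (simp add: AE_all_countable)
 from AE_\<pi>_tgt[OF this]
 have A: "AE \<theta> in \<pi>T. AE x in tgt \<theta>. \<forall>p k. 1 \<le> p --> 1 \<le> k --> p + k \<le> Suc T --> ?F p k \<theta> (x p) \<le> ennreal \<alpha>" by simp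
 note sp = AE_space_\<pi>T
 let ?D = "real N - 2 + 2 * \<alpha>"
 have D: "0 < ?D" using N pos by simp
 have eD: "of_nat (N - 2) + 2 * ennreal \<alpha> = ennreal ?D"
  unfolding ennreal_of_nat_eq_real_of_nat using N pos
  by (simp add: of_nat_diff ennreal_plus ennreal_mult flip: ennreal_numeral)
 have "((real N - 1) / ?D) ^ T \<le> \<rho> N"
 proof (rule ratio_ge_minorization[OF N1])
  show "0 \<le> ((real N - 1) / ?D) ^ T" using D N by simp
  have e: "ennreal (((real N - 1) / ?D) ^ T) = of_nat (N - 1) ^ T * inverse (ennreal ?D ^ T)"
   unfolding ennreal_of_nat_eq_real_of_nat using D N
   by (simp add: divide_inverse power_mult_distrib power_inverse ennreal_mult inverse_ennreal ennreal_power of_nat_diff)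
  show "AE \<theta> in \<pi>T. AE x in tgt \<theta>. \<forall>h\<in>bm X.
    ennreal (((real N - 1) / ?D) ^ T) * nn_integral (tgt \<theta>) h \<le> nn_integral (P N \<theta> x) h"
   using A sp
  proof eventually_elim
   case (elim \<theta>)
   interpret m: particle_model Z T N "M1 \<theta>" "M \<theta>" "G \<theta>" "SOME z. z \<in> space Z" by (rule model[OF elim(2) N1])
   have g: "0 < \<gamma> \<theta>" "\<gamma> \<theta> < \<top>" using \<gamma>_pos_finite[OF elim(2)] by auto
   have mx: "AE x in tgt \<theta>. x \<in> space X \<and> m.mixes (ennreal \<alpha>) x"
    using elim(1) space_tgt[OF elim(2)]
   proof eventually_elim
    case (elim x)
    then show ?case using m.mixesI[of x "ennreal \<alpha>"] pos unfolding X_eq by simp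
   qed
   then have mx': "AE x in fk_target Z T (M1 \<theta>) (M \<theta>) (G \<theta>). m.mixes (ennreal \<alpha>) x" unfolding tgt_eq by eventually_elim simp
   show ?case
    using mx
   proof eventually_elim
    case (elim x)
    show ?case
     unfolding e eD[symmetric] X_eq tgt_eq P
     using m.minorization_mixing[OF N g[unfolded \<gamma>], of "ennreal \<alpha>" x, OF _ _ _ mx'] elim pos unfolding X_eq by auto
   qed
  qed
 qed
 also have "(real N - 1) / ?D = (1 - 1 / N) / (1 + 2 * (\<alpha> - 1) / N)"
 proof -
  have "real N - 1 = real N * (1 - 1 / N)" "?D = real N * (1 + 2 * (\<alpha> - 1) / N)" using N by (simp_all add: field_simps)
  then show ?thesis using N by (simp only: mult_divide_mult_cancel_left_if) simp
 qed
 finally show ?thesis .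
qed

text \<open>\<open>\<alpha> = 0\<close> is impossible, as the bound for \<open>\<alpha> = 1 / 4\<close> would exceed \<open>1\<close>.\<close>

lemma mixing_pos:
 assumes mix: "mixing \<alpha>"
 shows "0 < \<alpha>"
proof (rule ccontr)
 assume "\<not> 0 < \<alpha>"
 then have "\<alpha> = 0" using mix by (simp add: mixing_def)
 then have "mixing (1/4)" using mix unfolding mixing_def by fastforce
 from gap_ratio_mixing_pos[OF order_refl this] have "2 ^ T \<le> \<rho> 2" by simp
 moreover have "\<rho> 2 \<le> 1" by (rule gibbs_kernel.ratio_bounds(2)[OF gibbs_kernel_P]) simp
 moreover have "(2::real) ^ 1 \<le> 2 ^ T" using T1 by (intro power_increasing) auto
 ultimately show False by simp
qed

lemma ratio_tendsto:
 assumes "ess_sup \<pi>T (\<lambda>\<theta>. (\<Prod>t=1..T. SUP z\<in>space Z. ennreal (G \<theta> t z)) / \<gamma> \<theta>) < \<infinity> \<or> (\<exists>\<alpha>. mixing \<alpha>)"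
 shows "\<rho> \<longlonglongrightarrow> 1"
proof -
 have "\<exists>l. l \<longlonglongrightarrow> 1 \<and> (\<forall>N\<ge>2. l N \<le> \<rho> N)"
  using assms
 proof
  let ?R = "ess_sup \<pi>T (\<lambda>\<theta>. (\<Prod>t=1..T. SUP z\<in>space Z. ennreal (G \<theta> t z)) / \<gamma> \<theta>)"
  assume "?R < \<infinity>"
  then have "\<forall>N\<ge>2. (1 - 1 / N) ^ T / (1 + (1 - (1 - 2 / N) ^ T) * (enn2real ?R - 1)) \<le> \<rho> N"
   using gap_ratio_bounded_potentials(2)[OF _ refl] by blast
  moreover have "(\<lambda>N. (1 - 1 / real N) ^ T / (1 + (1 - (1 - 2 / real N) ^ T) * (enn2real ?R - 1)))
    \<longlonglongrightarrow> (1 - 0) ^ T / (1 + (1 - (1 - 0) ^ T) * (enn2real ?R - 1))"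
   by (intro tendsto_intros lim_const_over_n) auto
  ultimately show ?thesis by (intro exI conjI) auto
 next
  assume "\<exists>\<alpha>. mixing \<alpha>"
  then obtain \<alpha> where \<alpha>: "mixing \<alpha>" ..
  then have "\<forall>N\<ge>2. ((1 - 1 / N) / (1 + 2 * (\<alpha> - 1) / N)) ^ T \<le> \<rho> N"
   using gap_ratio_mixing_pos[OF _ \<alpha> mixing_pos[OF \<alpha>]] by blast
  moreover have "(\<lambda>N. ((1 - 1 / real N) / (1 + 2 * (\<alpha> - 1) / real N)) ^ T) \<longlonglongrightarrow> ((1 - 0) / (1 + 0)) ^ T"
   by (intro tendsto_intros lim_const_over_n) auto
  ultimately show ?thesis by (intro exI conjI) auto
 qed
 then obtain l where l: "l \<longlonglongrightarrow> 1" "\<forall>N\<ge>2. l N \<le> \<rho> N" by blast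
 show ?thesis
 proof (rule real_tendsto_sandwich[OF _ _ l(1) tendsto_const])
  show "eventually (\<lambda>N. l N \<le> \<rho> N) sequentially" using l(2) by (auto simp: eventually_sequentially)
  have "\<rho> N \<le> 1" if "1 \<le> N" for N by (rule gibbs_kernel.ratio_bounds(2)[OF gibbs_kernel_P[OF that]])
  then show "eventually (\<lambda>N. \<rho> N \<le> 1) sequentially" by (auto simp: eventually_sequentially)
 qed
qed

end

text \<open>Here a and b are the asymptotic variances for the Gibbs and the particle Gibbs sampler.
  Since a \<le> b is known from positivity, it suffices that the lower bounds are at most a, which
  follows from a \<ge> v \<ge> 0.\<close>

lemma ereal_variance_bounds:
 fixes a b :: ereal and v \<epsilon> :: real
 assumes "0 \<le> v" "ereal v \<le> a" "a \<le> b"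
 shows "0 \<le> (a - ereal v) / 2" "(a - ereal v) / 2 \<le> b"
  and "0 < \<epsilon> ==> \<epsilon> \<le> 1 ==> (a - ereal ((1 - \<epsilon>) * v)) / ereal (2 - \<epsilon>) \<le> b"
proof -
 show "0 \<le> (a - ereal v) / 2" "(a - ereal v) / 2 \<le> b"
  using assms by (cases a; cases b; simp)+
 assume e: "0 < \<epsilon>" "\<epsilon> \<le> 1"
 show "(a - ereal ((1 - \<epsilon>) * v)) / ereal (2 - \<epsilon>) \<le> b"
 proof (cases a)
  case (real x)
  have "- ((1 - \<epsilon>) * v) \<le> (1 - \<epsilon>) * x" using e assms real mult_nonneg_nonneg[of "1 - \<epsilon>"] by (smt (verit) ereal_less_eq(3))
  then have "(x - (1 - \<epsilon>) * v) / (2 - \<epsilon>) \<le> x" using e by (simp add: field_simps)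
  then have "(a - ereal ((1 - \<epsilon>) * v)) / ereal (2 - \<epsilon>) \<le> a" using real e by simp
  then show ?thesis using assms(3) by (rule order_trans)
 qed (use assms in auto)
qed

section \<open>Functions of \<theta>: ergodicity and asymptotic variances\<close>

context gibbs_kernel
begin

text \<open>The law of \<theta> after k steps is \<kappa> averaged over x after k - 1 steps of
  \<open>Kx\<close>. The hypothesis covers k - 1 \<ge> 1, which explains k \<ge> 2.\<close>

lemma ergodicity_transfer:
 assumes \<G>: "\<G> \<subseteq> {g. integrable \<pi>X g}"
  and H: "\<forall>\<nu>\<in>space (prob_algebra X). \<forall>g\<in>\<G>. \<forall>k\<ge>(1::nat).
       integrable (\<nu> \<bind> kernel_power X Kx k) g -->
       ennreal \<bar>integral\<^sup>L (\<nu> \<bind> kernel_power X Kx k) g - (integral\<^sup>L \<pi>X g)\<bar> \<le> nrm g * W \<nu> * ennreal r ^ k"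
  and \<nu>: "\<nu> \<in> space (prob_algebra X)" "\<nu>' \<in> space (prob_algebra (\<Theta> \<Otimes>\<^sub>M X))" "distr \<nu>' X snd = \<nu>"
  and g: "g \<in> \<G>" "\<forall>x\<in>space X. g x = bar f x" and k: "2 \<le> k" and f: "integrable \<pi>T f"
  and i: "integrable (\<nu>' \<bind> kernel_power (\<Theta> \<Otimes>\<^sub>M X) S k) (lift f)"
 shows "ennreal \<bar>(\<integral>(\<theta>, x). f \<theta> \<partial>(\<nu>' \<bind> kernel_power (\<Theta> \<Otimes>\<^sub>M X) S k)) - (integral\<^sup>L \<pi>T f)\<bar> \<le> nrm g * W \<nu> * ennreal r ^ (k - 1)"
proof -
 obtain l where l: "k = Suc l" "1 \<le> l" using k by (cases k) auto
 let ?M = "\<nu> \<bind> kernel_power X Kx l"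
 have fm: "f \<in> bm \<Theta>" using borel_measurable_integrable[OF f] sets_\<pi>T by (simp cong: measurable_cong_sets)
 note F = integral_kernel_power_fst[OF \<nu>(2) fm i[unfolded l(1)], unfolded \<nu>(3)]
 have "sets \<nu> = sets X" "space \<nu> \<noteq> {}" using \<nu>(1) by (auto simp: space_prob_algebra dest: prob_space.not_empty)
 then have "space ?M = space X"
  using sets_eq_imp_space_eq[OF sets_kernel_bind[OF _ kernel_power_measurable_X]] by blast
 then have eq: "g x = bar f x" if "x \<in> space ?M" for x using g(2) that by simp
 have "integrable ?M g" using F(1) eq by (simp cong: Bochner_Integration.integrable_cong)
 moreover have "integral\<^sup>L ?M g = integral\<^sup>L ?M (bar f)" by (rule Bochner_Integration.integral_cong[OF refl eq])
 moreover have "integral\<^sup>L \<pi>X g = integral\<^sup>L \<pi>T f"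
  unfolding integral_bar(1)[OF f, symmetric] using g(2) by (intro Bochner_Integration.integral_cong) (auto simp: space_\<pi>X)
 ultimately show ?thesis using H[rule_format, OF \<nu>(1) g(1) l(2)] unfolding l(1) F(2) by simp
qed

lemma inner_kernel_power_fst:
 assumes f: "f \<in> L2 \<pi>T" and k: "1 \<le> k"
 shows "inner_L2 \<pi> (lift f) (kernel_op (kernel_power (\<Theta> \<Otimes>\<^sub>M X) S k) (lift f)) =
  inner_L2 \<pi>X (bar f) (kernel_op (kernel_power X Kx (k - 1)) (bar f))"
proof -
 obtain l where l: "k = Suc l" using k by (cases k) (auto simp: One_nat_def)
 then show ?thesis using joint_corr_Suc[OF f, of l]
  unfolding joint.corr_def x.corr_def kernel_power_cong_sets[OF sets_\<pi>] kernel_power_cong_sets[OF sets_\<pi>X] by simp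
qed

text \<open>The bound of \<open>asvar_bounds\<close> for \<open>bar f\<close> is inserted into
  \<open>asvar_joint\<close>; its surplus 1 / \<rho> - 1 merges with the variance of
  \<open>bar f\<close> already present. The second relation is in fact an equality, by
  \<open>asvar_joint\<close> for the exact sampler.\<close>

lemma asvar_joint_upper:
 fixes f
 defines "U \<equiv> ereal (var \<pi>T f) + ereal (1 / ratio * var \<pi>X (bar f)) + ereal (1 / ratio) * asvar \<pi>X \<Gamma>x (bar f)"
 assumes f: "f \<in> L2 \<pi>T" and r: "0 < ratio"
 shows "asvar \<pi> S (lift f) \<le> U"
  and "U \<le> ereal ((1 - 1 / ratio) * var \<pi>T f) + ereal (1 / ratio) * asvar \<pi> (scan_kernel \<Theta> X \<kappa> (\<lambda>\<theta> x. tgt \<theta>)) (lift f)"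
 unfolding U_def
proof -
 note b = asvar_bounds[OF bar_L2[OF f]]
 show "asvar \<pi> S (lift f) \<le> ereal (var \<pi>T f) + ereal (1 / ratio * var \<pi>X (bar f)) + ereal (1 / ratio) * asvar \<pi>X \<Gamma>x (bar f)"
  unfolding asvar_joint[OF f] using b(1,2) b(3)[OF r] r
  by (cases "asvar \<pi>X Kx (bar f)"; cases "asvar \<pi>X \<Gamma>x (bar f)") (auto simp: left_diff_distrib)
qed (use gibbs_kernel.asvar_joint[OF gibbs_kernel_const f] asvar_bounds(1)[OF bar_L2[OF f]] r in
 \<open>cases "asvar \<pi>X \<Gamma>x (bar f)"; auto simp: field_simps\<close>)

lemma asvar_joint_lower:
 assumes f: "f \<in> L2 \<pi>T"
 shows "asvar \<pi> (scan_kernel \<Theta> X \<kappa> (\<lambda>\<theta> x. tgt \<theta>)) (lift f) \<le> asvar \<pi> S (lift f)"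
proof -
 interpret g: gibbs_kernel \<Theta> X \<pi> \<pi>T \<pi>X tgt \<kappa> "\<lambda>\<theta> x. tgt \<theta>" by (rule gibbs_kernel_const)
 show ?thesis unfolding g.asvar_joint[OF f] asvar_joint[OF f]
  by (rule add_left_mono[OF asvar_bounds(2)[OF bar_L2[OF f]]])
qed

end

section \<open>Minorization constants, and limits for many particles\<close>

context particle_gibbs
begin

lemma minorization_le_1:
 assumes N: "1 \<le> N" and le: "\<forall>\<theta>\<in>space \<Theta>. \<forall>x\<in>space X. \<forall>B\<in>sets X. ennreal \<epsilon> * emeasure (tgt \<theta>) B \<le> emeasure (P N \<theta> x) B"
 shows "\<epsilon> \<le> 1"
proof -
 interpret K: gibbs_kernel \<Theta> X \<pi> \<pi>T \<pi>X tgt \<kappa> "P N" by (rule gibbs_kernel_P[OF N])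
 obtain \<theta> x where q: "\<theta> \<in> space \<Theta>" "x \<in> space X" using not_empty by (auto simp: space_\<pi>T space_\<pi>X)
 then have p: "prob_space (P N \<theta> x)" "space (P N \<theta> x) = space X"
  using prob_kernelD[OF K.K_measurable, of "(\<theta>, x)"] by (auto simp: space_pair_measure)
 note t = prob_kernelD[OF tgt q(1)]
 have "ennreal \<epsilon> * emeasure (tgt \<theta>) (space X) \<le> emeasure (P N \<theta> x) (space X)" using le q by blast
 then show ?thesis using prob_space.emeasure_space_1[OF p(1)] prob_space.emeasure_space_1[OF t(1)] p(2) t(3) by simp
qed

lemma Gap_tendsto:
 assumes \<rho>: "\<rho> \<longlonglongrightarrow> 1"
 shows "(\<lambda>N. Gap \<pi>X (scan_kernel_x \<Theta> X \<kappa> (P N))) \<longlonglongrightarrow> Gap \<pi>X (scan_kernel_x \<Theta> X \<kappa> (\<lambda>\<theta> x. tgt \<theta>))" (is "?g \<longlonglongrightarrow> ?c")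
proof -
 have b: "ereal (\<rho> N) * ?c \<le> ?g N \<and> ?g N \<le> ?c" if "1 \<le> N" for N
  using gibbs_kernel.Gap_bounds[OF gibbs_kernel_P[OF that]] by simp
 have "0 \<le> ?c" by (rule rev_pos_kernel.Gap_nonneg[OF gibbs_kernel.rev_pos_\<Gamma>x[OF gibbs_kernel_P[OF order_refl]]])
 from tendsto_ereal_mult_1[OF \<rho> this] show ?thesis
  by (rule tendsto_sandwich[rotated 2, OF _ tendsto_const]) (use b in \<open>auto simp: eventually_sequentially\<close>)
qed

text \<open>Squeezed between the exact value, which may be \<infinity>, and the upper bound, in
  which the coefficient 1 / \<rho> - 1 of the variance tends to 0.\<close>

lemma asvar_tendsto:
 assumes \<rho>: "\<rho> \<longlonglongrightarrow> 1" and f: "f \<in> L2 \<pi>X"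
 shows "(\<lambda>N. asvar \<pi>X (scan_kernel_x \<Theta> X \<kappa> (P N)) f) \<longlonglongrightarrow> asvar \<pi>X (scan_kernel_x \<Theta> X \<kappa> (\<lambda>\<theta> x. tgt \<theta>)) f" (is "?a \<longlonglongrightarrow> ?c")
proof -
 have b: "?c \<le> ?a N" "0 < \<rho> N ==> ?a N \<le> ereal ((1 / \<rho> N - 1) * var \<pi>X f) + ereal (1 / \<rho> N) * ?c" if "1 \<le> N" for N
  using gibbs_kernel.asvar_bounds[OF gibbs_kernel_P[OF that] f] by simp_all
 have v: "0 \<le> var \<pi>X f" "ereal (var \<pi>X f) \<le> ?c"
  using gibbs_kernel.asvar_bounds(1)[OF gibbs_kernel_P[OF order_refl] f] prob_space.var_nonneg[OF prob_\<pi>X f] by simp_all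
 then have c: "0 \<le> ?c" by (metis ereal_less_eq(5) order_trans)
 have i: "(\<lambda>N. 1 / \<rho> N) \<longlonglongrightarrow> 1" using tendsto_divide[OF tendsto_const[of 1] \<rho>] by simp
 have "(\<lambda>N. (1 / \<rho> N - 1) * var \<pi>X f) \<longlonglongrightarrow> (1 - 1) * var \<pi>X f" by (intro tendsto_intros i)
 then have "(\<lambda>N. ereal ((1 / \<rho> N - 1) * var \<pi>X f)) \<longlonglongrightarrow> ereal 0" by simp
 from tendsto_add_ereal_general[OF _ this tendsto_ereal_mult_1[OF i c]]
 have u: "(\<lambda>N. ereal ((1 / \<rho> N - 1) * var \<pi>X f) + ereal (1 / \<rho> N) * ?c) \<longlonglongrightarrow> ?c" by (simp flip: zero_ereal_def)
 have "eventually (\<lambda>N. 0 < \<rho> N) sequentially" using \<rho> by (rule order_tendstoD) simp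
 then have "eventually (\<lambda>N. ?a N \<le> ereal ((1 / \<rho> N - 1) * var \<pi>X f) + ereal (1 / \<rho> N) * ?c) sequentially"
  using eventually_ge_at_top[of 1] by eventually_elim (rule b(2))
 then show ?thesis
  by (rule tendsto_sandwich[OF _ _ tendsto_const u, rotated]) (use b(1) in \<open>auto simp: eventually_sequentially\<close>)
qed

lemma asvar_joint_tendsto:
 assumes \<rho>: "\<rho> \<longlonglongrightarrow> 1" and f: "f \<in> L2 \<pi>T"
 shows "(\<lambda>N. asvar \<pi> (scan_kernel \<Theta> X \<kappa> (P N)) (lift f)) \<longlonglongrightarrow> asvar \<pi> (scan_kernel \<Theta> X \<kappa> (\<lambda>\<theta> x. tgt \<theta>)) (lift f)"
proof -
 let ?v = "ereal (var \<pi>T f + var \<pi>X (bar f))"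
 have "(\<lambda>N. ?v + asvar \<pi>X (scan_kernel_x \<Theta> X \<kappa> (P N)) (bar f)) \<longlonglongrightarrow> ?v + asvar \<pi>X (scan_kernel_x \<Theta> X \<kappa> (\<lambda>\<theta> x. tgt \<theta>)) (bar f)"
  by (intro tendsto_add_ereal_general tendsto_const asvar_tendsto[OF \<rho> bar_L2[OF f]]) simp
 moreover have "eventually (\<lambda>N. ?v + asvar \<pi>X (scan_kernel_x \<Theta> X \<kappa> (P N)) (bar f) = asvar \<pi> (scan_kernel \<Theta> X \<kappa> (P N)) (lift f)) sequentially"
  using eventually_ge_at_top[of 1] by eventually_elim (simp add: gibbs_kernel.asvar_joint[OF gibbs_kernel_P f])
 ultimately show ?thesis
  unfolding gibbs_kernel.asvar_joint[OF gibbs_kernel_const f] by (simp add: Lim_transform_eventually)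
qed

end

theorem corollary28:
  fixes \<Theta> :: "'th measure" and Z :: "'z measure" and T :: nat
    and M1 :: "'th \<Rightarrow> 'z measure"
    and M :: "'th \<Rightarrow> nat \<Rightarrow> 'z \<Rightarrow> 'z measure"
    and G :: "'th \<Rightarrow> nat \<Rightarrow> 'z \<Rightarrow> real"
    and X :: "(nat \<Rightarrow> 'z) measure"
    and \<gamma> :: "'th \<Rightarrow> ennreal"
    and \<pi> :: "('th \<times> (nat \<Rightarrow> 'z)) measure"
    and \<pi>T :: "'th measure" and \<pi>X :: "(nat \<Rightarrow> 'z) measure"
    and tgt :: "'th \<Rightarrow> (nat \<Rightarrow> 'z) measure"
    and \<kappa> :: "(nat \<Rightarrow> 'z) \<Rightarrow> 'th measure"
    and bar :: "('th \<Rightarrow> real) \<Rightarrow> (nat \<Rightarrow> 'z) \<Rightarrow> real"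
    and P :: "nat \<Rightarrow> 'th \<Rightarrow> (nat \<Rightarrow> 'z) \<Rightarrow> (nat \<Rightarrow> 'z) measure"
    and \<Gamma> :: "'th \<times> (nat \<Rightarrow> 'z) \<Rightarrow> ('th \<times> (nat \<Rightarrow> 'z)) measure"
    and \<Gamma>\<^sub>x :: "(nat \<Rightarrow> 'z) \<Rightarrow> (nat \<Rightarrow> 'z) measure"
    and \<Phi> :: "nat \<Rightarrow> 'th \<times> (nat \<Rightarrow> 'z) \<Rightarrow> ('th \<times> (nat \<Rightarrow> 'z)) measure"
    and \<Phi>\<^sub>x :: "nat \<Rightarrow> (nat \<Rightarrow> 'z) \<Rightarrow> (nat \<Rightarrow> 'z) measure"
    and \<rho> :: "nat \<Rightarrow> real"
    and R :: ennreal
    and mixing :: "real \<Rightarrow> bool"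
  assumes T: "1 \<le> T"
    and X: "X = PiM {1..T} (\<lambda>_. Z)"
    and M1: "M1 \<in> \<Theta> \<rightarrow>\<^sub>M prob_algebra Z"
    and M: "\<And>t. t \<in> {2..T} \<Longrightarrow> (\<lambda>(\<theta>, z). M \<theta> t z) \<in> \<Theta> \<Otimes>\<^sub>M Z \<rightarrow>\<^sub>M prob_algebra Z"
    and G: "\<And>t. t \<in> {1..T} \<Longrightarrow> (\<lambda>(\<theta>, z). G \<theta> t z) \<in> borel_measurable (\<Theta> \<Otimes>\<^sub>M Z)"
    and G_nonneg: "\<And>\<theta> t z. \<theta> \<in> space \<Theta> \<Longrightarrow> t \<in> {1..T} \<Longrightarrow> z \<in> space Z \<Longrightarrow> 0 \<le> G \<theta> t z"
    and \<gamma>: "\<And>\<theta>. \<gamma> \<theta> = gamma_T Z T (M1 \<theta>) (M \<theta>) (G \<theta>)"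
    and \<gamma>_pos_finite: "\<And>\<theta>. \<theta> \<in> space \<Theta> \<Longrightarrow> 0 < \<gamma> \<theta> \<and> \<gamma> \<theta> < \<infinity>"
    and \<pi>: "\<pi> \<in> space (prob_algebra (\<Theta> \<Otimes>\<^sub>M X))"
    and \<pi>T: "\<pi>T = distr \<pi> \<Theta> fst"
    and \<pi>X: "\<pi>X = distr \<pi> X snd"
    and tgt: "\<And>\<theta>. tgt \<theta> = fk_target Z T (M1 \<theta>) (M \<theta>) (G \<theta>)"
    and \<pi>_tgt: "\<And>A B. A \<in> sets \<Theta> \<Longrightarrow> B \<in> sets X \<Longrightarrow>
          emeasure \<pi> (A \<times> B) = (\<integral>\<^sup>+ \<theta>. emeasure (tgt \<theta>) B * indicator A \<theta> \<partial>\<pi>T)"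
    and \<kappa>: "\<kappa> \<in> X \<rightarrow>\<^sub>M prob_algebra \<Theta>"
    and \<pi>_\<kappa>: "\<And>A B. A \<in> sets \<Theta> \<Longrightarrow> B \<in> sets X \<Longrightarrow>
          emeasure \<pi> (A \<times> B) = (\<integral>\<^sup>+ x. emeasure (\<kappa> x) A * indicator B x \<partial>\<pi>X)"
    and bar: "\<And>f x. bar f x = (\<integral>\<theta>. f \<theta> \<partial>\<kappa> x)"
    and P: "\<And>N \<theta>. P N \<theta> = icsmc Z T N (M1 \<theta>) (M \<theta>) (G \<theta>)"
    and \<Gamma>: "\<Gamma> = scan_kernel \<Theta> X \<kappa> (\<lambda>\<theta> x. tgt \<theta>)"
    and \<Gamma>\<^sub>x: "\<Gamma>\<^sub>x = scan_kernel_x \<Theta> X \<kappa> (\<lambda>\<theta> x. tgt \<theta>)"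
    and \<Phi>: "\<And>N. \<Phi> N = scan_kernel \<Theta> X \<kappa> (P N)"
    and \<Phi>\<^sub>x: "\<And>N. \<Phi>\<^sub>x N = scan_kernel_x \<Theta> X \<kappa> (P N)"
    and \<rho>: "\<And>N. \<rho> N = gap_ratio \<pi>T \<pi>X tgt (P N)"
    and R: "R = ess_sup \<pi>T (\<lambda>\<theta>. (\<Prod>t=1..T. SUP z\<in>space Z. ennreal (G \<theta> t z)) / \<gamma> \<theta>)"
    and mixing: "\<And>\<alpha>. mixing \<alpha> \<longleftrightarrow>
          0 \<le> \<alpha> \<and>
          (\<forall>p\<ge>1. \<forall>k\<ge>1. p + k \<le> T + 1 \<longrightarrow>
             ess_sup (distr \<pi> (\<Theta> \<Otimes>\<^sub>M Z) (\<lambda>(\<theta>, x). (\<theta>, x p)))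
               (\<lambda>(\<theta>, z). fk_Q Z T (M \<theta>) (G \<theta>) p (p + k) (\<lambda>_. 1) z
                  / fk_eta Z T (M1 \<theta>) (M \<theta>) (G \<theta>) p (fk_Q Z T (M \<theta>) (G \<theta>) p (p + k) (\<lambda>_. 1)))
             \<le> ennreal \<alpha>)"
  shows
    "(\<forall>N\<ge>2.
       \<comment> \<open>(a)\<close>
       (R < \<infinity> \<longrightarrow>
          \<rho> N \<ge> (1 - 1 / N) ^ T / (1 + (1 - (1 - 2 / N) ^ T) * (enn2real R - 1)))
       \<comment> \<open>(b)\<close>
     \<and> (\<forall>\<alpha>. mixing \<alpha> \<longrightarrow> \<rho> N \<ge> ((1 - 1 / N) / (1 + 2 * (\<alpha> - 1) / N)) ^ T)
       \<comment> \<open>(I)\<close>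
     \<and> (\<forall>f\<in>L2 \<pi>X.
          2 * dirichlet \<pi>X \<Gamma>\<^sub>x f \<ge> dirichlet \<pi>X (\<Phi>\<^sub>x N) f
        \<and> dirichlet \<pi>X (\<Phi>\<^sub>x N) f \<ge> \<rho> N * dirichlet \<pi>X \<Gamma>\<^sub>x f)
     \<and> 2 * Gap \<pi>X \<Gamma>\<^sub>x \<ge> Gap \<pi>X (\<Phi>\<^sub>x N)
     \<and> Gap \<pi>X (\<Phi>\<^sub>x N) \<ge> ereal (\<rho> N) * Gap \<pi>X \<Gamma>\<^sub>x
     \<and> (\<forall>f\<in>L2 \<pi>X.
          0 \<le> (asvar \<pi>X \<Gamma>\<^sub>x f - ereal (var \<pi>X f)) / 2
        \<and> (asvar \<pi>X \<Gamma>\<^sub>x f - ereal (var \<pi>X f)) / 2 \<le> asvar \<pi>X (\<Phi>\<^sub>x N) f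
        \<and> (\<rho> N > 0 \<longrightarrow>
             asvar \<pi>X (\<Phi>\<^sub>x N) f
               \<le> ereal ((1 / \<rho> N - 1) * var \<pi>X f) + ereal (1 / \<rho> N) * asvar \<pi>X \<Gamma>\<^sub>x f))
     \<and> (\<forall>f\<in>L2 \<pi>X. \<forall>\<epsilon>>0.
          (\<forall>\<theta>\<in>space \<Theta>. \<forall>x\<in>space X. \<forall>B\<in>sets X.
             emeasure (P N \<theta> x) B \<ge> ennreal \<epsilon> * emeasure (tgt \<theta>) B)
          \<longrightarrow> (asvar \<pi>X \<Gamma>\<^sub>x f - ereal ((1 - \<epsilon>) * var \<pi>X f)) / ereal (2 - \<epsilon>) \<le> asvar \<pi>X (\<Phi>\<^sub>x N) f)
     \<and> (\<forall>f\<in>L2 \<pi>X. asvar \<pi>X \<Gamma>\<^sub>x f \<le> asvar \<pi>X (\<Phi>\<^sub>x N) f)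
       \<comment> \<open>(II)\<close>
     \<and> (\<forall>(\<G> :: ((nat \<Rightarrow> 'z) \<Rightarrow> real) set) (nrm :: ((nat \<Rightarrow> 'z) \<Rightarrow> real) \<Rightarrow> ennreal)
          (r :: real) (W :: (nat \<Rightarrow> 'z) measure \<Rightarrow> ennreal).
          \<G> \<subseteq> {g. integrable \<pi>X g} \<and> 0 \<le> r \<and> r < 1
        \<and> (\<forall>\<nu>\<in>space (prob_algebra X). \<forall>g\<in>\<G>. \<forall>k\<ge>1.
             integrable (\<nu> \<bind> kernel_power X (\<Phi>\<^sub>x N) k) g \<longrightarrow>
             ennreal \<bar>(\<integral>x. g x \<partial>(\<nu> \<bind> kernel_power X (\<Phi>\<^sub>x N) k)) - (\<integral>x. g x \<partial>\<pi>X)\<bar>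
               \<le> nrm g * W \<nu> * ennreal r ^ k)
        \<longrightarrow>
          (\<forall>\<nu>\<in>space (prob_algebra X). \<forall>\<nu>'\<in>space (prob_algebra (\<Theta> \<Otimes>\<^sub>M X)). \<forall>f. \<forall>g\<in>\<G>. \<forall>k\<ge>2.
             distr \<nu>' X snd = \<nu>
           \<and> integrable \<pi>T f \<and> (\<forall>x\<in>space X. integrable (\<kappa> x) f)
           \<and> (\<forall>x\<in>space X. g x = bar f x)
           \<and> integrable (\<nu>' \<bind> kernel_power (\<Theta> \<Otimes>\<^sub>M X) (\<Phi> N) k) (\<lambda>(\<theta>, x). f \<theta>)
           \<longrightarrow>
             ennreal \<bar>(\<integral>(\<theta>, x). f \<theta> \<partial>(\<nu>' \<bind> kernel_power (\<Theta> \<Otimes>\<^sub>M X) (\<Phi> N) k)) - (\<integral>\<theta>. f \<theta> \<partial>\<pi>T)\<bar>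
               \<le> nrm g * W \<nu> * ennreal r ^ (k - 1)))
     \<and> (\<forall>f\<in>L2 \<pi>T.
          bar f \<in> L2 \<pi>X
        \<and> (\<forall>k\<ge>1.
             inner_L2 \<pi> (\<lambda>(\<theta>, x). f \<theta>)
                 (kernel_op (kernel_power (\<Theta> \<Otimes>\<^sub>M X) (\<Phi> N) k) (\<lambda>(\<theta>, x). f \<theta>))
             = inner_L2 \<pi>X (bar f) (kernel_op (kernel_power X (\<Phi>\<^sub>x N) (k - 1)) (bar f)))
        \<and> asvar \<pi> (\<Phi> N) (\<lambda>(\<theta>, x). f \<theta>)
            = ereal (var \<pi>T f) + ereal (var \<pi>X (bar f)) + asvar \<pi>X (\<Phi>\<^sub>x N) (bar f))
     \<and> (\<rho> N > 0 \<longrightarrow> (\<forall>f\<in>L2 \<pi>T.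
          asvar \<pi> (\<Phi> N) (\<lambda>(\<theta>, x). f \<theta>)
            \<le> ereal (var \<pi>T f) + ereal (1 / \<rho> N * var \<pi>X (bar f))
               + ereal (1 / \<rho> N) * asvar \<pi>X \<Gamma>\<^sub>x (bar f)
        \<and> ereal (var \<pi>T f) + ereal (1 / \<rho> N * var \<pi>X (bar f))
               + ereal (1 / \<rho> N) * asvar \<pi>X \<Gamma>\<^sub>x (bar f)
            \<le> ereal ((1 - 1 / \<rho> N) * var \<pi>T f) + ereal (1 / \<rho> N) * asvar \<pi> \<Gamma> (\<lambda>(\<theta>, x). f \<theta>)))
     \<and> (\<forall>f\<in>L2 \<pi>T. asvar \<pi> (\<Phi> N) (\<lambda>(\<theta>, x). f \<theta>) \<ge> asvar \<pi> \<Gamma> (\<lambda>(\<theta>, x). f \<theta>)))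
     \<and> (R < \<infinity> \<or> (\<exists>\<alpha>. mixing \<alpha>) \<longrightarrow>
          \<rho> \<longlonglongrightarrow> 1
        \<and> (\<lambda>N. Gap \<pi>X (\<Phi>\<^sub>x N)) \<longlonglongrightarrow> Gap \<pi>X \<Gamma>\<^sub>x
        \<and> (\<forall>f\<in>L2 \<pi>X. (\<lambda>N. asvar \<pi>X (\<Phi>\<^sub>x N) f) \<longlonglongrightarrow> asvar \<pi>X \<Gamma>\<^sub>x f)
        \<and> (\<forall>f\<in>L2 \<pi>T. (\<lambda>N. asvar \<pi> (\<Phi> N) (\<lambda>(\<theta>, x). f \<theta>)) \<longlonglongrightarrow> asvar \<pi> \<Gamma> (\<lambda>(\<theta>, x). f \<theta>)))"
proof -
 interpret pg: particle_gibbs \<Theta> Z T M1 M G X \<gamma> \<pi> \<pi>T \<pi>X tgt \<kappa> P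
  by unfold_locales (fact T X M1 M G G_nonneg \<gamma> \<gamma>_pos_finite \<pi> \<pi>T \<pi>X tgt \<pi>_tgt \<kappa> \<pi>_\<kappa> P)+
 have mixing': "mixing = pg.mixing" by (simp add: fun_eq_iff mixing pg.mixing_def)
 have bar': "bar = pg.bar" by (simp add: fun_eq_iff bar pg.bar_def)
 have \<rho>': "\<rho> = pg.\<rho>" by (simp add: fun_eq_iff \<rho>)
 have lim: "R < \<infinity> \<or> (\<exists>\<alpha>. mixing \<alpha>) ==> \<rho> \<longlonglongrightarrow> 1"
  unfolding \<rho>' mixing' R by (rule pg.ratio_tendsto)
 show ?thesis
 proof (intro conjI allI impI ballI)
  fix N :: nat assume N: "2 \<le> N"
  then have N1: "1 \<le> N" by simp
  interpret K: gibbs_kernel \<Theta> X \<pi> \<pi>T \<pi>X tgt \<kappa> "P N" by (rule pg.gibbs_kernel_P[OF N1])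
  have var: "0 \<le> var \<pi>X f" if "f \<in> L2 \<pi>X" for f by (rule K.x.var_nonneg[OF that])
  note b = K.asvar_bounds
  { assume "R < \<infinity>"
   then show "(1 - 1 / N) ^ T / (1 + (1 - (1 - 2 / N) ^ T) * (enn2real R - 1)) \<le> \<rho> N"
    unfolding \<rho> by (rule pg.gap_ratio_bounded_potentials(2)[OF N R]) }
  { fix \<alpha> assume "mixing \<alpha>"
   then have m: "pg.mixing \<alpha>" by (simp add: mixing')
   show "((1 - 1 / N) / (1 + 2 * (\<alpha> - 1) / N)) ^ T \<le> \<rho> N"
    unfolding \<rho> by (rule pg.gap_ratio_mixing_pos[OF N m pg.mixing_pos[OF m]]) }
  { fix f assume f: "f \<in> L2 \<pi>X"
   interpret g: rev_pos_kernel \<pi>X \<Gamma>\<^sub>x unfolding \<Gamma>\<^sub>x by (rule K.rev_pos_\<Gamma>x)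
   \<comment> \<open>Positivity yields the constant 1; the factor 2 is admissible because the form
     is nonnegative.\<close>
   show "dirichlet \<pi>X (\<Phi>\<^sub>x N) f \<le> 2 * dirichlet \<pi>X \<Gamma>\<^sub>x f"
    using K.dirichlet_Kx_le_\<Gamma>x[OF f] g.dirichlet_nn_integral(2)[OF f] unfolding \<Gamma>\<^sub>x \<Phi>\<^sub>x by simp
   show "\<rho> N * dirichlet \<pi>X \<Gamma>\<^sub>x f \<le> dirichlet \<pi>X (\<Phi>\<^sub>x N) f"
    unfolding \<rho> \<Gamma>\<^sub>x \<Phi>\<^sub>x by (rule K.ratio_dirichlet_le[OF f]) }
  { have "0 \<le> Gap \<pi>X \<Gamma>\<^sub>x" unfolding \<Gamma>\<^sub>x by (rule rev_pos_kernel.Gap_nonneg[OF K.rev_pos_\<Gamma>x])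
   then have "Gap \<pi>X \<Gamma>\<^sub>x \<le> 2 * Gap \<pi>X \<Gamma>\<^sub>x" by (cases "Gap \<pi>X \<Gamma>\<^sub>x") auto
   then show "Gap \<pi>X (\<Phi>\<^sub>x N) \<le> 2 * Gap \<pi>X \<Gamma>\<^sub>x"
    using K.Gap_bounds(1) unfolding \<Gamma>\<^sub>x \<Phi>\<^sub>x by (rule order_trans[rotated]) }
  show "ereal (\<rho> N) * Gap \<pi>X \<Gamma>\<^sub>x \<le> Gap \<pi>X (\<Phi>\<^sub>x N)"
   unfolding \<rho> \<Gamma>\<^sub>x \<Phi>\<^sub>x by (rule K.Gap_bounds(2))
  { fix f assume f: "f \<in> L2 \<pi>X"
   show "0 \<le> (asvar \<pi>X \<Gamma>\<^sub>x f - ereal (var \<pi>X f)) / 2" "(asvar \<pi>X \<Gamma>\<^sub>x f - ereal (var \<pi>X f)) / 2 \<le> asvar \<pi>X (\<Phi>\<^sub>x N) f"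
    unfolding \<Gamma>\<^sub>x \<Phi>\<^sub>x by (rule ereal_variance_bounds[OF var[OF f] b(1,2)[OF f]])+
   show "asvar \<pi>X \<Gamma>\<^sub>x f \<le> asvar \<pi>X (\<Phi>\<^sub>x N) f" unfolding \<Gamma>\<^sub>x \<Phi>\<^sub>x by (rule b(2)[OF f])
   assume "0 < \<rho> N"
   then show "asvar \<pi>X (\<Phi>\<^sub>x N) f \<le> ereal ((1 / \<rho> N - 1) * var \<pi>X f) + ereal (1 / \<rho> N) * asvar \<pi>X \<Gamma>\<^sub>x f"
    unfolding \<rho> \<Gamma>\<^sub>x \<Phi>\<^sub>x by (rule b(3)[OF f]) }
  { fix f \<epsilon> assume f: "f \<in> L2 \<pi>X" and e: "(0::real) < \<epsilon>"
    and le: "\<forall>\<theta>\<in>space \<Theta>. \<forall>x\<in>space X. \<forall>B\<in>sets X. ennreal \<epsilon> * emeasure (tgt \<theta>) B \<le> emeasure (P N \<theta> x) B"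
   \<comment> \<open>Comparing total masses gives \<epsilon> \<le> 1, so the divisor 2 - \<epsilon>
     is positive.\<close>
   show "(asvar \<pi>X \<Gamma>\<^sub>x f - ereal ((1 - \<epsilon>) * var \<pi>X f)) / ereal (2 - \<epsilon>) \<le> asvar \<pi>X (\<Phi>\<^sub>x N) f"
    unfolding \<Gamma>\<^sub>x \<Phi>\<^sub>x by (rule ereal_variance_bounds(3)[OF var[OF f] b(1,2)[OF f] e pg.minorization_le_1[OF N1 le]]) }
  { fix \<G> :: "((nat => 'z) => real) set" and nrm :: "((nat => 'z) => real) => ennreal"
    and r :: real and W :: "(nat => 'z) measure => ennreal" and \<nu> \<nu>' f g and k :: nat
   assume "\<G> \<subseteq> {g. integrable \<pi>X g} \<and> 0 \<le> r \<and> r < 1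
    \<and> (\<forall>\<nu>\<in>space (prob_algebra X). \<forall>g\<in>\<G>. \<forall>k\<ge>1.
       integrable (\<nu> \<bind> kernel_power X (\<Phi>\<^sub>x N) k) g -->
       ennreal \<bar>integral\<^sup>L (\<nu> \<bind> kernel_power X (\<Phi>\<^sub>x N) k) g - (integral\<^sup>L \<pi>X g)\<bar>
        \<le> nrm g * W \<nu> * ennreal r ^ k)"
    and \<nu>: "\<nu> \<in> space (prob_algebra X)" "\<nu>' \<in> space (prob_algebra (\<Theta> \<Otimes>\<^sub>M X))" and g: "g \<in> \<G>" and k: "2 \<le> k"
    and "distr \<nu>' X snd = \<nu>
      \<and> integrable \<pi>T f \<and> (\<forall>x\<in>space X. integrable (\<kappa> x) f)
      \<and> (\<forall>x\<in>space X. g x = bar f x)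
      \<and> integrable (\<nu>' \<bind> kernel_power (\<Theta> \<Otimes>\<^sub>M X) (\<Phi> N) k) (lift f)"
   then show "ennreal \<bar>(\<integral>(\<theta>, x). f \<theta> \<partial>(\<nu>' \<bind> kernel_power (\<Theta> \<Otimes>\<^sub>M X) (\<Phi> N) k)) - (integral\<^sup>L \<pi>T f)\<bar>
        \<le> nrm g * W \<nu> * ennreal r ^ (k - 1)"
    unfolding \<Phi> \<Phi>\<^sub>x bar' by (elim conjE) (rule K.ergodicity_transfer[where W=W and nrm=nrm and \<nu>=\<nu>], assumption+) }
  { fix f assume f: "f \<in> L2 \<pi>T"
   show "bar f \<in> L2 \<pi>X" unfolding bar' by (rule pg.bar_L2[OF f])
   show "asvar \<pi> (\<Phi> N) (lift f) = ereal (var \<pi>T f) + ereal (var \<pi>X (bar f)) + asvar \<pi>X (\<Phi>\<^sub>x N) (bar f)"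
    unfolding bar' \<Phi> \<Phi>\<^sub>x by (rule K.asvar_joint[OF f])
   show "asvar \<pi> \<Gamma> (lift f) \<le> asvar \<pi> (\<Phi> N) (lift f)"
    unfolding \<Phi> \<Gamma> by (rule K.asvar_joint_lower[OF f]) }
  { fix f and k :: nat assume f: "f \<in> L2 \<pi>T" "1 \<le> k"
   show "inner_L2 \<pi> (lift f) (kernel_op (kernel_power (\<Theta> \<Otimes>\<^sub>M X) (\<Phi> N) k) (lift f))
       = inner_L2 \<pi>X (bar f) (kernel_op (kernel_power X (\<Phi>\<^sub>x N) (k - 1)) (bar f))"
    unfolding bar' \<Phi> \<Phi>\<^sub>x by (rule K.inner_kernel_power_fst[OF f]) }
  { fix f assume r: "0 < \<rho> N" and f: "f \<in> L2 \<pi>T"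
   show "asvar \<pi> (\<Phi> N) (lift f)
      \<le> ereal (var \<pi>T f) + ereal (1 / \<rho> N * var \<pi>X (bar f)) + ereal (1 / \<rho> N) * asvar \<pi>X \<Gamma>\<^sub>x (bar f)"
    "ereal (var \<pi>T f) + ereal (1 / \<rho> N * var \<pi>X (bar f)) + ereal (1 / \<rho> N) * asvar \<pi>X \<Gamma>\<^sub>x (bar f)
      \<le> ereal ((1 - 1 / \<rho> N) * var \<pi>T f) + ereal (1 / \<rho> N) * asvar \<pi> \<Gamma> (lift f)"
    using K.asvar_joint_upper[OF f] r unfolding bar' \<Phi> \<Gamma> \<Gamma>\<^sub>x \<rho> by simp_all }
 next
  assume "R < \<infinity> \<or> (\<exists>\<alpha>. mixing \<alpha>)"
  then have r: "\<rho> \<longlonglongrightarrow> 1" by (rule lim)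
  show "\<rho> \<longlonglongrightarrow> 1" by (rule r)
  show "(\<lambda>N. Gap \<pi>X (\<Phi>\<^sub>x N)) \<longlonglongrightarrow> Gap \<pi>X \<Gamma>\<^sub>x"
   unfolding \<Phi>\<^sub>x \<Gamma>\<^sub>x by (rule pg.Gap_tendsto[OF r[unfolded \<rho>']])
  { fix f assume f: "f \<in> L2 \<pi>X"
   show "(\<lambda>N. asvar \<pi>X (\<Phi>\<^sub>x N) f) \<longlonglongrightarrow> asvar \<pi>X \<Gamma>\<^sub>x f"
    unfolding \<Phi>\<^sub>x \<Gamma>\<^sub>x by (rule pg.asvar_tendsto[OF r[unfolded \<rho>'] f]) }
  { fix f assume f: "f \<in> L2 \<pi>T"
   show "(\<lambda>N. asvar \<pi> (\<Phi> N) (lift f)) \<longlonglongrightarrow> asvar \<pi> \<Gamma> (lift f)"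
    unfolding \<Phi> \<Gamma> by (rule pg.asvar_joint_tendsto[OF r[unfolded \<rho>'] f]) }
 qed
qed

end
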